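(* Let $Q\to E\to M$ be a 2-fibered manifold, let $0\le s\le r$ and $l\ge 0$ be integers, and let $$B:J^rQ\times_{J^sQ}VJ^sQ\to\bigwedge^lT^*E$$ be a smooth morphism over $\mathrm{id}_E$, where $J^rQ$, $J^sQ$ and $VJ^sQ$ are formed with respect to the fibered manifold $Q\to E$. Then $$\mathbb{D}(S(B))=S(DB)\circ I,$$ as maps from the holonomic part of $J^1S(E,J^rQ)\times_{J^1S(E,J^sQ)}J^1S(E,VJ^sQ)$ (the domain of $I$) into $S(E,\bigwedge^{l+1}T^*E)$.
   Context: Finite dimensional manifolds and maps are $C^\infty$. A 2-fibered manifold $Q\to E\to M$ is a pair of surjective submersions. $Q$ is always regarded as a fibered manifold over $E$: $J^rQ=J^r(Q\to E)$, and $V$ denotes vertical tangent bundles with respect to the projection to $E$. $E_x$ is the fiber of $E\to M$ over $x\in M$. Bundles of sections: for a 2-fibered manifold $P\to E\to M$, $S(E,P)\to M$ is the bundle whose fiber over $x\in M$ is the set of all smooth sections $E_x\to P_x$ of $P\to E$ restricted over $E_x$ (with the Frölicher-type structure: a curve in $S(E,P)$ over a smooth curve $\underline c$ in $M$ is $F$-smooth if the induced map $\underline c^*E\to P$ is smooth). $F$-smooth (local) sections $\widehat u$ of $S(E,P)\to M$ are identified with smooth sections $u$ of $P\to E$ (defined over the preimage of an open subset of $M$) via $\widehat u(x)=u|_{E_x}$. $J^kS(E,P)$ is the space of $k$-jets $j^k_x\widehat u$; $j^k_x\widehat u=j^k_x\widehat v$ iff $j^k_yu=j^k_yv$ for all $y\in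 E_x$. A morphism $f:P\to P'$ over $\mathrm{id}_E$ induces $S(f):S(E,P)\to S(E,P')$, $u\mapsto f\circ u$; one has $S(E,P_1\times_{P_3}P_2)=S(E,P_1)\times_{S(E,P_3)}S(E,P_2)$. The canonical injection $i:J^kS(E,P)\to S(E,J^k(P\to E))$ is $i(j^k_x\widehat u)=(j^ku)|_{E_x}$. Finite dimensional side: $\varkappa_s:VJ^sQ\to J^sVQ$ is the canonical exchange isomorphism $\frac{\partial}{\partial t}|_0j^s_yu(t,\cdot)\mapsto j^s_y\frac{\partial}{\partial t}|_0u(t,\cdot)$, where $VQ$ is regarded as fibered over $E$. For $\psi:J^rQ\times_{J^sQ}J^sVQ\to P$ over $E$, $J^1_{\mathrm{hol}}\psi(j^{1+r}_ya,j^{1+s}_yb)=j^1_y(\psi(j^ra,j^sb))$. Put $$\mathcal{J}^1_{\mathrm{hol}}B:=J^1_{\mathrm{hol}}\big(B\circ(\mathrm{id}_{J^rQ}\times_{J^sQ}\varkappa_s^{-1})\big)\circ(\mathrm{id}_{J^{r+1}Q}\times_{J^{s+1}Q}\varkappa_{s+1}):J^{r+1}Q\times_{J^{s+1}Q}VJ^{s+1}Q\to J^1\bigwedge^lT^*E .$$ Let $\delta:J^1\bigwedge^lT^*E\to\bigwedge^{l+1}T^*E$ be the map associated with the exterior differential on $E$, i.e. $d\omega=\delta\circ j^1\omega$ for every $l$-form $\omega$. The formal exterior differential of $B$ is $$DB:=\delta\circ\mathcal{J}^1_{\mathrm{hol}}B:J^{r+1}Q\times_{J^{s+1}Q}VJ^{s+1}Q\to\bigwedge^{l+1}T^*E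 .$$ Functional side: $J^1S(B):J^1S(E,J^rQ)\times_{J^1S(E,J^sQ)}J^1S(E,VJ^sQ)\to J^1S(E,\bigwedge^lT^*E)$ is $(j^1_x\widehat a,j^1_x\widehat b)\mapsto j^1_x(S(B)(\widehat a,\widehat b))$, where the sections $a$ of $J^rQ\to E$ and $b$ of $VJ^sQ\to E$ representing the pair are chosen with the same projection to $J^sQ$. The formal exterior differential of $S(B)$ is $$\mathbb{D}(S(B)):=S(\delta)\circ i\circ J^1S(B),$$ with $i:J^1S(E,\bigwedge^lT^*E)\to S(E,J^1\bigwedge^lT^*E)$. The injection $I$: for a pair $(j^1_x\widehat a,j^1_x\widehat b)\in J^1S(E,J^rQ)\times_{J^1S(E,J^sQ)}J^1S(E,VJ^sQ)$, represented by sections $a$ of $J^rQ\to E$ and $b$ of $VJ^sQ\to E$ with the same projection to $J^sQ$, applying $i$ to both components gives maps $E_x\to J^1(J^rQ\to E)$ and $E_x\to J^1(VJ^sQ\to E)$. Regard $J^{r+1}Q\subset J^1J^rQ$ by the canonical inclusion of holonomic jets, and $VJ^{s+1}Q\subset J^1VJ^sQ$ by the composition $VJ^{s+1}Q\xrightarrow{\varkappa_{s+1}}J^{s+1}VQ\subset J^1J^sVQ\xrightarrow{J^1\varkappa_s^{-1}}J^1VJ^sQ$. The holonomic part consists of the pairs for which these two maps take values in $J^{r+1}Q$ and $VJ^{s+1}Q$, respectively; on it, $I$ is the resulting map into $S(E,J^{r+1}Q)\times_{S(E,J^{s+1}Q)}S(E,VJ^{s+1}Q)$. *)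

theory Defs
  imports "HOL-Analysis.Analysis"
begin

section \<open>Smooth functions on \<open>\<real>\<^sup>I\<close>, \<open>I\<close> a finite set\<close>

text \<open>The orders of the jet bundles are variables of the statement, so the dimensions of the
manifolds involved cannot be types. The space \<open>\<real>\<^sup>I\<close> is modelled by the functions
that vanish outside \<open>I\<close>, with the product topology of the function type.\<close>

definition Euc :: "'i set \<Rightarrow> ('i \<Rightarrow> real) set" where
  "Euc I = {x. \<forall>i. i \<notin> I \<longrightarrow> x i = 0}"

definition pd :: "'i \<Rightarrow> (('i \<Rightarrow> real) \<Rightarrow> real) \<Rightarrow> ('i \<Rightarrow> real) \<Rightarrow> real" where
  "pd i f x = deriv (\<lambda>t. f (x(i := t))) (x i)"

primrec pds :: "'i list \<Rightarrow> (('i \<Rightarrow> real) \<Rightarrow> real) \<Rightarrow> ('i \<Rightarrow> real) \<Rightarrow> real" where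
  "pds [] f = f"
| "pds (i # w) f = pd i (pds w f)"

text \<open>\<open>C\<^sup>\<infinity>\<close> on a (relatively) open subset \<open>U\<close> of \<open>\<real>\<^sup>I\<close>: all iterated
partial derivatives exist and are continuous.\<close>

definition Cinf :: "'i set \<Rightarrow> ('i \<Rightarrow> real) set \<Rightarrow> (('i \<Rightarrow> real) \<Rightarrow> real) \<Rightarrow> bool" where
  "Cinf I U f \<longleftrightarrow> (\<forall>w\<in>lists I. continuous_on U (pds w f) \<and>
     (\<forall>i\<in>I. \<forall>x\<in>U. (\<lambda>t. pds w f (x(i := t))) differentiable (at (x i))))"

section \<open>Manifolds and smooth maps\<close>

text \<open>A set with an atlas of coordinate systems in \<open>\<real>\<^bsup>idx\<^esup>\<close>. Besides manifolds
in the strict sense (\<open>manifold\<close> below) the type also carries submanifolds, described by the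
restrictions of the charts of the ambient manifold (\<open>restr\<close> below); the coordinate images are
then not open.\<close>

record ('a, 'i) mfd =
  pts :: "'a set"
  idx :: "'i set"
  charts :: "('a set \<times> ('a \<Rightarrow> 'i \<Rightarrow> real)) set"

definition mtop :: "('a, 'i) mfd \<Rightarrow> 'a topology" where
  "mtop N = topology_generated_by {D \<inter> \<psi> -` U | D \<psi> U. (D, \<psi>) \<in> charts N \<and> open U}"

definition compatible :: "('a, 'i) mfd \<Rightarrow> 'a set \<times> ('a \<Rightarrow> 'i \<Rightarrow> real) \<Rightarrow> bool" where
  "compatible N = (\<lambda>(D, \<psi>). D \<subseteq> pts N \<and> inj_on \<psi> D \<and>
     openin (top_of_set (Euc (idx N))) (\<psi> ` D) \<and>
     (\<forall>(C, \<eta>)\<in>charts N.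
        openin (top_of_set (Euc (idx N))) (\<psi> ` (D \<inter> C)) \<and>
        openin (top_of_set (Euc (idx N))) (\<eta> ` (D \<inter> C)) \<and>
        (\<forall>j\<in>idx N. Cinf (idx N) (\<psi> ` (D \<inter> C)) (\<lambda>x. \<eta> (inv_into D \<psi> x) j) \<and>
                   Cinf (idx N) (\<eta> ` (D \<inter> C)) (\<lambda>x. \<psi> (inv_into C \<eta> x) j))))"

text \<open>Smooth manifolds of dimension \<open>card (idx N)\<close>. The atlas need not be maximal; the charts of the
maximal atlas are those satisfying \<open>compatible N\<close>.\<close>

definition manifold :: "('a, 'i) mfd \<Rightarrow> bool" where
  "manifold N \<longleftrightarrow> finite (idx N) \<and> (\<Union>(fst ` charts N)) = pts N \<and>
     (\<forall>c\<in>charts N. compatible N c) \<and>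
     Hausdorff_space (mtop N) \<and> second_countable (mtop N)"

definition restr :: "('a, 'i) mfd \<Rightarrow> 'a set \<Rightarrow> ('a, 'i) mfd" where
  "restr N A = \<lparr>pts = pts N \<inter> A, idx = idx N,
     charts = {(D \<inter> A, \<psi>) | D \<psi>. (D, \<psi>) \<in> charts N}\<rparr>"

definition prodm :: "('a, 'i) mfd \<Rightarrow> ('b, 'j) mfd \<Rightarrow> ('a \<times> 'b, 'i + 'j) mfd" where
  "prodm N P = \<lparr>pts = pts N \<times> pts P, idx = idx N <+> idx P,
     charts = {(D \<times> C, \<lambda>(a, b). case_sum (\<psi> a) (\<eta> b)) | D \<psi> C \<eta>.
                 (D, \<psi>) \<in> charts N \<and> (C, \<eta>) \<in> charts P}\<rparr>"

definition realline :: "(real, unit) mfd" where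
  "realline = \<lparr>pts = UNIV, idx = {()}, charts = {(UNIV, \<lambda>t _. t)}\<rparr>"

text \<open>Smoothness of \<open>f\<close> on a neighbourhood of \<open>z\<close>. If \<open>\<psi>\<close> has open image then \<open>G\<close> is, near \<open>\<psi> z\<close>,
the coordinate expression \<open>\<eta> \<circ> f \<circ> \<psi>\<^sup>-\<^sup>1\<close>; on a submanifold it is a smooth extension of it.
Continuity is part of the condition, as points near \<open>z\<close> are mapped into \<open>C\<close>.\<close>

definition smooth_at :: "('a, 'i) mfd \<Rightarrow> ('b, 'j) mfd \<Rightarrow> ('a \<Rightarrow> 'b) \<Rightarrow> 'a \<Rightarrow> bool" where
  "smooth_at N P f z \<longleftrightarrow> z \<in> pts N \<and> f z \<in> pts P \<and>
     (\<forall>(D, \<psi>)\<in>charts N. \<forall>(C, \<eta>)\<in>charts P. z \<in> D \<longrightarrow> f z \<in> C \<longrightarrow>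
        (\<exists>U G. openin (top_of_set (Euc (idx N))) U \<and> \<psi> z \<in> U \<and>
           (\<forall>j\<in>idx P. Cinf (idx N) U (\<lambda>x. G x j)) \<and>
           (\<forall>z'\<in>D. \<psi> z' \<in> U \<longrightarrow> f z' \<in> C \<and> \<eta> (f z') = G (\<psi> z'))))"

definition smooth_map :: "('a, 'i) mfd \<Rightarrow> ('b, 'j) mfd \<Rightarrow> ('a \<Rightarrow> 'b) \<Rightarrow> bool" where
  "smooth_map N P f \<longleftrightarrow> (\<forall>z\<in>pts N. smooth_at N P f z)"

text \<open>Surjective submersions. Submersions are defined as in Lang's ``Fundamentals of Differential Geometry'': in suitable
charts around each point and its image the map is a coordinate projection.\<close>

definition surj_submersion :: "('a, 'i) mfd \<Rightarrow> ('b, 'j) mfd \<Rightarrow> ('a \<Rightarrow> 'b) \<Rightarrow> bool" where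
  "surj_submersion P N f \<longleftrightarrow> smooth_map P N f \<and> f ` pts P = pts N \<and>
     (\<forall>z\<in>pts P. \<exists>D \<psi> C \<phi> \<kappa>. compatible P (D, \<psi>) \<and> z \<in> D \<and> compatible N (C, \<phi>) \<and> f ` D \<subseteq> C \<and>
        inj_on \<kappa> (idx N) \<and> \<kappa> ` idx N \<subseteq> idx P \<and>
        (\<forall>z'\<in>D. \<forall>i\<in>idx N. \<phi> (f z') i = \<psi> z' (\<kappa> i)))"

section \<open>Tangent vectors\<close>

text \<open>Tangent vectors are velocities \<open>\<partial>/\<partial>t|\<^sub>0 c(t)\<close>, i.e. classes of curves.\<close>

definition curve :: "('a, 'i) mfd \<Rightarrow> (real \<Rightarrow> 'a) \<Rightarrow> bool" where
  "curve N c \<longleftrightarrow> smooth_at realline N c 0"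

definition vel :: "('a \<Rightarrow> 'i \<Rightarrow> real) \<Rightarrow> (real \<Rightarrow> 'a) \<Rightarrow> 'i \<Rightarrow> real" where
  "vel \<psi> c i = deriv (\<lambda>t. \<psi> (c t) i) 0"

definition tvec :: "('a, 'i) mfd \<Rightarrow> (real \<Rightarrow> 'a) \<Rightarrow> (real \<Rightarrow> 'a) set" where
  "tvec N c = {c'. curve N c' \<and> c' 0 = c 0 \<and>
     (\<forall>(D, \<psi>)\<in>charts N. c 0 \<in> D \<longrightarrow> (\<forall>i\<in>idx N. vel \<psi> c' i = vel \<psi> c i))}"

definition foot :: "(real \<Rightarrow> 'a) set \<Rightarrow> 'a" where
  "foot v = (SOME c. c \<in> v) 0"

definition vcomp :: "('a \<Rightarrow> 'i \<Rightarrow> real) \<Rightarrow> (real \<Rightarrow> 'a) set \<Rightarrow> 'i \<Rightarrow> real" where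
  "vcomp \<psi> v = vel \<psi> (SOME c. c \<in> v)"

definition TM :: "('a, 'i) mfd \<Rightarrow> ((real \<Rightarrow> 'a) set, 'i + 'i) mfd" where
  "TM N = \<lparr>pts = {tvec N c | c. curve N c}, idx = idx N <+> idx N,
     charts = {({tvec N c | c. curve N c \<and> c 0 \<in> D},
                \<lambda>v. case_sum (\<psi> (foot v)) (vcomp \<psi> v)) | D \<psi>. (D, \<psi>) \<in> charts N}\<rparr>"

definition tspace :: "('a, 'i) mfd \<Rightarrow> 'a \<Rightarrow> (real \<Rightarrow> 'a) set set" where
  "tspace N z = {v \<in> pts (TM N). foot v = z}"

definition Tmap :: "('b, 'j) mfd \<Rightarrow> ('a \<Rightarrow> 'b) \<Rightarrow> (real \<Rightarrow> 'a) set \<Rightarrow> (real \<Rightarrow> 'b) set" where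
  "Tmap P f v = tvec P (f \<circ> (SOME c. c \<in> v))"

section \<open>Fibered manifolds, jets of sections, vertical bundles\<close>

record ('p, 'j, 'e) fibm =
  tot :: "('p, 'j) mfd"
  bas :: "('e, nat) mfd"
  prj :: "'p \<Rightarrow> 'e"

definition fibered_manifold :: "('p, 'j, 'e) fibm \<Rightarrow> bool" where
  "fibered_manifold Y \<longleftrightarrow> manifold (tot Y) \<and> manifold (bas Y) \<and>
     surj_submersion (tot Y) (bas Y) (prj Y)"

definition section_on :: "('p, 'j, 'e) fibm \<Rightarrow> 'e set \<Rightarrow> ('e \<Rightarrow> 'p) \<Rightarrow> bool" where
  "section_on Y W u \<longleftrightarrow> (\<forall>y\<in>W. smooth_at (bas Y) (tot Y) u y \<and> prj Y (u y) = y)"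

definition local_section :: "('p, 'j, 'e) fibm \<Rightarrow> 'e \<Rightarrow> ('e \<Rightarrow> 'p) \<Rightarrow> bool" where
  "local_section Y y u \<longleftrightarrow> (\<exists>W. openin (mtop (bas Y)) W \<and> y \<in> W \<and> section_on Y W u)"

text \<open>The \<open>k\<close>-jet at \<open>y\<close> of a map \<open>u\<close> from \<open>E\<close> to \<open>P\<close> smooth near \<open>y\<close>, together with its source.\<close>

definition jet :: "nat \<Rightarrow> ('e, nat) mfd \<Rightarrow> ('p, 'j) mfd \<Rightarrow> 'e \<Rightarrow> ('e \<Rightarrow> 'p) \<Rightarrow> 'e \<times> ('e \<Rightarrow> 'p) set" where
  "jet k E P y u = (y, {v. smooth_at E P v y \<and> v y = u y \<and>
     (\<forall>(D, \<phi>)\<in>charts E. \<forall>(C, \<eta>)\<in>charts P. y \<in> D \<longrightarrow> u y \<in> C \<longrightarrow>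
        (\<forall>\<alpha>\<in>lists (idx E). length \<alpha> \<le> k \<longrightarrow> (\<forall>j\<in>idx P.
           pds \<alpha> (\<lambda>x. \<eta> (v (inv_into D \<phi> x)) j) (\<phi> y) =
           pds \<alpha> (\<lambda>x. \<eta> (u (inv_into D \<phi> x)) j) (\<phi> y))))})"

definition jrep :: "'e \<times> ('e \<Rightarrow> 'p) set \<Rightarrow> 'e \<Rightarrow> 'p" where
  "jrep X = (SOME u. u \<in> snd X)"

text \<open>The manifold of \<open>k\<close>-jets of maps from \<open>E\<close> to \<open>P\<close>; its coordinates are those of the source and the
partial derivatives of order at most \<open>k\<close>, the multiindices being encoded as sorted lists.\<close>

definition multiindices :: "nat \<Rightarrow> nat set \<Rightarrow> nat list set" where
  "multiindices k I = {\<alpha>\<in>lists I. sorted \<alpha> \<and> length \<alpha> \<le> k}"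

definition JM :: "nat \<Rightarrow> ('e, nat) mfd \<Rightarrow> ('p, 'j) mfd \<Rightarrow>
    ('e \<times> ('e \<Rightarrow> 'p) set, nat + 'j \<times> nat list) mfd" where
  "JM k E P = \<lparr>pts = {jet k E P y u | y u. smooth_at E P u y},
     idx = idx E <+> idx P \<times> multiindices k (idx E),
     charts = {({jet k E P y u | y u. smooth_at E P u y \<and> y \<in> D \<and> u y \<in> C},
                \<lambda>X. case_sum (\<phi> (fst X))
                  (\<lambda>(j, \<alpha>). if j \<in> idx P \<and> \<alpha> \<in> multiindices k (idx E)
                     then pds \<alpha> (\<lambda>x. \<eta> (jrep X (inv_into D \<phi> x)) j) (\<phi> (fst X)) else 0))
               | D \<phi> C \<eta>. (D, \<phi>) \<in> charts E \<and> (C, \<eta>) \<in> charts P}\<rparr>"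

abbreviation sjet :: "nat \<Rightarrow> ('p, 'j, 'e) fibm \<Rightarrow> 'e \<Rightarrow> ('e \<Rightarrow> 'p) \<Rightarrow> 'e \<times> ('e \<Rightarrow> 'p) set" where
  "sjet k Y \<equiv> jet k (bas Y) (tot Y)"

text \<open>\<open>J\<^sup>kY\<close>, the submanifold of jets of local sections of \<open>Y\<close>, fibered over the base of \<open>Y\<close>.\<close>

definition Jet :: "nat \<Rightarrow> ('p, 'j, 'e) fibm \<Rightarrow>
    ('e \<times> ('e \<Rightarrow> 'p) set, nat + 'j \<times> nat list, 'e) fibm" where
  "Jet k Y = \<lparr>tot = restr (JM k (bas Y) (tot Y)) {sjet k Y y u | y u. local_section Y y u},
     bas = bas Y, prj = fst\<rparr>"

definition jproj :: "nat \<Rightarrow> ('p, 'j, 'e) fibm \<Rightarrow> 'e \<times> ('e \<Rightarrow> 'p) set \<Rightarrow> 'e \<times> ('e \<Rightarrow> 'p) set" where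
  "jproj s Y X = sjet s Y (fst X) (jrep X)"

text \<open>\<open>VY\<close>, the kernel of the tangent map of the projection, fibered over the base of \<open>Y\<close>.\<close>

definition Vert :: "('p, 'j, 'e) fibm \<Rightarrow> ((real \<Rightarrow> 'p) set, 'j + 'j, 'e) fibm" where
  "Vert Y = \<lparr>tot = restr (TM (tot Y))
       {v. Tmap (bas Y) (prj Y) v = tvec (bas Y) (\<lambda>_. prj Y (foot v))},
     bas = bas Y, prj = prj Y \<circ> foot\<rparr>"

text \<open>\<open>J\<^sup>rY \<times> VJ\<^sup>sY\<close>, fibered product over \<open>J\<^sup>sY\<close>.\<close>

definition JV :: "nat \<Rightarrow> nat \<Rightarrow> ('p, 'j, 'e) fibm \<Rightarrow>
    (('e \<times> ('e \<Rightarrow> 'p) set) \<times> (real \<Rightarrow> 'e \<times> ('e \<Rightarrow> 'p) set) set,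
     (nat + 'j \<times> nat list) + (nat + 'j \<times> nat list) + (nat + 'j \<times> nat list)) mfd" where
  "JV r s Y = restr (prodm (tot (Jet r Y)) (tot (Vert (Jet s Y)))) {(X, v). jproj s Y X = foot v}"

text \<open>The exchange map \<open>\<kappa>\<^sub>s\<close> sends \<open>\<partial>/\<partial>t|\<^sub>0 j\<^sup>s\<^sub>y u(t,_)\<close> to \<open>j\<^sup>s\<^sub>y (\<partial>/\<partial>t|\<^sub>0 u(t,_))\<close>.\<close>

definition exch :: "nat \<Rightarrow> ('p, 'j, 'e) fibm \<Rightarrow> (real \<Rightarrow> 'e \<times> ('e \<Rightarrow> 'p) set) set \<Rightarrow>
    'e \<times> ('e \<Rightarrow> (real \<Rightarrow> 'p) set) set" where
  "exch s Y v = (THE Z. \<exists>u y \<epsilon> W. 0 < \<epsilon> \<and> openin (mtop (bas Y)) W \<and> y \<in> W \<and>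
     (\<forall>t\<in>{-\<epsilon><..<\<epsilon>}. \<forall>y'\<in>W.
        smooth_at (prodm realline (bas Y)) (tot Y) (\<lambda>(t, y). u t y) (t, y') \<and>
        prj Y (u t y') = y') \<and>
     v = tvec (tot (Jet s Y)) (\<lambda>t. sjet s Y y (u t)) \<and>
     Z = sjet s (Vert Y) y (\<lambda>y'. tvec (tot Y) (\<lambda>t. u t y')))"

definition exch_inv :: "nat \<Rightarrow> ('p, 'j, 'e) fibm \<Rightarrow>
    'e \<times> ('e \<Rightarrow> (real \<Rightarrow> 'p) set) set \<Rightarrow> (real \<Rightarrow> 'e \<times> ('e \<Rightarrow> 'p) set) set" where
  "exch_inv s Y = inv_into (pts (tot (Vert (Jet s Y)))) (exch s Y)"

section \<open>Exterior forms\<close>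

text \<open>An element of \<open>\<Lambda>\<^sup>lT\<^sup>*\<^sub>yE\<close> is an alternating multilinear function of lists of \<open>l\<close> tangent
vectors at \<open>y\<close>, extended by \<open>0\<close> to all other lists. Linear combinations of tangent vectors are
expressed in charts.\<close>

definition lincomb :: "('e, 'i) mfd \<Rightarrow> 'e \<Rightarrow> (real \<Rightarrow> 'e) set \<Rightarrow>
    real \<Rightarrow> (real \<Rightarrow> 'e) set \<Rightarrow> real \<Rightarrow> (real \<Rightarrow> 'e) set \<Rightarrow> bool" where
  "lincomb E y u a v b w \<longleftrightarrow> u \<in> tspace E y \<and> v \<in> tspace E y \<and> w \<in> tspace E y \<and>
     (\<forall>(D, \<phi>)\<in>charts E. y \<in> D \<longrightarrow>
        (\<forall>i\<in>idx E. vcomp \<phi> u i = a * vcomp \<phi> v i + b * vcomp \<phi> w i))"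

definition altform :: "('e, 'i) mfd \<Rightarrow> nat \<Rightarrow> 'e \<Rightarrow> ((real \<Rightarrow> 'e) set list \<Rightarrow> real) \<Rightarrow> bool" where
  "altform E l y \<omega> \<longleftrightarrow>
     (\<forall>vs. \<not> (length vs = l \<and> set vs \<subseteq> tspace E y) \<longrightarrow> \<omega> vs = 0) \<and>
     (\<forall>vs k u a v b w. length vs = l \<and> set vs \<subseteq> tspace E y \<and> k < l \<and> lincomb E y u a v b w \<longrightarrow>
        \<omega> (vs[k := u]) = a * \<omega> (vs[k := v]) + b * \<omega> (vs[k := w])) \<and>
     (\<forall>vs. length vs = l \<and> set vs \<subseteq> tspace E y \<and> \<not> distinct vs \<longrightarrow> \<omega> vs = 0)"

text \<open>The tangent vector at \<open>y\<close> with components \<open>\<xi>\<close> in the chart \<open>(D, \<phi>)\<close>.\<close>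

definition cvec :: "('e, 'i) mfd \<Rightarrow> 'e set \<Rightarrow> ('e \<Rightarrow> 'i \<Rightarrow> real) \<Rightarrow> 'e \<Rightarrow> ('i \<Rightarrow> real) \<Rightarrow>
    (real \<Rightarrow> 'e) set" where
  "cvec E D \<phi> y \<xi> = tvec E (\<lambda>t. inv_into D \<phi> (\<lambda>i. \<phi> y i + t * \<xi> i))"

definition Forms :: "nat \<Rightarrow> ('e, nat) mfd \<Rightarrow>
    ('e \<times> ((real \<Rightarrow> 'e) set list \<Rightarrow> real), nat + nat list, 'e) fibm" where
  "Forms l E = \<lparr>tot =
     \<lparr>pts = {(y, \<omega>). y \<in> pts E \<and> altform E l y \<omega>},
      idx = idx E <+> {\<alpha>\<in>lists (idx E). length \<alpha> = l \<and> sorted_wrt (<) \<alpha>},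
      charts = {({(y, \<omega>). y \<in> D \<and> altform E l y \<omega>},
                 \<lambda>(y, \<omega>). case_sum (\<phi> y)
                   (\<lambda>\<alpha>. if \<alpha> \<in> lists (idx E) \<and> length \<alpha> = l \<and> sorted_wrt (<) \<alpha>
                      then \<omega> (map (\<lambda>i. cvec E D \<phi> y (\<lambda>j. of_bool (j = i))) \<alpha>) else 0))
                | D \<phi>. (D, \<phi>) \<in> charts E}\<rparr>,
     bas = E, prj = fst\<rparr>"

text \<open>The exterior differential at \<open>y\<close> in a chart around \<open>y\<close>:
\<open>d\<omega>(v\<^sub>0,\<dots>,v\<^sub>l) = \<Sum>\<^sub>k (-1)\<^sup>k \<partial>\<^bsub>v\<^sub>k\<^esub> (\<omega>(v\<^sub>0,\<dots>,v\<^sub>l without v\<^sub>k))\<close>, where the vectors are extended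
to vector fields with constant components.\<close>

definition extd :: "('e, nat) mfd \<Rightarrow> nat \<Rightarrow> ('e \<Rightarrow> 'e \<times> ((real \<Rightarrow> 'e) set list \<Rightarrow> real)) \<Rightarrow>
    'e \<Rightarrow> 'e \<times> ((real \<Rightarrow> 'e) set list \<Rightarrow> real)" where
  "extd E l \<omega> y = (let (D, \<phi>) = (SOME c. c \<in> charts E \<and> y \<in> fst c) in
     (y, \<lambda>vs. if length vs = Suc l \<and> set vs \<subseteq> tspace E y
        then \<Sum>k\<le>l. (-1) ^ k * (\<Sum>i\<in>idx E. vcomp \<phi> (vs ! k) i *
          pd i (\<lambda>x. let z = inv_into D \<phi> x in
            snd (\<omega> z) (map (\<lambda>v. cvec E D \<phi> z (vcomp \<phi> v)) (take k vs @ drop (Suc k) vs))) (\<phi> y))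
        else 0))"

definition delta :: "('e, nat) mfd \<Rightarrow> nat \<Rightarrow>
    'e \<times> ('e \<Rightarrow> 'e \<times> ((real \<Rightarrow> 'e) set list \<Rightarrow> real)) set \<Rightarrow>
    'e \<times> ((real \<Rightarrow> 'e) set list \<Rightarrow> real)" where
  "delta E l Z = (THE \<theta>. \<exists>\<omega>. local_section (Forms l E) (fst Z) \<omega> \<and>
     sjet 1 (Forms l E) (fst Z) \<omega> = Z \<and> \<theta> = extd E l \<omega> (fst Z))"

section \<open>The formal exterior differential on the finite dimensional side\<close>

text \<open>\<open>J1hol r s Y P \<psi> (j\<^bsup>r+1\<^esup>\<^sub>y a, j\<^bsup>s+1\<^esup>\<^sub>y b) = j\<^sup>1\<^sub>y (\<psi> (j\<^sup>r a, j\<^sup>s b))\<close> for \<open>\<psi>\<close> defined on the fibered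
product of \<open>J\<^sup>rY\<close> and \<open>J\<^sup>sVY\<close> over \<open>J\<^sup>sY\<close>; the representatives are sections for which
\<open>(j\<^sup>r a, j\<^sup>s b)\<close> stays in this fibered product.\<close>

definition J1hol :: "nat \<Rightarrow> nat \<Rightarrow> ('p, 'j, 'e) fibm \<Rightarrow> ('w, 'k, 'e) fibm \<Rightarrow>
    (('e \<times> ('e \<Rightarrow> 'p) set) \<times> ('e \<times> ('e \<Rightarrow> (real \<Rightarrow> 'p) set) set) \<Rightarrow> 'w) \<Rightarrow>
    ('e \<times> ('e \<Rightarrow> 'p) set) \<times> ('e \<times> ('e \<Rightarrow> (real \<Rightarrow> 'p) set) set) \<Rightarrow> 'e \<times> ('e \<Rightarrow> 'w) set" where
  "J1hol r s Y P \<psi> = (\<lambda>(X, Z). THE \<Xi>. \<exists>y W a b.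
     openin (mtop (bas Y)) W \<and> y \<in> W \<and> section_on Y W a \<and> section_on (Vert Y) W b \<and>
     X = sjet (Suc r) Y y a \<and> Z = sjet (Suc s) (Vert Y) y b \<and>
     (\<forall>y'\<in>W. sjet s Y y' a = sjet s Y y' (foot \<circ> b)) \<and>
     \<Xi> = sjet 1 P y (\<lambda>y'. \<psi> (sjet r Y y' a, sjet s (Vert Y) y' b)))"

definition scrJ1hol :: "nat \<Rightarrow> nat \<Rightarrow> nat \<Rightarrow> ('p, 'j, 'e) fibm \<Rightarrow>
    (('e \<times> ('e \<Rightarrow> 'p) set) \<times> (real \<Rightarrow> 'e \<times> ('e \<Rightarrow> 'p) set) set \<Rightarrow>
       'e \<times> ((real \<Rightarrow> 'e) set list \<Rightarrow> real)) \<Rightarrow>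
    ('e \<times> ('e \<Rightarrow> 'p) set) \<times> (real \<Rightarrow> 'e \<times> ('e \<Rightarrow> 'p) set) set \<Rightarrow>
    'e \<times> ('e \<Rightarrow> 'e \<times> ((real \<Rightarrow> 'e) set list \<Rightarrow> real)) set" where
  "scrJ1hol r s l Y B = (\<lambda>(X, v).
     J1hol r s Y (Forms l (bas Y)) (\<lambda>(X', Z'). B (X', exch_inv s Y Z')) (X, exch (Suc s) Y v))"

definition formal_d :: "nat \<Rightarrow> nat \<Rightarrow> nat \<Rightarrow> ('p, 'j, 'e) fibm \<Rightarrow>
    (('e \<times> ('e \<Rightarrow> 'p) set) \<times> (real \<Rightarrow> 'e \<times> ('e \<Rightarrow> 'p) set) set \<Rightarrow>
       'e \<times> ((real \<Rightarrow> 'e) set list \<Rightarrow> real)) \<Rightarrow>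
    ('e \<times> ('e \<Rightarrow> 'p) set) \<times> (real \<Rightarrow> 'e \<times> ('e \<Rightarrow> 'p) set) set \<Rightarrow>
    'e \<times> ((real \<Rightarrow> 'e) set list \<Rightarrow> real)" where
  "formal_d r s l Y B = delta (bas Y) l \<circ> scrJ1hol r s l Y B"

section \<open>Holonomic jets\<close>

text \<open>The inclusion of \<open>J\<^bsup>k+1\<^esup>Y\<close> into \<open>J\<^sup>1J\<^sup>kY\<close>.\<close>

definition hol :: "nat \<Rightarrow> ('p, 'j, 'e) fibm \<Rightarrow> 'e \<times> ('e \<Rightarrow> 'p) set \<Rightarrow>
    'e \<times> ('e \<Rightarrow> 'e \<times> ('e \<Rightarrow> 'p) set) set" where
  "hol k Y X = (THE Z. \<exists>y a. local_section Y y a \<and> X = sjet (Suc k) Y y a \<and>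
     Z = sjet 1 (Jet k Y) y (\<lambda>y'. sjet k Y y' a))"

definition J1map :: "('p, 'j, 'e) fibm \<Rightarrow> ('w, 'k, 'e) fibm \<Rightarrow> ('p \<Rightarrow> 'w) \<Rightarrow>
    'e \<times> ('e \<Rightarrow> 'p) set \<Rightarrow> 'e \<times> ('e \<Rightarrow> 'w) set" where
  "J1map Y Y' f X = (THE Z. \<exists>y w. local_section Y y w \<and> X = sjet 1 Y y w \<and> Z = sjet 1 Y' y (f \<circ> w))"

text \<open>The inclusion of \<open>VJ\<^bsup>s+1\<^esup>Y\<close> into \<open>J\<^sup>1VJ\<^sup>sY\<close>.\<close>

definition holV :: "nat \<Rightarrow> ('p, 'j, 'e) fibm \<Rightarrow> (real \<Rightarrow> 'e \<times> ('e \<Rightarrow> 'p) set) set \<Rightarrow>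
    'e \<times> ('e \<Rightarrow> (real \<Rightarrow> 'e \<times> ('e \<Rightarrow> 'p) set) set) set" where
  "holV s Y = J1map (Jet s (Vert Y)) (Vert (Jet s Y)) (exch_inv s Y)
     \<circ> hol s (Vert Y) \<circ> exch (Suc s) Y"

section \<open>The functional side\<close>

text \<open>Let \<open>\<pi>\<close> be the projection of \<open>E\<close> onto \<open>M\<close>. An element of the fiber of \<open>S(E,P)\<close> over \<open>x\<close> is
represented by a function that is \<open>undefined\<close> outside \<open>E\<^sub>x\<close> (\<open>restrict\<close>). An \<open>F\<close>-smooth section
of \<open>S(E,P)\<close> on \<open>U\<close> is given by the corresponding section of \<open>P\<close> on \<open>\<pi>\<^sup>-\<^sup>1(U)\<close>.\<close>

definition over :: "('e, 'i) mfd \<Rightarrow> ('e \<Rightarrow> 'm) \<Rightarrow> 'm set \<Rightarrow> 'e set" where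
  "over E \<pi> U = {y \<in> pts E. \<pi> y \<in> U}"

definition Fsection :: "('m, 'i) mfd \<Rightarrow> ('e \<Rightarrow> 'm) \<Rightarrow> ('p, 'j, 'e) fibm \<Rightarrow> 'm set \<Rightarrow> ('e \<Rightarrow> 'p) \<Rightarrow> bool" where
  "Fsection M \<pi> P U u \<longleftrightarrow> openin (mtop M) U \<and> section_on P (over (bas P) \<pi> U) u"

text \<open>The \<open>k\<close>-jet at \<open>x\<close> of a local section of \<open>S(E,P)\<close>, together with \<open>x\<close>.\<close>

definition Fjet :: "nat \<Rightarrow> ('m, 'i) mfd \<Rightarrow> ('e \<Rightarrow> 'm) \<Rightarrow> ('p, 'j, 'e) fibm \<Rightarrow> 'm \<Rightarrow> ('e \<Rightarrow> 'p) \<Rightarrow>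
    'm \<times> ('e \<Rightarrow> 'p) set" where
  "Fjet k M \<pi> P x u = (x, {v. (\<exists>U. x \<in> U \<and> Fsection M \<pi> P U v) \<and>
     (\<forall>y\<in>over (bas P) \<pi> {x}. sjet k P y v = sjet k P y u)})"

definition Smap :: "'e set \<Rightarrow> ('p \<Rightarrow> 'w) \<Rightarrow> ('e \<Rightarrow> 'p) \<Rightarrow> 'e \<Rightarrow> 'w" where
  "Smap E\<^sub>x f \<sigma> = restrict (f \<circ> \<sigma>) E\<^sub>x"

definition inj_i :: "nat \<Rightarrow> ('e \<Rightarrow> 'm) \<Rightarrow> ('p, 'j, 'e) fibm \<Rightarrow> 'm \<times> ('e \<Rightarrow> 'p) set \<Rightarrow>
    'e \<Rightarrow> 'e \<times> ('e \<Rightarrow> 'p) set" where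
  "inj_i k \<pi> P X = restrict (\<lambda>y. sjet k P y (SOME u. u \<in> snd X)) (over (bas P) \<pi> {fst X})"

text \<open>Sections \<open>a\<close> of \<open>J\<^sup>rY\<close> and \<open>b\<close> of \<open>VJ\<^sup>sY\<close> over \<open>\<pi>\<^sup>-\<^sup>1(U)\<close>, with the same projection to \<open>J\<^sup>sY\<close>,
representing the pair \<open>(X, Z)\<close> of jets at \<open>x\<close>.\<close>

definition represents :: "nat \<Rightarrow> nat \<Rightarrow> ('m, 'i) mfd \<Rightarrow> ('e \<Rightarrow> 'm) \<Rightarrow> ('p, 'j, 'e) fibm \<Rightarrow> 'm \<Rightarrow>
    ('e \<Rightarrow> 'e \<times> ('e \<Rightarrow> 'p) set) \<Rightarrow> ('e \<Rightarrow> (real \<Rightarrow> 'e \<times> ('e \<Rightarrow> 'p) set) set) \<Rightarrow>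
    'm \<times> ('e \<Rightarrow> 'e \<times> ('e \<Rightarrow> 'p) set) set \<Rightarrow>
    'm \<times> ('e \<Rightarrow> (real \<Rightarrow> 'e \<times> ('e \<Rightarrow> 'p) set) set) set \<Rightarrow> bool" where
  "represents r s M \<pi> Y x a b X Z \<longleftrightarrow> (\<exists>U. x \<in> U \<and>
     Fsection M \<pi> (Jet r Y) U a \<and> Fsection M \<pi> (Vert (Jet s Y)) U b \<and>
     (\<forall>y\<in>over (bas Y) \<pi> U. jproj s Y (a y) = foot (b y)) \<and>
     X = Fjet 1 M \<pi> (Jet r Y) x a \<and> Z = Fjet 1 M \<pi> (Vert (Jet s Y)) x b)"

text \<open>The fibered product of \<open>J\<^sup>1S(E,J\<^sup>rY)\<close> and \<open>J\<^sup>1S(E,VJ\<^sup>sY)\<close> over \<open>J\<^sup>1S(E,J\<^sup>sY)\<close> is the space of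
\<open>1\<close>-jets of sections of the fibered product of \<open>S(E,J\<^sup>rY)\<close> and \<open>S(E,VJ\<^sup>sY)\<close> over \<open>S(E,J\<^sup>sY)\<close>,
i.e. its elements are the pairs of jets represented by sections with the same projection.\<close>

definition J1S_fibprod :: "nat \<Rightarrow> nat \<Rightarrow> ('m, 'i) mfd \<Rightarrow> ('e \<Rightarrow> 'm) \<Rightarrow> ('p, 'j, 'e) fibm \<Rightarrow>
    (('m \<times> ('e \<Rightarrow> 'e \<times> ('e \<Rightarrow> 'p) set) set) \<times>
     ('m \<times> ('e \<Rightarrow> (real \<Rightarrow> 'e \<times> ('e \<Rightarrow> 'p) set) set) set)) set" where
  "J1S_fibprod r s M \<pi> Y = {(X, Z). \<exists>x\<in>pts M. \<exists>a b. represents r s M \<pi> Y x a b X Z}"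

definition J1S :: "nat \<Rightarrow> nat \<Rightarrow> ('m, 'i) mfd \<Rightarrow> ('e \<Rightarrow> 'm) \<Rightarrow> ('p, 'j, 'e) fibm \<Rightarrow>
    ('w, 'k, 'e) fibm \<Rightarrow>
    (('e \<times> ('e \<Rightarrow> 'p) set) \<times> (real \<Rightarrow> 'e \<times> ('e \<Rightarrow> 'p) set) set \<Rightarrow> 'w) \<Rightarrow>
    ('m \<times> ('e \<Rightarrow> 'e \<times> ('e \<Rightarrow> 'p) set) set) \<times>
    ('m \<times> ('e \<Rightarrow> (real \<Rightarrow> 'e \<times> ('e \<Rightarrow> 'p) set) set) set) \<Rightarrow> 'm \<times> ('e \<Rightarrow> 'w) set" where
  "J1S r s M \<pi> Y P B = (\<lambda>(X, Z). THE \<Xi>. \<exists>x\<in>pts M. \<exists>a b. represents r s M \<pi> Y x a b X Z \<and>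
     \<Xi> = Fjet 1 M \<pi> P x (\<lambda>y. B (a y, b y)))"

definition functional_d :: "nat \<Rightarrow> nat \<Rightarrow> nat \<Rightarrow> ('m, 'i) mfd \<Rightarrow> ('e \<Rightarrow> 'm) \<Rightarrow> ('p, 'j, 'e) fibm \<Rightarrow>
    (('e \<times> ('e \<Rightarrow> 'p) set) \<times> (real \<Rightarrow> 'e \<times> ('e \<Rightarrow> 'p) set) set \<Rightarrow>
       'e \<times> ((real \<Rightarrow> 'e) set list \<Rightarrow> real)) \<Rightarrow>
    ('m \<times> ('e \<Rightarrow> 'e \<times> ('e \<Rightarrow> 'p) set) set) \<times>
    ('m \<times> ('e \<Rightarrow> (real \<Rightarrow> 'e \<times> ('e \<Rightarrow> 'p) set) set) set) \<Rightarrow>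
    'e \<Rightarrow> 'e \<times> ((real \<Rightarrow> 'e) set list \<Rightarrow> real)" where
  "functional_d r s l M \<pi> Y B XZ = Smap (over (bas Y) \<pi> {fst (fst XZ)}) (delta (bas Y) l)
     (inj_i 1 \<pi> (Forms l (bas Y)) (J1S r s M \<pi> Y (Forms l (bas Y)) B XZ))"

definition holonomic_part :: "nat \<Rightarrow> nat \<Rightarrow> ('m, 'i) mfd \<Rightarrow> ('e \<Rightarrow> 'm) \<Rightarrow> ('p, 'j, 'e) fibm \<Rightarrow>
    (('m \<times> ('e \<Rightarrow> 'e \<times> ('e \<Rightarrow> 'p) set) set) \<times>
     ('m \<times> ('e \<Rightarrow> (real \<Rightarrow> 'e \<times> ('e \<Rightarrow> 'p) set) set) set)) set" where
  "holonomic_part r s M \<pi> Y = {(X, Z) \<in> J1S_fibprod r s M \<pi> Y.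
     \<forall>y\<in>over (bas Y) \<pi> {fst X}.
       inj_i 1 \<pi> (Jet r Y) X y \<in> hol r Y ` pts (tot (Jet (Suc r) Y)) \<and>
       inj_i 1 \<pi> (Vert (Jet s Y)) Z y \<in> holV s Y ` pts (tot (Vert (Jet (Suc s) Y)))}"

text \<open>A pair of sections over \<open>E\<^sub>x\<close> is identified with a section of pairs.\<close>

definition inj_I :: "nat \<Rightarrow> nat \<Rightarrow> ('e \<Rightarrow> 'm) \<Rightarrow> ('p, 'j, 'e) fibm \<Rightarrow>
    ('m \<times> ('e \<Rightarrow> 'e \<times> ('e \<Rightarrow> 'p) set) set) \<times>
    ('m \<times> ('e \<Rightarrow> (real \<Rightarrow> 'e \<times> ('e \<Rightarrow> 'p) set) set) set) \<Rightarrow>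
    'e \<Rightarrow> ('e \<times> ('e \<Rightarrow> 'p) set) \<times> (real \<Rightarrow> 'e \<times> ('e \<Rightarrow> 'p) set) set" where
  "inj_I r s \<pi> Y = (\<lambda>(X, Z). restrict
     (\<lambda>y. (inv_into (pts (tot (Jet (Suc r) Y))) (hol r Y) (inj_i 1 \<pi> (Jet r Y) X y),
           inv_into (pts (tot (Vert (Jet (Suc s) Y)))) (holV s Y) (inj_i 1 \<pi> (Vert (Jet s Y)) Z y)))
     (over (bas Y) \<pi> {fst X}))"

end

theory Submission
  imports Defs
begin

text \<open>Over \<open>y \<in> E\<^sub>x\<close> both sides are \<open>\<delta>\<close> applied to \<open>j\<^sup>1\<^sub>y(B \<circ> (a, b))\<close>, where \<open>a\<close> and \<open>b\<close>
represent the given pair: the \<open>1\<close>-jet of a composition depends only on the \<open>1\<close>-jets of its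
ingredients, so it makes no difference whether they are represented by \<open>a\<close>, \<open>b\<close> or by prolongations
\<open>j\<^sup>r a'\<close>, \<open>\<kappa>\<^sub>s\<^sup>-\<^sup>1 \<circ> j\<^sup>s b'\<close>. The substance lies in the existence of the latter.
A vertical curve in \<open>J\<^sup>s\<^sup>+\<^sup>1Q\<close> has to be realized, up to first order, by the jets of a smooth family of
sections \<open>u(t, _)\<close> whose member \<open>u(0, _)\<close> is a prescribed section. To this end, Taylor polynomials
in a chart are added to the given section, and a smooth retraction onto the fibres of \<open>Q \<rightarrow> E\<close>,
available by submersion charts, turns the resulting maps into sections.\<close>

section \<open>Smooth functions near a point of \<open>\<real>\<^sup>I\<close>\<close>

text \<open>What shapes the argument is the compatibility condition in \<open>J1hol\<close>: its
  representatives must satisfy j^s a = j^s(foot b) on a whole neighbourhood, whereas a point (X, v)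
  of the finite dimensional fibered product only provides a and b separately. The given sections of
  J^rQ and VJ^sQ have a common projection to J^sQ. Comparing first jets of this projection, seen
  from either side, shows that the separate representatives have the same (s+1)-jet at y. Hence the
  foot of v is the (s+1)-jet of a, and a family realizing v may be started exactly at a; the
  condition then holds identically near y. Every bundle operation here is a definite description, so
  its value must be shown not to depend on representatives. All such questions are reduced to
  contact of order k in charts (\<open>agr\<close> for functions on R^I, \<open>agf\<close> on a
  manifold, \<open>jeq\<close> for maps). Exchanging time and base derivatives rests on the symmetry
  of second partial derivatives, proved below for this notion of smoothness.\<close>

definition near :: "'i set \<Rightarrow> ('i \<Rightarrow> real) \<Rightarrow> ('i \<Rightarrow> real) filter" where
  "near I x = inf (nhds x) (principal (Euc I))"

abbreviation open_Euc :: "'i set \<Rightarrow> ('i \<Rightarrow> real) set \<Rightarrow> bool" where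
  "open_Euc I U \<equiv> openin (top_of_set (Euc I)) U"

section \<open>Points of R^I and the neighbourhood filter\<close>

lemma EucI: "(\<And>i. i \<notin> I \<Longrightarrow> x i = 0) \<Longrightarrow> x \<in> Euc I"
  by (simp add: Euc_def)

lemma EucD: "x \<in> Euc I \<Longrightarrow> i \<notin> I \<Longrightarrow> x i = 0"
  by (simp add: Euc_def)

lemma Euc_eqI: "x \<in> Euc I \<Longrightarrow> y \<in> Euc I \<Longrightarrow> (\<And>i. i \<in> I \<Longrightarrow> x i = y i) \<Longrightarrow> x = y"
  by (metis EucD ext)

lemma Euc_upd: "x \<in> Euc I \<Longrightarrow> i \<in> I \<Longrightarrow> x(i := t) \<in> Euc I"
  by (auto simp: Euc_def)

lemma open_Euc_subset: "open_Euc I U \<Longrightarrow> U \<subseteq> Euc I"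
  using openin_subset by fastforce

lemma eventually_near:
  assumes "x \<in> Euc I"
  shows "eventually P (near I x) \<longleftrightarrow> (\<exists>U. open_Euc I U \<and> x \<in> U \<and> (\<forall>y\<in>U. P y))"
proof
  assume "eventually P (near I x)"
  then obtain S where "open S" "x \<in> S" "\<And>y. y \<in> S \<Longrightarrow> y \<in> Euc I \<Longrightarrow> P y"
    by (auto simp: near_def eventually_inf_principal eventually_nhds)
  then show "\<exists>U. open_Euc I U \<and> x \<in> U \<and> (\<forall>y\<in>U. P y)"
    using assms by (intro exI[of _ "Euc I \<inter> S"]) (auto simp: openin_open)
next
  assume "\<exists>U. open_Euc I U \<and> x \<in> U \<and> (\<forall>y\<in>U. P y)"
  then show "eventually P (near I x)"
    by (auto simp: near_def eventually_inf_principal eventually_nhds openin_open)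
qed

lemma eventually_near_open: "open_Euc I U \<Longrightarrow> x \<in> U \<Longrightarrow> eventually (\<lambda>y. y \<in> U) (near I x)"
  using open_Euc_subset eventually_near by blast

lemma eventually_near_Euc: "eventually (\<lambda>y. y \<in> Euc I) (near I x)"
  by (simp add: near_def eventually_inf_principal)

lemma eventually_near_self: "eventually P (near I x) \<Longrightarrow> x \<in> Euc I \<Longrightarrow> P x"
  by (auto simp: eventually_near)

lemma eventually_eventually_near:
  "x \<in> Euc I \<Longrightarrow> eventually P (near I x) \<Longrightarrow> eventually (\<lambda>y. eventually P (near I y)) (near I x)"
  by (subst eventually_near, assumption, subst (asm) eventually_near, assumption)
    (metis eventually_near open_Euc_subset subsetD)

lemma tendsto_fun: "((\<lambda>a. h a) \<longlongrightarrow> l) F \<longleftrightarrow> (\<forall>i. ((\<lambda>a. h a i) \<longlongrightarrow> l i) F)"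
  for h :: "'a \<Rightarrow> 'i \<Rightarrow> 'b::topological_space"
  using limitin_componentwise[of "\<lambda>_. euclidean" UNIV h l F]
  by (simp add: euclidean_product_topology limitin_canonical_iff)

text \<open>Coordinates outside I vanish on \<open>Euc I\<close>, so only those in I have to be
  tested for convergence; the eventual membership in \<open>Euc I\<close> settles the
  others.\<close>

lemma filterlim_near:
  assumes "l \<in> Euc I" "\<And>i. i \<in> I \<Longrightarrow> ((\<lambda>a. h a i) \<longlongrightarrow> l i) F" "eventually (\<lambda>a. h a \<in> Euc I) F"
  shows "filterlim h (near I l) F"
proof -
  have "((\<lambda>a. h a i) \<longlongrightarrow> l i) F" for i
  proof (cases "i \<in> I")
    case False
    then show ?thesis using assms(1,3)
      by (intro tendsto_eventually) (auto elim!: eventually_mono simp: Euc_def)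
  qed (use assms in auto)
  then show ?thesis
    using assms(3) unfolding near_def filterlim_inf filterlim_principal by (simp add: tendsto_fun)
qed

lemma filterlim_near_D: "filterlim h (near I l) F \<Longrightarrow> ((\<lambda>a. h a i) \<longlongrightarrow> l i) F"
  unfolding near_def filterlim_inf by (simp add: tendsto_fun)

lemma filterlim_upd:
  assumes "x \<in> Euc I" "i \<in> I"
  shows "filterlim (\<lambda>t. x(i := t)) (near I x) (nhds (x i))"
proof (rule filterlim_near)
  show "((\<lambda>t. (x(i := t)) j) \<longlongrightarrow> x j) (nhds (x i))" for j
    by (cases "j = i") (auto simp: filterlim_ident)
qed (use assms in \<open>auto simp: Euc_upd\<close>)

text \<open>The topology is that of the whole function type, but on \<open>Euc I\<close> only
  finitely many coordinates can vary, so boxes form a base of neighbourhoods. This provides the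
  explicit radii that the mean value arguments need.\<close>

lemma eventually_near_box:
  assumes "finite I" "x \<in> Euc I"
  shows "eventually P (near I x) \<longleftrightarrow>
    (\<exists>e>0. \<forall>y\<in>Euc I. (\<forall>i\<in>I. \<bar>y i - x i\<bar> < e) \<longrightarrow> P y)" (is "?L \<longleftrightarrow> ?R")
proof
  assume ?R
  then obtain e where e: "e > 0" "\<And>y. y \<in> Euc I \<Longrightarrow> (\<forall>i\<in>I. \<bar>y i - x i\<bar> < e) \<Longrightarrow> P y" by auto
  have "((\<lambda>y. y i) \<longlongrightarrow> x i) (near I x)" for i
    by (rule filterlim_near_D) (rule filterlim_ident)
  then have "eventually (\<lambda>y. \<bar>y i - x i\<bar> < e) (near I x)" for i
    using e(1) by (simp add: tendsto_iff dist_real_def)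
  then have "eventually (\<lambda>y. \<forall>i\<in>I. \<bar>y i - x i\<bar> < e) (near I x)"
    using assms(1) by (simp add: eventually_ball_finite)
  then show ?L using eventually_near_Euc[of I x] by eventually_elim (use e in auto)
next
  assume L: ?L
  define B where "B = (\<lambda>e. {y\<in>Euc I. \<forall>i\<in>I. \<bar>y i - x i\<bar> < e})"
  \<comment> \<open>The filter with the boxes as a base. That the identity tends to x along it can
    be checked one coordinate at a time.\<close>
  define F where "F = (INF e\<in>{0<..}. principal (B e))"
  have ev: "eventually Q F \<longleftrightarrow> (\<exists>e>0. \<forall>y\<in>B e. Q y)" for Q
  proof -
    have "eventually Q F \<longleftrightarrow> (\<exists>e\<in>{0<..}. eventually Q (principal (B e)))"
      unfolding F_def
    proof (rule eventually_INF_base)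
      fix a b :: real assume "a \<in> {0<..}" "b \<in> {0<..}"
      then show "\<exists>c\<in>{0<..}. principal (B c) \<le> inf (principal (B a)) (principal (B b))"
        by (intro bexI[of _ "min a b"]) (auto simp: B_def)
    qed (auto intro: exI[of _ 1])
    then show ?thesis by (auto simp: eventually_principal)
  qed
  have "filterlim (\<lambda>y. y) (near I x) F"
  proof (rule filterlim_near)
    fix i assume "i \<in> I"
    then show "((\<lambda>y. y i) \<longlongrightarrow> x i) F"
      by (auto simp: tendsto_iff dist_real_def ev B_def)
  qed (use assms in \<open>auto simp: ev B_def intro: exI[of _ 1]\<close>)
  then have "eventually P F" using L by (simp add: filterlim_iff)
  then show ?R by (auto simp: ev B_def)
qed

text \<open>Relative openness makes neighbourhoods in U and in \<open>Euc I\<close> coincide near x.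
  The filter \<open>near\<close> contains x itself, unlike \<open>at\<close>, but the limit is f x,
  so that point causes no difference.\<close>

lemma continuous_on_near:
  fixes f :: "('i \<Rightarrow> real) \<Rightarrow> 'b::topological_space"
  assumes U: "open_Euc I U"
  shows "continuous_on U f \<longleftrightarrow> (\<forall>x\<in>U. (f \<longlongrightarrow> f x) (near I x))"
proof -
  obtain S where S: "open S" "U = Euc I \<inter> S" using U unfolding openin_open by blast
  have "(f \<longlongrightarrow> f x) (at x within U) \<longleftrightarrow> (f \<longlongrightarrow> f x) (near I x)" if x: "x \<in> U" for x
  proof -
    have "at x within U = at x within Euc I"
      by (rule at_within_nhd[of _ S]) (use S x in auto)
    moreover have "(f \<longlongrightarrow> f x) (at x within Euc I) \<longleftrightarrow> (f \<longlongrightarrow> f x) (near I x)"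
    proof
      assume "(f \<longlongrightarrow> f x) (near I x)"
      moreover have "at x within Euc I \<le> near I x"
        unfolding at_within_def near_def by (intro inf_mono) auto
      ultimately show "(f \<longlongrightarrow> f x) (at x within Euc I)" by (rule tendsto_mono[rotated])
    next
      assume L: "(f \<longlongrightarrow> f x) (at x within Euc I)"
      show "(f \<longlongrightarrow> f x) (near I x)"
        unfolding tendsto_def
      proof (intro allI impI)
        fix T assume T: "open T" "f x \<in> T"
        with L have "eventually (\<lambda>y. f y \<in> T) (at x within Euc I)" by (simp add: tendsto_def)
        then have "eventually (\<lambda>y. y \<noteq> x \<longrightarrow> y \<in> Euc I \<longrightarrow> f y \<in> T) (nhds x)"
          unfolding eventually_at_filter .
        then show "eventually (\<lambda>y. f y \<in> T) (near I x)"
          unfolding near_def eventually_inf_principal by eventually_elim (use T in auto)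
      qed
    qed
    ultimately show ?thesis by simp
  qed
  then show ?thesis by (auto simp: continuous_on_def)
qed

section \<open>Locality of derivatives and germs of smooth functions\<close>

lemma pd_cong:
  assumes "eventually (\<lambda>y. f y = g y) (near I x)" "x \<in> Euc I" "i \<in> I"
  shows "pd i f x = pd i g x"
proof -
  have "eventually (\<lambda>t. f (x(i := t)) = g (x(i := t))) (nhds (x i))"
    using eventually_compose_filterlim[OF assms(1) filterlim_upd[OF assms(2,3)]] .
  then show ?thesis unfolding pd_def by (rule deriv_cong_ev) auto
qed

text \<open>The induction has to carry equality near x rather than at x, because the next derivative
  is taken of the functions compared.\<close>

lemma eventually_pds_cong:
  assumes "eventually (\<lambda>y. f y = g y) (near I x)" "x \<in> Euc I" "w \<in> lists I"
  shows "eventually (\<lambda>y. pds w f y = pds w g y) (near I x)"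
  using assms(3)
proof induction
  case (Cons i w)
  from eventually_eventually_near[OF assms(2) Cons.IH] eventually_near_Euc[of I x]
  show ?case by eventually_elim (use Cons pd_cong in auto)
qed (use assms in auto)

lemma pds_cong:
  "eventually (\<lambda>y. f y = g y) (near I x) \<Longrightarrow> x \<in> Euc I \<Longrightarrow> w \<in> lists I \<Longrightarrow> pds w f x = pds w g x"
  using eventually_pds_cong eventually_near_self by blast

lemma pds_append: "pds (v @ w) f = pds v (pds w f)"
  by (induction v) auto

lemma Cinf_pds:
  assumes "Cinf I U f" "w \<in> lists I" shows "Cinf I U (pds w f)"
  unfolding Cinf_def
proof
  fix v assume "v \<in> lists I"
  then have "v @ w \<in> lists I" using assms(2) by auto
  from assms(1)[unfolded Cinf_def, rule_format, OF this]
  show "continuous_on U (pds v (pds w f)) \<and>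
    (\<forall>i\<in>I. \<forall>x\<in>U. (\<lambda>t. pds v (pds w f) (x(i := t))) differentiable at (x i))"
    by (simp add: pds_append)
qed

lemma Cinf_continuous: "Cinf I U f \<Longrightarrow> continuous_on U f"
  by (force simp: Cinf_def dest: bspec[of _ _ "[]"])

lemma Cinf_pd_has_derivative:
  "Cinf I U f \<Longrightarrow> i \<in> I \<Longrightarrow> x \<in> U \<Longrightarrow>
    ((\<lambda>t. f (x(i := t))) has_real_derivative pd i f x) (at (x i))"
  unfolding pd_def Cinf_def
  by (metis DERIV_deriv_iff_real_differentiable lists.Nil pds.simps(1))

text \<open>A class of continuous functions closed under partial differentiation consists of smooth
  functions. Derivatives are matched with members of S on U only; openness of U keeps the coordinate
  lines through a point of U inside U for a while, so the values elsewhere do not enter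
  (\<open>tr\<close>).\<close>

lemma Cinf_coinduct:
  assumes "open_Euc I U" "S f"
    and cont: "\<And>f. S f \<Longrightarrow> continuous_on U f"
    and der: "\<And>f i. S f \<Longrightarrow> i \<in> I \<Longrightarrow>
      \<exists>g. S g \<and> (\<forall>x\<in>U. ((\<lambda>t. f (x(i := t))) has_real_derivative g x) (at (x i)))"
  shows "Cinf I U f"
proof -
  have UE: "U \<subseteq> Euc I" using assms(1) by (rule open_Euc_subset)
  have tr: "((\<lambda>t. f (x(i := t))) has_real_derivative d) (at (x i))"
    if "\<And>y. y \<in> U \<Longrightarrow> f y = g y" "x \<in> U" "i \<in> I"
      "((\<lambda>t. g (x(i := t))) has_real_derivative d) (at (x i))" for f g x i d
  proof -
    have "eventually (\<lambda>y. y \<in> U) (near I x)" using assms(1) that(2) by (rule eventually_near_open)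
    then have "eventually (\<lambda>t. x(i := t) \<in> U) (nhds (x i))"
      by (rule eventually_compose_filterlim[OF _ filterlim_upd]) (use that UE in auto)
    then have "eventually (\<lambda>t. f (x(i := t)) = g (x(i := t))) (nhds (x i))"
      by eventually_elim (use that in auto)
    then show ?thesis using that(4) by (subst DERIV_cong_ev[OF refl _ refl])
  qed
  have *: "\<exists>g. S g \<and> (\<forall>x\<in>U. pds w f x = g x)" if "w \<in> lists I" for w
    using that
  proof induction
    case Nil then show ?case using assms(2) by auto
  next
    case (Cons i w)
    then obtain g where g: "S g" "\<And>x. x \<in> U \<Longrightarrow> pds w f x = g x" by auto
    from der[OF g(1) Cons.hyps(1)] obtain g' where
      g': "S g'" "\<And>x. x \<in> U \<Longrightarrow> ((\<lambda>t. g (x(i := t))) has_real_derivative g' x) (at (x i))" by auto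
    have "pds (i # w) f x = g' x" if "x \<in> U" for x
      using DERIV_imp_deriv[OF tr[OF g(2) that Cons.hyps(1) g'(2)[OF that]]] unfolding pds.simps pd_def .
    then show ?case using g'(1) by auto
  qed
  show ?thesis unfolding Cinf_def
  proof (intro ballI conjI)
    fix w assume w: "w \<in> lists I"
    obtain g where g: "S g" "\<And>x. x \<in> U \<Longrightarrow> pds w f x = g x" using *[OF w] by auto
    show "continuous_on U (pds w f)" using cont[OF g(1)] g(2) by (simp cong: continuous_on_cong)
    fix i x assume ix: "i \<in> I" "x \<in> U"
    from der[OF g(1) ix(1)] ix(2) obtain d where "((\<lambda>t. g (x(i := t))) has_real_derivative d) (at (x i))"
      by auto
    from tr[OF g(2) ix(2,1) this] show "(\<lambda>t. pds w f (x(i := t))) differentiable at (x i)"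
      unfolding real_differentiable_def by blast
  qed
qed

definition sm :: "'i set \<Rightarrow> (('i \<Rightarrow> real) \<Rightarrow> real) \<Rightarrow> ('i \<Rightarrow> real) \<Rightarrow> bool" where
  "sm I f x \<longleftrightarrow> (\<exists>U. open_Euc I U \<and> x \<in> U \<and> Cinf I U f)"

lemma sm_Euc: "sm I f x \<Longrightarrow> x \<in> Euc I"
  using open_Euc_subset by (auto simp: sm_def)

lemma eventually_sm: "sm I f x \<Longrightarrow> eventually (sm I f) (near I x)"
  by (subst eventually_near[OF sm_Euc]) (auto simp: sm_def)

lemma sm_pds: "sm I f x \<Longrightarrow> w \<in> lists I \<Longrightarrow> sm I (pds w f) x"
  unfolding sm_def using Cinf_pds by blast

lemma sm_pd: "sm I f x \<Longrightarrow> i \<in> I \<Longrightarrow> sm I (pd i f) x"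
  using sm_pds[of I f x "[i]"] by simp

lemma sm_tendsto: "sm I f x \<Longrightarrow> (f \<longlongrightarrow> f x) (near I x)"
  using Cinf_continuous continuous_on_near by (fastforce simp: sm_def)

lemma sm_has_derivative:
  "sm I f x \<Longrightarrow> i \<in> I \<Longrightarrow> ((\<lambda>t. f (x(i := t))) has_real_derivative pd i f x) (at (x i))"
  by (auto simp: sm_def Cinf_pd_has_derivative)

lemma Cinf_iff_sm: "open_Euc I U \<Longrightarrow> Cinf I U f \<longleftrightarrow> (\<forall>x\<in>U. sm I f x)"
proof
  assume U: "open_Euc I U" and f: "\<forall>x\<in>U. sm I f x"
  show "Cinf I U f"
    unfolding Cinf_def
  proof (intro ballI conjI)
    fix w assume w: "w \<in> lists I"
    show "continuous_on U (pds w f)"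
      using sm_tendsto[OF sm_pds[OF _ w]] f U by (simp add: continuous_on_near)
    fix i x assume "i \<in> I" "x \<in> U"
    then show "(\<lambda>t. pds w f (x(i := t))) differentiable at (x i)"
      using sm_has_derivative[OF sm_pds[OF _ w]] f real_differentiable_def by blast
  qed
qed (auto simp: sm_def)

text \<open>Coinduction over the functions that agree on U with some smooth function: their partial
  derivatives on U are those of the smooth one, hence again of this kind.\<close>

lemma sm_cong:
  assumes "sm I f x" "eventually (\<lambda>y. f y = g y) (near I x)"
  shows "sm I g x"
proof -
  have x: "x \<in> Euc I" using assms(1) by (rule sm_Euc)
  have "eventually (\<lambda>y. sm I f y \<and> f y = g y) (near I x)"
    using eventually_sm[OF assms(1)] assms(2) by (rule eventually_conj)
  then obtain U where U: "open_Euc I U" "x \<in> U" "\<And>y. y \<in> U \<Longrightarrow> sm I f y \<and> f y = g y"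
    unfolding eventually_near[OF x] by auto
  have "Cinf I U f" using U by (simp add: Cinf_iff_sm)
  have "Cinf I U g"
  proof (rule Cinf_coinduct[where S = "\<lambda>g. \<exists>f. Cinf I U f \<and> (\<forall>y\<in>U. f y = g y)", OF U(1)])
    show "\<exists>f. Cinf I U f \<and> (\<forall>y\<in>U. f y = g y)" using U \<open>Cinf I U f\<close> by blast
    show "continuous_on U h" if "\<exists>f. Cinf I U f \<and> (\<forall>y\<in>U. f y = h y)" for h
      using that Cinf_continuous by (metis (no_types, lifting) continuous_on_cong)
    fix h i assume "\<exists>f. Cinf I U f \<and> (\<forall>y\<in>U. f y = h y)" and i: "i \<in> I"
    then obtain f where f: "Cinf I U f" "\<And>y. y \<in> U \<Longrightarrow> f y = h y" by auto
    have "((\<lambda>t. h (y(i := t))) has_real_derivative pd i f y) (at (y i))" if y: "y \<in> U" for y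
    proof -
      have "eventually (\<lambda>t. y(i := t) \<in> U) (nhds (y i))"
        by (rule eventually_compose_filterlim[OF eventually_near_open[OF U(1) y] filterlim_upd])
          (use y open_Euc_subset[OF U(1)] i in auto)
      then have "eventually (\<lambda>t. f (y(i := t)) = h (y(i := t))) (nhds (y i))"
        by eventually_elim (use f in auto)
      then show ?thesis using Cinf_pd_has_derivative[OF f(1) i y]
        by (subst (asm) DERIV_cong_ev[OF refl _ refl])
    qed
    moreover have "Cinf I U (pd i f)" using Cinf_pds[OF f(1), of "[i]"] i by simp
    ultimately show "\<exists>g. (\<exists>f. Cinf I U f \<and> (\<forall>y\<in>U. f y = g y)) \<and>
        (\<forall>x\<in>U. ((\<lambda>t. h (x(i := t))) has_real_derivative g x) (at (x i)))" by blast
  qed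
  then show ?thesis using U by (auto simp: sm_def)
qed

section \<open>Mean value theorem and chain rule\<close>

lemma mvt_pd:
  assumes "\<And>r. \<bar>r - a\<bar> \<le> \<bar>s - a\<bar> \<Longrightarrow> sm I F (x(k := r))" "k \<in> I"
  shows "\<exists>r. \<bar>r - a\<bar> \<le> \<bar>s - a\<bar> \<and> F (x(k := s)) - F (x(k := a)) = pd k F (x(k := r)) * (s - a)"
proof (cases "s = a")
  case False
  have d: "((\<lambda>t. F (x(k := t))) has_real_derivative pd k F (x(k := r))) (at r)"
    if "\<bar>r - a\<bar> \<le> \<bar>s - a\<bar>" for r
    using sm_has_derivative[OF assms(1)[OF that] assms(2)] by simp
  consider "a < s" | "s < a" using False by linarith
  then show ?thesis
  proof cases
    case 1
    from MVT2[OF 1, of "\<lambda>t. F (x(k := t))" "\<lambda>r. pd k F (x(k := r))"] d 1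
    obtain z where "a < z" "z < s" "F (x(k := s)) - F (x(k := a)) = (s - a) * pd k F (x(k := z))" by auto
    then show ?thesis by (intro exI[of _ z]) (auto simp: mult.commute)
  next
    case 2
    from MVT2[OF 2, of "\<lambda>t. F (x(k := t))" "\<lambda>r. pd k F (x(k := r))"] d 2
    obtain z where "s < z" "z < a" "F (x(k := a)) - F (x(k := s)) = (a - s) * pd k F (x(k := z))" by auto
    then show ?thesis by (intro exI[of _ z]) (auto simp: algebra_simps)
  qed
qed auto

text \<open>The coordinates are switched from z to \<gamma> t one at a time: \<open>mix A t\<close>
  has switched those in A. Each switch contributes, by the mean value theorem, a partial derivative
  at an intermediate point times the increment of one coordinate, and continuity of the partial
  derivatives gives the limit. Total differentiability is thereby bypassed.\<close>

lemma chain_rule: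
  assumes fin: "finite J" and sm: "sm J F (\<gamma> t0)"
    and d: "\<And>j. j \<in> J \<Longrightarrow> ((\<lambda>t. \<gamma> t j) has_real_derivative d j) (at t0)"
    and ev: "eventually (\<lambda>t. \<gamma> t \<in> Euc J) (nhds t0)"
  shows "((\<lambda>t. F (\<gamma> t)) has_real_derivative (\<Sum>j\<in>J. pd j F (\<gamma> t0) * d j)) (at t0)"
proof -
  define z where "z = \<gamma> t0"
  have z: "z \<in> Euc J" using sm unfolding z_def by (rule sm_Euc)
  define mix where "mix A t = (\<lambda>j. if j \<in> A then \<gamma> t j else z j)" for A t
  have mix0: "mix A t0 = z" for A by (auto simp: mix_def z_def)
  have lim: "((\<lambda>t. \<gamma> t j) \<longlongrightarrow> z j) (nhds t0)" if "j \<in> J" for j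
    using DERIV_isCont[OF d[OF that]] unfolding z_def isCont_def
    by (simp only: tendsto_at_iff_tendsto_nhds[of "\<lambda>t. \<gamma> t j"])
  have "((\<lambda>t. F (mix A t)) has_real_derivative (\<Sum>j\<in>A. pd j F z * d j)) (at t0)" if "A \<subseteq> J" for A
    using finite_subset[OF that fin] that
  proof (induction A rule: finite_induct)
    case empty
    then show ?case by (simp add: mix_def)
  next
    case (insert k A)
    then have k: "k \<in> J" and A: "A \<subseteq> J" by auto
    define D where "D t = F ((mix A t)(k := \<gamma> t k)) - F (mix A t)" for t
    \<comment> \<open>The difference quotient of the k-th switch, given its limit as value where the
      increment vanishes; then D t is the product of \<theta> t and the increment for every
      t.\<close>
    define \<theta> where "\<theta> t = (if \<gamma> t k = z k then pd k F z else D t / (\<gamma> t k - z k))" for t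
    have mk: "mix A t k = z k" for t using insert by (simp add: mix_def)
    have upd: "(mix A t)(k := z k) = mix A t" for t using mk by auto
    have D\<theta>: "D t = \<theta> t * (\<gamma> t k - z k)" for t
      by (auto simp: \<theta>_def D_def upd)
    have "(\<theta> \<longlongrightarrow> pd k F z) (nhds t0)"
      unfolding tendsto_iff
    proof (intro allI impI)
      fix e :: real assume e: "e > 0"
      have smz: "sm J F z" using sm by (simp add: z_def)
      have "eventually (\<lambda>y. dist (pd k F y) (pd k F z) < e \<and> sm J F y) (near J z)"
        using sm_tendsto[OF sm_pd[OF smz k]] e eventually_sm[OF smz]
        by (auto simp: tendsto_iff intro!: eventually_conj)
      then obtain r where r: "r > 0" "\<And>y. y \<in> Euc J \<Longrightarrow> (\<forall>i\<in>J. \<bar>y i - z i\<bar> < r) \<Longrightarrow>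
          dist (pd k F y) (pd k F z) < e \<and> sm J F y"
        unfolding eventually_near_box[OF fin z] by auto
      have "eventually (\<lambda>t. \<forall>j\<in>J. \<bar>\<gamma> t j - z j\<bar> < r) (nhds t0)"
        using lim r(1) fin by (auto simp: eventually_ball_finite_distrib tendsto_iff dist_real_def)
      then show "eventually (\<lambda>t. dist (\<theta> t) (pd k F z) < e) (nhds t0)"
        using ev
      proof eventually_elim
        case (elim t)
        show ?case
        proof (cases "\<gamma> t k = z k")
          case True then show ?thesis using e by (simp add: \<theta>_def)
        next
          case False
          have *: "dist (pd k F ((mix A t)(k := s))) (pd k F z) < e \<and> sm J F ((mix A t)(k := s))"
            if "\<bar>s - z k\<bar> \<le> \<bar>\<gamma> t k - z k\<bar>" for s
          proof (rule r(2))
            show "(mix A t)(k := s) \<in> Euc J"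
              using k A z by (auto simp: Euc_def mix_def)
            show "\<forall>i\<in>J. \<bar>((mix A t)(k := s)) i - z i\<bar> < r"
              using that elim(1) k r(1) by (auto simp: mix_def)
          qed
          then obtain s where s: "\<bar>s - z k\<bar> \<le> \<bar>\<gamma> t k - z k\<bar>"
            "F ((mix A t)(k := \<gamma> t k)) - F ((mix A t)(k := z k)) = pd k F ((mix A t)(k := s)) * (\<gamma> t k - z k)"
            using mvt_pd[of "z k" "\<gamma> t k" J F "mix A t" k] k by blast
          then have "D t = pd k F ((mix A t)(k := s)) * (\<gamma> t k - z k)" by (simp add: D_def upd)
          then have "\<theta> t = pd k F ((mix A t)(k := s))" using False by (simp add: \<theta>_def)
          then show ?thesis using * s(1) by auto
        qed
      qed
    qed
    then have "(\<theta> \<longlongrightarrow> pd k F z) (at t0)"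
      by (rule tendsto_mono[rotated]) (simp add: at_within_def)
    moreover have "((\<lambda>t. (\<gamma> t k - z k) / (t - t0)) \<longlongrightarrow> d k) (at t0)"
      using d[OF k] by (simp add: has_field_derivative_iff z_def)
    ultimately have "((\<lambda>t. \<theta> t * ((\<gamma> t k - z k) / (t - t0))) \<longlongrightarrow> pd k F z * d k) (at t0)"
      by (rule tendsto_mult)
    then have "(D has_real_derivative pd k F z * d k) (at t0)"
      by (simp add: has_field_derivative_iff D\<theta> z_def)
    from DERIV_add[OF insert.IH[OF A] this]
    have "((\<lambda>t. F ((mix A t)(k := \<gamma> t k))) has_real_derivative (\<Sum>j\<in>insert k A. pd j F z * d j)) (at t0)"
      using insert by (simp add: D_def add.commute)
    moreover have "(mix A t)(k := \<gamma> t k) = mix (insert k A) t" for t by (auto simp: mix_def)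
    ultimately show ?case by simp
  qed
  from this[of J] have 1: "((\<lambda>t. F (mix J t)) has_real_derivative (\<Sum>j\<in>J. pd j F z * d j)) (at t0)" by simp
  have "eventually (\<lambda>t. F (mix J t) = F (\<gamma> t)) (nhds t0)"
    using ev
  proof eventually_elim
    case (elim t)
    then have "mix J t = \<gamma> t" using z by (auto simp: mix_def Euc_def)
    then show ?case by simp
  qed
  then show ?thesis using 1 unfolding z_def[symmetric]
    by (subst (asm) DERIV_cong_ev[OF refl _ refl])
qed

section \<open>Closure of smooth functions under algebra and composition\<close>

lemma sm_const: "x \<in> Euc I \<Longrightarrow> sm I (\<lambda>_. c) x"
proof -
  assume x: "x \<in> Euc I"
  have o: "open_Euc I (Euc I)" by simp
  have "Cinf I (Euc I) (\<lambda>_. c)"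
  proof (rule Cinf_coinduct[where S = "\<lambda>f. \<exists>c. f = (\<lambda>_. c)", OF o])
    show "\<And>f i. \<exists>c. f = (\<lambda>_. c) \<Longrightarrow> i \<in> I \<Longrightarrow> \<exists>g. (\<exists>c. g = (\<lambda>_. c)) \<and>
        (\<forall>x\<in>Euc I. ((\<lambda>t. f (x(i := t))) has_real_derivative g x) (at (x i)))"
      by (intro exI[of _ "\<lambda>_. 0"]) auto
  qed auto
  then show ?thesis using x o unfolding sm_def by blast
qed

lemma sm_coord: "x \<in> Euc I \<Longrightarrow> sm I (\<lambda>x. x i) x"
proof -
  assume x: "x \<in> Euc I"
  have o: "open_Euc I (Euc I)" by simp
  have "Cinf I (Euc I) (\<lambda>x. x i)"
  proof (rule Cinf_coinduct[where S = "\<lambda>f. f = (\<lambda>x. x i) \<or> (\<exists>c. f = (\<lambda>_. c))", OF o])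
    show "\<exists>g. (g = (\<lambda>x. x i) \<or> (\<exists>c. g = (\<lambda>_. c))) \<and>
        (\<forall>x\<in>Euc I. ((\<lambda>t. f (x(j := t))) has_real_derivative g x) (at (x j)))"
      if "f = (\<lambda>x. x i) \<or> (\<exists>c. f = (\<lambda>_. c))" for f j
      using that
    proof
      assume f: "f = (\<lambda>x. x i)"
      show ?thesis
        by (intro exI[of _ "\<lambda>_. if i = j then 1 else 0"]) (auto simp: f intro!: derivative_eq_intros)
    qed (auto intro: exI[of _ "\<lambda>_. 0"])
    show "continuous_on (Euc I) f" if "f = (\<lambda>x. x i) \<or> (\<exists>c. f = (\<lambda>_. c))" for f
      using that by (auto intro: continuous_on_subset[OF continuous_on_product_coordinates])
  qed auto
  then show ?thesis using x o unfolding sm_def by blast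
qed

text \<open>A class of functions closed under partial differentiation by the chain rule, so that
\<open>Cinf_coinduct\<close> applies to it.\<close>

inductive smalg :: "'i set \<Rightarrow> ('i \<Rightarrow> real) set \<Rightarrow> 'j set \<Rightarrow> ('j \<Rightarrow> real) set \<Rightarrow> (('i \<Rightarrow> real) \<Rightarrow> 'j \<Rightarrow> real) \<Rightarrow>
    (('i \<Rightarrow> real) \<Rightarrow> real) \<Rightarrow> bool" for I U J V H where
  base: "Cinf I U f \<Longrightarrow> smalg I U J V H f"
| comp: "Cinf J V F \<Longrightarrow> smalg I U J V H (\<lambda>x. F (H x))"
| add: "smalg I U J V H f \<Longrightarrow> smalg I U J V H g \<Longrightarrow> smalg I U J V H (\<lambda>x. f x + g x)"
| mult: "smalg I U J V H f \<Longrightarrow> smalg I U J V H g \<Longrightarrow> smalg I U J V H (\<lambda>x. f x * g x)"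

lemma filterlim_sm:
  assumes "\<And>j. j \<in> J \<Longrightarrow> sm I (\<lambda>y. H y j) x" "eventually (\<lambda>y. H y \<in> Euc J) (near I x)" "H x \<in> Euc J"
  shows "filterlim H (near J (H x)) (near I x)"
  by (rule filterlim_near) (use assms sm_tendsto in auto)

text \<open>The i-th derivative of F o H is the sum over j of (pd j F o H) times pd i of the j-th
  component of H. It is built from generators by sums and products, so the class is closed under
  differentiation. The sum is assembled by induction over subsets K of J.\<close>

lemma smalg_Cinf:
  assumes J: "finite J" and U: "open_Euc I U" and V: "open_Euc J V"
    and H: "\<And>j. j \<in> J \<Longrightarrow> Cinf I U (\<lambda>x. H x j)" and HV: "\<And>x. x \<in> U \<Longrightarrow> H x \<in> V"
    and f: "smalg I U J V H f"
  shows "Cinf I U f"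
proof (rule Cinf_coinduct[where S = "smalg I U J V H", OF U f])
  have UE: "U \<subseteq> Euc I" "V \<subseteq> Euc J" using U V open_Euc_subset by auto
  have evU: "eventually (\<lambda>y. y \<in> U) (near I x)" if "x \<in> U" for x
    using U that by (rule eventually_near_open)
  show "continuous_on U f" if "smalg I U J V H f" for f
    using that
  proof induction
    case (comp F)
    have "((\<lambda>x. F (H x)) \<longlongrightarrow> F (H x)) (near I x)" if x: "x \<in> U" for x
    proof (rule filterlim_compose[where g = F and f = H and ?F2.0 = "near J (H x)"])
      show "(F \<longlongrightarrow> F (H x)) (near J (H x))"
        using comp V HV[OF x] by (intro sm_tendsto) (auto simp: sm_def)
      show "filterlim H (near J (H x)) (near I x)"
      proof (rule filterlim_sm)
        show "eventually (\<lambda>y. H y \<in> Euc J) (near I x)"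
          using evU[OF x] by eventually_elim (use HV UE in auto)
      qed (use H HV UE U x in \<open>auto simp: sm_def\<close>)
    qed
    then show ?case using U by (simp add: continuous_on_near)
  qed (auto intro: continuous_intros Cinf_continuous)
  show "\<exists>g. smalg I U J V H g \<and> (\<forall>x\<in>U. ((\<lambda>t. f (x(i := t))) has_real_derivative g x) (at (x i)))"
    if "smalg I U J V H f" "i \<in> I" for f i
    using that(1)
  proof induction
    case (base f)
    then show ?case using that(2) Cinf_pds[OF base, of "[i]"]
      by (intro exI[of _ "pd i f"] conjI ballI smalg.base Cinf_pd_has_derivative[OF base]) auto
  next
    case (comp F)
    define g where "g = (\<lambda>K x. \<Sum>j\<in>K. pd j F (H x) * pd i (\<lambda>x. H x j) x)"
    have "smalg I U J V H (g K)" if "K \<subseteq> J" for K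
      using finite_subset[OF that J] that
    proof (induction K)
      case empty
      have "Cinf I U (\<lambda>_. 0)" using UE U by (auto simp: Cinf_iff_sm intro!: sm_const)
      then show ?case by (auto simp: g_def intro: smalg.base)
    next
      case (insert j K)
      have 1: "smalg I U J V H (\<lambda>x. pd j F (H x))"
        using Cinf_pds[OF comp, of "[j]"] insert by (intro smalg.comp) auto
      have 2: "smalg I U J V H (pd i (\<lambda>x. H x j))"
        using Cinf_pds[OF H, of j "[i]"] insert \<open>i \<in> I\<close> by (intro smalg.base) auto
      have "g (insert j K) = (\<lambda>x. pd j F (H x) * pd i (\<lambda>x. H x j) x + g K x)"
        using insert by (simp add: g_def)
      then show ?case using smalg.add[OF smalg.mult[OF 1 2] insert.IH] insert by simp
    qed
    then have "smalg I U J V H (g J)" by simp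
    moreover have "((\<lambda>t. F (H (x(i := t)))) has_real_derivative g J x) (at (x i))" if x: "x \<in> U" for x
    proof -
      have "eventually (\<lambda>t. H (x(i := t)) \<in> Euc J) (nhds (x i))"
        by (rule eventually_mono[OF eventually_compose_filterlim[OF evU[OF x] filterlim_upd[of x I i]]])
          (use HV UE x \<open>i \<in> I\<close> in auto)
      then show ?thesis
        using chain_rule[OF J, of F "\<lambda>t. H (x(i := t))" "x i" "\<lambda>j. pd i (\<lambda>x. H x j) x"]
          Cinf_pd_has_derivative[OF H \<open>i \<in> I\<close> x] comp V HV[OF x]
        by (auto simp: g_def sm_def)
    qed
    ultimately show ?case by blast
  next
    case (add f g)
    then obtain f' g' where
      "smalg I U J V H f'" "\<forall>x\<in>U. ((\<lambda>t. f (x(i := t))) has_real_derivative f' x) (at (x i))"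
      "smalg I U J V H g'" "\<forall>x\<in>U. ((\<lambda>t. g (x(i := t))) has_real_derivative g' x) (at (x i))" by blast
    then show ?case
      by (intro exI[of _ "\<lambda>x. f' x + g' x"] conjI ballI smalg.add DERIV_add) blast+
  next
    case (mult f g)
    then obtain f' g' where
      "smalg I U J V H f'" "\<forall>x\<in>U. ((\<lambda>t. f (x(i := t))) has_real_derivative f' x) (at (x i))"
      "smalg I U J V H g'" "\<forall>x\<in>U. ((\<lambda>t. g (x(i := t))) has_real_derivative g' x) (at (x i))" by blast
    note 1 = this
    show ?case
    proof (intro exI[of _ "\<lambda>x. f' x * g x + g' x * f x"] conjI ballI)
      show "smalg I U J V H (\<lambda>x. f' x * g x + g' x * f x)"
        by (intro smalg.add smalg.mult 1 mult.hyps)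
      fix x assume "x \<in> U"
      with 1 have "((\<lambda>t. f (x(i := t))) has_real_derivative f' x) (at (x i))"
        "((\<lambda>t. g (x(i := t))) has_real_derivative g' x) (at (x i))" by blast+
      from DERIV_mult[OF this]
      show "((\<lambda>t. f (x(i := t)) * g (x(i := t))) has_real_derivative f' x * g x + g' x * f x) (at (x i))"
        by simp
    qed
  qed
qed

text \<open>Sums and products need no inner map, so H is taken to be the map into R^0; what is left
  is the algebra generated by the smooth functions on U.\<close>

lemma sm_smalg:
  assumes "\<And>U. open_Euc I U \<Longrightarrow> x \<in> U \<Longrightarrow> Cinf I U f \<Longrightarrow> Cinf I U g \<Longrightarrow>
      smalg I U ({} :: unit set) (Euc {}) (\<lambda>_ _. 0) h"
    and "sm I f x" "sm I g x"
  shows "sm I h x"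
proof -
  have "eventually (\<lambda>y. sm I f y \<and> sm I g y) (near I x)"
    using assms(2,3) by (intro eventually_conj eventually_sm)
  then obtain U where U: "open_Euc I U" "x \<in> U" "\<And>y. y \<in> U \<Longrightarrow> sm I f y \<and> sm I g y"
    unfolding eventually_near[OF sm_Euc[OF assms(2)]] by auto
  have "smalg I U ({} :: unit set) (Euc {}) (\<lambda>_ _. 0) h"
    by (rule assms(1)[OF U(1,2)]) (use U in \<open>auto simp: Cinf_iff_sm\<close>)
  then have "Cinf I U h" by (rule smalg_Cinf[rotated 5]) (use U in \<open>auto simp: Euc_def\<close>)
  then show ?thesis using U unfolding sm_def by blast
qed

lemma sm_add: "sm I f x \<Longrightarrow> sm I g x \<Longrightarrow> sm I (\<lambda>x. f x + g x) x"
  by (rule sm_smalg[of I x f g]) (auto intro: smalg.intros)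

lemma sm_mult: "sm I f x \<Longrightarrow> sm I g x \<Longrightarrow> sm I (\<lambda>x. f x * g x) x"
  by (rule sm_smalg[of I x f g]) (auto intro: smalg.intros)

lemma sm_cmult: "sm I f x \<Longrightarrow> sm I (\<lambda>x. c * f x) x"
  by (intro sm_mult sm_const sm_Euc)

lemma sm_sum:
  "x \<in> Euc I \<Longrightarrow> finite A \<Longrightarrow> (\<And>a. a \<in> A \<Longrightarrow> sm I (f a) x) \<Longrightarrow> sm I (\<lambda>x. \<Sum>a\<in>A. f a x) x"
  by (induction A rule: infinite_finite_induct) (auto intro: sm_const sm_add)

text \<open>On a small neighbourhood U all components of H are smooth and H takes values in the
  domain V of F; there F o H is a generator of the class \<open>smalg\<close>.\<close>

lemma sm_comp:
  assumes J: "finite J" and F: "sm J F (H x)" and H: "\<And>j. j \<in> J \<Longrightarrow> sm I (\<lambda>y. H y j) x"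
    and ev: "eventually (\<lambda>y. H y \<in> Euc J) (near I x)" and x: "x \<in> Euc I"
  shows "sm I (\<lambda>y. F (H y)) x"
proof -
  obtain V where V: "open_Euc J V" "H x \<in> V" "Cinf J V F" using F by (auto simp: sm_def)
  have "eventually (\<lambda>y. H y \<in> V) (near I x)"
    by (rule eventually_compose_filterlim[OF eventually_near_open[OF V(1,2)]], rule filterlim_sm)
      (use H ev sm_Euc[OF F] in auto)
  moreover have "eventually (\<lambda>y. \<forall>j\<in>J. sm I (\<lambda>y. H y j) y) (near I x)"
    using H eventually_sm by (auto simp: eventually_ball_finite_distrib J)
  ultimately have "eventually (\<lambda>y. H y \<in> V \<and> (\<forall>j\<in>J. sm I (\<lambda>y. H y j) y)) (near I x)"
    by (rule eventually_conj)
  then obtain U where U: "open_Euc I U" "x \<in> U" "\<And>y. y \<in> U \<Longrightarrow> H y \<in> V \<and> (\<forall>j\<in>J. sm I (\<lambda>y. H y j) y)"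
    unfolding eventually_near[OF x] by auto
  have "Cinf I U (\<lambda>y. F (H y))"
    by (rule smalg_Cinf[OF J U(1) V(1) _ _ smalg.comp[OF V(3)]]) (use U in \<open>auto simp: Cinf_iff_sm\<close>)
  then show ?thesis using U unfolding sm_def by blast
qed

lemma pd_comp:
  assumes J: "finite J" and F: "sm J F (H x)" and H: "\<And>j. j \<in> J \<Longrightarrow> sm I (\<lambda>y. H y j) x"
    and ev: "eventually (\<lambda>y. H y \<in> Euc J) (near I x)" and x: "x \<in> Euc I" and i: "i \<in> I"
  shows "pd i (\<lambda>y. F (H y)) x = (\<Sum>j\<in>J. pd j F (H x) * pd i (\<lambda>y. H y j) x)"
proof -
  have "((\<lambda>t. F (H (x(i := t)))) has_real_derivative (\<Sum>j\<in>J. pd j F (H x) * pd i (\<lambda>y. H y j) x)) (at (x i))"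
    using chain_rule[OF J, of F "\<lambda>t. H (x(i := t))" "x i" "\<lambda>j. pd i (\<lambda>x. H x j) x"]
      sm_has_derivative[OF H i] eventually_compose_filterlim[OF ev filterlim_upd[OF x i]] F by simp
  then show ?thesis unfolding pd_def[of i "\<lambda>y. F (H y)"] by (rule DERIV_imp_deriv)
qed

section \<open>Sum and product rules for derivatives\<close>

lemma pd_add: "sm I f x \<Longrightarrow> sm I g x \<Longrightarrow> i \<in> I \<Longrightarrow> pd i (\<lambda>x. f x + g x) x = pd i f x + pd i g x"
  using DERIV_imp_deriv[OF DERIV_add[OF sm_has_derivative[of I f x i] sm_has_derivative[of I g x i]]]
  by (simp add: pd_def)

lemma pd_mult:
  "sm I f x \<Longrightarrow> sm I g x \<Longrightarrow> i \<in> I \<Longrightarrow> pd i (\<lambda>x. f x * g x) x = pd i f x * g x + pd i g x * f x"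
  using DERIV_imp_deriv[OF DERIV_mult[OF sm_has_derivative[of I f x i] sm_has_derivative[of I g x i]]]
  by (simp add: pd_def)

lemma pd_const: "pd i (\<lambda>_. c) x = 0"
  by (simp add: pd_def)

lemma pds_add:
  "sm I f x \<Longrightarrow> sm I g x \<Longrightarrow> \<alpha> \<in> lists I \<Longrightarrow> pds \<alpha> (\<lambda>x. f x + g x) x = pds \<alpha> f x + pds \<alpha> g x"
proof (induction \<alpha> arbitrary: x)
  case (Cons i \<alpha>)
  have "eventually (\<lambda>y. sm I f y \<and> sm I g y) (near I x)"
    using Cons.prems by (intro eventually_conj eventually_sm)
  then have "eventually (\<lambda>y. pds \<alpha> (\<lambda>x. f x + g x) y = pds \<alpha> f y + pds \<alpha> g y) (near I x)"
    by eventually_elim (use Cons in auto)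
  then have "pd i (pds \<alpha> (\<lambda>x. f x + g x)) x = pd i (\<lambda>y. pds \<alpha> f y + pds \<alpha> g y) x"
    by (rule pd_cong) (use Cons.prems sm_Euc in auto)
  then show ?case using Cons.prems by (simp add: pd_add[of I] sm_pds)
qed auto

lemma pds_cmult: "sm I f x \<Longrightarrow> \<alpha> \<in> lists I \<Longrightarrow> pds \<alpha> (\<lambda>x. c * f x) x = c * pds \<alpha> f x"
proof (induction \<alpha> arbitrary: x)
  case (Cons i \<alpha>)
  have "eventually (\<lambda>y. pds \<alpha> (\<lambda>x. c * f x) y = c * pds \<alpha> f y) (near I x)"
    using eventually_sm[OF Cons.prems(1)] by eventually_elim (use Cons in auto)
  then have "pd i (pds \<alpha> (\<lambda>x. c * f x)) x = pd i (\<lambda>y. c * pds \<alpha> f y) x"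
    by (rule pd_cong) (use Cons.prems sm_Euc in auto)
  then show ?case using Cons.prems
    by (simp add: pd_mult[of I] sm_pds sm_const[OF sm_Euc[OF Cons.prems(1)]] pd_const)
qed auto

lemma pds_const: "pds \<alpha> (\<lambda>_. 0) x = 0"
  by (induction \<alpha> arbitrary: x) (auto simp: pd_def[of _ "pds _ _"])

lemma pds_sum:
  assumes "x \<in> Euc I" "finite A" "\<And>a. a \<in> A \<Longrightarrow> sm I (f a) x" "\<alpha> \<in> lists I"
  shows "pds \<alpha> (\<lambda>x. \<Sum>a\<in>A. f a x) x = (\<Sum>a\<in>A. pds \<alpha> (f a) x)"
  using assms(2,3)
  by (induction A rule: finite_induct) (use assms in \<open>auto simp: pds_add[of I] sm_sum pds_const\<close>)

section \<open>Symmetry of second partial derivatives\<close>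

lemma second_difference:
  assumes r: "\<And>y. y \<in> Euc I \<Longrightarrow> (\<forall>k\<in>I. \<bar>y k - x k\<bar> < r) \<Longrightarrow> sm I f y"
    and x: "x \<in> Euc I" and ij: "i \<in> I" "j \<in> I" "i \<noteq> j" and h: "0 < h" "h < r"
  shows "\<exists>y\<in>Euc I. (\<forall>k\<in>I. \<bar>y k - x k\<bar> \<le> h) \<and>
    f (x(i := x i + h, j := x j + h)) - f (x(i := x i + h)) - f (x(j := x j + h)) + f x
      = h * h * pd j (pd i f) y"
proof -
  have S: "sm I f (x(i := s, j := t))" if "\<bar>s - x i\<bar> \<le> h" "\<bar>t - x j\<bar> \<le> h" for s t
    by (rule r) (use that x ij h in \<open>auto simp: Euc_def\<close>)
  have S': "sm I f (x(i := s))" if "\<bar>s - x i\<bar> \<le> h" for s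
    using S[OF that, of "x j"] h ij by (simp add: fun_upd_idem)
  have d: "((\<lambda>t. f (x(i := t, j := x j + h)) - f (x(i := t))) has_real_derivative
      pd i f (x(i := s, j := x j + h)) - pd i f (x(i := s))) (at s)" if "x i \<le> s" "s \<le> x i + h" for s
  proof (rule DERIV_diff)
    show "((\<lambda>t. f (x(i := t))) has_real_derivative pd i f (x(i := s))) (at s)"
      using sm_has_derivative[OF S' ij(1)] that by simp
    have "((\<lambda>t. f (x(i := s, j := x j + h, i := t))) has_real_derivative pd i f (x(i := s, j := x j + h))) (at s)"
      using sm_has_derivative[OF S ij(1), of s "x j + h"] that h ij by simp
    moreover have "x(i := s, j := x j + h, i := t) = x(i := t, j := x j + h)" for t using ij by auto
    ultimately show "((\<lambda>t. f (x(i := t, j := x j + h))) has_real_derivative pd i f (x(i := s, j := x j + h))) (at s)"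
      by simp
  qed
  \<comment> \<open>Mean value theorem in the i-th coordinate, for the difference of f on the two
    lines where the j-th coordinate is x j + h and x j.\<close>
  obtain s where s: "x i < s" "s < x i + h"
    "(f (x(i := x i + h, j := x j + h)) - f (x(i := x i + h))) - (f (x(i := x i, j := x j + h)) - f (x(i := x i)))
      = h * (pd i f (x(i := s, j := x j + h)) - pd i f (x(i := s)))"
    using MVT2[of "x i" "x i + h", OF _ d] h by auto
  have d2: "((\<lambda>t. pd i f (x(i := s, j := t))) has_real_derivative pd j (pd i f) (x(i := s, j := t))) (at t)"
    if "x j \<le> t" "t \<le> x j + h" for t
    using sm_has_derivative[OF sm_pd[OF S ij(1)] ij(2), of s t] s that by simp
  \<comment> \<open>Mean value theorem in the j-th coordinate, now for pd i f; the mixed derivative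
    appears at an intermediate point.\<close>
  obtain t where t: "x j < t" "t < x j + h"
    "pd i f (x(i := s, j := x j + h)) - pd i f (x(i := s, j := x j)) = h * pd j (pd i f) (x(i := s, j := t))"
    using MVT2[of "x j" "x j + h", OF _ d2] h by auto
  have "x(i := s, j := x j) = x(i := s)" using ij by auto
  then show ?thesis using s t x ij
    by (intro bexI[of _ "x(i := s, j := t)"]) (auto simp: Euc_def algebra_simps)
qed

text \<open>The second difference is symmetric in i and j. Evaluating it in both orders shows that
  the two mixed derivatives take the same value at two points y and z close to x. By continuity
  their values at x differ by less than any e.\<close>

lemma pd_commute:
  assumes I: "finite I" and f: "sm I f x" and ij: "i \<in> I" "j \<in> I"
  shows "pd i (pd j f) x = pd j (pd i f) x"
proof (cases "i = j")
  case False
  have x: "x \<in> Euc I" using f by (rule sm_Euc)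
  have "\<bar>pd i (pd j f) x - pd j (pd i f) x\<bar> \<le> 0 + e" if e: "e > 0" for e
  proof -
    let ?P = "\<lambda>y. dist (pd i (pd j f) y) (pd i (pd j f) x) < e/2 \<and>
      dist (pd j (pd i f) y) (pd j (pd i f) x) < e/2 \<and> sm I f y"
    have "eventually ?P (near I x)"
      using tendstoD[OF sm_tendsto[OF sm_pd[OF sm_pd[OF f]]], of _ _ "e/2"] ij e eventually_sm[OF f]
      by (intro eventually_conj) auto
    then obtain r where r: "r > 0" "\<And>y. y \<in> Euc I \<Longrightarrow> (\<forall>i\<in>I. \<bar>y i - x i\<bar> < r) \<Longrightarrow> ?P y"
      unfolding eventually_near_box[OF I x] by auto
    have h: "0 < r/2" "r/2 < r" using r by auto
    have S: "sm I f y" if "y \<in> Euc I" "\<forall>k\<in>I. \<bar>y k - x k\<bar> < r" for y using r(2)[OF that] by simp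
    obtain y where y: "y \<in> Euc I" "\<forall>k\<in>I. \<bar>y k - x k\<bar> \<le> r/2"
      "f (x(i := x i + r/2, j := x j + r/2)) - f (x(i := x i + r/2)) - f (x(j := x j + r/2)) + f x
       = r/2 * (r/2) * pd j (pd i f) y"
      using second_difference[OF S x ij False h] by blast
    obtain z where z: "z \<in> Euc I" "\<forall>k\<in>I. \<bar>z k - x k\<bar> \<le> r/2"
      "f (x(j := x j + r/2, i := x i + r/2)) - f (x(j := x j + r/2)) - f (x(i := x i + r/2)) + f x
       = r/2 * (r/2) * pd i (pd j f) z"
      using second_difference[OF S x ij(2,1) _ h] False by blast
    have "r/2 * (r/2) * pd j (pd i f) y = r/2 * (r/2) * pd i (pd j f) z"
      unfolding y(3)[symmetric] z(3)[symmetric] using False by (simp add: fun_upd_twist)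
    then have "pd j (pd i f) y = pd i (pd j f) z" using r(1) by simp
    moreover have "?P y" "?P z"
      by (rule r(2); use y z r(1) in force)+
    ultimately show ?thesis unfolding dist_real_def by linarith
  qed
  then have "\<bar>pd i (pd j f) x - pd j (pd i f) x\<bar> \<le> 0" by (rule field_le_epsilon)
  then show ?thesis by simp
qed auto

lemma pds_move:
  assumes I: "finite I" and "\<alpha> \<in> lists I" "i \<in> I" "\<beta> \<in> lists I" "sm I f x"
  shows "pds (\<alpha> @ i # \<beta>) f x = pd i (pds (\<alpha> @ \<beta>) f) x"
  using assms(2,5)
proof (induction \<alpha> arbitrary: x rule: list.induct)
  case (Cons k \<alpha>)
  have "eventually (\<lambda>y. pds (\<alpha> @ i # \<beta>) f y = pd i (pds (\<alpha> @ \<beta>) f) y) (near I x)"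
    using eventually_sm[OF Cons.prems(2)] by eventually_elim (use Cons in auto)
  then have "pd k (pds (\<alpha> @ i # \<beta>) f) x = pd k (pd i (pds (\<alpha> @ \<beta>) f)) x"
    by (rule pd_cong) (use Cons.prems sm_Euc in auto)
  also have "\<dots> = pd i (pd k (pds (\<alpha> @ \<beta>) f)) x"
    by (rule pd_commute[OF I sm_pds]) (use Cons.prems assms in auto)
  finally show ?case by simp
qed auto

text \<open>Symmetry makes an iterated derivative of a smooth function depend on the multiset of
  directions only: the first entry of \<alpha> is found in \<beta> and moved to the front there. The
  equality for the tails is again needed near x.\<close>

lemma pds_perm:
  assumes I: "finite I" and "\<alpha> \<in> lists I" "mset \<alpha> = mset \<beta>" "sm I f x"
  shows "pds \<alpha> f x = pds \<beta> f x"
  using assms(2-4)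
proof (induction \<alpha> arbitrary: \<beta> x rule: list.induct)
  case (Cons i \<alpha>)
  have "i \<in> set \<beta>" using Cons.prems(2) by (metis list.set_intros(1) set_mset_mset)
  then obtain \<beta>1 \<beta>2 where \<beta>: "\<beta> = \<beta>1 @ i # \<beta>2" by (meson split_list)
  have m: "mset \<alpha> = mset (\<beta>1 @ \<beta>2)" using Cons.prems(2) by (simp add: \<beta>)
  have l: "\<beta>1 \<in> lists I" "\<beta>2 \<in> lists I"
    using mset_eq_setD[OF Cons.prems(2)] Cons.prems(1) by (auto simp: \<beta>)
  have "eventually (\<lambda>y. pds \<alpha> f y = pds (\<beta>1 @ \<beta>2) f y) (near I x)"
    using eventually_sm[OF Cons.prems(3)] by eventually_elim (use Cons m in auto)
  then have "pd i (pds \<alpha> f) x = pd i (pds (\<beta>1 @ \<beta>2) f) x"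
    by (rule pd_cong) (use Cons.prems sm_Euc in auto)
  also have "\<dots> = pds \<beta> f x"
    unfolding \<beta> by (rule pds_move[OF I, symmetric]) (use l Cons.prems in auto)
  finally show ?case by simp
qed auto

section \<open>Contact of order k for functions on R^I\<close>

definition agr :: "'i set \<Rightarrow> nat \<Rightarrow> (('i \<Rightarrow> real) \<Rightarrow> real) \<Rightarrow> (('i \<Rightarrow> real) \<Rightarrow> real) \<Rightarrow> ('i \<Rightarrow> real) \<Rightarrow> bool" where
  "agr I k f g x \<longleftrightarrow> (\<forall>\<alpha>\<in>lists I. length \<alpha> \<le> k \<longrightarrow> pds \<alpha> f x = pds \<alpha> g x)"

lemma agr_0: "agr I 0 f g x \<longleftrightarrow> f x = g x"
  by (auto simp: agr_def)

text \<open>The last entry of a list is the derivative taken first, so it is split off at the end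
  and no derivatives have to be interchanged. This recursion drives the inductions for products and
  composites.\<close>

lemma agr_Suc: "agr I (Suc k) f g x \<longleftrightarrow> f x = g x \<and> (\<forall>i\<in>I. agr I k (pd i f) (pd i g) x)"
proof
  assume L: "agr I (Suc k) f g x"
  have "pds \<alpha> (pd i f) x = pds \<alpha> (pd i g) x" if "i \<in> I" "\<alpha> \<in> lists I" "length \<alpha> \<le> k" for i \<alpha>
    using L[unfolded agr_def, rule_format, of "\<alpha> @ [i]"] that by (simp add: pds_append)
  then show "f x = g x \<and> (\<forall>i\<in>I. agr I k (pd i f) (pd i g) x)"
    using L[unfolded agr_def, rule_format, of "[]"] by (auto simp: agr_def)
next
  assume R: "f x = g x \<and> (\<forall>i\<in>I. agr I k (pd i f) (pd i g) x)"
  show "agr I (Suc k) f g x" unfolding agr_def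
  proof (intro ballI impI)
    fix \<alpha> assume "\<alpha> \<in> lists I" "length \<alpha> \<le> Suc k"
    then show "pds \<alpha> f x = pds \<alpha> g x"
      by (cases \<alpha> rule: rev_cases) (use R in \<open>auto simp: pds_append agr_def\<close>)
  qed
qed

lemma agr_cong:
  "eventually (\<lambda>y. f y = f' y) (near I x) \<Longrightarrow> eventually (\<lambda>y. g y = g' y) (near I x) \<Longrightarrow> x \<in> Euc I \<Longrightarrow>
    agr I k f g x \<longleftrightarrow> agr I k f' g' x"
  using pds_cong[of f f' I x] pds_cong[of g g' I x] by (auto simp: agr_def)

lemma agr_le: "agr I k f g x \<Longrightarrow> m \<le> k \<Longrightarrow> agr I m f g x"
  by (auto simp: agr_def)

lemma agr_add:
  "sm I f x \<Longrightarrow> sm I f' x \<Longrightarrow> sm I g x \<Longrightarrow> sm I g' x \<Longrightarrow> agr I k f f' x \<Longrightarrow> agr I k g g' x \<Longrightarrow>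
    agr I k (\<lambda>x. f x + g x) (\<lambda>x. f' x + g' x) x"
  by (simp add: agr_def pds_add[of I])

lemma agr_sum:
  "x \<in> Euc I \<Longrightarrow> finite A \<Longrightarrow> (\<And>a. a \<in> A \<Longrightarrow> sm I (f a) x \<and> sm I (g a) x \<and> agr I k (f a) (g a) x) \<Longrightarrow>
    agr I k (\<lambda>x. \<Sum>a\<in>A. f a x) (\<lambda>x. \<Sum>a\<in>A. g a x) x"
  by (simp add: agr_def pds_sum[of x I])

text \<open>By the product rule, valid near x, the derivative of a product is a sum of products
  whose factors are in contact of order k. The factors change in this step, so the induction is over
  all of them.\<close>

lemma agr_mult:
  assumes "sm I f x" "sm I f' x" "sm I g x" "sm I g' x" "agr I k f f' x" "agr I k g g' x"
  shows "agr I k (\<lambda>x. f x * g x) (\<lambda>x. f' x * g' x) x"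
  using assms
proof (induction k arbitrary: f f' g g')
  case (Suc k)
  have ev: "eventually (\<lambda>y. pd i (\<lambda>x. f x * g x) y = pd i f y * g y + pd i g y * f y) (near I x)"
    if "sm I f x" "sm I g x" "i \<in> I" for f g i
    using eventually_sm[OF that(1)] eventually_sm[OF that(2)]
    by eventually_elim (use that in \<open>auto simp: pd_mult\<close>)
  have "agr I k (pd i (\<lambda>x. f x * g x)) (pd i (\<lambda>x. f' x * g' x)) x" if i: "i \<in> I" for i
    by (subst agr_cong[OF ev ev], use Suc.prems i sm_Euc in auto, intro agr_add Suc.IH sm_mult sm_pd)
      (use Suc.prems i in \<open>auto simp: agr_Suc intro: agr_le[of _ "Suc k"]\<close>)
  then show ?case using Suc.prems by (simp add: agr_Suc)
qed (simp add: agr_0)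

text \<open>Stated by contact rather than by values, which avoids the formula of Faa di Bruno.\<close>

lemma agr_comp:
  fixes H H' :: "('i \<Rightarrow> real) \<Rightarrow> 'j \<Rightarrow> real"
  assumes J: "finite J" and F: "sm J F (H x)" "sm J F' (H x)"
    and H: "\<And>j. j \<in> J \<Longrightarrow> sm I (\<lambda>y. H y j) x" "\<And>j. j \<in> J \<Longrightarrow> sm I (\<lambda>y. H' y j) x"
    and ev: "eventually (\<lambda>y. H y \<in> Euc J) (near I x)" "eventually (\<lambda>y. H' y \<in> Euc J) (near I x)"
    and x: "x \<in> Euc I"
    and aF: "agr J k F F' (H x)" and aH: "\<And>j. j \<in> J \<Longrightarrow> agr I k (\<lambda>y. H y j) (\<lambda>y. H' y j) x"
  shows "agr I k (\<lambda>y. F (H y)) (\<lambda>y. F' (H' y)) x"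
proof -
  have "H x j = H' x j" if "j \<in> J" for j
    using agr_le[OF aH[OF that], of 0] by (simp add: agr_0)
  then have HH: "H x = H' x"
    using eventually_near_self[OF ev(1) x] eventually_near_self[OF ev(2) x] by (intro Euc_eqI)
  show ?thesis
    using F aF aH
  proof (induction k arbitrary: F F')
    case 0 then show ?case using HH by (auto simp: agr_0)
  next
    case (Suc k)
    \<comment> \<open>The chain rule is needed on a neighbourhood of x, since up to k further
      derivatives of both sides are compared.\<close>
    have evp: "eventually (\<lambda>y. pd i (\<lambda>y. F (H y)) y = (\<Sum>j\<in>J. pd j F (H y) * pd i (\<lambda>y. H y j) y)) (near I x)"
      if "sm J F (H x)" "\<And>j. j \<in> J \<Longrightarrow> sm I (\<lambda>y. H y j) x" "eventually (\<lambda>y. H y \<in> Euc J) (near I x)" "i \<in> I"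
      for F i and H :: "('i \<Rightarrow> real) \<Rightarrow> 'j \<Rightarrow> real"
    proof -
      have "eventually (\<lambda>y. sm J F (H y)) (near I x)"
        by (rule eventually_compose_filterlim[OF eventually_sm[OF that(1)]], rule filterlim_sm)
          (use that sm_Euc[OF that(1)] in auto)
      moreover have "eventually (\<lambda>y. \<forall>j\<in>J. sm I (\<lambda>y. H y j) y) (near I x)"
        using that eventually_sm by (auto simp: eventually_ball_finite_distrib J)
      moreover note eventually_eventually_near[OF x that(3)] eventually_near_Euc[of I x]
      ultimately show ?thesis
        by eventually_elim (rule pd_comp, use J that in auto)
    qed
    have "agr I k (pd i (\<lambda>y. F (H y))) (pd i (\<lambda>y. F' (H' y))) x" if i: "i \<in> I" for i
    proof -
      have a: "agr I k (\<lambda>y. pd j F (H y)) (\<lambda>y. pd j F' (H' y)) x" if "j \<in> J" for j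
        by (rule Suc.IH) (use that Suc.prems in \<open>auto simp: agr_Suc intro: sm_pd agr_le[of _ "Suc k"]\<close>)
      have s: "sm I (\<lambda>y. pd j F (H y)) x" "sm I (\<lambda>y. pd j F' (H' y)) x" if "j \<in> J" for j
        using sm_comp[OF J sm_pd[OF Suc.prems(1) that] H(1) ev(1) x]
          sm_comp[OF J sm_pd[OF Suc.prems(2)[unfolded HH] that] H(2) ev(2) x] by auto
      have "agr I k (\<lambda>y. \<Sum>j\<in>J. pd j F (H y) * pd i (\<lambda>y. H y j) y) (\<lambda>y. \<Sum>j\<in>J. pd j F' (H' y) * pd i (\<lambda>y. H' y j) y) x"
        by (rule agr_sum[OF x J]; intro conjI sm_mult agr_mult s a sm_pd H i; use Suc.prems i in \<open>simp add: agr_Suc\<close>)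
      then show ?thesis
        using agr_cong[OF evp[OF Suc.prems(1) H(1) ev(1) i] evp[OF Suc.prems(2)[unfolded HH] H(2) ev(2) i] x] by simp
    qed
    then show ?case using Suc.prems HH by (auto simp: agr_Suc)
  qed
qed

text \<open>Jet coordinates record derivatives along sorted lists only; symmetry recovers the
  remaining ones.\<close>

lemma agr_sorted:
  assumes I: "finite I" and f: "sm I f x" "sm I g x"
    and *: "\<And>\<alpha>. \<alpha> \<in> multiindices k I \<Longrightarrow> pds \<alpha> f x = pds \<alpha> g x"
  shows "agr I k f g x"
  unfolding agr_def
proof (intro ballI impI)
  fix \<alpha> assume a: "\<alpha> \<in> lists I" "length \<alpha> \<le> k"
  then have "sort \<alpha> \<in> multiindices k I" by (auto simp: multiindices_def)
  from *[OF this] show "pds \<alpha> f x = pds \<alpha> g x"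
    using pds_perm[OF I a(1) _ f(1), of "sort \<alpha>"] pds_perm[OF I a(1) _ f(2), of "sort \<alpha>"] by simp
qed

section \<open>Slices of functions and Taylor monomials\<close>

lemma pds_case_sum:
  "pds \<alpha> (\<lambda>x. H (case_sum c x)) x = pds (map Inr \<alpha>) H (case_sum c x)"
proof (induction \<alpha> arbitrary: x)
  case (Cons i \<alpha>)
  \<comment> \<open>Varying an \<open>Inr\<close> coordinate commutes with freezing the
    \<open>Inl\<close> block. This is how derivatives of u(t, _) for fixed t become partial
    derivatives of a function of t and the base coordinates.\<close>
  have "(case_sum c x)(Inr i := t) = case_sum c (x(i := t))" for t
    by (auto simp: fun_eq_iff split: sum.split)
  then show ?case by (simp add: Cons.IH[abs_def] pd_def)
qed auto

text \<open>The monomial \<open>x\<^sup>\<beta> / \<beta>!\<close>; the multiindex is encoded by a list, whose order is irrelevant.\<close>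

definition taylor_mono :: "'i set \<Rightarrow> 'i list \<Rightarrow> ('i \<Rightarrow> real) \<Rightarrow> real" where
  "taylor_mono I \<beta> x = (\<Prod>i\<in>I. x i ^ count_list \<beta> i / fact (count_list \<beta> i))"

text \<open>The monomials are dual to the derivatives at their centre, so a polynomial with
  prescribed derivatives there has these numbers as coefficients.\<close>

lemma pds_taylor_mono:
  assumes I: "finite I" and "\<alpha> \<in> lists I" "\<beta> \<in> lists I"
  shows "pds \<alpha> (\<lambda>x. taylor_mono I \<beta> (\<lambda>i. x i - c i)) c = (if mset \<alpha> = mset \<beta> then 1 else 0)"
proof -
  \<comment> \<open>The k-th derivative of t^n / n!, equal to 0 for k > n. The monomial is a product
    of such functions of one variable, one per coordinate.\<close>
  define pw :: "nat \<Rightarrow> nat \<Rightarrow> real \<Rightarrow> real" where "pw n k t = (if k \<le> n then t ^ (n - k) / fact (n - k) else 0)" for n k t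
  have pw: "(pw n k has_real_derivative pw n (Suc k) t) (at t)" for n k t
  proof (cases "k < n")
    case True
    then obtain m where m: "n - k = Suc m" "n - Suc k = m" by (metis Suc_diff_Suc)
    have "((\<lambda>t::real. t ^ Suc m / fact (Suc m)) has_real_derivative t ^ m / fact m) (at t)"
      by (rule derivative_eq_intros refl)+ (simp add: divide_simps del: of_nat_Suc power_Suc fact_Suc, simp)
    then show ?thesis using True m by (simp add: pw_def[abs_def])
  next
    case False
    then have "pw n k = (\<lambda>_. if k = n then 1 else 0)" by (auto simp: pw_def)
    then show ?thesis using False by (simp add: pw_def)
  qed
  have "pds \<alpha> (\<lambda>x. taylor_mono I \<beta> (\<lambda>i. x i - c i)) x =
      (\<Prod>i\<in>I. pw (count_list \<beta> i) (count_list \<alpha> i) (x i - c i))" for x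
    using assms(2)
  proof (induction \<alpha> arbitrary: x rule: list.induct)
    case Nil then show ?case by (simp add: taylor_mono_def pw_def)
  next
    case (Cons k \<alpha>)
    then have k: "k \<in> I" and eq: "pds \<alpha> (\<lambda>x. taylor_mono I \<beta> (\<lambda>i. x i - c i)) =
        (\<lambda>x. \<Prod>i\<in>I. pw (count_list \<beta> i) (count_list \<alpha> i) (x i - c i))" by auto
    define P where "P = (\<Prod>i\<in>I - {k}. pw (count_list \<beta> i) (count_list \<alpha> i) (x i - c i))"
    have 1: "(\<Prod>i\<in>I. pw (count_list \<beta> i) (count_list \<alpha> i) ((x(k := t)) i - c i))
      = pw (count_list \<beta> k) (count_list \<alpha> k) (t - c k) * P" for t
      unfolding P_def by (subst prod.remove[OF I k]) (auto intro!: arg_cong2[where f = "(*)"] prod.cong)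
    have "(\<Prod>i\<in>I - {k}. pw (count_list \<beta> i) (count_list (k # \<alpha>) i) (x i - c i)) = P"
      unfolding P_def by (rule prod.cong) auto
    then have 2: "(\<Prod>i\<in>I. pw (count_list \<beta> i) (count_list (k # \<alpha>) i) (x i - c i))
      = pw (count_list \<beta> k) (Suc (count_list \<alpha> k)) (x k - c k) * P"
      by (subst prod.remove[OF I k]) simp
    have "((\<lambda>t. pw (count_list \<beta> k) (count_list \<alpha> k) (t - c k) * P) has_real_derivative
      pw (count_list \<beta> k) (Suc (count_list \<alpha> k)) (x k - c k) * P) (at (x k))"
    proof (rule DERIV_cmult_right)
      have "((\<lambda>t. t - c k) has_real_derivative 1) (at (x k))" by (auto intro!: derivative_eq_intros)
      from DERIV_chain2[OF pw this] show "((\<lambda>t. pw (count_list \<beta> k) (count_list \<alpha> k) (t - c k)) has_real_derivative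
        pw (count_list \<beta> k) (Suc (count_list \<alpha> k)) (x k - c k)) (at (x k))" by simp
    qed
    then show ?case unfolding pds.simps eq pd_def 1 2 by (rule DERIV_imp_deriv)
  qed
  then have *: "pds \<alpha> (\<lambda>x. taylor_mono I \<beta> (\<lambda>i. x i - c i)) c =
      (\<Prod>i\<in>I. if count_list \<alpha> i = count_list \<beta> i then 1 else 0)"
    by (auto simp: pw_def intro!: prod.cong)
  have cnt: "count_list \<gamma> i = count (mset \<gamma>) i" for \<gamma> :: "'a list" and i
    by (simp add: count_mset)
  show ?thesis
  proof (cases "mset \<alpha> = mset \<beta>")
    case True then show ?thesis unfolding * cnt by simp
  next
    case False
    then obtain i where i: "count (mset \<alpha>) i \<noteq> count (mset \<beta>) i" by (meson multiset_eqI)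
    then have "i \<in> set \<alpha> \<union> set \<beta>" by (metis Un_iff count_eq_zero_iff set_mset_mset)
    then have "i \<in> I" using assms by auto
    then show ?thesis using False i I unfolding * cnt by (auto simp: prod_zero_iff)
  qed
qed

lemma sm_prod:
  "x \<in> Euc I \<Longrightarrow> finite A \<Longrightarrow> (\<And>a. a \<in> A \<Longrightarrow> sm I (f a) x) \<Longrightarrow> sm I (\<lambda>x. \<Prod>a\<in>A. f a x) x"
  by (induction A rule: infinite_finite_induct) (auto intro: sm_const sm_mult)

lemma sm_power: "sm I f x \<Longrightarrow> sm I (\<lambda>x. f x ^ n) x"
  by (induction n) (auto intro: sm_mult sm_const sm_Euc)

lemma sm_taylor_mono:
  "x \<in> Euc I \<Longrightarrow> finite J \<Longrightarrow> (\<And>j. j \<in> J \<Longrightarrow> sm I (\<lambda>x. f x j) x) \<Longrightarrow> sm I (\<lambda>x. taylor_mono J \<beta> (f x)) x"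
  unfolding taylor_mono_def divide_inverse by (intro sm_prod sm_mult sm_power sm_const)

lemma sm_diff: "sm I f x \<Longrightarrow> sm I g x \<Longrightarrow> sm I (\<lambda>x. f x - g x) x"
  using sm_add[of I f x "\<lambda>x. - 1 * g x"] sm_cmult[of I g x "- 1"] by simp

section \<open>Smoothness in charts\<close>

definition atlas :: "('a, 'i) mfd \<Rightarrow> bool" where
  "atlas N \<longleftrightarrow> finite (idx N) \<and> \<Union>(fst ` charts N) = pts N \<and> (\<forall>c\<in>charts N. compatible N c)"

text \<open>What remains of \<open>atlas\<close> when transition maps are not considered. For tangent and jet bundles and for submanifolds
only this is needed.\<close>

definition tame :: "('a, 'i) mfd \<Rightarrow> bool" where
  "tame N \<longleftrightarrow> finite (idx N) \<and> \<Union>(fst ` charts N) = pts N \<and>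
     (\<forall>(D, \<psi>)\<in>charts N. \<psi> ` D \<subseteq> Euc (idx N))"

lemma charts_cover:
  "\<Union>(fst ` charts N) = pts N \<Longrightarrow> z \<in> pts N \<longleftrightarrow> (\<exists>D \<psi>. (D, \<psi>) \<in> charts N \<and> z \<in> D)"
  by (drule sym) (simp add: Bex_def split_paired_Ex)

lemma compatible_dom:
  assumes "compatible N (D, \<psi>)"
  shows "D \<subseteq> pts N" "inj_on \<psi> D" "open_Euc (idx N) (\<psi> ` D)" "\<psi> ` D \<subseteq> Euc (idx N)"
  using assms open_Euc_subset by (auto simp: compatible_def)

lemma compatible_trans:
  assumes "compatible N (D, \<psi>)" "(C, \<eta>) \<in> charts N"
  shows "open_Euc (idx N) (\<psi> ` (D \<inter> C))" "open_Euc (idx N) (\<eta> ` (D \<inter> C))"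
    "\<And>j. j \<in> idx N \<Longrightarrow> Cinf (idx N) (\<psi> ` (D \<inter> C)) (\<lambda>x. \<eta> (inv_into D \<psi> x) j)"
    "\<And>j. j \<in> idx N \<Longrightarrow> Cinf (idx N) (\<eta> ` (D \<inter> C)) (\<lambda>x. \<psi> (inv_into C \<eta> x) j)"
  using assms by (auto simp: compatible_def)

lemma atlas_compatible: "atlas N \<Longrightarrow> (D, \<psi>) \<in> charts N \<Longrightarrow> compatible N (D, \<psi>)"
  by (auto simp: atlas_def)

lemma atlas_finite: "atlas N \<Longrightarrow> finite (idx N)"
  by (simp add: atlas_def)

lemma atlas_chart: "atlas N \<Longrightarrow> z \<in> pts N \<Longrightarrow> \<exists>D \<psi>. (D, \<psi>) \<in> charts N \<and> z \<in> D"
  by (simp add: atlas_def charts_cover)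

lemma tame_chart: "tame N \<Longrightarrow> z \<in> pts N \<Longrightarrow> \<exists>D \<psi>. (D, \<psi>) \<in> charts N \<and> z \<in> D"
  by (simp add: tame_def charts_cover)

lemma tame_Euc: "tame N \<Longrightarrow> (D, \<psi>) \<in> charts N \<Longrightarrow> z \<in> D \<Longrightarrow> \<psi> z \<in> Euc (idx N)"
  unfolding tame_def by blast

lemma tame_finite: "tame N \<Longrightarrow> finite (idx N)"
  by (simp add: tame_def)

lemma tame_pts: "tame N \<Longrightarrow> (D, \<psi>) \<in> charts N \<Longrightarrow> z \<in> D \<Longrightarrow> z \<in> pts N"
  unfolding tame_def by (metis charts_cover)

lemma atlas_tame: "atlas N \<Longrightarrow> tame N"
  unfolding atlas_def tame_def by (metis (no_types, lifting) case_prodI2 compatible_dom(4))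

lemma manifold_atlas: "manifold N \<Longrightarrow> atlas N"
  by (simp add: manifold_def atlas_def)

section \<open>The topology of a manifold read in charts\<close>

lemma topspace_mtop: "atlas N \<Longrightarrow> topspace (mtop N) = pts N"
proof -
  assume N: "atlas N"
  have "z \<in> \<Union>{D \<inter> \<psi> -` U | D \<psi> U. (D, \<psi>) \<in> charts N \<and> open U} \<longleftrightarrow> (\<exists>D \<psi>. (D, \<psi>) \<in> charts N \<and> z \<in> D)" for z
    using open_UNIV by blast
  moreover have "z \<in> pts N \<longleftrightarrow> (\<exists>D \<psi>. (D, \<psi>) \<in> charts N \<and> z \<in> D)" for z
    using N by (simp add: atlas_def charts_cover)
  ultimately show ?thesis by (simp add: mtop_def set_eq_iff)
qed

lemma compatible_sm:
  assumes N: "compatible N (D, \<psi>)" "(C, \<eta>) \<in> charts N" and z: "z \<in> D" "z \<in> C"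
  shows "\<And>j. j \<in> idx N \<Longrightarrow> sm (idx N) (\<lambda>x. \<eta> (inv_into D \<psi> x) j) (\<psi> z)"
    and "\<And>j. j \<in> idx N \<Longrightarrow> sm (idx N) (\<lambda>x. \<psi> (inv_into C \<eta> x) j) (\<eta> z)"
    and "eventually (\<lambda>x. inv_into D \<psi> x \<in> C) (near (idx N) (\<psi> z))"
    and "eventually (\<lambda>x. x \<in> \<eta> ` (D \<inter> C)) (near (idx N) (\<eta> z))"
    and "eventually (\<lambda>x. x \<in> \<psi> ` (D \<inter> C)) (near (idx N) (\<psi> z))"
proof -
  note t = compatible_trans[OF N]
  show "sm (idx N) (\<lambda>x. \<eta> (inv_into D \<psi> x) j) (\<psi> z)" if "j \<in> idx N" for j
    using t(1) t(3)[OF that] z unfolding sm_def by blast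
  show "sm (idx N) (\<lambda>x. \<psi> (inv_into C \<eta> x) j) (\<eta> z)" if "j \<in> idx N" for j
    using t(2) t(4)[OF that] z unfolding sm_def by blast
  show "eventually (\<lambda>x. x \<in> \<eta> ` (D \<inter> C)) (near (idx N) (\<eta> z))"
    using t(2) z by (auto intro: eventually_near_open)
  show e: "eventually (\<lambda>x. x \<in> \<psi> ` (D \<inter> C)) (near (idx N) (\<psi> z))"
    using t(1) z by (auto intro: eventually_near_open)
  show "eventually (\<lambda>x. inv_into D \<psi> x \<in> C) (near (idx N) (\<psi> z))"
    using e by eventually_elim (use compatible_dom(2)[OF N(1)] in auto)
qed

lemma eventually_chart:
  "compatible N (D, \<psi>) \<Longrightarrow> z \<in> D \<Longrightarrow>
    eventually (\<lambda>x. x \<in> \<psi> ` D \<and> inv_into D \<psi> x \<in> D \<and> \<psi> (inv_into D \<psi> x) = x) (near (idx N) (\<psi> z))"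
  by (rule eventually_mono[OF eventually_near_open[OF compatible_dom(3)]])
    (auto intro: inv_into_into f_inv_into_f)

lemma eventually_mtop_D:
  assumes N: "atlas N" and D: "compatible N (D, \<psi>)" "z \<in> D"
    and S: "openin (mtop N) S" "z \<in> S"
  shows "eventually (\<lambda>x. inv_into D \<psi> x \<in> S) (near (idx N) (\<psi> z))"
  using S[unfolded mtop_def openin_topology_generated_by_iff]
proof induction
  case (Basis S)
  then obtain C \<eta> U where C: "S = C \<inter> \<eta> -` U" "(C, \<eta>) \<in> charts N" "open U" by auto
  have z: "z \<in> C" "\<eta> z \<in> U" using Basis C by auto
  note t = compatible_sm[OF D(1) C(2) D(2) z(1)]
  have C': "compatible N (C, \<eta>)" using N C(2) by (rule atlas_compatible)
  have i: "inv_into D \<psi> (\<psi> z) = z" using D compatible_dom(2)[OF D(1)] by simp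
  have "filterlim (\<lambda>x. \<eta> (inv_into D \<psi> x)) (near (idx N) (\<eta> (inv_into D \<psi> (\<psi> z)))) (near (idx N) (\<psi> z))"
  proof (rule filterlim_sm)
    show "eventually (\<lambda>x. \<eta> (inv_into D \<psi> x) \<in> Euc (idx N)) (near (idx N) (\<psi> z))"
      using t(3) by eventually_elim (use compatible_dom(4)[OF C'] in auto)
  qed (use t compatible_dom(4)[OF C'] z i in auto)
  moreover have "eventually (\<lambda>x. x \<in> U) (near (idx N) (\<eta> z))"
    using C(3) z by (auto simp: near_def eventually_inf_principal eventually_nhds)
  ultimately have "eventually (\<lambda>x. \<eta> (inv_into D \<psi> x) \<in> U) (near (idx N) (\<psi> z))"
    unfolding i by (rule eventually_compose_filterlim[rotated])
  then show ?case using t(3) by eventually_elim (use C in auto)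
next
  case (UN K)
  then obtain k where k: "k \<in> K" "z \<in> k" by auto
  from UN(2)[OF this] show ?case by eventually_elim (use k in auto)
qed (auto elim: eventually_elim2)

text \<open>Transition maps are continuous in both directions, so any compatible chart, whether or
  not it belongs to the atlas, may be used to test a local statement. Submersion charts are of this
  more general kind.\<close>

lemma eventually_mtop:
  assumes N: "atlas N" and D: "compatible N (D, \<psi>)" "z \<in> D"
  shows "eventually Q (nhdsin (mtop N) z) \<longleftrightarrow> eventually (\<lambda>x. Q (inv_into D \<psi> x)) (near (idx N) (\<psi> z))"
proof
  have zp: "z \<in> pts N" using D compatible_dom(1) by blast
  assume "eventually Q (nhdsin (mtop N) z)"
  then obtain S where S: "openin (mtop N) S" "z \<in> S" "\<And>x. x \<in> S \<Longrightarrow> Q x"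
    using zp by (auto simp: eventually_nhdsin topspace_mtop[OF N])
  from eventually_mtop_D[OF N D S(1,2)] show "eventually (\<lambda>x. Q (inv_into D \<psi> x)) (near (idx N) (\<psi> z))"
    by eventually_elim (use S in auto)
next
  assume ev: "eventually (\<lambda>x. Q (inv_into D \<psi> x)) (near (idx N) (\<psi> z))"
  have zp: "z \<in> pts N" using D compatible_dom(1) by blast
  \<comment> \<open>Only charts of the atlas generate the topology, so the neighbourhood found in
    the given chart is first transported to one of them.\<close>
  obtain C \<eta> where C: "(C, \<eta>) \<in> charts N" "z \<in> C" using atlas_chart[OF N zp] by blast
  have C': "compatible N (C, \<eta>)" using N C(1) by (rule atlas_compatible)
  note t = compatible_sm[OF D(1) C(1) D(2) C(2)]
  have i: "inv_into C \<eta> (\<eta> z) = z" using C compatible_dom(2)[OF C'] by simp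
  have tD: "inv_into C \<eta> x \<in> D" if "x \<in> \<eta> ` (D \<inter> C)" for x
    using that compatible_dom(2)[OF C'] by auto
  have "filterlim (\<lambda>x. \<psi> (inv_into C \<eta> x)) (near (idx N) (\<psi> (inv_into C \<eta> (\<eta> z)))) (near (idx N) (\<eta> z))"
  proof (rule filterlim_sm)
    show "eventually (\<lambda>x. \<psi> (inv_into C \<eta> x) \<in> Euc (idx N)) (near (idx N) (\<eta> z))"
      using t(4) by eventually_elim (use compatible_dom(4)[OF D(1)] tD in auto)
  qed (use t compatible_dom(4)[OF D(1)] D i in auto)
  from eventually_compose_filterlim[OF _ this, unfolded i, OF ev] t(4)
  have "eventually (\<lambda>x. Q (inv_into C \<eta> x) \<and> x \<in> \<eta> ` (D \<inter> C)) (near (idx N) (\<eta> z))"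
    by eventually_elim (use tD compatible_dom(2)[OF D(1)] in auto)
  then obtain S where S: "open S" "\<eta> z \<in> S" "\<And>x. x \<in> S \<Longrightarrow> x \<in> Euc (idx N) \<Longrightarrow> Q (inv_into C \<eta> x)"
    by (auto simp: near_def eventually_inf_principal eventually_nhds)
  have "openin (mtop N) (C \<inter> \<eta> -` S)"
    unfolding mtop_def openin_topology_generated_by_iff
    by (rule generate_topology_on.Basis) (use C S in blast)
  moreover have "Q w" if "w \<in> C \<inter> \<eta> -` S" for w
    using S(3)[of "\<eta> w"] that compatible_dom(2,4)[OF C'] by auto
  ultimately show "eventually Q (nhdsin (mtop N) z)"
    using C S by (auto simp: eventually_nhdsin)
qed

lemma eventually_mtop_self: "atlas N \<Longrightarrow> z \<in> pts N \<Longrightarrow> eventually Q (nhdsin (mtop N) z) \<Longrightarrow> Q z"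
  by (auto simp: eventually_nhdsin topspace_mtop)

lemma eventually_dom: "atlas N \<Longrightarrow> compatible N (D, \<psi>) \<Longrightarrow> z \<in> D \<Longrightarrow> eventually (\<lambda>z. z \<in> D) (nhdsin (mtop N) z)"
  by (simp add: eventually_mtop) (auto elim: eventually_mono[OF eventually_chart])

lemma eventually_eventually_mtop:
  "eventually Q (nhdsin (mtop N) z) \<Longrightarrow> eventually (\<lambda>z. eventually Q (nhdsin (mtop N) z)) (nhdsin (mtop N) z)"
  by (auto simp: eventually_nhdsin)

lemma eventually_pts: "atlas N \<Longrightarrow> eventually (\<lambda>z. z \<in> pts N) (nhdsin (mtop N) z)"
  by (auto simp: eventually_nhdsin topspace_mtop intro!: exI[of _ "pts N"]) (metis openin_topspace topspace_mtop)

section \<open>Smooth real functions on a manifold\<close>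

definition smf :: "('a, 'i) mfd \<Rightarrow> ('a \<Rightarrow> real) \<Rightarrow> 'a \<Rightarrow> bool" where
  "smf N h z \<longleftrightarrow> (\<exists>(D, \<psi>)\<in>charts N. z \<in> D \<and> sm (idx N) (\<lambda>x. h (inv_into D \<psi> x)) (\<psi> z))"

lemma sm_trans:
  assumes N: "finite (idx N)" and D: "compatible N (D, \<psi>)" "inj_on \<psi> D" and C: "compatible N (C, \<eta>)" "inj_on \<eta> C"
    and z: "z \<in> D" "z \<in> C"
    and t: "\<And>j. j \<in> idx N \<Longrightarrow> sm (idx N) (\<lambda>x. \<eta> (inv_into D \<psi> x) j) (\<psi> z)"
      "eventually (\<lambda>x. inv_into D \<psi> x \<in> C) (near (idx N) (\<psi> z))"
    and h: "sm (idx N) (\<lambda>x. h (inv_into C \<eta> x)) (\<eta> z)"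
  shows "sm (idx N) (\<lambda>x. h (inv_into D \<psi> x)) (\<psi> z)"
proof -
  have "sm (idx N) (\<lambda>x. h (inv_into C \<eta> (\<eta> (inv_into D \<psi> x)))) (\<psi> z)"
  proof (rule sm_comp[OF N, where H = "\<lambda>x. \<eta> (inv_into D \<psi> x)" and F = "\<lambda>x. h (inv_into C \<eta> x)"])
    show "eventually (\<lambda>x. \<eta> (inv_into D \<psi> x) \<in> Euc (idx N)) (near (idx N) (\<psi> z))"
      using t(2) by eventually_elim (use compatible_dom(4)[OF C(1)] in auto)
  qed (use assms compatible_dom(4)[OF D(1)] in auto)
  then show ?thesis
    by (rule sm_cong) (use t(2) in eventually_elim, use C in auto)
qed

text \<open>Smoothness of transition maps makes the choice of the chart in \<open>smf\<close>
  immaterial, so the rules for \<open>sm\<close> can be copied to manifolds by working in one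
  chart.\<close>

lemma smf_iff:
  assumes N: "atlas N" and D: "compatible N (D, \<psi>)" "z \<in> D"
  shows "smf N h z \<longleftrightarrow> sm (idx N) (\<lambda>x. h (inv_into D \<psi> x)) (\<psi> z)"
proof
  assume "smf N h z"
  then obtain C \<eta> where C: "(C, \<eta>) \<in> charts N" "z \<in> C" "sm (idx N) (\<lambda>x. h (inv_into C \<eta> x)) (\<eta> z)"
    by (auto simp: smf_def)
  note C' = atlas_compatible[OF N C(1)]
  note t = compatible_sm[OF D(1) C(1) D(2) C(2)]
  show "sm (idx N) (\<lambda>x. h (inv_into D \<psi> x)) (\<psi> z)"
    by (rule sm_trans[OF atlas_finite[OF N] D(1) _ C' _ D(2) C(2) t(1,3) C(3)])
      (use compatible_dom[OF D(1)] compatible_dom[OF C'] in auto)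
next
  assume h: "sm (idx N) (\<lambda>x. h (inv_into D \<psi> x)) (\<psi> z)"
  obtain C \<eta> where C: "(C, \<eta>) \<in> charts N" "z \<in> C"
    using atlas_chart[OF N] D compatible_dom(1) by blast
  note C' = atlas_compatible[OF N C(1)]
  note t = compatible_sm[OF D(1) C(1) D(2) C(2)]
  have "eventually (\<lambda>x. inv_into C \<eta> x \<in> D) (near (idx N) (\<eta> z))"
    using t(4) by eventually_elim (use compatible_dom(2)[OF C'] in auto)
  then have "sm (idx N) (\<lambda>x. h (inv_into C \<eta> x)) (\<eta> z)"
    by (intro sm_trans[OF atlas_finite[OF N] C' _ D(1) _ C(2) D(2) t(2) _ h])
      (use compatible_dom[OF D(1)] compatible_dom[OF C'] in auto)
  then show "smf N h z" using C by (auto simp: smf_def)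
qed

lemma smf_pts: "atlas N \<Longrightarrow> smf N h z \<Longrightarrow> z \<in> pts N"
  by (auto simp: smf_def intro: tame_pts[OF atlas_tame])

lemma smf_chartE:
  assumes "atlas N" "z \<in> pts N"
  obtains D \<psi> where "(D, \<psi>) \<in> charts N" "compatible N (D, \<psi>)" "z \<in> D" "inv_into D \<psi> (\<psi> z) = z"
    "\<psi> z \<in> Euc (idx N)"
proof -
  obtain D \<psi> where D: "(D, \<psi>) \<in> charts N" "z \<in> D" using atlas_chart[OF assms] by blast
  moreover note atlas_compatible[OF assms(1) D(1)]
  ultimately show ?thesis using that compatible_dom(2,4)[of N D \<psi>] by auto
qed

lemma smf_cong:
  assumes N: "atlas N" and h: "smf N h z" and ev: "eventually (\<lambda>z. h z = g z) (nhdsin (mtop N) z)"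
  shows "smf N g z"
proof -
  obtain D \<psi> where D: "compatible N (D, \<psi>)" "z \<in> D" using smf_chartE[OF N smf_pts[OF N h]] by metis
  show ?thesis using sm_cong[OF h[unfolded smf_iff[OF N D]] ev[unfolded eventually_mtop[OF N D]]]
    unfolding smf_iff[OF N D] .
qed

lemma eventually_smf:
  assumes N: "atlas N" and h: "smf N h z" shows "eventually (smf N h) (nhdsin (mtop N) z)"
proof -
  obtain D \<psi> where D: "compatible N (D, \<psi>)" "z \<in> D" using smf_chartE[OF N smf_pts[OF N h]] by metis
  show ?thesis unfolding eventually_mtop[OF N D]
    using eventually_sm[OF h[unfolded smf_iff[OF N D]]] eventually_chart[OF D]
    by eventually_elim (use smf_iff[OF N D(1)] in auto)
qed

lemma smf_tendsto:
  assumes N: "atlas N" and h: "smf N h z" shows "(h \<longlongrightarrow> h z) (nhdsin (mtop N) z)"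
proof -
  obtain D \<psi> where D: "compatible N (D, \<psi>)" "z \<in> D" "inv_into D \<psi> (\<psi> z) = z"
    using smf_chartE[OF N smf_pts[OF N h]] by metis
  show ?thesis
    using sm_tendsto[OF h[unfolded smf_iff[OF N D(1,2)]]]
    by (simp add: tendsto_def eventually_mtop[OF N D(1,2)] D(3))
qed

lemma smf_const: "atlas N \<Longrightarrow> z \<in> pts N \<Longrightarrow> smf N (\<lambda>_. c) z"
  by (rule smf_chartE[of N z], assumption, assumption) (simp add: smf_iff sm_const)

lemma smf_add: "atlas N \<Longrightarrow> smf N f z \<Longrightarrow> smf N g z \<Longrightarrow> smf N (\<lambda>z. f z + g z) z"
  by (rule smf_chartE[OF _ smf_pts[of N f z]]) (simp_all add: smf_iff sm_add)

lemma smf_diff: "atlas N \<Longrightarrow> smf N f z \<Longrightarrow> smf N g z \<Longrightarrow> smf N (\<lambda>z. f z - g z) z"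
  by (rule smf_chartE[OF _ smf_pts[of N f z]]) (simp_all add: smf_iff sm_diff)

lemma smf_mult: "atlas N \<Longrightarrow> smf N f z \<Longrightarrow> smf N g z \<Longrightarrow> smf N (\<lambda>z. f z * g z) z"
  by (rule smf_chartE[OF _ smf_pts[of N f z]]) (simp_all add: smf_iff sm_mult)

lemma smf_sum:
  "atlas N \<Longrightarrow> z \<in> pts N \<Longrightarrow> finite A \<Longrightarrow> (\<And>a. a \<in> A \<Longrightarrow> smf N (f a) z) \<Longrightarrow> smf N (\<lambda>z. \<Sum>a\<in>A. f a z) z"
  by (rule smf_chartE[of N z], assumption, assumption) (simp add: smf_iff sm_sum)

lemma smf_taylor_mono:
  "atlas N \<Longrightarrow> z \<in> pts N \<Longrightarrow> finite J \<Longrightarrow> (\<And>j. j \<in> J \<Longrightarrow> smf N (\<lambda>z. f z j) z) \<Longrightarrow>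
    smf N (\<lambda>z. taylor_mono J \<beta> (f z)) z"
  by (rule smf_chartE[of N z], assumption, assumption) (simp add: smf_iff sm_taylor_mono)

lemma smf_coord: "atlas N \<Longrightarrow> compatible N (D, \<psi>) \<Longrightarrow> z \<in> D \<Longrightarrow> smf N (\<lambda>z. \<psi> z i) z"
  unfolding smf_iff
  by (rule sm_cong[OF sm_coord]) (auto dest: compatible_dom(4) elim: eventually_mono[OF eventually_chart])

lemma filterlim_smf:
  assumes N: "atlas N" and H: "\<And>j. j \<in> J \<Longrightarrow> smf N (\<lambda>z. H z j) z"
    and ev: "eventually (\<lambda>z. H z \<in> Euc J) (nhdsin (mtop N) z)" and z: "z \<in> pts N"
  shows "filterlim H (near J (H z)) (nhdsin (mtop N) z)"
  by (rule filterlim_near) (use H ev eventually_mtop_self[OF N z ev] smf_tendsto[OF N] in auto)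

lemma smf_comp:
  assumes N: "atlas N" and J: "finite J" and F: "sm J F (H z)" and H: "\<And>j. j \<in> J \<Longrightarrow> smf N (\<lambda>z. H z j) z"
    and ev: "eventually (\<lambda>z. H z \<in> Euc J) (nhdsin (mtop N) z)" and z: "z \<in> pts N"
  shows "smf N (\<lambda>z. F (H z)) z"
proof -
  obtain D \<psi> where D: "compatible N (D, \<psi>)" "z \<in> D" "inv_into D \<psi> (\<psi> z) = z" "\<psi> z \<in> Euc (idx N)"
    using smf_chartE[OF N z] by metis
  show ?thesis unfolding smf_iff[OF N D(1,2)]
  proof (rule sm_comp[OF J, where H = "\<lambda>x. H (inv_into D \<psi> x)"])
    show "sm (idx N) (\<lambda>x. H (inv_into D \<psi> x) j) (\<psi> z)" if "j \<in> J" for j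
      using H[OF that] unfolding smf_iff[OF N D(1,2)] .
  qed (use F ev[unfolded eventually_mtop[OF N D(1,2)]] D in auto)
qed

section \<open>Smooth maps in coordinates\<close>

definition csm :: "('a, 'i) mfd \<Rightarrow> ('b, 'j) mfd \<Rightarrow> 'a set \<Rightarrow> ('a \<Rightarrow> 'i \<Rightarrow> real) \<Rightarrow> 'b set \<Rightarrow> ('b \<Rightarrow> 'j \<Rightarrow> real) \<Rightarrow>
    ('a \<Rightarrow> 'b) \<Rightarrow> 'a \<Rightarrow> bool" where
  "csm N P D \<psi> C \<eta> f z \<longleftrightarrow> z \<in> D \<and> f z \<in> C \<and> \<psi> z \<in> Euc (idx N) \<and>
     (\<exists>G. (\<forall>j\<in>idx P. sm (idx N) (\<lambda>x. G x j) (\<psi> z)) \<and>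
        (\<forall>\<^sub>F x in near (idx N) (\<psi> z). \<forall>z'\<in>D. \<psi> z' = x \<longrightarrow> f z' \<in> C \<and> (\<forall>j\<in>idx P. \<eta> (f z') j = G x j)))"

text \<open>Only some chart of the source is examined, whereas \<open>smooth_at\<close> quantifies over all of them. Thus
a composition \<open>g \<circ> f\<close> is seen to be smooth without transition maps of the space in between.\<close>

definition wsmooth :: "('a, 'i) mfd \<Rightarrow> ('b, 'j) mfd \<Rightarrow> ('a \<Rightarrow> 'b) \<Rightarrow> 'a \<Rightarrow> bool" where
  "wsmooth N P f z \<longleftrightarrow> z \<in> pts N \<and> f z \<in> pts P \<and>
     (\<forall>C \<eta>. (C, \<eta>) \<in> charts P \<longrightarrow> f z \<in> C \<longrightarrow> (\<exists>D \<psi>. (D, \<psi>) \<in> charts N \<and> csm N P D \<psi> C \<eta> f z))"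

text \<open>\<open>csm\<close> isolates the condition for a single pair of charts. Its G is a smooth
  function near the image point in R^I, constrained only on the image of the chart domain, which may
  be thin for a submanifold, and only in the coordinates of \<open>idx P\<close>.\<close>

lemma smooth_at_csm:
  assumes N: "tame N" and P: "tame P"
  shows "smooth_at N P f z \<longleftrightarrow> z \<in> pts N \<and> f z \<in> pts P \<and>
    (\<forall>D \<psi> C \<eta>. (D, \<psi>) \<in> charts N \<longrightarrow> (C, \<eta>) \<in> charts P \<longrightarrow> z \<in> D \<longrightarrow> f z \<in> C \<longrightarrow>
      csm N P D \<psi> C \<eta> f z)"
proof -
  have "csm N P D \<psi> C \<eta> f z \<longleftrightarrow>
     (\<exists>U G. openin (top_of_set (Euc (idx N))) U \<and> \<psi> z \<in> U \<and>
           (\<forall>j\<in>idx P. Cinf (idx N) U (\<lambda>x. G x j)) \<and>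
           (\<forall>z'\<in>D. \<psi> z' \<in> U \<longrightarrow> f z' \<in> C \<and> \<eta> (f z') = G (\<psi> z')))" (is "_ \<longleftrightarrow> ?R")
    if D: "(D, \<psi>) \<in> charts N" "(C, \<eta>) \<in> charts P" "z \<in> D" "f z \<in> C" for D \<psi> C \<eta>
  proof
    assume "csm N P D \<psi> C \<eta> f z"
    then obtain G where E: "\<psi> z \<in> Euc (idx N)" and G: "\<And>j. j\<in>idx P \<Longrightarrow> sm (idx N) (\<lambda>x. G x j) (\<psi> z)"
      "\<forall>\<^sub>F x in near (idx N) (\<psi> z). \<forall>z'\<in>D. \<psi> z' = x \<longrightarrow> f z' \<in> C \<and> (\<forall>j\<in>idx P. \<eta> (f z') j = G x j)"
      by (auto simp: csm_def)
    \<comment> \<open>\<open>smooth_at\<close> asks for equality of whole coordinate vectors. Those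
      of P vanish outside \<open>idx P\<close>, so G is cut off to do the same.\<close>
    define G' where "G' x = (\<lambda>j. if j \<in> idx P then G x j else 0)" for x
    have "\<forall>\<^sub>F x in near (idx N) (\<psi> z). \<forall>j\<in>idx P. sm (idx N) (\<lambda>x. G x j) x"
      using G(1) eventually_sm by (auto simp: eventually_ball_finite_distrib tame_finite[OF P])
    with G(2) have "\<forall>\<^sub>F x in near (idx N) (\<psi> z). (\<forall>j\<in>idx P. sm (idx N) (\<lambda>x. G x j) x) \<and>
       (\<forall>z'\<in>D. \<psi> z' = x \<longrightarrow> f z' \<in> C \<and> (\<forall>j\<in>idx P. \<eta> (f z') j = G x j))"
      by eventually_elim auto
    then obtain U where U: "open_Euc (idx N) U" "\<psi> z \<in> U"
      "\<And>x. x \<in> U \<Longrightarrow> (\<forall>j\<in>idx P. sm (idx N) (\<lambda>x. G x j) x) \<and>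
       (\<forall>z'\<in>D. \<psi> z' = x \<longrightarrow> f z' \<in> C \<and> (\<forall>j\<in>idx P. \<eta> (f z') j = G x j))"
      unfolding eventually_near[OF E] by auto
    have "\<eta> (f z') = G' (\<psi> z')" if "z' \<in> D" "\<psi> z' \<in> U" for z'
      using U(3)[OF that(2)] that tame_Euc[OF P D(2)] by (intro ext) (auto simp: G'_def dest: EucD)
    moreover have "(\<lambda>x. G' x j) = (\<lambda>x. G x j)" if "j \<in> idx P" for j using that by (simp add: G'_def)
    ultimately show ?R using U by (intro exI[of _ U] exI[of _ G']) (auto simp: Cinf_iff_sm)
  next
    assume ?R
    then obtain U G where U: "open_Euc (idx N) U" "\<psi> z \<in> U" "\<forall>j\<in>idx P. Cinf (idx N) U (\<lambda>x. G x j)"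
      "\<forall>z'\<in>D. \<psi> z' \<in> U \<longrightarrow> f z' \<in> C \<and> \<eta> (f z') = G (\<psi> z')" by blast
    show "csm N P D \<psi> C \<eta> f z"
      unfolding csm_def
    proof (intro conjI exI[of _ G])
      show "\<forall>\<^sub>F x in near (idx N) (\<psi> z). \<forall>z'\<in>D. \<psi> z' = x \<longrightarrow> f z' \<in> C \<and> (\<forall>j\<in>idx P. \<eta> (f z') j = G x j)"
        using eventually_near_open[OF U(1,2)] by eventually_elim (use U in auto)
    qed (use U D open_Euc_subset[OF U(1)] in \<open>auto simp: sm_def\<close>)
  qed
  then show ?thesis unfolding smooth_at_def by (simp add: Ball_def split_paired_All)
qed

text \<open>Charts of an atlas have open images, where the coordinate expression of f serves as its
  own extension.\<close>

lemma csm_atlas: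
  assumes N: "atlas N" and D: "compatible N (D, \<psi>)" "z \<in> D"
  shows "csm N P D \<psi> C \<eta> f z \<longleftrightarrow> f z \<in> C \<and> eventually (\<lambda>z. f z \<in> C) (nhdsin (mtop N) z) \<and>
    (\<forall>j\<in>idx P. smf N (\<lambda>z. \<eta> (f z) j) z)" (is "?L \<longleftrightarrow> ?R")
proof
  assume ?L
  then obtain G where G: "\<And>j. j\<in>idx P \<Longrightarrow> sm (idx N) (\<lambda>x. G x j) (\<psi> z)"
      "\<forall>\<^sub>F x in near (idx N) (\<psi> z). \<forall>z'\<in>D. \<psi> z' = x \<longrightarrow> f z' \<in> C \<and> (\<forall>j\<in>idx P. \<eta> (f z') j = G x j)"
      and fz: "f z \<in> C"
    by (auto simp: csm_def)
  have ev: "\<forall>\<^sub>F x in near (idx N) (\<psi> z). f (inv_into D \<psi> x) \<in> C \<and> (\<forall>j\<in>idx P. \<eta> (f (inv_into D \<psi> x)) j = G x j)"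
    using G(2) eventually_chart[OF D] by eventually_elim auto
  have "sm (idx N) (\<lambda>x. \<eta> (f (inv_into D \<psi> x)) j) (\<psi> z)" if "j \<in> idx P" for j
    by (rule sm_cong[OF G(1)[OF that]]) (use ev in eventually_elim, use that in auto)
  then show ?R using fz ev by (auto simp: eventually_mtop[OF N D] smf_iff[OF N D] elim: eventually_mono)
next
  assume ?R
  then show ?L unfolding csm_def
    by (intro conjI exI[of _ "\<lambda>x. \<eta> (f (inv_into D \<psi> x))"])
      (use D compatible_dom(2,4)[OF D(1)] in \<open>auto simp: eventually_mtop[OF N D] smf_iff[OF N D] elim!: eventually_mono\<close>)
qed

lemma smooth_at_iff:
  fixes P :: "('b, 'j) mfd"
  assumes N: "atlas N" and P: "tame P"
  shows "smooth_at N P f z \<longleftrightarrow> z \<in> pts N \<and> f z \<in> pts P \<and>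
    (\<forall>(C, \<eta>)\<in>charts P. f z \<in> C \<longrightarrow> eventually (\<lambda>z. f z \<in> C) (nhdsin (mtop N) z) \<and>
      (\<forall>j\<in>idx P. smf N (\<lambda>z. \<eta> (f z) j) z))"
proof -
  define R where "R C \<eta> \<longleftrightarrow> eventually (\<lambda>z. f z \<in> C) (nhdsin (mtop N) z) \<and>
      (\<forall>j\<in>idx P. smf N (\<lambda>z. \<eta> (f z) j) z)" for C and \<eta> :: "'b \<Rightarrow> 'j \<Rightarrow> real"
  have "csm N P D \<psi> C \<eta> f z \<longleftrightarrow> f z \<in> C \<and> R C \<eta>" if "(D, \<psi>) \<in> charts N" "z \<in> D" for D \<psi> C \<eta>
    using csm_atlas[OF N atlas_compatible[OF N that(1)] that(2)] by (simp add: R_def)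
  then show ?thesis
    unfolding smooth_at_csm[OF atlas_tame[OF N] P] R_def[symmetric]
    using atlas_chart[OF N, of z] by (simp add: Ball_def) metis
qed

lemma smooth_atI:
  assumes "atlas N" "tame P" "z \<in> pts N" "f z \<in> pts P"
    "\<And>C \<eta>. (C, \<eta>) \<in> charts P \<Longrightarrow> f z \<in> C \<Longrightarrow> eventually (\<lambda>z. f z \<in> C) (nhdsin (mtop N) z)"
    "\<And>C \<eta> j. (C, \<eta>) \<in> charts P \<Longrightarrow> f z \<in> C \<Longrightarrow> j \<in> idx P \<Longrightarrow> smf N (\<lambda>z. \<eta> (f z) j) z"
  shows "smooth_at N P f z"
  using assms by (auto simp: smooth_at_iff)

lemma smooth_atD:
  assumes "smooth_at N P f z" "atlas N" "tame P" "(C, \<eta>) \<in> charts P" "f z \<in> C"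
  shows "eventually (\<lambda>z. f z \<in> C) (nhdsin (mtop N) z)" "\<And>j. j \<in> idx P \<Longrightarrow> smf N (\<lambda>z. \<eta> (f z) j) z"
  using assms by (auto simp: smooth_at_iff)

lemma smooth_at_pts: "smooth_at N P f z \<Longrightarrow> z \<in> pts N" "smooth_at N P f z \<Longrightarrow> f z \<in> pts P"
  by (auto simp: smooth_at_def)

lemma csm_comp:
  assumes N': "tame N'" "(D', \<psi>') \<in> charts N'"
    and f: "csm N N' D \<psi> D' \<psi>' f z" and g: "csm N' P D' \<psi>' C \<eta> g (f z)"
  shows "csm N P D \<psi> C \<eta> (\<lambda>z. g (f z)) z"
proof -
  obtain F where F: "\<And>j. j\<in>idx N' \<Longrightarrow> sm (idx N) (\<lambda>x. F x j) (\<psi> z)"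
      "\<forall>\<^sub>F x in near (idx N) (\<psi> z). \<forall>z'\<in>D. \<psi> z' = x \<longrightarrow> f z' \<in> D' \<and> (\<forall>j\<in>idx N'. \<psi>' (f z') j = F x j)"
      and z: "z \<in> D" "f z \<in> D'" "\<psi> z \<in> Euc (idx N)"
    using f by (auto simp: csm_def)
  obtain G where G: "\<And>j. j\<in>idx P \<Longrightarrow> sm (idx N') (\<lambda>x. G x j) (\<psi>' (f z))"
      "\<forall>\<^sub>F x in near (idx N') (\<psi>' (f z)). \<forall>z'\<in>D'. \<psi>' z' = x \<longrightarrow> g z' \<in> C \<and> (\<forall>j\<in>idx P. \<eta> (g z') j = G x j)"
      and z': "g (f z) \<in> C"
    using g by (auto simp: csm_def)
  \<comment> \<open>The extension F of the inner map need not take values in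
    \<open>Euc (idx N')\<close>; cutting it off makes it tend to the point around which G is
    defined.\<close>
  define F' where "F' x = (\<lambda>j. if j \<in> idx N' then F x j else 0)" for x
  have F'E: "F' x \<in> Euc (idx N')" for x by (auto simp: F'_def intro: EucI)
  have F's: "sm (idx N) (\<lambda>x. F' x j) (\<psi> z)" if "j \<in> idx N'" for j
    using F(1)[OF that] that by (simp add: F'_def)
  have F'eq: "\<psi>' (f w) = F' x" if "f w \<in> D'" "\<forall>j\<in>idx N'. \<psi>' (f w) j = F x j" for w x
    using that tame_Euc[OF N'] by (intro ext) (auto simp: F'_def dest: EucD)
  have z0: "F' (\<psi> z) = \<psi>' (f z)"
    using eventually_near_self[OF F(2) z(3)] z by (intro F'eq[symmetric]) auto
  have "filterlim F' (near (idx N') (F' (\<psi> z))) (near (idx N) (\<psi> z))"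
    by (rule filterlim_sm) (use F's F'E in auto)
  from eventually_compose_filterlim[OF _ this, unfolded z0, OF G(2)] F(2)
  have "\<forall>\<^sub>F x in near (idx N) (\<psi> z). \<forall>z'\<in>D. \<psi> z' = x \<longrightarrow> g (f z') \<in> C \<and> (\<forall>j\<in>idx P. \<eta> (g (f z')) j = G (F' x) j)"
    by eventually_elim (use F'eq in auto)
  moreover have "sm (idx N) (\<lambda>x. G (F' x) j) (\<psi> z)" if "j \<in> idx P" for j
    by (rule sm_comp[OF tame_finite[OF N'(1)], where H = F']) (use G(1)[OF that] F's F'E z z0 in auto)
  ultimately show ?thesis using z z' by (auto simp: csm_def intro!: exI[of _ "\<lambda>x. G (F' x)"])
qed

lemma wsmooth_pts: "wsmooth N P f z \<Longrightarrow> z \<in> pts N" "wsmooth N P f z \<Longrightarrow> f z \<in> pts P"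
  by (auto simp: wsmooth_def)

lemma wsmoothD:
  "wsmooth N P f z \<Longrightarrow> (C, \<eta>) \<in> charts P \<Longrightarrow> f z \<in> C \<Longrightarrow> \<exists>D \<psi>. (D, \<psi>) \<in> charts N \<and> csm N P D \<psi> C \<eta> f z"
  by (simp add: wsmooth_def)

lemma smooth_at_wsmooth:
  assumes "smooth_at N P f z" "tame N" "tame P" shows "wsmooth N P f z"
  using assms tame_chart[OF assms(2), of z] unfolding wsmooth_def smooth_at_csm[OF assms(2,3)] by metis

lemma smooth_at_comp:
  assumes N: "tame N" "tame N'" "tame P" and f: "smooth_at N N' f z" and g: "wsmooth N' P g (f z)"
  shows "smooth_at N P (\<lambda>z. g (f z)) z"
  unfolding smooth_at_csm[OF N(1,3)]
proof (intro conjI allI impI)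
  fix D \<psi> C \<eta> assume D: "(D, \<psi>) \<in> charts N" "(C, \<eta>) \<in> charts P" "z \<in> D" "g (f z) \<in> C"
  obtain D' \<psi>' where D': "(D', \<psi>') \<in> charts N'" "csm N' P D' \<psi>' C \<eta> g (f z)"
    using wsmoothD[OF g D(2,4)] by blast
  then have "f z \<in> D'" by (simp add: csm_def)
  then have "csm N N' D \<psi> D' \<psi>' f z" using f[unfolded smooth_at_csm[OF N(1,2)]] D D' by simp
  then show "csm N P D \<psi> C \<eta> (\<lambda>z. g (f z)) z" using D'(2) by (rule csm_comp[OF N(2) D'(1)])
qed (use smooth_at_pts[OF f] wsmooth_pts[OF g] in auto)

lemma wsmooth_comp:
  assumes N: "tame N'" and f: "wsmooth N N' f z" and g: "wsmooth N' P g (f z)"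
  shows "wsmooth N P (\<lambda>z. g (f z)) z"
  unfolding wsmooth_def
proof (intro conjI allI impI)
  fix C \<eta> assume D: "(C, \<eta>) \<in> charts P" "g (f z) \<in> C"
  obtain D' \<psi>' where D': "(D', \<psi>') \<in> charts N'" "csm N' P D' \<psi>' C \<eta> g (f z)"
    using wsmoothD[OF g D] by blast
  then have "f z \<in> D'" by (simp add: csm_def)
  then obtain D \<psi> where D\<psi>: "(D, \<psi>) \<in> charts N" "csm N N' D \<psi> D' \<psi>' f z"
    using wsmoothD[OF f D'(1)] by blast
  from D\<psi>(2) D'(2) have "csm N P D \<psi> C \<eta> (\<lambda>z. g (f z)) z" by (rule csm_comp[OF N D'(1)])
  then show "\<exists>D \<psi>. (D, \<psi>) \<in> charts N \<and> csm N P D \<psi> C \<eta> (\<lambda>z. g (f z)) z" using D\<psi>(1) by blast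
qed (use wsmooth_pts[OF f] wsmooth_pts[OF g] in auto)

lemma smooth_at_id: "atlas N \<Longrightarrow> z \<in> pts N \<Longrightarrow> smooth_at N N (\<lambda>z. z) z"
  by (rule smooth_atI) (auto intro: atlas_tame eventually_dom smf_coord atlas_compatible)

lemma smf_smooth_at:
  assumes N: "atlas N" and P: "atlas P" and f: "smooth_at N P f z" and h: "smf P h (f z)"
  shows "smf N (\<lambda>z. h (f z)) z"
proof -
  have z: "z \<in> pts N" "f z \<in> pts P" using smooth_at_pts[OF f] by auto
  obtain D \<psi> where D: "(D, \<psi>) \<in> charts P" "compatible P (D, \<psi>)" "f z \<in> D" "inv_into D \<psi> (\<psi> (f z)) = f z"
    using smf_chartE[OF P z(2)] by metis
  note d = smooth_atD[OF f N atlas_tame[OF P] D(1,3)]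
  have "smf N (\<lambda>w. h (inv_into D \<psi> (\<psi> (f w)))) z"
  proof (rule smf_comp[OF N atlas_finite[OF P], where H = "\<lambda>w. \<psi> (f w)"])
    show "eventually (\<lambda>w. \<psi> (f w) \<in> Euc (idx P)) (nhdsin (mtop N) z)"
      using d(1) by eventually_elim (use compatible_dom(4)[OF D(2)] in auto)
  qed (use h d z D in \<open>auto simp: smf_iff[OF P D(2,3)]\<close>)
  then show ?thesis
    by (rule smf_cong[OF N]) (use d(1) in eventually_elim, use compatible_dom(2)[OF D(2)] in auto)
qed

lemma smooth_at_eventually:
  assumes N: "atlas N" and P: "atlas P" and f: "smooth_at N P f z" and Q: "eventually Q (nhdsin (mtop P) (f z))"
  shows "eventually (\<lambda>z. Q (f z)) (nhdsin (mtop N) z)"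
proof -
  have z: "z \<in> pts N" "f z \<in> pts P" using smooth_at_pts[OF f] by auto
  obtain D \<psi> where D: "(D, \<psi>) \<in> charts P" "compatible P (D, \<psi>)" "f z \<in> D" "inv_into D \<psi> (\<psi> (f z)) = f z"
    using smf_chartE[OF P z(2)] by metis
  note d = smooth_atD[OF f N atlas_tame[OF P] D(1,3)]
  have "filterlim (\<lambda>w. \<psi> (f w)) (near (idx P) (\<psi> (f z))) (nhdsin (mtop N) z)"
  proof (rule filterlim_smf[OF N])
    show "eventually (\<lambda>w. \<psi> (f w) \<in> Euc (idx P)) (nhdsin (mtop N) z)"
      using d(1) by eventually_elim (use compatible_dom(4)[OF D(2)] in auto)
  qed (use d z in auto)
  from eventually_compose_filterlim[OF Q[unfolded eventually_mtop[OF P D(2,3)]] this] d(1)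
  show ?thesis by eventually_elim (use compatible_dom(2)[OF D(2)] in auto)
qed

text \<open>For a target with smooth transition maps one chart around f z suffices, although
  \<open>smooth_at\<close> speaks of all of them.\<close>

lemma smooth_at_compatible:
  assumes N: "atlas N" and P: "atlas P" and C: "compatible P (C, \<eta>)" and z: "z \<in> pts N"
    and f: "f z \<in> C" "eventually (\<lambda>z. f z \<in> C) (nhdsin (mtop N) z)" "\<And>j. j \<in> idx P \<Longrightarrow> smf N (\<lambda>z. \<eta> (f z) j) z"
  shows "smooth_at N P f z"
proof (rule smooth_atI[OF N atlas_tame[OF P] z])
  show "f z \<in> pts P" using f C compatible_dom(1) by blast
  fix D \<psi> assume D: "(D, \<psi>) \<in> charts P" "f z \<in> D"
  note t = compatible_sm[OF C D(1) f(1) D(2)]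
  have E: "eventually (\<lambda>w. \<eta> (f w) \<in> Euc (idx P)) (nhdsin (mtop N) z)"
    using f(2) by eventually_elim (use compatible_dom(4)[OF C] in auto)
  have "filterlim (\<lambda>w. \<eta> (f w)) (near (idx P) (\<eta> (f z))) (nhdsin (mtop N) z)"
    by (rule filterlim_smf[OF N]) (use f z E in auto)
  from eventually_compose_filterlim[OF t(3) this] f(2)
  show "eventually (\<lambda>z. f z \<in> D) (nhdsin (mtop N) z)"
    by eventually_elim (use compatible_dom(2)[OF C] in auto)
  fix j assume j: "j \<in> idx P"
  have "smf N (\<lambda>w. \<psi> (inv_into C \<eta> (\<eta> (f w))) j) z"
    by (rule smf_comp[OF N atlas_finite[OF P], where H = "\<lambda>w. \<eta> (f w)"]) (use t j f z E in auto)
  then show "smf N (\<lambda>z. \<psi> (f z) j) z"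
    by (rule smf_cong[OF N]) (use f(2) in eventually_elim, use compatible_dom(2)[OF C] in auto)
qed

lemma eventually_smooth_at:
  assumes N: "atlas N" and P: "atlas P" and f: "smooth_at N P f z"
  shows "eventually (smooth_at N P f) (nhdsin (mtop N) z)"
proof -
  have z: "z \<in> pts N" "f z \<in> pts P" using smooth_at_pts[OF f] by auto
  obtain D \<psi> where D: "(D, \<psi>) \<in> charts P" "compatible P (D, \<psi>)" "f z \<in> D" "inv_into D \<psi> (\<psi> (f z)) = f z"
    using smf_chartE[OF P z(2)] by metis
  note d = smooth_atD[OF f N atlas_tame[OF P] D(1,3)]
  have "eventually (\<lambda>z. \<forall>j\<in>idx P. smf N (\<lambda>z. \<psi> (f z) j) z) (nhdsin (mtop N) z)"
    using d(2) eventually_smf[OF N] by (auto simp: eventually_ball_finite_distrib atlas_finite[OF P])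
  then show ?thesis using eventually_eventually_mtop[OF d(1)] d(1) eventually_pts[OF N, of z]
    by eventually_elim (rule smooth_at_compatible[OF N P D(2)], simp_all)
qed

section \<open>Products and submanifolds\<close>

lemma atlasI:
  assumes "finite (idx N)" "\<And>z. z \<in> pts N \<longleftrightarrow> (\<exists>D \<psi>. (D, \<psi>) \<in> charts N \<and> z \<in> D)"
    "\<And>D \<psi>. (D, \<psi>) \<in> charts N \<Longrightarrow> compatible N (D, \<psi>)"
  shows "atlas N"
proof -
  have "\<Union>(fst ` charts N) = pts N" by (rule set_eqI) (simp add: assms(2) Bex_def split_paired_Ex)
  then show ?thesis using assms by (auto simp: atlas_def)
qed

section \<open>The real line as a manifold\<close>

lemma inv_realline: "inv_into UNIV (\<lambda>t _. t) x = x ()" for x :: "unit \<Rightarrow> real"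
  by (rule inv_into_f_eq) (auto simp: inj_on_def fun_eq_iff)

lemma Euc_unit: "Euc {()} = UNIV"
  by (auto simp: Euc_def)

lemma range_realline: "range (\<lambda>t _. t) = (UNIV :: (unit \<Rightarrow> real) set)"
proof -
  have "x \<in> range (\<lambda>t _. t)" for x :: "unit \<Rightarrow> real" by (rule range_eqI[of _ _ "x ()"]) (simp add: fun_eq_iff)
  then show ?thesis by blast
qed

lemma compatible_realline: "compatible realline (UNIV, \<lambda>t _. t)"
proof -
  have i: "inv_into UNIV (\<lambda>t _. t) = (\<lambda>x :: unit \<Rightarrow> real. x ())" by (rule ext) (rule inv_realline)
  show ?thesis unfolding compatible_def realline_def
    using Euc_unit by (auto simp: range_realline i inj_on_def fun_eq_iff Cinf_iff_sm intro!: sm_coord)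
qed

lemma charts_realline: "charts realline = {(UNIV, \<lambda>t _. t)}" "idx realline = {()}" "pts realline = UNIV"
  by (simp_all add: realline_def)

lemma atlas_realline: "atlas realline"
  by (rule atlasI) (auto simp: charts_realline compatible_realline)

lemma eventually_realline: "eventually Q (nhdsin (mtop realline) t) \<longleftrightarrow> eventually Q (nhds t)"
proof -
  have "eventually Q (nhdsin (mtop realline) t) \<longleftrightarrow> eventually (\<lambda>x. Q (x ())) (near {()} (\<lambda>_. t))"
    using eventually_mtop[OF atlas_realline compatible_realline, of t Q] by (simp add: inv_realline charts_realline)
  also have "\<dots> \<longleftrightarrow> eventually Q (nhds t)"
  proof
    assume "eventually (\<lambda>x. Q (x ())) (near {()} (\<lambda>_. t))"
    moreover have "filterlim (\<lambda>s _. s) (near {()} (\<lambda>_. t)) (nhds t)"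
      by (rule filterlim_near) (auto simp: Euc_unit filterlim_ident)
    ultimately have "eventually (\<lambda>s. Q ((\<lambda>_. s) ())) (nhds t)" by (rule eventually_compose_filterlim)
    then show "eventually Q (nhds t)" by simp
  next
    assume "eventually Q (nhds t)"
    moreover have "filterlim (\<lambda>x. x ()) (nhds t) (near {()} (\<lambda>_. t))"
      using filterlim_near_D[OF filterlim_ident[of "near {()} (\<lambda>_. t)"], of "()"] by simp
    ultimately show "eventually (\<lambda>x. Q (x ())) (near {()} (\<lambda>_. t))" by (rule eventually_compose_filterlim)
  qed
  finally show ?thesis .
qed

section \<open>Products\<close>

lemma case_sum_comp: "case_sum x y \<circ> Inl = x" "case_sum x y \<circ> Inr = y"
  by auto

lemma inv_into_prod:
  assumes "inj_on \<psi> D" "inj_on \<eta> C" "a \<in> D" "b \<in> C"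
  shows "inv_into (D \<times> C) (\<lambda>(a, b). case_sum (\<psi> a) (\<eta> b)) (case_sum (\<psi> a) (\<eta> b)) = (a, b)"
proof (rule inv_into_f_eq)
  show "inj_on (\<lambda>(a, b). case_sum (\<psi> a) (\<eta> b)) (D \<times> C)"
  proof (rule inj_onI, clarify)
    fix a b a' b' assume "a \<in> D" "a' \<in> D" "b \<in> C" "b' \<in> C"
      and e: "case_sum (\<psi> a) (\<eta> b) = case_sum (\<psi> a') (\<eta> b')"
    moreover have "\<psi> a = \<psi> a'" "\<eta> b = \<eta> b'"
      using arg_cong[OF e, of "\<lambda>x. x \<circ> Inl"] arg_cong[OF e, of "\<lambda>x. x \<circ> Inr"]
      by (simp_all only: case_sum_comp)
    ultimately show "a = a' \<and> b = b'" using inj_onD[OF assms(1), of a a'] inj_onD[OF assms(2), of b b'] by blast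
  qed
qed (use assms in auto)

lemma case_sum_surj: "case_sum (x \<circ> Inl) (x \<circ> Inr) = x"
  by (auto simp: fun_eq_iff split: sum.split)

lemma Euc_sum: "x \<in> Euc (I <+> J) \<longleftrightarrow> x \<circ> Inl \<in> Euc I \<and> x \<circ> Inr \<in> Euc J"
proof
  assume R: "x \<circ> Inl \<in> Euc I \<and> x \<circ> Inr \<in> Euc J"
  show "x \<in> Euc (I <+> J)"
  proof (rule EucI)
    fix i assume "i \<notin> I <+> J" then show "x i = 0" using R by (cases i) (auto simp: Euc_def)
  qed
qed (auto simp: Euc_def)

lemma open_Euc_sum:
  assumes "open_Euc I U" "open_Euc J V"
  shows "open_Euc (I <+> J) {x. x \<circ> Inl \<in> U \<and> x \<circ> Inr \<in> V}"
proof -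
  obtain S T where S: "open S" "U = Euc I \<inter> S" "open T" "V = Euc J \<inter> T"
    using assms unfolding openin_open by blast
  have "continuous_on UNIV (\<lambda>x :: 'a + 'b \<Rightarrow> real. x \<circ> Inl)"
    by (rule continuous_on_coordinatewise_then_product) (auto intro: continuous_on_product_coordinates)
  moreover have "continuous_on UNIV (\<lambda>x :: 'a + 'b \<Rightarrow> real. x \<circ> Inr)"
    by (rule continuous_on_coordinatewise_then_product) (auto intro: continuous_on_product_coordinates)
  ultimately have "open ((\<lambda>x. x \<circ> Inl) -` S :: ('a + 'b \<Rightarrow> real) set)" "open ((\<lambda>x. x \<circ> Inr) -` T :: ('a + 'b \<Rightarrow> real) set)"
    using S by (auto simp: continuous_on_open_vimage)
  then have "open ((\<lambda>x. x \<circ> Inl) -` S \<inter> (\<lambda>x. x \<circ> Inr) -` T :: ('a + 'b \<Rightarrow> real) set)" by (rule open_Int)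
  moreover have "{x. x \<circ> Inl \<in> U \<and> x \<circ> Inr \<in> V} = Euc (I <+> J) \<inter> ((\<lambda>x. x \<circ> Inl) -` S \<inter> (\<lambda>x. x \<circ> Inr) -` T)"
    using S by (auto simp: Euc_sum)
  ultimately show ?thesis by (auto simp: openin_open)
qed

lemma image_case_sum:
  "(\<lambda>(a, b). case_sum (\<psi> a) (\<eta> b)) ` (D \<times> C) = {x. x \<circ> Inl \<in> \<psi> ` D \<and> x \<circ> Inr \<in> \<eta> ` C}"
proof safe
  fix x a b assume "x \<circ> Inl = \<psi> a" "a \<in> D" "x \<circ> Inr = \<eta> b" "b \<in> C"
  then show "x \<in> (\<lambda>(a, b). case_sum (\<psi> a) (\<eta> b)) ` (D \<times> C)"
    using case_sum_surj[of x] by (intro image_eqI[of _ _ "(a, b)"]) auto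
qed (auto simp: case_sum_comp)

lemma sm_Inl: "finite I \<Longrightarrow> sm I F (x \<circ> Inl) \<Longrightarrow> x \<in> Euc (I <+> J) \<Longrightarrow> sm (I <+> J) (\<lambda>x. F (x \<circ> Inl)) x"
  by (rule sm_comp[of I F "\<lambda>x. x \<circ> Inl"])
    (auto simp: Euc_sum intro!: sm_coord eventually_mono[OF eventually_near_Euc])

lemma sm_Inr: "finite J \<Longrightarrow> sm J F (x \<circ> Inr) \<Longrightarrow> x \<in> Euc (I <+> J) \<Longrightarrow> sm (I <+> J) (\<lambda>x. F (x \<circ> Inr)) x"
  by (rule sm_comp[of J F "\<lambda>x. x \<circ> Inr"])
    (auto simp: Euc_sum intro!: sm_coord eventually_mono[OF eventually_near_Euc])

lemma Cinf_prod_trans: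
  assumes fin: "finite I" "finite J" and i: "inj_on \<psi> D" "inj_on \<eta> C"
    and U: "D' \<subseteq> D" "C' \<subseteq> C" "open_Euc I (\<psi> ` D')" "open_Euc J (\<eta> ` C')"
    and c: "\<And>i. i \<in> I \<Longrightarrow> Cinf I (\<psi> ` D') (\<lambda>x. \<psi>' (inv_into D \<psi> x) i)"
      "\<And>j. j \<in> J \<Longrightarrow> Cinf J (\<eta> ` C') (\<lambda>x. \<eta>' (inv_into C \<eta> x) j)"
    and k: "k \<in> I <+> J"
  shows "Cinf (I <+> J) ((\<lambda>(a, b). case_sum (\<psi> a) (\<eta> b)) ` (D' \<times> C'))
    (\<lambda>x. (\<lambda>(a, b). case_sum (\<psi>' a) (\<eta>' b)) (inv_into (D \<times> C) (\<lambda>(a, b). case_sum (\<psi> a) (\<eta> b)) x) k)"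
proof -
  let ?W = "(\<lambda>(a, b). case_sum (\<psi> a) (\<eta> b)) ` (D' \<times> C')"
  have W: "open_Euc (I <+> J) ?W" unfolding image_case_sum by (rule open_Euc_sum[OF U(3,4)])
  have inv: "inv_into (D \<times> C) (\<lambda>(a, b). case_sum (\<psi> a) (\<eta> b)) x = (inv_into D \<psi> (x \<circ> Inl), inv_into C \<eta> (x \<circ> Inr))"
    if xW: "x \<in> ?W" for x
  proof -
    obtain p where "x = (\<lambda>(a, b). case_sum (\<psi> a) (\<eta> b)) p" "p \<in> D' \<times> C'" using xW unfolding image_iff by blast
    moreover obtain a b where "p = (a, b)" by (cases p)
    ultimately have ab: "a \<in> D'" "b \<in> C'" "x = case_sum (\<psi> a) (\<eta> b)" by simp_all
    moreover have "a \<in> D" "b \<in> C" using ab U by auto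
    ultimately show ?thesis by (simp add: case_sum_comp inv_into_prod[OF i] i)
  qed
  show ?thesis unfolding Cinf_iff_sm[OF W]
  proof
    fix x assume x: "x \<in> ?W"
    have xE: "x \<in> Euc (I <+> J)" using x open_Euc_subset[OF W] by blast
    have x': "x \<circ> Inl \<in> \<psi> ` D'" "x \<circ> Inr \<in> \<eta> ` C'" using x by (auto simp: image_case_sum)
    have "sm (I <+> J) (\<lambda>x. case_sum (\<psi>' (inv_into D \<psi> (x \<circ> Inl))) (\<eta>' (inv_into C \<eta> (x \<circ> Inr))) k) x"
    proof (cases k)
      case (Inl m)
      then have m: "m \<in> I" using k by auto
      have "sm I (\<lambda>x. \<psi>' (inv_into D \<psi> x) m) (x \<circ> Inl)" using c(1)[OF m] U(3) x'(1) by (auto simp: sm_def)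
      from sm_Inl[OF fin(1) this xE] show ?thesis using Inl by simp
    next
      case (Inr m)
      then have m: "m \<in> J" using k by auto
      have "sm J (\<lambda>x. \<eta>' (inv_into C \<eta> x) m) (x \<circ> Inr)" using c(2)[OF m] U(4) x'(2) by (auto simp: sm_def)
      from sm_Inr[OF fin(2) this xE] show ?thesis using Inr by simp
    qed
    then show "sm (I <+> J) (\<lambda>x. (\<lambda>(a, b). case_sum (\<psi>' a) (\<eta>' b))
        (inv_into (D \<times> C) (\<lambda>(a, b). case_sum (\<psi> a) (\<eta> b)) x) k) x"
      by (rule sm_cong) (use eventually_near_open[OF W x] in eventually_elim, use inv in auto)
  qed
qed

lemma charts_prodm: "charts (prodm N P) = {(D \<times> C, \<lambda>(a, b). case_sum (\<psi> a) (\<eta> b)) | D \<psi> C \<eta>.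
    (D, \<psi>) \<in> charts N \<and> (C, \<eta>) \<in> charts P}"
  and idx_prodm: "idx (prodm N P) = idx N <+> idx P" and pts_prodm: "pts (prodm N P) = pts N \<times> pts P"
  by (simp_all add: prodm_def)

lemma charts_prodmI: "(D, \<psi>) \<in> charts N \<Longrightarrow> (C, \<eta>) \<in> charts P \<Longrightarrow>
    (D \<times> C, \<lambda>(a, b). case_sum (\<psi> a) (\<eta> b)) \<in> charts (prodm N P)"
  by (auto simp: charts_prodm)

lemma charts_prodmE:
  assumes "(W, \<Psi>) \<in> charts (prodm N P)"
  obtains D \<psi> C \<eta> where "W = D \<times> C" "\<Psi> = (\<lambda>(a, b). case_sum (\<psi> a) (\<eta> b))" "(D, \<psi>) \<in> charts N" "(C, \<eta>) \<in> charts P"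
  using assms by (auto simp: charts_prodm)

lemma inj_on_case_sum:
  assumes "inj_on \<psi> D" "inj_on \<eta> C" shows "inj_on (\<lambda>(a, b). case_sum (\<psi> a) (\<eta> b)) (D \<times> C)"
  by (rule inj_on_inverseI[where g = "inv_into (D \<times> C) (\<lambda>(a, b). case_sum (\<psi> a) (\<eta> b))"])
    (use inv_into_prod[OF assms] in auto)

lemma compatible_prodm:
  assumes N: "atlas N" and P: "atlas P" and D: "compatible N (D, \<psi>)" and C: "compatible P (C, \<eta>)"
  shows "compatible (prodm N P) (D \<times> C, \<lambda>(a, b). case_sum (\<psi> a) (\<eta> b))"
proof -
  let ?\<Psi> = "\<lambda>(a, b). case_sum (\<psi> a) (\<eta> b)"
  note d = compatible_dom[OF D] and c = compatible_dom[OF C]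
  have "openin (top_of_set (Euc (idx (prodm N P)))) (?\<Psi> ` (D \<times> C \<inter> W)) \<and>
        openin (top_of_set (Euc (idx (prodm N P)))) (\<Psi>' ` (D \<times> C \<inter> W)) \<and>
        (\<forall>j\<in>idx (prodm N P). Cinf (idx (prodm N P)) (?\<Psi> ` (D \<times> C \<inter> W)) (\<lambda>x. \<Psi>' (inv_into (D \<times> C) ?\<Psi> x) j) \<and>
             Cinf (idx (prodm N P)) (\<Psi>' ` (D \<times> C \<inter> W)) (\<lambda>x. ?\<Psi> (inv_into W \<Psi>' x) j))"
    if "(W, \<Psi>') \<in> charts (prodm N P)" for W \<Psi>'
    using that
  proof (rule charts_prodmE)
    fix D' \<psi>' C' \<eta>' assume W: "W = D' \<times> C'" "\<Psi>' = (\<lambda>(a, b). case_sum (\<psi>' a) (\<eta>' b))"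
      and D': "(D', \<psi>') \<in> charts N" and C': "(C', \<eta>') \<in> charts P"
    note t = compatible_trans[OF D D'] and u = compatible_trans[OF C C']
    have W': "D \<times> C \<inter> D' \<times> C' = (D \<inter> D') \<times> (C \<inter> C')" by auto
    note i' = compatible_dom(2)[OF atlas_compatible[OF N D']] compatible_dom(2)[OF atlas_compatible[OF P C']]
    note fin = atlas_finite[OF N] atlas_finite[OF P]
    have "open_Euc (idx N <+> idx P) (?\<Psi> ` ((D \<inter> D') \<times> (C \<inter> C')))"
      unfolding image_case_sum by (rule open_Euc_sum[OF t(1) u(1)])
    moreover have "open_Euc (idx N <+> idx P) ((\<lambda>(a, b). case_sum (\<psi>' a) (\<eta>' b)) ` ((D \<inter> D') \<times> (C \<inter> C')))"
      unfolding image_case_sum by (rule open_Euc_sum[OF t(2) u(2)])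
    moreover have "Cinf (idx N <+> idx P) (?\<Psi> ` ((D \<inter> D') \<times> (C \<inter> C')))
        (\<lambda>x. (\<lambda>(a, b). case_sum (\<psi>' a) (\<eta>' b)) (inv_into (D \<times> C) ?\<Psi> x) j)" if "j \<in> idx N <+> idx P" for j
      by (rule Cinf_prod_trans[OF fin d(2) c(2) Int_lower1 Int_lower1 t(1) u(1) t(3) u(3) that])
    moreover have "Cinf (idx N <+> idx P) ((\<lambda>(a, b). case_sum (\<psi>' a) (\<eta>' b)) ` ((D \<inter> D') \<times> (C \<inter> C')))
        (\<lambda>x. ?\<Psi> (inv_into (D' \<times> C') (\<lambda>(a, b). case_sum (\<psi>' a) (\<eta>' b)) x) j)" if "j \<in> idx N <+> idx P" for j
      by (rule Cinf_prod_trans[OF fin i' Int_lower2 Int_lower2 t(2) u(2) t(4) u(4) that])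
    ultimately show ?thesis unfolding W idx_prodm W' by blast
  qed
  moreover have "openin (top_of_set (Euc (idx (prodm N P)))) (?\<Psi> ` (D \<times> C))"
    unfolding image_case_sum idx_prodm by (rule open_Euc_sum[OF d(3) c(3)])
  moreover have "inj_on ?\<Psi> (D \<times> C)" by (rule inj_on_case_sum[OF d(2) c(2)])
  moreover have "D \<times> C \<subseteq> pts (prodm N P)" using d(1) c(1) by (auto simp: pts_prodm)
  ultimately show ?thesis unfolding compatible_def prod.case by (simp add: Ball_def split_paired_All)
qed

lemma cover_prodm:
  assumes "\<Union>(fst ` charts N) = pts N" "\<Union>(fst ` charts P) = pts P"
  shows "z \<in> pts (prodm N P) \<longleftrightarrow> (\<exists>D \<psi>. (D, \<psi>) \<in> charts (prodm N P) \<and> z \<in> D)"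
proof -
  obtain a b where z: "z = (a, b)" by (cases z)
  show ?thesis
  proof
    assume "z \<in> pts (prodm N P)"
    then obtain D \<psi> C \<eta> where "(D, \<psi>) \<in> charts N" "a \<in> D" "(C, \<eta>) \<in> charts P" "b \<in> C"
      using charts_cover[OF assms(1), of a] charts_cover[OF assms(2), of b] by (auto simp: z pts_prodm)
    then show "\<exists>D \<psi>. (D, \<psi>) \<in> charts (prodm N P) \<and> z \<in> D" unfolding z using charts_prodmI by blast
  next
    assume "\<exists>D \<psi>. (D, \<psi>) \<in> charts (prodm N P) \<and> z \<in> D"
    then obtain W \<Psi> where W: "(W, \<Psi>) \<in> charts (prodm N P)" "z \<in> W" by blast
    from W(1) show "z \<in> pts (prodm N P)"
    proof (rule charts_prodmE)
      fix D \<psi> C \<eta> assume "W = D \<times> C" "(D, \<psi>) \<in> charts N" "(C, \<eta>) \<in> charts P"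
      then show ?thesis using W(2) charts_cover[OF assms(1), of a] charts_cover[OF assms(2), of b]
        by (auto simp: z pts_prodm)
    qed
  qed
qed

lemma atlas_prodm: "atlas N \<Longrightarrow> atlas P \<Longrightarrow> atlas (prodm N P)"
proof (rule atlasI)
  assume N: "atlas N" "atlas P"
  show "finite (idx (prodm N P))" using N by (simp add: idx_prodm atlas_finite)
  show "z \<in> pts (prodm N P) \<longleftrightarrow> (\<exists>D \<psi>. (D, \<psi>) \<in> charts (prodm N P) \<and> z \<in> D)" for z
    by (rule cover_prodm) (use N in \<open>auto simp: atlas_def\<close>)
  show "compatible (prodm N P) (D, \<psi>)" if "(D, \<psi>) \<in> charts (prodm N P)" for D \<psi>
    using that by (rule charts_prodmE)
      (simp add: compatible_prodm N atlas_compatible[OF N(1)] atlas_compatible[OF N(2)])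
qed

lemma tameI:
  assumes "finite (idx N)" "\<And>z. z \<in> pts N \<longleftrightarrow> (\<exists>D \<psi>. (D, \<psi>) \<in> charts N \<and> z \<in> D)"
    "\<And>D \<psi> z. (D, \<psi>) \<in> charts N \<Longrightarrow> z \<in> D \<Longrightarrow> \<psi> z \<in> Euc (idx N)"
  shows "tame N"
proof -
  have "\<Union>(fst ` charts N) = pts N" by (rule set_eqI) (simp add: assms(2) Bex_def split_paired_Ex)
  then show ?thesis using assms by (auto simp: tame_def)
qed

lemma tame_prodm: "tame N \<Longrightarrow> tame P \<Longrightarrow> tame (prodm N P)"
proof (rule tameI)
  assume N: "tame N" "tame P"
  show "finite (idx (prodm N P))" using N by (simp add: idx_prodm tame_finite)
  show "z \<in> pts (prodm N P) \<longleftrightarrow> (\<exists>D \<psi>. (D, \<psi>) \<in> charts (prodm N P) \<and> z \<in> D)" for z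
    by (rule cover_prodm) (use N in \<open>auto simp: tame_def\<close>)
  show "\<psi> z \<in> Euc (idx (prodm N P))" if "(D, \<psi>) \<in> charts (prodm N P)" "z \<in> D" for D \<psi> z
    using that(1)
  proof (rule charts_prodmE)
    fix D' \<psi>' C \<eta> assume w: "D = D' \<times> C" "\<psi> = (\<lambda>(a, b). case_sum (\<psi>' a) (\<eta> b))"
      "(D', \<psi>') \<in> charts N" "(C, \<eta>) \<in> charts P"
    show ?thesis using that(2) tame_Euc[OF N(1) w(3)] tame_Euc[OF N(2) w(4)]
      by (auto simp: w idx_prodm Euc_sum case_sum_comp)
  qed
qed

lemma smooth_at_fst:
  assumes "atlas N" "atlas P" "a \<in> pts N" "b \<in> pts P"
  shows "smooth_at (prodm N P) N fst (a, b)"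
proof (rule smf_chartE[OF assms(1,3)], rule smf_chartE[OF assms(2,4)])
  fix D \<psi> C \<eta> assume D: "compatible N (D, \<psi>)" "a \<in> D" and C: "compatible P (C, \<eta>)" "b \<in> C"
  have DC: "compatible (prodm N P) (D \<times> C, \<lambda>(a, b). case_sum (\<psi> a) (\<eta> b))" by (rule compatible_prodm) fact+
  note at = atlas_prodm[OF assms(1,2)]
  show ?thesis
  proof (rule smooth_at_compatible[OF at assms(1) D(1)])
    have "(a, b) \<in> D \<times> C" using D C by simp
    show "eventually (\<lambda>z. fst z \<in> D) (nhdsin (mtop (prodm N P)) (a, b))"
      using eventually_dom[OF at DC \<open>(a, b) \<in> D \<times> C\<close>] by (auto elim: eventually_mono)
    show "smf (prodm N P) (\<lambda>z. \<psi> (fst z) j) (a, b)" for j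
      using smf_coord[OF at DC \<open>(a, b) \<in> D \<times> C\<close>, of "Inl j"] by (simp add: case_prod_beta)
  qed (use D assms in \<open>auto simp: pts_prodm\<close>)
qed

lemma smooth_at_snd:
  assumes "atlas N" "atlas P" "a \<in> pts N" "b \<in> pts P"
  shows "smooth_at (prodm N P) P snd (a, b)"
proof (rule smf_chartE[OF assms(1,3)], rule smf_chartE[OF assms(2,4)])
  fix D \<psi> C \<eta> assume D: "compatible N (D, \<psi>)" "a \<in> D" and C: "compatible P (C, \<eta>)" "b \<in> C"
  have DC: "compatible (prodm N P) (D \<times> C, \<lambda>(a, b). case_sum (\<psi> a) (\<eta> b))" by (rule compatible_prodm) fact+
  note at = atlas_prodm[OF assms(1,2)]
  show ?thesis
  proof (rule smooth_at_compatible[OF at assms(2) C(1)])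
    have "(a, b) \<in> D \<times> C" using D C by simp
    show "eventually (\<lambda>z. snd z \<in> C) (nhdsin (mtop (prodm N P)) (a, b))"
      using eventually_dom[OF at DC \<open>(a, b) \<in> D \<times> C\<close>] by (auto elim: eventually_mono)
    show "smf (prodm N P) (\<lambda>z. \<eta> (snd z) j) (a, b)" for j
      using smf_coord[OF at DC \<open>(a, b) \<in> D \<times> C\<close>, of "Inr j"] by (simp add: case_prod_beta)
  qed (use C assms in \<open>auto simp: pts_prodm\<close>)
qed

lemma smooth_at_pair:
  assumes K: "atlas K" and N: "tame N" "tame P" and f: "smooth_at K N f z" and g: "smooth_at K P g z"
  shows "smooth_at K (prodm N P) (\<lambda>z. (f z, g z)) z"
proof (rule smooth_atI[OF K tame_prodm[OF N]])
  fix W \<Psi> assume W: "(W, \<Psi>) \<in> charts (prodm N P)" "(f z, g z) \<in> W"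
  obtain D \<psi> C \<eta> where w: "W = D \<times> C" "\<Psi> = (\<lambda>(a, b). case_sum (\<psi> a) (\<eta> b))" "(D, \<psi>) \<in> charts N" "(C, \<eta>) \<in> charts P"
    using W(1) by (rule charts_prodmE)
  have fg: "f z \<in> D" "g z \<in> C" using W w by auto
  note d = smooth_atD[OF f K N(1) w(3) fg(1)] and c = smooth_atD[OF g K N(2) w(4) fg(2)]
  show "eventually (\<lambda>z. (f z, g z) \<in> W) (nhdsin (mtop K) z)"
    using d(1) c(1) by eventually_elim (simp add: w)
  show "smf K (\<lambda>z. \<Psi> (f z, g z) j) z" if "j \<in> idx (prodm N P)" for j
    using that d(2) c(2) by (cases j) (auto simp: idx_prodm w)
qed (use smooth_at_pts[OF f] smooth_at_pts[OF g] in \<open>auto simp: pts_prodm\<close>)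

lemma smooth_at_const: "atlas K \<Longrightarrow> tame N \<Longrightarrow> z \<in> pts K \<Longrightarrow> a \<in> pts N \<Longrightarrow> smooth_at K N (\<lambda>_. a) z"
  by (rule smooth_atI) (auto intro: smf_const)

text \<open>The topology of \<open>prodm\<close> is generated by product charts, so rectangular
  neighbourhoods have to be extracted: a box in a product chart is a product of boxes in the
  factors.\<close>

lemma eventually_prodm:
  assumes N: "atlas N" and P: "atlas P" and ab: "a \<in> pts N" "b \<in> pts P"
    and Q: "eventually Q (nhdsin (mtop (prodm N P)) (a, b))"
  shows "\<exists>Q1 Q2. eventually Q1 (nhdsin (mtop N) a) \<and> eventually Q2 (nhdsin (mtop P) b) \<and>
    (\<forall>a b. Q1 a \<longrightarrow> Q2 b \<longrightarrow> Q (a, b))"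
proof (rule smf_chartE[OF N ab(1)], rule smf_chartE[OF P ab(2)])
  fix D \<psi> C \<eta> assume D: "compatible N (D, \<psi>)" "a \<in> D" "inv_into D \<psi> (\<psi> a) = a" "\<psi> a \<in> Euc (idx N)"
    and C: "compatible P (C, \<eta>)" "b \<in> C" "inv_into C \<eta> (\<eta> b) = b" "\<eta> b \<in> Euc (idx P)"
  let ?\<Psi> = "\<lambda>(a, b). case_sum (\<psi> a) (\<eta> b)"
  have DC: "compatible (prodm N P) (D \<times> C, ?\<Psi>)" by (rule compatible_prodm) fact+
  have E: "?\<Psi> (a, b) \<in> Euc (idx N <+> idx P)" using D C by (simp add: Euc_sum case_sum_comp)
  have fin: "finite (idx N <+> idx P)" using N P by (simp add: atlas_finite)
  have "(a, b) \<in> D \<times> C" using D C by simp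
  from Q[unfolded eventually_mtop[OF atlas_prodm[OF N P] DC this]]
  obtain e where e: "e > 0" "\<And>y. y \<in> Euc (idx N <+> idx P) \<Longrightarrow> (\<forall>i\<in>idx N <+> idx P. \<bar>y i - ?\<Psi> (a, b) i\<bar> < e) \<Longrightarrow>
      Q (inv_into (D \<times> C) ?\<Psi> y)"
    unfolding idx_prodm eventually_near_box[OF fin E] by auto
  have 1: "eventually (\<lambda>z. \<forall>i\<in>idx N. \<bar>\<psi> z i - \<psi> a i\<bar> < e) (nhdsin (mtop N) a)"
    using smf_tendsto[OF N smf_coord[OF N D(1,2)]] e(1)
    by (auto simp: eventually_ball_finite_distrib atlas_finite[OF N] tendsto_iff dist_real_def)
  have 2: "eventually (\<lambda>z. \<forall>i\<in>idx P. \<bar>\<eta> z i - \<eta> b i\<bar> < e) (nhdsin (mtop P) b)"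
    using smf_tendsto[OF P smf_coord[OF P C(1,2)]] e(1)
    by (auto simp: eventually_ball_finite_distrib atlas_finite[OF P] tendsto_iff dist_real_def)
  have "Q (a', b')" if "a' \<in> D" "\<forall>i\<in>idx N. \<bar>\<psi> a' i - \<psi> a i\<bar> < e" "b' \<in> C" "\<forall>i\<in>idx P. \<bar>\<eta> b' i - \<eta> b i\<bar> < e" for a' b'
  proof -
    have "Q (inv_into (D \<times> C) ?\<Psi> (case_sum (\<psi> a') (\<eta> b')))"
      by (rule e(2)) (use that compatible_dom(4)[OF D(1)] compatible_dom(4)[OF C(1)] in
          \<open>auto simp: Euc_sum case_sum_comp\<close>)
    then show ?thesis using inv_into_prod that compatible_dom(2)[OF D(1)] compatible_dom(2)[OF C(1)] by metis
  qed
  then show ?thesis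
    using eventually_conj[OF eventually_dom[OF N D(1,2)] 1] eventually_conj[OF eventually_dom[OF P C(1,2)] 2]
    by blast
qed

section \<open>Submanifolds given by restricted charts\<close>

lemma charts_restr: "charts (restr N A) = {(D \<inter> A, \<psi>) | D \<psi>. (D, \<psi>) \<in> charts N}"
  and idx_restr: "idx (restr N A) = idx N" and pts_restr: "pts (restr N A) = pts N \<inter> A"
  by (simp_all add: restr_def)

lemma tame_restr:
  assumes N: "tame N" shows "tame (restr N A)"
proof (rule tameI)
  have *: "z \<in> pts N \<longleftrightarrow> (\<exists>D \<psi>. (D, \<psi>) \<in> charts N \<and> z \<in> D)" for z
    using N by (simp add: tame_def charts_cover)
  show "z \<in> pts (restr N A) \<longleftrightarrow> (\<exists>D \<psi>. (D, \<psi>) \<in> charts (restr N A) \<and> z \<in> D)" for z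
    unfolding charts_restr pts_restr Int_iff * by auto
qed (use N in \<open>auto simp: idx_restr charts_restr tame_finite tame_Euc\<close>)

text \<open>Chart domains of the submanifold are D \<inter> A. Since smoothness includes that nearby
  points go into the chart domain, it also makes the map stay in A near z.\<close>

lemma smooth_at_restr:
  assumes K: "atlas K" and P: "tame P"
  shows "smooth_at K (restr P A) f z \<longleftrightarrow> smooth_at K P f z \<and> eventually (\<lambda>z. f z \<in> A) (nhdsin (mtop K) z)"
    (is "?L \<longleftrightarrow> ?R")
proof
  assume f: ?L
  note z = smooth_at_pts[OF f]
  then obtain D \<psi> where D: "(D, \<psi>) \<in> charts P" "f z \<in> D" "f z \<in> A"
    using tame_chart[OF P, of "f z"] by (auto simp: pts_restr)
  have *: "eventually (\<lambda>z. f z \<in> D) (nhdsin (mtop K) z) \<and> eventually (\<lambda>z. f z \<in> A) (nhdsin (mtop K) z) \<and> (\<forall>j\<in>idx P. smf K (\<lambda>z. \<psi> (f z) j) z)"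
    if "(D, \<psi>) \<in> charts P" "f z \<in> D" for D \<psi>
    using smooth_atD[OF f K tame_restr[OF P], of "D \<inter> A" \<psi>] that D(3) by (auto simp: charts_restr idx_restr eventually_conj_iff)
  have "eventually (\<lambda>z. f z \<in> A) (nhdsin (mtop K) z)"
    using *[OF D(1,2)] by simp
  moreover have "smooth_at K P f z"
    by (rule smooth_atI[OF K P]) (use z * in \<open>auto simp: pts_restr\<close>)
  ultimately show ?R by simp
next
  assume R: ?R
  then have z: "z \<in> pts K" "f z \<in> pts P" using smooth_at_pts[of K P f z] by simp_all
  have fz: "f z \<in> A" using eventually_mtop_self[OF K z(1)] R by blast
  show ?L
  proof (rule smooth_atI[OF K tame_restr[OF P]])
    fix D \<psi> assume D: "(D, \<psi>) \<in> charts (restr P A)" "f z \<in> D"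
    then obtain D' where D': "D = D' \<inter> A" "(D', \<psi>) \<in> charts P" "f z \<in> D'" by (auto simp: charts_restr)
    note d = smooth_atD[OF conjunct1[OF R] K P D'(2,3)]
    show "eventually (\<lambda>z. f z \<in> D) (nhdsin (mtop K) z)"
      using d(1) conjunct2[OF R] by eventually_elim (simp add: D')
    show "smf K (\<lambda>z. \<psi> (f z) j) z" if "j \<in> idx (restr P A)" for j using d(2) that by (simp add: idx_restr)
  qed (use z fz in \<open>auto simp: pts_restr\<close>)
qed

lemma csm_mono:
  assumes "csm N P D \<psi> C \<eta> f z" "idx N' = idx N" "idx P' = idx P" "D' \<subseteq> D" "z \<in> D'"
    "\<And>w. w \<in> D' \<Longrightarrow> f w \<in> C \<Longrightarrow> f w \<in> C'"
  shows "csm N' P' D' \<psi> C' \<eta> f z"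
proof -
  obtain G where G: "\<forall>j\<in>idx P. sm (idx N) (\<lambda>x. G x j) (\<psi> z)"
    "\<forall>\<^sub>F x in near (idx N) (\<psi> z). \<forall>z'\<in>D. \<psi> z' = x \<longrightarrow> f z' \<in> C \<and> (\<forall>j\<in>idx P. \<eta> (f z') j = G x j)"
    using assms(1) by (auto simp: csm_def)
  have "\<forall>\<^sub>F x in near (idx N) (\<psi> z). \<forall>z'\<in>D'. \<psi> z' = x \<longrightarrow> f z' \<in> C' \<and> (\<forall>j\<in>idx P. \<eta> (f z') j = G x j)"
    using G(2) by eventually_elim (use assms(4,6) in auto)
  then show ?thesis using assms G(1) unfolding csm_def by auto
qed

text \<open>The extension G of the coordinate expression still works when it has to match f on fewer
  points.\<close>

lemma wsmooth_restr:
  assumes "wsmooth N P f z" "z \<in> A"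
  shows "wsmooth (restr N A) P f z"
  unfolding wsmooth_def
proof (intro conjI allI impI)
  fix C \<eta> assume C: "(C, \<eta>) \<in> charts P" "f z \<in> C"
  from wsmoothD[OF assms(1) this] obtain D \<psi> where D: "(D, \<psi>) \<in> charts N" "csm N P D \<psi> C \<eta> f z" by blast
  have "csm (restr N A) P (D \<inter> A) \<psi> C \<eta> f z"
    by (rule csm_mono[OF D(2)]) (use D(2) assms(2) in \<open>auto simp: csm_def idx_restr\<close>)
  then show "\<exists>D \<psi>. (D, \<psi>) \<in> charts (restr N A) \<and> csm (restr N A) P D \<psi> C \<eta> f z"
    using D(1) by (auto simp: charts_restr)
qed (use wsmooth_pts[OF assms(1)] assms(2) in \<open>auto simp: pts_restr\<close>)

section \<open>Contact of maps\<close>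

definition agf :: "('a, 'i) mfd \<Rightarrow> nat \<Rightarrow> ('a \<Rightarrow> real) \<Rightarrow> ('a \<Rightarrow> real) \<Rightarrow> 'a \<Rightarrow> bool" where
  "agf E k f g y \<longleftrightarrow> (\<forall>D \<phi>. (D, \<phi>) \<in> charts E \<longrightarrow> y \<in> D \<longrightarrow>
     agr (idx E) k (\<lambda>x. f (inv_into D \<phi> x)) (\<lambda>x. g (inv_into D \<phi> x)) (\<phi> y))"

text \<open>Contact survives the passage to another chart because composing with the transition map
  preserves it (\<open>agr_comp\<close>).\<close>

lemma agf_iff:
  assumes E: "atlas E" and D: "(D, \<phi>) \<in> charts E" "y \<in> D" and f: "smf E f y" "smf E g y"
  shows "agf E k f g y \<longleftrightarrow> agr (idx E) k (\<lambda>x. f (inv_into D \<phi> x)) (\<lambda>x. g (inv_into D \<phi> x)) (\<phi> y)"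
proof
  assume a: "agr (idx E) k (\<lambda>x. f (inv_into D \<phi> x)) (\<lambda>x. g (inv_into D \<phi> x)) (\<phi> y)"
  have cD: "compatible E (D, \<phi>)" using E D(1) by (rule atlas_compatible)
  have "agr (idx E) k (\<lambda>x. f (inv_into C \<eta> x)) (\<lambda>x. g (inv_into C \<eta> x)) (\<eta> y)"
    if C: "(C, \<eta>) \<in> charts E" "y \<in> C" for C \<eta>
  proof -
    have cC: "compatible E (C, \<eta>)" using E C(1) by (rule atlas_compatible)
    note t = compatible_sm[OF cC D(1) C(2) D(2)]
    have i: "inv_into C \<eta> (\<eta> y) = y" "inv_into D \<phi> (\<phi> y) = y" "\<eta> y \<in> Euc (idx E)"
      using compatible_dom(2,4)[OF cC] compatible_dom(2)[OF cD] C D by auto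
    have ev: "eventually (\<lambda>x. \<phi> (inv_into C \<eta> x) \<in> Euc (idx E)) (near (idx E) (\<eta> y))"
      using t(3) by eventually_elim (use compatible_dom(4)[OF cD] in auto)
    have "agr (idx E) k (\<lambda>x. f (inv_into D \<phi> (\<phi> (inv_into C \<eta> x)))) (\<lambda>x. g (inv_into D \<phi> (\<phi> (inv_into C \<eta> x)))) (\<eta> y)"
      by (rule agr_comp[OF atlas_finite[OF E], where F = "\<lambda>x. f (inv_into D \<phi> x)" and H = "\<lambda>x. \<phi> (inv_into C \<eta> x)"])
        (use f[unfolded smf_iff[OF E cD D(2)]] t ev a i in \<open>auto simp: agr_def\<close>)
    then show ?thesis
      by (rule agr_cong[THEN iffD1, rotated 3])
        (use t(3) compatible_dom(2)[OF cD] i in \<open>auto elim: eventually_mono\<close>)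
  qed
  then show "agf E k f g y" by (auto simp: agf_def)
qed (use D in \<open>auto simp: agf_def\<close>)

lemma agf_cong:
  assumes E: "atlas E" and y: "y \<in> pts E" and ev: "eventually (\<lambda>z. f z = f' z) (nhdsin (mtop E) y)"
    "eventually (\<lambda>z. g z = g' z) (nhdsin (mtop E) y)"
  shows "agf E k f g y \<longleftrightarrow> agf E k f' g' y"
proof -
  have "agr (idx E) k (\<lambda>x. f (inv_into D \<phi> x)) (\<lambda>x. g (inv_into D \<phi> x)) (\<phi> y) \<longleftrightarrow>
    agr (idx E) k (\<lambda>x. f' (inv_into D \<phi> x)) (\<lambda>x. g' (inv_into D \<phi> x)) (\<phi> y)"
    if "(D, \<phi>) \<in> charts E" "y \<in> D" for D \<phi>
  proof -
    have D: "compatible E (D, \<phi>)" using E that(1) by (rule atlas_compatible)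
    show ?thesis
      by (rule agr_cong) (use ev compatible_dom(4)[OF D] that in \<open>auto simp: eventually_mtop[OF E D that(2)]\<close>)
  qed
  then show ?thesis by (simp add: agf_def)
qed

lemma agf_sym: "agf E k f g y \<Longrightarrow> agf E k g f y"
  by (simp add: agf_def agr_def)

lemma agf_trans: "agf E k f g y \<Longrightarrow> agf E k g h y \<Longrightarrow> agf E k f h y"
  by (simp add: agf_def agr_def)

lemma agf_le: "agf E k f g y \<Longrightarrow> m \<le> k \<Longrightarrow> agf E m f g y"
  unfolding agf_def using agr_le by blast

lemma agf_refl: "agf E k f f y"
  by (simp add: agf_def agr_def)

lemma agf_comp:
  assumes E: "atlas E" and J: "finite J" and F: "sm J F (H y)"
    and H: "\<And>j. j \<in> J \<Longrightarrow> smf E (\<lambda>z. H z j) y" "\<And>j. j \<in> J \<Longrightarrow> smf E (\<lambda>z. H' z j) y"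
    and ev: "eventually (\<lambda>z. H z \<in> Euc J) (nhdsin (mtop E) y)" "eventually (\<lambda>z. H' z \<in> Euc J) (nhdsin (mtop E) y)"
    and y: "y \<in> pts E" and a: "\<And>j. j \<in> J \<Longrightarrow> agf E k (\<lambda>z. H z j) (\<lambda>z. H' z j) y"
  shows "agf E k (\<lambda>z. F (H z)) (\<lambda>z. F (H' z)) y"
  unfolding agf_def
proof (intro allI impI)
  fix D \<phi> assume D: "(D, \<phi>) \<in> charts E" "y \<in> D"
  have cD: "compatible E (D, \<phi>)" using E D(1) by (rule atlas_compatible)
  have i: "inv_into D \<phi> (\<phi> y) = y" "\<phi> y \<in> Euc (idx E)"
    using compatible_dom(2,4)[OF cD] D by auto
  show "agr (idx E) k (\<lambda>x. F (H (inv_into D \<phi> x))) (\<lambda>x. F (H' (inv_into D \<phi> x))) (\<phi> y)"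
  proof (rule agr_comp[OF J, where H = "\<lambda>x. H (inv_into D \<phi> x)" and F = F and F' = F])
    show "agr J k F F (H (inv_into D \<phi> (\<phi> y)))" by (simp add: agr_def)
  qed (use F H a ev i D in \<open>auto simp: smf_iff[OF E cD D(2)] eventually_mtop[OF E cD D(2)] agf_def\<close>)
qed

text \<open>Contact of u and u' is pushed forward through the smooth extension G of F, which exists
  even where the chart image is thin. No transition map of N is involved, so N may be a jet bundle
  or a vertical bundle.\<close>

lemma csm_agf:
  assumes E: "atlas E" and N: "tame N" "(D, \<psi>) \<in> charts N" and F: "csm N P D \<psi> C \<eta> F (u y)"
    and u: "eventually (\<lambda>z. u z \<in> D) (nhdsin (mtop E) y)" "eventually (\<lambda>z. u' z \<in> D) (nhdsin (mtop E) y)"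
      "\<And>i. i \<in> idx N \<Longrightarrow> smf E (\<lambda>z. \<psi> (u z) i) y" "\<And>i. i \<in> idx N \<Longrightarrow> smf E (\<lambda>z. \<psi> (u' z) i) y"
    and a: "\<And>i. i \<in> idx N \<Longrightarrow> agf E k (\<lambda>z. \<psi> (u z) i) (\<lambda>z. \<psi> (u' z) i) y"
    and y: "y \<in> pts E" "u' y = u y" and j: "j \<in> idx P"
  shows "agf E k (\<lambda>z. \<eta> (F (u z)) j) (\<lambda>z. \<eta> (F (u' z)) j) y"
proof -
  obtain G where G: "sm (idx N) (\<lambda>x. G x j) (\<psi> (u y))"
      "\<forall>\<^sub>F x in near (idx N) (\<psi> (u y)). \<forall>z'\<in>D. \<psi> z' = x \<longrightarrow> F z' \<in> C \<and> (\<forall>j\<in>idx P. \<eta> (F z') j = G x j)"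
    using F j by (auto simp: csm_def)
  have E': "eventually (\<lambda>z. \<psi> (u z) \<in> Euc (idx N)) (nhdsin (mtop E) y)"
    "eventually (\<lambda>z. \<psi> (u' z) \<in> Euc (idx N)) (nhdsin (mtop E) y)"
    by (rule eventually_mono[OF u(1)], rule tame_Euc[OF N], assumption,
        rule eventually_mono[OF u(2)], rule tame_Euc[OF N], assumption)
  have ev: "eventually (\<lambda>z. \<eta> (F (v z)) j = G (\<psi> (v z)) j) (nhdsin (mtop E) y)"
    if "\<And>i. i \<in> idx N \<Longrightarrow> smf E (\<lambda>z. \<psi> (v z) i) y" "eventually (\<lambda>z. \<psi> (v z) \<in> Euc (idx N)) (nhdsin (mtop E) y)"
      "v y = u y" "eventually (\<lambda>z. v z \<in> D) (nhdsin (mtop E) y)" for v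
  proof -
    have "filterlim (\<lambda>z. \<psi> (v z)) (near (idx N) (\<psi> (v y))) (nhdsin (mtop E) y)"
      by (rule filterlim_smf[OF E]) (use that y in auto)
    from eventually_compose_filterlim[OF _ this, unfolded that(3), OF G(2)] that(4)
    show ?thesis by eventually_elim (use j in auto)
  qed
  have "agf E k (\<lambda>z. G (\<psi> (u z)) j) (\<lambda>z. G (\<psi> (u' z)) j) y"
    by (rule agf_comp[OF E tame_finite[OF N(1)], where H = "\<lambda>z. \<psi> (u z)" and F = "\<lambda>x. G x j"]) (use G u a E' y in auto)
  then show ?thesis
    using agf_cong[OF E y(1) ev[OF u(3) E'(1) refl u(1)] ev[OF u(4) E'(2) y(2) u(2)]] by blast
qed

section \<open>Contact of maps and jets\<close>

definition jeq :: "nat \<Rightarrow> ('e, 'i) mfd \<Rightarrow> ('p, 'j) mfd \<Rightarrow> 'e \<Rightarrow> ('e \<Rightarrow> 'p) \<Rightarrow> ('e \<Rightarrow> 'p) \<Rightarrow> bool" where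
  "jeq k E P y u v \<longleftrightarrow> v y = u y \<and> (\<forall>C \<eta> j. (C, \<eta>) \<in> charts P \<longrightarrow> u y \<in> C \<longrightarrow> j \<in> idx P \<longrightarrow>
     agf E k (\<lambda>y. \<eta> (u y) j) (\<lambda>y. \<eta> (v y) j) y)"

text \<open>Separates the equivalence relation behind a jet from the requirement that its members be
  smooth, so that equalities of jets become statements of contact.\<close>

lemma jet_def_jeq: "jet k E P y u = (y, {v. smooth_at E P v y \<and> jeq k E P y u v})"
proof -
  have "(\<forall>(D, \<phi>)\<in>charts E. \<forall>(C, \<eta>)\<in>charts P. y \<in> D \<longrightarrow> u y \<in> C \<longrightarrow>
        (\<forall>\<alpha>\<in>lists (idx E). length \<alpha> \<le> k \<longrightarrow> (\<forall>j\<in>idx P.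
           pds \<alpha> (\<lambda>x. \<eta> (v (inv_into D \<phi> x)) j) (\<phi> y) =
           pds \<alpha> (\<lambda>x. \<eta> (u (inv_into D \<phi> x)) j) (\<phi> y)))) \<longleftrightarrow>
    (\<forall>C \<eta> j. (C, \<eta>) \<in> charts P \<longrightarrow> u y \<in> C \<longrightarrow> j \<in> idx P \<longrightarrow>
     agf E k (\<lambda>y. \<eta> (u y) j) (\<lambda>y. \<eta> (v y) j) y)" (is "?L \<longleftrightarrow> ?R") for v
  proof
    assume L: ?L
    show ?R unfolding agf_def agr_def
    proof (intro allI impI ballI, rule sym)
      fix C \<eta> j D \<phi> \<alpha> assume a: "(C, \<eta>) \<in> charts P" "u y \<in> C" "j \<in> idx P" "(D, \<phi>) \<in> charts E" "y \<in> D"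
        "\<alpha> \<in> lists (idx E)" "length \<alpha> \<le> k"
      have "\<forall>(C, \<eta>)\<in>charts P. y \<in> D \<longrightarrow> u y \<in> C \<longrightarrow>
        (\<forall>\<alpha>\<in>lists (idx E). length \<alpha> \<le> k \<longrightarrow> (\<forall>j\<in>idx P.
           pds \<alpha> (\<lambda>x. \<eta> (v (inv_into D \<phi> x)) j) (\<phi> y) =
           pds \<alpha> (\<lambda>x. \<eta> (u (inv_into D \<phi> x)) j) (\<phi> y)))" using bspec[OF L a(4)] by (simp only: prod.case)
      from bspec[OF this a(1)] show "pds \<alpha> (\<lambda>x. \<eta> (v (inv_into D \<phi> x)) j) (\<phi> y) =
           pds \<alpha> (\<lambda>x. \<eta> (u (inv_into D \<phi> x)) j) (\<phi> y)" using a by (simp only: prod.case)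
    qed
  next
    assume R: ?R
    show ?L
      unfolding Ball_def[of "charts E"] Ball_def[of "charts P"] split_paired_All prod.case
    proof (intro allI impI ballI)
      fix D \<phi> C \<eta> \<alpha> j assume a: "(D, \<phi>) \<in> charts E" "(C, \<eta>) \<in> charts P" "y \<in> D" "u y \<in> C"
        "\<alpha> \<in> lists (idx E)" "length \<alpha> \<le> k" "j \<in> idx P"
      then have "agf E k (\<lambda>y. \<eta> (u y) j) (\<lambda>y. \<eta> (v y) j) y" using R by blast
      then have "pds \<alpha> (\<lambda>x. \<eta> (u (inv_into D \<phi> x)) j) (\<phi> y) =
           pds \<alpha> (\<lambda>x. \<eta> (v (inv_into D \<phi> x)) j) (\<phi> y)" using a(1,3,5,6) unfolding agf_def agr_def by blast
      then show "pds \<alpha> (\<lambda>x. \<eta> (v (inv_into D \<phi> x)) j) (\<phi> y) =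
           pds \<alpha> (\<lambda>x. \<eta> (u (inv_into D \<phi> x)) j) (\<phi> y)" by (rule sym)
    qed
  qed
  then show ?thesis unfolding jet_def jeq_def by simp
qed

lemma jeq_sym: "jeq k E P y u v \<Longrightarrow> jeq k E P y v u"
  by (auto simp: jeq_def intro: agf_sym)

lemma jeq_trans: "jeq k E P y u v \<Longrightarrow> jeq k E P y v w \<Longrightarrow> jeq k E P y u w"
  unfolding jeq_def using agf_trans by metis

lemma jeq_refl: "jeq k E P y u u"
  by (auto simp: jeq_def intro: agf_refl)

lemma jeq_le: "jeq k E P y u v \<Longrightarrow> m \<le> k \<Longrightarrow> jeq m E P y u v"
  by (auto simp: jeq_def intro: agf_le)

lemma jet_eqI: "jeq k E P y u v \<Longrightarrow> jet k E P y u = jet k E P y v"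
proof -
  assume uv: "jeq k E P y u v"
  have "jeq k E P y u w \<longleftrightarrow> jeq k E P y v w" for w
    using jeq_trans[OF uv] jeq_trans[OF jeq_sym[OF uv]] by blast
  then show ?thesis by (simp add: jet_def_jeq)
qed

text \<open>Smoothness of u puts u into its own jet. Without it both classes could be empty, and
  hence equal, with no contact between u and v.\<close>

lemma jet_eqD:
  assumes "jet k E P y u = jet k E P y' v" "smooth_at E P u y" shows "y' = y" "jeq k E P y u v"
proof -
  show y: "y' = y" using assms(1) by (simp add: jet_def_jeq)
  have "u \<in> snd (jet k E P y u)" using assms(2) by (simp add: jet_def_jeq jeq_refl)
  then have "u \<in> snd (jet k E P y v)" using assms(1) y by simp
  then have "jeq k E P y v u" by (simp add: jet_def_jeq)
  then show "jeq k E P y u v" by (rule jeq_sym)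
qed

text \<open>The weak smoothness of F is enough: contact of u and u' is known in every chart of N, in
  particular in the one in which F has a smooth expression.\<close>

lemma jeq_comp:
  assumes E: "atlas E" and N: "tame N" and u: "smooth_at E N u y" "smooth_at E N u' y"
    and a: "jeq k E N y u u'" and F: "wsmooth N P F (u y)"
  shows "jeq k E P y (\<lambda>z. F (u z)) (\<lambda>z. F (u' z))"
  unfolding jeq_def
proof (intro conjI allI impI)
  have y: "u' y = u y" using a by (simp add: jeq_def)
  then show "F (u' y) = F (u y)" by simp
  fix C \<eta> j assume C: "(C, \<eta>) \<in> charts P" "F (u y) \<in> C" "j \<in> idx P"
  obtain D \<psi> where D: "(D, \<psi>) \<in> charts N" "csm N P D \<psi> C \<eta> F (u y)" using wsmoothD[OF F C(1,2)] by blast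
  have uD: "u y \<in> D" "u' y \<in> D" using D(2) y by (auto simp: csm_def)
  show "agf E k (\<lambda>z. \<eta> (F (u z)) j) (\<lambda>z. \<eta> (F (u' z)) j) y"
    by (rule csm_agf[where u = u and u' = u', OF E N D])
      (use smooth_atD[OF u(1) E N D(1) uD(1)] smooth_atD[OF u(2) E N D(1) uD(2)] a smooth_at_pts[OF u(1)] y C uD D
        in \<open>auto simp: jeq_def\<close>)
qed

lemma agf_realline:
  "agf realline 1 f g t \<longleftrightarrow> f t = g t \<and> deriv f t = deriv g t"
  by (simp add: agf_def charts_realline inv_realline agr_Suc agr_0 pd_def)

section \<open>Tangent, vertical and jet bundles\<close>

lemma jeq_vel: "jeq 1 realline N 0 c c' \<longleftrightarrow> c' 0 = c 0 \<and>
    (\<forall>D \<psi> i. (D, \<psi>) \<in> charts N \<longrightarrow> c 0 \<in> D \<longrightarrow> i \<in> idx N \<longrightarrow> vel \<psi> c' i = vel \<psi> c i)"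
  unfolding jeq_def agf_realline vel_def by (rule conj_cong[OF refl]) metis

text \<open>A tangent vector is the 1-jet at 0 of a curve, so all results on contact apply to
  velocities.\<close>

lemma tvec_jeq: "tvec N c = {c'. curve N c' \<and> jeq 1 realline N 0 c c'}"
  unfolding tvec_def jeq_vel by (auto simp: Ball_def split_paired_All)

lemma tvec_eqI: "jeq 1 realline N 0 c c' \<Longrightarrow> tvec N c = tvec N c'"
proof -
  assume c: "jeq 1 realline N 0 c c'"
  have "jeq 1 realline N 0 c w \<longleftrightarrow> jeq 1 realline N 0 c' w" for w
    using jeq_trans[OF c] jeq_trans[OF jeq_sym[OF c]] by blast
  then show ?thesis by (simp add: tvec_jeq)
qed

lemma curve_in_tvec: "curve N c \<Longrightarrow> c \<in> tvec N c"
  by (simp add: tvec_jeq jeq_refl)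

lemma tvec_eqD: "tvec N c = tvec N c' \<Longrightarrow> curve N c \<Longrightarrow> jeq 1 realline N 0 c c'"
  using curve_in_tvec[of N c] jeq_sym by (auto simp: tvec_jeq)

lemma tvec_some:
  assumes "curve N c"
  shows "curve N (SOME c'. c' \<in> tvec N c)" "jeq 1 realline N 0 c (SOME c'. c' \<in> tvec N c)"
  using someI[of "\<lambda>c'. c' \<in> tvec N c", OF curve_in_tvec[OF assms]] by (simp_all add: tvec_jeq)

lemma foot_tvec: "curve N c \<Longrightarrow> foot (tvec N c) = c 0"
  using tvec_some(2)[of N c] by (simp add: foot_def jeq_def)

lemma curve_pts: "curve N c \<Longrightarrow> c 0 \<in> pts N"
  by (simp add: curve_def smooth_at_pts)

lemma curveD:
  assumes "curve N c" "tame N" "(D, \<psi>) \<in> charts N" "c 0 \<in> D"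
  shows "eventually (\<lambda>t. c t \<in> D) (nhds 0)" "\<And>i. i \<in> idx N \<Longrightarrow> smf realline (\<lambda>t. \<psi> (c t) i) 0"
  using smooth_atD[OF assms(1)[unfolded curve_def] atlas_realline assms(2-4)] by (auto simp: eventually_realline)

lemma vel_outside:
  assumes "curve N c" "tame N" "(D, \<psi>) \<in> charts N" "c 0 \<in> D" "i \<notin> idx N"
  shows "vel \<psi> c i = 0"
proof -
  have "eventually (\<lambda>t. \<psi> (c t) i = 0) (nhds 0)"
    using curveD(1)[OF assms(1-4)] by eventually_elim (rule EucD[OF tame_Euc[OF assms(2,3)] assms(5)])
  then have "deriv (\<lambda>t. \<psi> (c t) i) 0 = deriv (\<lambda>_. 0) 0" by (rule deriv_cong_ev) simp
  then show ?thesis by (simp add: vel_def)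
qed

lemma vcomp_tvec:
  assumes "curve N c" "tame N" "(D, \<psi>) \<in> charts N" "c 0 \<in> D"
  shows "vcomp \<psi> (tvec N c) = vel \<psi> c"
proof
  fix i
  note s = tvec_some[OF assms(1)]
  show "vcomp \<psi> (tvec N c) i = vel \<psi> c i"
  proof (cases "i \<in> idx N")
    case True
    then show ?thesis using s(2)[unfolded jeq_vel] assms(3,4) unfolding vcomp_def by blast
  next
    case False
    have "(SOME c'. c' \<in> tvec N c) 0 \<in> D" using s(2) assms(4) by (simp add: jeq_def)
    then show ?thesis
      using vel_outside[OF assms False] vel_outside[OF s(1) assms(2,3) _ False] by (simp add: vcomp_def)
  qed
qed

lemma charts_TM: "charts (TM N) = {({tvec N c | c. curve N c \<and> c 0 \<in> D},
     \<lambda>v. case_sum (\<psi> (foot v)) (vcomp \<psi> v)) | D \<psi>. (D, \<psi>) \<in> charts N}"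
  and idx_TM: "idx (TM N) = idx N <+> idx N" and pts_TM: "pts (TM N) = {tvec N c | c. curve N c}"
  by (simp_all add: TM_def)

lemma tame_TM:
  assumes N: "tame N" shows "tame (TM N)"
proof (rule tameI)
  show "finite (idx (TM N))" using N by (simp add: idx_TM tame_finite)
  show "v \<in> pts (TM N) \<longleftrightarrow> (\<exists>D \<psi>. (D, \<psi>) \<in> charts (TM N) \<and> v \<in> D)" for v
  proof
    assume "v \<in> pts (TM N)"
    then obtain c where c: "curve N c" "v = tvec N c" by (auto simp: pts_TM)
    obtain D \<psi> where D: "(D, \<psi>) \<in> charts N" "c 0 \<in> D" using tame_chart[OF N curve_pts[OF c(1)]] by blast
    then show "\<exists>D \<psi>. (D, \<psi>) \<in> charts (TM N) \<and> v \<in> D" unfolding charts_TM using c by blast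
  qed (auto simp: charts_TM pts_TM)
  show "\<psi> v \<in> Euc (idx (TM N))" if V: "(D, \<psi>) \<in> charts (TM N)" "v \<in> D" for D \<psi> v
  proof -
    obtain D' \<psi>' where D: "D = {tvec N c | c. curve N c \<and> c 0 \<in> D'}" "(D', \<psi>') \<in> charts N"
      "\<psi> = (\<lambda>v. case_sum (\<psi>' (foot v)) (vcomp \<psi>' v))" using V(1) by (auto simp: charts_TM)
    then obtain c where c: "v = tvec N c" "curve N c" "c 0 \<in> D'" using V(2) by blast
    have "vel \<psi>' c \<in> Euc (idx N)" by (rule EucI) (rule vel_outside[OF c(2) N D(2) c(3)])
    then show ?thesis using tame_Euc[OF N D(2) c(3)]
      by (simp add: D(3) c(1) foot_tvec[OF c(2)] vcomp_tvec[OF c(2) N D(2) c(3)] Euc_sum idx_TM case_sum_comp)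
  qed
qed

lemma wsmooth_foot:
  assumes N: "tame N" and v: "v \<in> pts (TM N)" shows "wsmooth (TM N) N foot v"
proof -
  obtain c where c: "v = tvec N c" "curve N c" using v by (auto simp: pts_TM)
  show ?thesis unfolding wsmooth_def
  proof (intro conjI allI impI)
    show "foot v \<in> pts N" using c by (simp add: foot_tvec curve_pts)
    fix C \<eta> assume C: "(C, \<eta>) \<in> charts N" "foot v \<in> C"
    define W where "W = {tvec N c | c. curve N c \<and> c 0 \<in> C}"
    define \<Psi> where "\<Psi> = (\<lambda>v. case_sum (\<eta> (foot v)) (vcomp \<eta> v))"
    have W: "(W, \<Psi>) \<in> charts (TM N)" using C(1) unfolding charts_TM W_def \<Psi>_def by blast
    have "v \<in> W" using c C(2) unfolding W_def by (auto simp: foot_tvec)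
    have E: "\<Psi> v \<in> Euc (idx (TM N))" using tame_Euc[OF tame_TM[OF N] W \<open>v \<in> W\<close>] .
    have "csm (TM N) N W \<Psi> C \<eta> foot v"
      unfolding csm_def
    proof (intro conjI exI[of _ "\<lambda>x i. x (Inl i)"])
      show "\<forall>\<^sub>F x in near (idx (TM N)) (\<Psi> v). \<forall>z'\<in>W. \<Psi> z' = x \<longrightarrow> foot z' \<in> C \<and> (\<forall>j\<in>idx N. \<eta> (foot z') j = x (Inl j))"
        by (rule always_eventually) (auto simp: W_def \<Psi>_def foot_tvec)
      show "\<forall>j\<in>idx N. sm (idx (TM N)) (\<lambda>x. x (Inl j)) (\<Psi> v)" using sm_coord[OF E] by blast
    qed (use C E \<open>v \<in> W\<close> in auto)
    then show "\<exists>D \<psi>. (D, \<psi>) \<in> charts (TM N) \<and> csm (TM N) N D \<psi> C \<eta> foot v" using W by blast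
  qed (use v in auto)
qed

section \<open>Fibered manifolds and vertical bundles\<close>

definition fib :: "('p, 'j, 'e) fibm \<Rightarrow> bool" where
  "fib Y \<longleftrightarrow> atlas (bas Y) \<and> tame (tot Y) \<and> (\<forall>z\<in>pts (tot Y). wsmooth (tot Y) (bas Y) (prj Y) z)"

lemma fibD: "fib Y \<Longrightarrow> atlas (bas Y)" "fib Y \<Longrightarrow> tame (tot Y)" "fib Y \<Longrightarrow> tame (bas Y)"
  "fib Y \<Longrightarrow> z \<in> pts (tot Y) \<Longrightarrow> wsmooth (tot Y) (bas Y) (prj Y) z"
  by (auto simp: fib_def atlas_tame)

text \<open>\<open>fib\<close> is the weakening that passes from Y to \<open>Jet k Y\<close> and
  \<open>Vert Y\<close>, hence to their iterations. The submersion charts of a fibered manifold are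
  required only where families of sections are constructed.\<close>

lemma fibered_manifold_fib: "fibered_manifold Y \<Longrightarrow> fib Y"
  by (auto simp: fib_def fibered_manifold_def surj_submersion_def smooth_map_def manifold_atlas atlas_tame
      intro!: smooth_at_wsmooth)

text \<open>Verticality constrains the velocity at 0 only: the projected curve is stationary to
  first order but may move.\<close>

definition vcurve :: "('p, 'j, 'e) fibm \<Rightarrow> (real \<Rightarrow> 'p) \<Rightarrow> bool" where
  "vcurve Y c \<longleftrightarrow> curve (tot Y) c \<and> jeq 1 realline (bas Y) 0 (\<lambda>t. prj Y (c t)) (\<lambda>_. prj Y (c 0))"

lemma vcurve_curve: "vcurve Y c \<Longrightarrow> curve (tot Y) c"
  by (simp add: vcurve_def)

text \<open>\<open>Tmap\<close> uses a chosen representative c' of the tangent vector; contact of c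
  and c' passes to their projections, so c itself may be tested.\<close>

lemma vert_iff:
  assumes Y: "fib Y" and c: "curve (tot Y) c"
  shows "Tmap (bas Y) (prj Y) (tvec (tot Y) c) = tvec (bas Y) (\<lambda>_. prj Y (foot (tvec (tot Y) c))) \<longleftrightarrow> vcurve Y c"
proof -
  define c' where "c' = (SOME c'. c' \<in> tvec (tot Y) c)"
  have c': "curve (tot Y) c'" "jeq 1 realline (tot Y) 0 c c'" using tvec_some[OF c] by (simp_all add: c'_def)
  have w: "wsmooth (tot Y) (bas Y) (prj Y) (c 0)" using fibD(4)[OF Y curve_pts[OF c]] .
  have j: "jeq 1 realline (bas Y) 0 (\<lambda>t. prj Y (c t)) (\<lambda>t. prj Y (c' t))"
    by (rule jeq_comp[OF atlas_realline fibD(2)[OF Y] _ _ c'(2) w]) (use c c' in \<open>auto simp: curve_def\<close>)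
  have k: "curve (bas Y) (\<lambda>_. prj Y (c 0))"
    unfolding curve_def by (rule smooth_at_const[OF atlas_realline fibD(3)[OF Y]])
      (use wsmooth_pts[OF w] in \<open>auto simp: charts_realline\<close>)
  have "Tmap (bas Y) (prj Y) (tvec (tot Y) c) = tvec (bas Y) (\<lambda>t. prj Y (c' t))"
    by (simp add: Tmap_def c'_def comp_def)
  also have "\<dots> = tvec (bas Y) (\<lambda>t. prj Y (c t))" by (rule tvec_eqI[OF j, symmetric])
  finally have "?thesis \<longleftrightarrow> (tvec (bas Y) (\<lambda>_. prj Y (c 0)) = tvec (bas Y) (\<lambda>t. prj Y (c t)) \<longleftrightarrow> vcurve Y c)"
    using foot_tvec[OF c] by auto
  moreover have "tvec (bas Y) (\<lambda>_. prj Y (c 0)) = tvec (bas Y) (\<lambda>t. prj Y (c t)) \<longleftrightarrow> vcurve Y c"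
    using tvec_eqD[OF _ k, of "\<lambda>t. prj Y (c t)"] tvec_eqI[of "bas Y" "\<lambda>_. prj Y (c 0)" "\<lambda>t. prj Y (c t)"] c
      jeq_sym[of 1 realline "bas Y" 0]
    unfolding vcurve_def by blast
  ultimately show ?thesis by simp
qed

lemma bas_Vert [simp]: "bas (Vert Y) = bas Y" and prj_Vert: "prj (Vert Y) = prj Y \<circ> foot"
  and idx_Vert: "idx (tot (Vert Y)) = idx (tot Y) <+> idx (tot Y)"
  by (simp_all add: Vert_def idx_restr idx_TM)

lemma pts_Vert: "fib Y \<Longrightarrow> pts (tot (Vert Y)) = {tvec (tot Y) c | c. vcurve Y c}"
proof (intro set_eqI iffI)
  assume Y: "fib Y"
  fix v assume "v \<in> pts (tot (Vert Y))"
  then obtain c where "curve (tot Y) c" "v = tvec (tot Y) c"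
    "Tmap (bas Y) (prj Y) v = tvec (bas Y) (\<lambda>_. prj Y (foot v))" by (auto simp: Vert_def pts_restr pts_TM)
  then show "v \<in> {tvec (tot Y) c | c. vcurve Y c}" using vert_iff[OF Y] by blast
next
  assume Y: "fib Y"
  fix v assume "v \<in> {tvec (tot Y) c | c. vcurve Y c}"
  then obtain c where c: "vcurve Y c" "v = tvec (tot Y) c" by blast
  then show "v \<in> pts (tot (Vert Y))" using vert_iff[OF Y vcurve_curve[OF c(1)]] vcurve_curve[OF c(1)]
    by (auto simp: Vert_def pts_restr pts_TM)
qed

definition Vdom :: "('p, 'j, 'e) fibm \<Rightarrow> 'p set \<Rightarrow> (real \<Rightarrow> 'p) set set" where
  "Vdom Y D = {tvec (tot Y) c | c. vcurve Y c \<and> c 0 \<in> D}"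

definition Vco :: "('p \<Rightarrow> 'j \<Rightarrow> real) \<Rightarrow> (real \<Rightarrow> 'p) set \<Rightarrow> 'j + 'j \<Rightarrow> real" where
  "Vco \<psi> = (\<lambda>v. case_sum (\<psi> (foot v)) (vcomp \<psi> v))"

lemma charts_restr_image:
  "{(D \<inter> A, \<psi>) | D \<psi>. (D, \<psi>) \<in> {(g D, h \<psi>) | D \<psi>. (D, \<psi>) \<in> S}} =
    {((\<lambda>D. g D \<inter> A) D, h \<psi>) | D \<psi>. (D, \<psi>) \<in> S}"
  by auto

lemma charts_Vert:
  assumes Y: "fib Y"
  shows "charts (tot (Vert Y)) = {(Vdom Y D, Vco \<psi>) | D \<psi>. (D, \<psi>) \<in> charts (tot Y)}"
proof -
  have e: "{tvec (tot Y) c | c. curve (tot Y) c \<and> c 0 \<in> D} \<inter>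
     {v. Tmap (bas Y) (prj Y) v = tvec (bas Y) (\<lambda>_. prj Y (foot v))} = Vdom Y D" for D
    using vert_iff[OF Y] vcurve_curve[of Y] unfolding Vdom_def by blast
  note g = charts_restr_image
  show ?thesis unfolding Vert_def fibm.simps charts_restr charts_TM Vco_def
    by (subst g[where g = "\<lambda>D. {tvec (tot Y) c | c. curve (tot Y) c \<and> c 0 \<in> D}"]) (simp only: e)
qed

lemma tvec_Vdom: "curve (tot Y) c \<Longrightarrow> tvec (tot Y) c \<in> Vdom Y D \<Longrightarrow> c 0 \<in> D"
proof -
  assume c: "curve (tot Y) c" "tvec (tot Y) c \<in> Vdom Y D"
  then obtain c' where c': "tvec (tot Y) c = tvec (tot Y) c'" "c' 0 \<in> D" by (auto simp: Vdom_def)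
  from tvec_eqD[OF c'(1) c(1)] c'(2) show "c 0 \<in> D" by (simp add: jeq_def)
qed

lemma Vco_tvec:
  assumes "curve (tot Y) c" "fib Y" "(D, \<psi>) \<in> charts (tot Y)" "c 0 \<in> D"
  shows "Vco \<psi> (tvec (tot Y) c) = case_sum (\<psi> (c 0)) (vel \<psi> c)"
  using assms by (simp add: Vco_def foot_tvec vcomp_tvec[OF assms(1) fibD(2)])

lemma wsmooth_foot_Vert:
  assumes Y: "fib Y" and v: "v \<in> pts (tot (Vert Y))" shows "wsmooth (tot (Vert Y)) (tot Y) foot v"
  unfolding Vert_def fibm.simps
  by (rule wsmooth_restr[OF wsmooth_foot[OF fibD(2)[OF Y]]]) (use v in \<open>auto simp: Vert_def pts_restr\<close>)

lemma fib_Vert: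
  assumes Y: "fib Y" shows "fib (Vert Y)"
  unfolding fib_def
proof (intro conjI ballI)
  show "tame (tot (Vert Y))"
    unfolding Vert_def fibm.simps by (rule tame_restr[OF tame_TM[OF fibD(2)[OF Y]]])
  fix v assume v: "v \<in> pts (tot (Vert Y))"
  note f = wsmooth_foot_Vert[OF Y v]
  have "wsmooth (tot (Vert Y)) (bas Y) (\<lambda>v. prj Y (foot v)) v"
    by (rule wsmooth_comp[OF fibD(2)[OF Y] f fibD(4)[OF Y wsmooth_pts(2)[OF f]]])
  then show "wsmooth (tot (Vert Y)) (bas (Vert Y)) (prj (Vert Y)) v" by (simp add: prj_Vert comp_def)
qed (use fibD[OF Y] in simp)

section \<open>Local sections and the charts of jet bundles\<close>

lemma local_section_iff:
  assumes E: "atlas (bas Y)"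
  shows "local_section Y y u \<longleftrightarrow> y \<in> pts (bas Y) \<and>
    eventually (\<lambda>y'. smooth_at (bas Y) (tot Y) u y' \<and> prj Y (u y') = y') (nhdsin (mtop (bas Y)) y)"
  unfolding local_section_def section_on_def eventually_nhdsin topspace_mtop[OF E]
  using openin_subset[of "mtop (bas Y)"] topspace_mtop[OF E] by blast

lemma local_sectionD:
  assumes "atlas (bas Y)" "local_section Y y u"
  shows "smooth_at (bas Y) (tot Y) u y" "prj Y (u y) = y" "y \<in> pts (bas Y)"
proof -
  obtain W where "y \<in> W" "section_on Y W u" using assms(2) unfolding local_section_def by blast
  then show "smooth_at (bas Y) (tot Y) u y" "prj Y (u y) = y" by (simp_all add: section_on_def)
  then show "y \<in> pts (bas Y)" by (simp add: smooth_at_pts)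
qed

lemma eventually_local_section:
  assumes E: "atlas (bas Y)" and u: "local_section Y y u"
  shows "eventually (\<lambda>y. local_section Y y u) (nhdsin (mtop (bas Y)) y)"
proof -
  note u' = u[unfolded local_section_iff[OF E]]
  show ?thesis using eventually_eventually_mtop[OF conjunct2[OF u']] eventually_pts[OF E, of y]
    by eventually_elim (simp add: local_section_iff[OF E])
qed

lemma local_sectionI:
  assumes "atlas (bas Y)" "y \<in> pts (bas Y)"
    "eventually (\<lambda>y'. smooth_at (bas Y) (tot Y) u y' \<and> prj Y (u y') = y') (nhdsin (mtop (bas Y)) y)"
  shows "local_section Y y u"
  using assms by (simp add: local_section_iff)

lemma section_on_local: "openin (mtop (bas Y)) W \<Longrightarrow> section_on Y W u \<Longrightarrow> y \<in> W \<Longrightarrow> local_section Y y u"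
  by (auto simp: local_section_def)

lemma sjet_cong:
  fixes Y :: "('p, 'j, 'e) fibm"
  assumes Y: "fib Y" and y: "y \<in> pts (bas Y)" and ev: "eventually (\<lambda>y. u y = v y) (nhdsin (mtop (bas Y)) y)"
  shows "sjet k Y y u = sjet k Y y v"
proof (rule jet_eqI)
  have uv: "u y = v y" by (rule eventually_mtop_self[OF fibD(1)[OF Y] y ev])
  have "agf (bas Y) k (\<lambda>y. \<eta> (u y) j) (\<lambda>y. \<eta> (v y) j) y" for \<eta> :: "'p \<Rightarrow> 'j \<Rightarrow> real" and j
    by (subst agf_cong[OF fibD(1)[OF Y] y, where f' = "\<lambda>y. \<eta> (v y) j" and g' = "\<lambda>y. \<eta> (v y) j"])
      (use ev in \<open>auto elim: eventually_mono intro: agf_refl\<close>)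
  then show "jeq k (bas Y) (tot Y) y u v" using uv by (simp add: jeq_def)
qed

lemma jrep_jet:
  assumes "smooth_at E P u y"
  shows "smooth_at E P (jrep (jet k E P y u)) y" "jeq k E P y u (jrep (jet k E P y u))"
proof -
  have "u \<in> snd (jet k E P y u)" using assms by (simp add: jet_def_jeq jeq_refl)
  then have "jrep (jet k E P y u) \<in> snd (jet k E P y u)" unfolding jrep_def by (rule someI[where P = "\<lambda>v. v \<in> snd (jet k E P y u)"])
  then show "smooth_at E P (jrep (jet k E P y u)) y" "jeq k E P y u (jrep (jet k E P y u))"
    by (simp_all add: jet_def_jeq)
qed

lemma fst_jet [simp]: "fst (jet k E P y u) = y"
  by (simp add: jet_def)

definition Jdom :: "nat \<Rightarrow> ('p, 'j, 'e) fibm \<Rightarrow> 'e set \<Rightarrow> 'p set \<Rightarrow> ('e \<times> ('e \<Rightarrow> 'p) set) set" where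
  "Jdom k Y D C = {sjet k Y y u | y u. local_section Y y u \<and> y \<in> D \<and> u y \<in> C}"

definition Jco :: "nat \<Rightarrow> ('p, 'j, 'e) fibm \<Rightarrow> 'e set \<Rightarrow> ('e \<Rightarrow> nat \<Rightarrow> real) \<Rightarrow> ('p \<Rightarrow> 'j \<Rightarrow> real) \<Rightarrow>
    'e \<times> ('e \<Rightarrow> 'p) set \<Rightarrow> nat + 'j \<times> nat list \<Rightarrow> real" where
  "Jco k Y D \<phi> \<eta> = (\<lambda>X. case_sum (\<phi> (fst X))
     (\<lambda>(j, \<alpha>). if j \<in> idx (tot Y) \<and> \<alpha> \<in> multiindices k (idx (bas Y))
        then pds \<alpha> (\<lambda>x. \<eta> (jrep X (inv_into D \<phi> x)) j) (\<phi> (fst X)) else 0))"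

lemma bas_Jet [simp]: "bas (Jet k Y) = bas Y" and prj_Jet [simp]: "prj (Jet k Y) = fst"
  and idx_Jet: "idx (tot (Jet k Y)) = idx (bas Y) <+> idx (tot Y) \<times> multiindices k (idx (bas Y))"
  by (simp_all add: Jet_def idx_restr JM_def)

lemma Jdom_fst: "X \<in> Jdom k Y D C \<Longrightarrow> fst X \<in> D"
  unfolding Jdom_def by (elim CollectE exE conjE) simp

lemma sjet_Jdom:
  assumes E: "atlas (bas Y)" and u: "local_section Y y u"
  shows "sjet k Y y u \<in> Jdom k Y D C \<longleftrightarrow> y \<in> D \<and> u y \<in> C"
proof
  assume "sjet k Y y u \<in> Jdom k Y D C"
  then obtain y' u' where *: "sjet k Y y u = sjet k Y y' u'" "y' \<in> D" "u' y' \<in> C" by (auto simp: Jdom_def)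
  from jet_eqD[OF *(1) local_sectionD(1)[OF E u]] *(2,3) show "y \<in> D \<and> u y \<in> C" by (auto simp: jeq_def)
qed (use u in \<open>auto simp: Jdom_def\<close>)

lemma charts_Jet:
  assumes E: "atlas (bas Y)"
  shows "charts (tot (Jet k Y)) = {(Jdom k Y D C, Jco k Y D \<phi> \<eta>) | D \<phi> C \<eta>.
    (D, \<phi>) \<in> charts (bas Y) \<and> (C, \<eta>) \<in> charts (tot Y)}"
proof -
  have *: "{sjet k Y y u | y u. smooth_at (bas Y) (tot Y) u y \<and> y \<in> D \<and> u y \<in> C} \<inter>
      {sjet k Y y u | y u. local_section Y y u} = Jdom k Y D C" for D C
  proof (intro set_eqI iffI)
    fix X assume "X \<in> {sjet k Y y u | y u. smooth_at (bas Y) (tot Y) u y \<and> y \<in> D \<and> u y \<in> C} \<inter>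
      {sjet k Y y u | y u. local_section Y y u}"
    then obtain y u y' u' where u: "X = sjet k Y y u" "smooth_at (bas Y) (tot Y) u y" "y \<in> D" "u y \<in> C"
      "X = sjet k Y y' u'" "local_section Y y' u'" by blast
    have "y' = y" "jeq k (bas Y) (tot Y) y u u'" using jet_eqD[of k "bas Y" "tot Y" y u y' u'] u by simp_all
    then have "X = sjet k Y y u' \<and> local_section Y y u' \<and> y \<in> D \<and> u' y \<in> C" using u by (simp add: jeq_def)
    then show "X \<in> Jdom k Y D C" unfolding Jdom_def by blast
  next
    fix X assume "X \<in> Jdom k Y D C"
    then show "X \<in> {sjet k Y y u | y u. smooth_at (bas Y) (tot Y) u y \<and> y \<in> D \<and> u y \<in> C} \<inter>
      {sjet k Y y u | y u. local_section Y y u}" using local_sectionD(1)[OF E] unfolding Jdom_def by blast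
  qed
  show ?thesis
    unfolding Jet_def fibm.simps charts_restr JM_def mfd.simps
  proof (intro set_eqI iffI)
    fix c assume "c \<in> {(D \<inter> {sjet k Y y u | y u. local_section Y y u}, \<psi>) | D \<psi>. (D, \<psi>) \<in>
      {({sjet k Y y u | y u. smooth_at (bas Y) (tot Y) u y \<and> y \<in> D \<and> u y \<in> C},
                \<lambda>X. case_sum (\<phi> (fst X))
                  (\<lambda>(j, \<alpha>). if j \<in> idx (tot Y) \<and> \<alpha> \<in> multiindices k (idx (bas Y))
                     then pds \<alpha> (\<lambda>x. \<eta> (jrep X (inv_into D \<phi> x)) j) (\<phi> (fst X)) else 0))
               | D \<phi> C \<eta>. (D, \<phi>) \<in> charts (bas Y) \<and> (C, \<eta>) \<in> charts (tot Y)}}"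
    then obtain D \<phi> C \<eta> where "c = (Jdom k Y D C, Jco k Y D \<phi> \<eta>)" "(D, \<phi>) \<in> charts (bas Y)" "(C, \<eta>) \<in> charts (tot Y)"
      unfolding Jco_def *[symmetric] by blast
    then show "c \<in> {(Jdom k Y D C, Jco k Y D \<phi> \<eta>) | D \<phi> C \<eta>.
      (D, \<phi>) \<in> charts (bas Y) \<and> (C, \<eta>) \<in> charts (tot Y)}" by blast
  next
    fix c assume "c \<in> {(Jdom k Y D C, Jco k Y D \<phi> \<eta>) | D \<phi> C \<eta>.
      (D, \<phi>) \<in> charts (bas Y) \<and> (C, \<eta>) \<in> charts (tot Y)}"
    then show "c \<in> {(D \<inter> {sjet k Y y u | y u. local_section Y y u}, \<psi>) | D \<psi>. (D, \<psi>) \<in>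
      {({sjet k Y y u | y u. smooth_at (bas Y) (tot Y) u y \<and> y \<in> D \<and> u y \<in> C},
                \<lambda>X. case_sum (\<phi> (fst X))
                  (\<lambda>(j, \<alpha>). if j \<in> idx (tot Y) \<and> \<alpha> \<in> multiindices k (idx (bas Y))
                     then pds \<alpha> (\<lambda>x. \<eta> (jrep X (inv_into D \<phi> x)) j) (\<phi> (fst X)) else 0))
               | D \<phi> C \<eta>. (D, \<phi>) \<in> charts (bas Y) \<and> (C, \<eta>) \<in> charts (tot Y)}}"
      unfolding Jco_def *[symmetric] by blast
  qed
qed

lemma pts_Jet:
  assumes E: "atlas (bas Y)" shows "pts (tot (Jet k Y)) = {sjet k Y y u | y u. local_section Y y u}"
  using local_sectionD(1)[OF E] by (auto simp: Jet_def pts_restr JM_def)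

lemma finite_multiindices: "finite I \<Longrightarrow> finite (multiindices k I)"
  by (rule finite_subset[OF _ finite_lists_length_le[of I k]]) (auto simp: multiindices_def)

lemma multiindices_lists: "\<alpha> \<in> multiindices k I \<Longrightarrow> \<alpha> \<in> lists I" "\<alpha> \<in> multiindices k I \<Longrightarrow> length \<alpha> \<le> k"
  by (auto simp: multiindices_def)

text \<open>\<open>Jco\<close> differentiates the representative chosen by \<open>jrep\<close>; it
  is in contact of order k with u, so the derivatives that occur are those of u.\<close>

lemma Jco_sjet:
  assumes E: "atlas (bas Y)" and u: "smooth_at (bas Y) (tot Y) u y"
    and D: "(D, \<phi>) \<in> charts (bas Y)" "y \<in> D" and C: "(C, \<eta>) \<in> charts (tot Y)" "u y \<in> C"
  shows "Jco k Y D \<phi> \<eta> (sjet k Y y u) = case_sum (\<phi> y)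
     (\<lambda>(j, \<alpha>). if j \<in> idx (tot Y) \<and> \<alpha> \<in> multiindices k (idx (bas Y))
        then pds \<alpha> (\<lambda>x. \<eta> (u (inv_into D \<phi> x)) j) (\<phi> y) else 0)"
proof -
  have "pds \<alpha> (\<lambda>x. \<eta> (jrep (sjet k Y y u) (inv_into D \<phi> x)) j) (\<phi> y) = pds \<alpha> (\<lambda>x. \<eta> (u (inv_into D \<phi> x)) j) (\<phi> y)"
    if "j \<in> idx (tot Y)" "\<alpha> \<in> multiindices k (idx (bas Y))" for j \<alpha>
  proof -
    have "agf (bas Y) k (\<lambda>y. \<eta> (u y) j) (\<lambda>z. \<eta> (jrep (sjet k Y y u) z) j) y"
      using jrep_jet(2)[OF u, of k] C that(1) unfolding jeq_def by blast
    then show ?thesis using D multiindices_lists[OF that(2)] by (simp add: agf_def agr_def)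
  qed
  then show ?thesis unfolding Jco_def fst_jet by (intro arg_cong2[where f = case_sum] refl ext) auto
qed

lemma tame_Jet:
  assumes Y: "fib Y" shows "tame (tot (Jet k Y))"
proof (rule tameI)
  note E = fibD(1)[OF Y]
  show "finite (idx (tot (Jet k Y)))"
    using atlas_finite[OF E] tame_finite[OF fibD(2)[OF Y]] by (simp add: idx_Jet finite_multiindices)
  show "X \<in> pts (tot (Jet k Y)) \<longleftrightarrow> (\<exists>D \<psi>. (D, \<psi>) \<in> charts (tot (Jet k Y)) \<and> X \<in> D)" for X
  proof
    assume "X \<in> pts (tot (Jet k Y))"
    then obtain y u where u: "X = sjet k Y y u" "local_section Y y u" by (auto simp: pts_Jet[OF E])
    obtain D \<phi> where D: "(D, \<phi>) \<in> charts (bas Y)" "y \<in> D"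
      using atlas_chart[OF E local_sectionD(3)[OF E u(2)]] by blast
    obtain C \<eta> where C: "(C, \<eta>) \<in> charts (tot Y)" "u y \<in> C"
      using tame_chart[OF fibD(2)[OF Y] smooth_at_pts(2)[OF local_sectionD(1)[OF E u(2)]]] by blast
    have "X \<in> Jdom k Y D C" using u D C by (auto simp: Jdom_def)
    then show "\<exists>D \<psi>. (D, \<psi>) \<in> charts (tot (Jet k Y)) \<and> X \<in> D" unfolding charts_Jet[OF E] using D C by blast
  next
    assume "\<exists>D \<psi>. (D, \<psi>) \<in> charts (tot (Jet k Y)) \<and> X \<in> D"
    then show "X \<in> pts (tot (Jet k Y))" unfolding charts_Jet[OF E] pts_Jet[OF E] Jdom_def by blast
  qed
  show "\<psi> X \<in> Euc (idx (tot (Jet k Y)))" if V: "(W, \<psi>) \<in> charts (tot (Jet k Y))" "X \<in> W" for W \<psi> X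
  proof -
    obtain D \<phi> C \<eta> where D: "W = Jdom k Y D C" "\<psi> = Jco k Y D \<phi> \<eta>" "(D, \<phi>) \<in> charts (bas Y)"
      using V(1) unfolding charts_Jet[OF E] by blast
    have "fst X \<in> D" using V(2) Jdom_fst unfolding D by blast
    then have "\<phi> (fst X) \<in> Euc (idx (bas Y))" using tame_Euc[OF fibD(3)[OF Y] D(3)] by blast
    moreover have "(\<lambda>(j, \<alpha>). if j \<in> idx (tot Y) \<and> \<alpha> \<in> multiindices k (idx (bas Y))
        then pds \<alpha> (\<lambda>x. \<eta> (jrep X (inv_into D \<phi> x)) j) (\<phi> (fst X)) else 0)
      \<in> Euc (idx (tot Y) \<times> multiindices k (idx (bas Y)))" by (rule EucI) (auto split: prod.splits)
    ultimately show ?thesis unfolding idx_Jet Euc_sum D(2) Jco_def case_sum_comp by simp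
  qed
qed

lemma wsmooth_Jet_fst:
  assumes Y: "fib Y" and X: "X \<in> pts (tot (Jet k Y))" shows "wsmooth (tot (Jet k Y)) (bas Y) fst X"
proof -
  note E = fibD(1)[OF Y]
  obtain y u where u: "X = sjet k Y y u" "local_section Y y u" using X by (auto simp: pts_Jet[OF E])
  show ?thesis unfolding wsmooth_def
  proof (intro conjI allI impI)
    show "fst X \<in> pts (bas Y)" using u local_sectionD(3)[OF E] by auto
    fix D \<phi> assume D: "(D, \<phi>) \<in> charts (bas Y)" "fst X \<in> D"
    obtain C \<eta> where C: "(C, \<eta>) \<in> charts (tot Y)" "u y \<in> C"
      using tame_chart[OF fibD(2)[OF Y] smooth_at_pts(2)[OF local_sectionD(1)[OF E u(2)]]] by blast
    have W: "(Jdom k Y D C, Jco k Y D \<phi> \<eta>) \<in> charts (tot (Jet k Y))" unfolding charts_Jet[OF E] using D C by blast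
    have XW: "X \<in> Jdom k Y D C" using u D C by (auto simp: Jdom_def)
    have Eu: "Jco k Y D \<phi> \<eta> X \<in> Euc (idx (tot (Jet k Y)))" using tame_Euc[OF tame_Jet[OF Y] W XW] .
    have "csm (tot (Jet k Y)) (bas Y) (Jdom k Y D C) (Jco k Y D \<phi> \<eta>) D \<phi> fst X"
      unfolding csm_def
    proof (intro conjI exI[of _ "\<lambda>x i. x (Inl i)"])
      show "\<forall>\<^sub>F x in near (idx (tot (Jet k Y))) (Jco k Y D \<phi> \<eta> X). \<forall>z'\<in>Jdom k Y D C. Jco k Y D \<phi> \<eta> z' = x \<longrightarrow>
          fst z' \<in> D \<and> (\<forall>j\<in>idx (bas Y). \<phi> (fst z') j = x (Inl j))"
        by (rule always_eventually) (auto dest: Jdom_fst simp: Jco_def)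
      show "\<forall>j\<in>idx (bas Y). sm (idx (tot (Jet k Y))) (\<lambda>x. x (Inl j)) (Jco k Y D \<phi> \<eta> X)" using sm_coord[OF Eu] by blast
    qed (use D Eu XW in auto)
    then show "\<exists>D' \<psi>. (D', \<psi>) \<in> charts (tot (Jet k Y)) \<and> csm (tot (Jet k Y)) (bas Y) D' \<psi> D \<phi> fst X" using W by blast
  qed (use X in auto)
qed

lemma fib_Jet: "fib Y \<Longrightarrow> fib (Jet k Y)"
  unfolding fib_def[of "Jet k Y"] bas_Jet prj_Jet using wsmooth_Jet_fst tame_Jet fibD(1) by blast

section \<open>Prolongation of sections\<close>

lemma jeq_cong:
  fixes P :: "('p, 'j) mfd"
  assumes E: "atlas E" and y: "y \<in> pts E" and ev: "eventually (\<lambda>y. u y = v y) (nhdsin (mtop E) y)"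
  shows "jeq k E P y u v"
proof -
  have "agf E k (\<lambda>y. \<eta> (u y) j) (\<lambda>y. \<eta> (v y) j) y" for \<eta> :: "'p \<Rightarrow> 'j \<Rightarrow> real" and j
    by (subst agf_cong[OF E y, where f' = "\<lambda>y. \<eta> (v y) j" and g' = "\<lambda>y. \<eta> (v y) j"])
      (use ev in \<open>auto elim: eventually_mono intro: agf_refl\<close>)
  then show ?thesis using eventually_mtop_self[OF E y ev] by (simp add: jeq_def)
qed

lemma Jdom_Jco_chart:
  "atlas (bas Y) \<Longrightarrow> (D, \<phi>) \<in> charts (bas Y) \<Longrightarrow> (C, \<eta>) \<in> charts (tot Y) \<Longrightarrow>
    (Jdom k Y D C, Jco k Y D \<phi> \<eta>) \<in> charts (tot (Jet k Y))"
  by (auto simp: charts_Jet)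

lemma Jet_chartE:
  assumes "(W, \<Psi>) \<in> charts (tot (Jet k Y))" "atlas (bas Y)"
  obtains D \<phi> C \<eta> where "W = Jdom k Y D C" "\<Psi> = Jco k Y D \<phi> \<eta>" "(D, \<phi>) \<in> charts (bas Y)" "(C, \<eta>) \<in> charts (tot Y)"
  using assms(1) unfolding charts_Jet[OF assms(2)] by blast

lemma eventually_in_chart:
  assumes Y: "fib Y" and a: "local_section Y y a" and D: "(D, \<phi>) \<in> charts (bas Y)" "y \<in> D"
    and C: "(C, \<eta>) \<in> charts (tot Y)" "a y \<in> C"
  shows "eventually (\<lambda>y. local_section Y y a \<and> y \<in> D \<and> a y \<in> C) (nhdsin (mtop (bas Y)) y)"
  using eventually_local_section[OF fibD(1)[OF Y] a]
    eventually_dom[OF fibD(1)[OF Y] atlas_compatible[OF fibD(1)[OF Y] D(1)] D(2)]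
    smooth_atD(1)[OF local_sectionD(1)[OF fibD(1)[OF Y] a] fibD(1,2)[OF Y] C]
  by eventually_elim simp

lemma section_sm:
  assumes Y: "fib Y" and a: "local_section Y y a" and D: "(D, \<phi>) \<in> charts (bas Y)" "y \<in> D"
    and C: "(C, \<eta>) \<in> charts (tot Y)" "a y \<in> C" and j: "j \<in> idx (tot Y)"
  shows "sm (idx (bas Y)) (\<lambda>x. \<eta> (a (inv_into D \<phi> x)) j) (\<phi> y)"
  using smooth_atD(2)[OF local_sectionD(1)[OF fibD(1)[OF Y] a] fibD(1,2)[OF Y] C j]
  unfolding smf_iff[OF fibD(1)[OF Y] atlas_compatible[OF fibD(1)[OF Y] D(1)] D(2)] .

lemma smooth_at_sjet:
  assumes Y: "fib Y" and a: "local_section Y y a"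
  shows "smooth_at (bas Y) (tot (Jet k Y)) (\<lambda>y. sjet k Y y a) y"
proof (rule smooth_atI[OF fibD(1)[OF Y] tame_Jet[OF Y]])
  note E = fibD(1)[OF Y]
  show y: "y \<in> pts (bas Y)" using local_sectionD(3)[OF E a] .
  show "sjet k Y y a \<in> pts (tot (Jet k Y))" using a by (auto simp: pts_Jet[OF E])
  fix W \<Psi> assume W: "(W, \<Psi>) \<in> charts (tot (Jet k Y))" "sjet k Y y a \<in> W"
  obtain D \<phi> C \<eta> where w: "W = Jdom k Y D C" "\<Psi> = Jco k Y D \<phi> \<eta>" and D: "(D, \<phi>) \<in> charts (bas Y)"
    and C: "(C, \<eta>) \<in> charts (tot Y)" using Jet_chartE[OF W(1) E] .
  have yD: "y \<in> D" "a y \<in> C" using W(2) unfolding w sjet_Jdom[OF E a] by auto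
  note ev = eventually_in_chart[OF Y a D yD(1) C yD(2)]
  show "eventually (\<lambda>y. sjet k Y y a \<in> W) (nhdsin (mtop (bas Y)) y)"
    using ev by eventually_elim (simp add: w sjet_Jdom[OF E])
  fix i assume i: "i \<in> idx (tot (Jet k Y))"
  have cD: "compatible (bas Y) (D, \<phi>)" using atlas_compatible[OF E D] .
  have "smf (bas Y) (\<lambda>y. case_sum (\<phi> y) (\<lambda>(j, \<alpha>). if j \<in> idx (tot Y) \<and> \<alpha> \<in> multiindices k (idx (bas Y))
      then pds \<alpha> (\<lambda>x. \<eta> (a (inv_into D \<phi> x)) j) (\<phi> y) else 0) i) y"
  proof (cases i)
    case (Inl m)
    then show ?thesis using smf_coord[OF E cD yD(1)] by simp
  next
    case (Inr p)
    obtain j \<alpha> where p: "p = (j, \<alpha>)" by (cases p)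
    then have j: "j \<in> idx (tot Y)" "\<alpha> \<in> multiindices k (idx (bas Y))" using i Inr by (auto simp: idx_Jet)
    have "smf (bas Y) (\<lambda>y. pds \<alpha> (\<lambda>x. \<eta> (a (inv_into D \<phi> x)) j) (\<phi> y)) y"
    proof (rule smf_comp[OF E atlas_finite[OF E], where H = \<phi>])
      show "sm (idx (bas Y)) (pds \<alpha> (\<lambda>x. \<eta> (a (inv_into D \<phi> x)) j)) (\<phi> y)"
        using section_sm[OF Y a D yD(1) C yD(2) j(1)] multiindices_lists(1)[OF j(2)] by (rule sm_pds)
      show "eventually (\<lambda>y. \<phi> y \<in> Euc (idx (bas Y))) (nhdsin (mtop (bas Y)) y)"
        using ev by eventually_elim (use tame_Euc[OF fibD(3)[OF Y] D] in simp)
    qed (use smf_coord[OF E cD yD(1)] y in auto)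
    then show ?thesis using Inr p j by simp
  qed
  then show "smf (bas Y) (\<lambda>y. \<Psi> (sjet k Y y a) i) y"
  proof (rule smf_cong[OF E])
    show "eventually (\<lambda>y. case_sum (\<phi> y) (\<lambda>(j, \<alpha>). if j \<in> idx (tot Y) \<and> \<alpha> \<in> multiindices k (idx (bas Y))
      then pds \<alpha> (\<lambda>x. \<eta> (a (inv_into D \<phi> x)) j) (\<phi> y) else 0) i = \<Psi> (sjet k Y y a) i) (nhdsin (mtop (bas Y)) y)"
      using ev
    proof eventually_elim
      case (elim z)
      then show ?case using Jco_sjet[OF E local_sectionD(1)[OF E, of z a] D _ C, of k] by (simp add: w)
    qed
  qed
qed

lemma local_section_sjet:
  assumes Y: "fib Y" and a: "local_section Y y a"
  shows "local_section (Jet k Y) y (\<lambda>y. sjet k Y y a)"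
proof (rule local_sectionI)
  show "atlas (bas (Jet k Y))" using fibD(1)[OF Y] by simp
  show "y \<in> pts (bas (Jet k Y))" using local_sectionD(3)[OF fibD(1)[OF Y] a] by simp
  show "eventually (\<lambda>y. smooth_at (bas (Jet k Y)) (tot (Jet k Y)) (\<lambda>y. sjet k Y y a) y \<and>
      prj (Jet k Y) (sjet k Y y a) = y) (nhdsin (mtop (bas (Jet k Y))) y)"
    using eventually_local_section[OF fibD(1)[OF Y] a] unfolding bas_Jet
    by eventually_elim (simp add: smooth_at_sjet[OF Y])
qed

lemma jproj_sjet:
  assumes E: "atlas (bas Y)" and a: "local_section Y y a" and s: "s \<le> r"
  shows "jproj s Y (sjet r Y y a) = sjet s Y y a"
  using jet_eqI[OF jeq_le[OF jrep_jet(2)[OF local_sectionD(1)[OF E a], of r] s]] by (simp add: jproj_def)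

lemma wsmooth_jproj:
  assumes Y: "fib Y" and s: "s \<le> r" and X: "X \<in> pts (tot (Jet r Y))"
  shows "wsmooth (tot (Jet r Y)) (tot (Jet s Y)) (jproj s Y) X"
  unfolding wsmooth_def
proof (intro conjI allI impI)
  note E = fibD(1)[OF Y]
  obtain y u where u: "X = sjet r Y y u" "local_section Y y u" using X by (auto simp: pts_Jet[OF E])
  have jX: "jproj s Y X = sjet s Y y u" using jproj_sjet[OF E u(2) s] u(1) by simp
  then show "jproj s Y X \<in> pts (tot (Jet s Y))" using u(2) by (auto simp: pts_Jet[OF E])
  fix W \<Psi> assume W: "(W, \<Psi>) \<in> charts (tot (Jet s Y))" "jproj s Y X \<in> W"
  obtain D \<phi> C \<eta> where w: "W = Jdom s Y D C" "\<Psi> = Jco s Y D \<phi> \<eta>" and D: "(D, \<phi>) \<in> charts (bas Y)"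
    and C: "(C, \<eta>) \<in> charts (tot Y)" using Jet_chartE[OF W(1) E] .
  have yD: "y \<in> D" "u y \<in> C" using W(2) unfolding w jX sjet_Jdom[OF E u(2)] by auto
  have W': "(Jdom r Y D C, Jco r Y D \<phi> \<eta>) \<in> charts (tot (Jet r Y))" using Jdom_Jco_chart[OF E D C] .
  have XW: "X \<in> Jdom r Y D C" using sjet_Jdom[OF E u(2)] yD u(1) by simp
  have Eu: "Jco r Y D \<phi> \<eta> X \<in> Euc (idx (tot (Jet r Y)))" using tame_Euc[OF tame_Jet[OF Y] W' XW] .
  have *: "jproj s Y z \<in> W \<and> (\<forall>j\<in>idx (tot (Jet s Y)). \<Psi> (jproj s Y z) j = Jco r Y D \<phi> \<eta> z j)" if "z \<in> Jdom r Y D C" for z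
  proof -
    from that obtain y' v where v: "z = sjet r Y y' v" "local_section Y y' v" "y' \<in> D" "v y' \<in> C"
      unfolding Jdom_def by blast
    note sv = local_sectionD(1)[OF E v(2)]
    have j: "jproj s Y z = sjet s Y y' v" using jproj_sjet[OF E v(2) s] v(1) by simp
    have "multiindices s (idx (bas Y)) \<subseteq> multiindices r (idx (bas Y))" using s by (auto simp: multiindices_def)
    then show ?thesis unfolding j[unfolded v(1)] v(1) w(2) w(1) Jco_sjet[OF E sv D v(3) C v(4)] sjet_Jdom[OF E v(2)]
      using v(3,4) by (auto simp: idx_Jet split: sum.splits)
  qed
  have "csm (tot (Jet r Y)) (tot (Jet s Y)) (Jdom r Y D C) (Jco r Y D \<phi> \<eta>) W \<Psi> (jproj s Y) X"
    unfolding csm_def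
  \<comment> \<open>In corresponding charts the projection forgets the derivatives of order above s.
    The coordinates that remain carry the same indices, so the identity is an extension of its
    expression.\<close>
  proof (intro conjI exI[of _ "\<lambda>x. x"])
    show "\<forall>\<^sub>F x in near (idx (tot (Jet r Y))) (Jco r Y D \<phi> \<eta> X). \<forall>z'\<in>Jdom r Y D C. Jco r Y D \<phi> \<eta> z' = x \<longrightarrow>
        jproj s Y z' \<in> W \<and> (\<forall>j\<in>idx (tot (Jet s Y)). \<Psi> (jproj s Y z') j = x j)"
      by (rule always_eventually) (use * in blast)
    show "\<forall>j\<in>idx (tot (Jet s Y)). sm (idx (tot (Jet r Y))) (\<lambda>x. x j) (Jco r Y D \<phi> \<eta> X)" using sm_coord[OF Eu] by blast
  qed (use W XW Eu in auto)
  then show "\<exists>D' \<psi>. (D', \<psi>) \<in> charts (tot (Jet r Y)) \<and> csm (tot (Jet r Y)) (tot (Jet s Y)) D' \<psi> W \<Psi> (jproj s Y) X"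
    using W' by blast
qed (use X in auto)

lemma agr_pds: "agr I (length \<alpha> + m) f g x \<Longrightarrow> \<alpha> \<in> lists I \<Longrightarrow> agr I m (pds \<alpha> f) (pds \<alpha> g) x"
  unfolding agr_def pds_append[symmetric] by auto

text \<open>The coordinate with index (j, \<alpha>) of z \<mapsto> j^k_z a equals the derivative
  \<alpha> of the j-th component of a at all points near y, so first derivatives of both may be
  identified.\<close>

lemma jeq_hol_aux:
  assumes Y: "fib Y" and a: "local_section Y y a" "local_section Y y a'" and aa: "a' y = a y"
    and D: "(D, \<phi>) \<in> charts (bas Y)" "y \<in> D" and C: "(C, \<eta>) \<in> charts (tot Y)" "a y \<in> C"
    and j: "j \<in> idx (tot Y)" "\<alpha> \<in> multiindices k (idx (bas Y))"
  shows "agf (bas Y) 1 (\<lambda>y. Jco k Y D \<phi> \<eta> (sjet k Y y a) (Inr (j, \<alpha>))) (\<lambda>y. Jco k Y D \<phi> \<eta> (sjet k Y y a') (Inr (j, \<alpha>))) y \<longleftrightarrow>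
    agr (idx (bas Y)) 1 (pds \<alpha> (\<lambda>x. \<eta> (a (inv_into D \<phi> x)) j)) (pds \<alpha> (\<lambda>x. \<eta> (a' (inv_into D \<phi> x)) j)) (\<phi> y)"
proof -
  note E = fibD(1)[OF Y]
  have cD: "compatible (bas Y) (D, \<phi>)" using atlas_compatible[OF E D(1)] .
  have W: "(Jdom k Y D C, Jco k Y D \<phi> \<eta>) \<in> charts (tot (Jet k Y))" using Jdom_Jco_chart[OF E D(1) C(1)] .
  have i: "Inr (j, \<alpha>) \<in> idx (tot (Jet k Y))" using j by (auto simp: idx_Jet)
  have s: "smf (bas Y) (\<lambda>y. Jco k Y D \<phi> \<eta> (sjet k Y y b) (Inr (j, \<alpha>))) y" if "local_section Y y b" "b y \<in> C" for b
    by (rule smooth_atD(2)[OF smooth_at_sjet[OF Y that(1)] E tame_Jet[OF Y] W _ i])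
      (use that D in \<open>simp add: sjet_Jdom[OF E]\<close>)
  have ev: "eventually (\<lambda>x. Jco k Y D \<phi> \<eta> (sjet k Y (inv_into D \<phi> x) b) (Inr (j, \<alpha>)) =
      pds \<alpha> (\<lambda>x. \<eta> (b (inv_into D \<phi> x)) j) x) (near (idx (bas Y)) (\<phi> y))"
    if b: "local_section Y y b" "b y \<in> C" for b
    using eventually_in_chart[OF Y b(1) D C(1) b(2), unfolded eventually_mtop[OF E cD D(2)]] eventually_chart[OF cD D(2)]
  proof eventually_elim
    case (elim x)
    then have z: "local_section Y (inv_into D \<phi> x) b" "inv_into D \<phi> x \<in> D" "b (inv_into D \<phi> x) \<in> C" by auto
    show ?case using Jco_sjet[OF E local_sectionD(1)[OF E z(1)] D(1) z(2) C(1) z(3), of k] j elim by simp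
  qed
  have E': "\<phi> y \<in> Euc (idx (bas Y))" using tame_Euc[OF fibD(3)[OF Y] D] .
  show ?thesis
    unfolding agf_iff[OF E D s[OF a(1) C(2)] s[OF a(2) C(2)[folded aa]]]
    by (rule agr_cong[OF ev[OF a(1) C(2)] ev[OF a(2) C(2)[folded aa]] E'])
qed

text \<open>The 1-jet of a coordinate of order at most k involves derivatives of order at most k +
  1. Hence the inclusion of holonomic jets does not depend on the representing section.\<close>

lemma jeq_hol:
  assumes Y: "fib Y" and a: "local_section Y y a" "local_section Y y a'"
    and j: "jeq (Suc k) (bas Y) (tot Y) y a a'"
  shows "jeq 1 (bas Y) (tot (Jet k Y)) y (\<lambda>y. sjet k Y y a) (\<lambda>y. sjet k Y y a')"
  unfolding jeq_def
proof (intro conjI allI impI)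
  note E = fibD(1)[OF Y]
  have aa: "a' y = a y" using j by (simp add: jeq_def)
  show "sjet k Y y a' = sjet k Y y a" using jet_eqI[OF jeq_le[OF j], of k] by simp
  fix W \<Psi> i assume W: "(W, \<Psi>) \<in> charts (tot (Jet k Y))" "sjet k Y y a \<in> W" and i: "i \<in> idx (tot (Jet k Y))"
  obtain D \<phi> C \<eta> where w: "W = Jdom k Y D C" "\<Psi> = Jco k Y D \<phi> \<eta>" and D: "(D, \<phi>) \<in> charts (bas Y)"
    and C: "(C, \<eta>) \<in> charts (tot Y)" using Jet_chartE[OF W(1) E] .
  have yD: "y \<in> D" "a y \<in> C" using W(2) unfolding w sjet_Jdom[OF E a(1)] by auto
  show "agf (bas Y) 1 (\<lambda>y. \<Psi> (sjet k Y y a) i) (\<lambda>y. \<Psi> (sjet k Y y a') i) y"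
  proof (cases i)
    case (Inl m)
    then show ?thesis by (simp add: w Jco_def agf_refl)
  next
    case (Inr p)
    obtain l \<alpha> where p: "p = (l, \<alpha>)" by (cases p)
    then have l: "l \<in> idx (tot Y)" "\<alpha> \<in> multiindices k (idx (bas Y))" using i Inr by (auto simp: idx_Jet)
    have "agr (idx (bas Y)) (Suc k) (\<lambda>x. \<eta> (a (inv_into D \<phi> x)) l) (\<lambda>x. \<eta> (a' (inv_into D \<phi> x)) l) (\<phi> y)"
      using j D yD C l(1) unfolding jeq_def agf_def by blast
    then have "agr (idx (bas Y)) 1 (pds \<alpha> (\<lambda>x. \<eta> (a (inv_into D \<phi> x)) l)) (pds \<alpha> (\<lambda>x. \<eta> (a' (inv_into D \<phi> x)) l)) (\<phi> y)"
      by (intro agr_pds[OF agr_le[of _ "Suc k"]]) (use multiindices_lists[OF l(2)] in auto)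
    then show ?thesis unfolding w Inr p jeq_hol_aux[OF Y a aa D yD(1) C yD(2) l] .
  qed
qed

text \<open>Injectivity of the inclusion of holonomic jets: a derivative of order k + 1 is a first
  derivative of a jet coordinate of order k. Later this raises contact of two prolongations in J^sQ
  to equality of (s+1)-jets.\<close>

lemma jeq_hol_inj:
  assumes Y: "fib Y" and a: "local_section Y y a" "local_section Y y a'"
    and j: "jeq 1 (bas Y) (tot (Jet k Y)) y (\<lambda>y. sjet k Y y a) (\<lambda>y. sjet k Y y a')"
  shows "jeq (Suc k) (bas Y) (tot Y) y a a'"
  unfolding jeq_def
proof (intro conjI allI impI)
  note E = fibD(1)[OF Y]
  have "sjet k Y y a = sjet k Y y a'" using j by (simp add: jeq_def)
  then have jk: "jeq k (bas Y) (tot Y) y a a'" by (rule jet_eqD(2)[OF _ local_sectionD(1)[OF E a(1)]])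
  then show aa: "a' y = a y" by (simp add: jeq_def)
  fix C \<eta> l assume C: "(C, \<eta>) \<in> charts (tot Y)" "a y \<in> C" and l: "l \<in> idx (tot Y)"
  obtain D \<phi> where D: "(D, \<phi>) \<in> charts (bas Y)" "y \<in> D" using atlas_chart[OF E local_sectionD(3)[OF E a(1)]] by blast
  have W: "(Jdom k Y D C, Jco k Y D \<phi> \<eta>) \<in> charts (tot (Jet k Y))" using Jdom_Jco_chart[OF E D(1) C(1)] .
  have yW: "sjet k Y y a \<in> Jdom k Y D C" using sjet_Jdom[OF E a(1)] D C by blast
  note s = smooth_atD(2)[OF local_sectionD(1)[OF E a(1)] E fibD(2)[OF Y] C l]
    smooth_atD(2)[OF local_sectionD(1)[OF E a(2)] E fibD(2)[OF Y] C(1) C(2)[folded aa] l]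
  let ?f = "\<lambda>x. \<eta> (a (inv_into D \<phi> x)) l" and ?g = "\<lambda>x. \<eta> (a' (inv_into D \<phi> x)) l"
  show "agf (bas Y) (Suc k) (\<lambda>y. \<eta> (a y) l) (\<lambda>y. \<eta> (a' y) l) y"
    unfolding agf_iff[OF E D s]
  proof (rule agr_sorted[OF atlas_finite[OF E]])
    show "sm (idx (bas Y)) ?f (\<phi> y)" by (rule section_sm[OF Y a(1) D C l])
    show "sm (idx (bas Y)) ?g (\<phi> y)" by (rule section_sm[OF Y a(2) D C(1) C(2)[folded aa] l])
    fix \<alpha> assume \<alpha>: "\<alpha> \<in> multiindices (Suc k) (idx (bas Y))"
    show "pds \<alpha> ?f (\<phi> y) = pds \<alpha> ?g (\<phi> y)"
    proof (cases "length \<alpha> \<le> k")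
      case True
      have "agr (idx (bas Y)) k ?f ?g (\<phi> y)" using jk C D l unfolding jeq_def agf_def by blast
      then show ?thesis using True multiindices_lists(1)[OF \<alpha>] unfolding agr_def by blast
    next
      case False
      \<comment> \<open>The head of the list is the derivative taken last; the tail is sorted and of
        length at most k, hence labels a coordinate of J^k.\<close>
      then obtain i \<beta> where \<beta>: "\<alpha> = i # \<beta>" using \<alpha> by (cases \<alpha>) auto
      then have \<beta>': "\<beta> \<in> multiindices k (idx (bas Y))" "i \<in> idx (bas Y)" using \<alpha> by (auto simp: multiindices_def)
      have "agf (bas Y) 1 (\<lambda>y. Jco k Y D \<phi> \<eta> (sjet k Y y a) (Inr (l, \<beta>))) (\<lambda>y. Jco k Y D \<phi> \<eta> (sjet k Y y a') (Inr (l, \<beta>))) y"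
        using j W yW l \<beta>' unfolding jeq_def idx_Jet by blast
      then have "agr (idx (bas Y)) 1 (pds \<beta> ?f) (pds \<beta> ?g) (\<phi> y)"
        unfolding jeq_hol_aux[OF Y a aa D C l \<beta>'(1)] .
      then show ?thesis using \<beta>'(2) by (simp add: \<beta> agr_Suc agr_0)
    qed
  qed
qed

lemma hol_sjet:
  assumes Y: "fib Y" and a: "local_section Y y a"
  shows "hol k Y (sjet (Suc k) Y y a) = sjet 1 (Jet k Y) y (\<lambda>y. sjet k Y y a)"
  unfolding hol_def
proof (rule the_equality)
  fix Z assume "\<exists>y' a'. local_section Y y' a' \<and> sjet (Suc k) Y y a = sjet (Suc k) Y y' a' \<and>
     Z = sjet 1 (Jet k Y) y' (\<lambda>y. sjet k Y y a')"
  then obtain y' a' where a': "local_section Y y' a'" "sjet (Suc k) Y y a = sjet (Suc k) Y y' a'"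
     "Z = sjet 1 (Jet k Y) y' (\<lambda>y. sjet k Y y a')" by blast
  note d = jet_eqD[OF a'(2) local_sectionD(1)[OF fibD(1)[OF Y] a]]
  show "Z = sjet 1 (Jet k Y) y (\<lambda>y. sjet k Y y a)"
    unfolding a'(3) d(1) bas_Jet by (rule jet_eqI[OF jeq_sym[OF jeq_hol[OF Y a a'(1)[unfolded d(1)] d(2)]], symmetric, THEN sym])
qed (use a in blast)

section \<open>Families of sections\<close>

lemma eventually_prodmI:
  assumes N: "atlas N" and P: "atlas P" and ab: "a \<in> pts N" "b \<in> pts P"
    and Q: "eventually Q1 (nhdsin (mtop N) a)" "eventually Q2 (nhdsin (mtop P) b)"
  shows "eventually (\<lambda>p. Q1 (fst p) \<and> Q2 (snd p)) (nhdsin (mtop (prodm N P)) (a, b))"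
proof (rule eventually_conj)
  show "eventually (\<lambda>p. Q1 (fst p)) (nhdsin (mtop (prodm N P)) (a, b))"
    by (rule smooth_at_eventually[OF atlas_prodm[OF N P] N smooth_at_fst[OF N P ab]]) (simp add: Q)
  show "eventually (\<lambda>p. Q2 (snd p)) (nhdsin (mtop (prodm N P)) (a, b))"
    by (rule smooth_at_eventually[OF atlas_prodm[OF N P] P smooth_at_snd[OF N P ab]]) (simp add: Q)
qed

text \<open>The families \<open>u(t, _)\<close> to which \<open>exch\<close> refers, as a condition on germs.\<close>

definition fam :: "('p, 'j, 'e) fibm \<Rightarrow> (real \<Rightarrow> 'e \<Rightarrow> 'p) \<Rightarrow> 'e \<Rightarrow> bool" where
  "fam Y u y \<longleftrightarrow> y \<in> pts (bas Y) \<and> eventually (\<lambda>p.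
     smooth_at (prodm realline (bas Y)) (tot Y) (\<lambda>(t, y). u t y) p \<and> prj Y (u (fst p) (snd p)) = snd p)
     (nhdsin (mtop (prodm realline (bas Y))) (0, y))"

lemma pts_realline: "t \<in> pts realline"
  by (simp add: charts_realline)

lemma famE:
  assumes E: "atlas (bas Y)" and u: "fam Y u y"
  obtains Q1 Q2 where "eventually Q1 (nhds 0)" "eventually Q2 (nhdsin (mtop (bas Y)) y)"
    "\<And>t y. Q1 t \<Longrightarrow> Q2 y \<Longrightarrow> smooth_at (prodm realline (bas Y)) (tot Y) (\<lambda>(t, y). u t y) (t, y)"
    "\<And>t y. Q1 t \<Longrightarrow> Q2 y \<Longrightarrow> prj Y (u t y) = y"
proof -
  have y: "y \<in> pts (bas Y)" and ev: "eventually (\<lambda>p.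
     smooth_at (prodm realline (bas Y)) (tot Y) (\<lambda>(t, y). u t y) p \<and> prj Y (u (fst p) (snd p)) = snd p)
     (nhdsin (mtop (prodm realline (bas Y))) (0, y))" using u by (simp_all add: fam_def)
  obtain Q1 Q2 where Q: "eventually Q1 (nhdsin (mtop realline) 0)" "eventually Q2 (nhdsin (mtop (bas Y)) y)"
    "\<And>a b. Q1 a \<Longrightarrow> Q2 b \<Longrightarrow> smooth_at (prodm realline (bas Y)) (tot Y) (\<lambda>(t, y). u t y) (a, b) \<and> prj Y (u a b) = b"
    using eventually_prodm[OF atlas_realline E pts_realline y ev] by auto
  show ?thesis by (rule that[of Q1 Q2]) (use Q in \<open>auto simp: eventually_realline\<close>)
qed

lemma famI:
  assumes E: "atlas (bas Y)" and y: "y \<in> pts (bas Y)"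
    and "eventually Q1 (nhds 0)" "eventually Q2 (nhdsin (mtop (bas Y)) y)"
    "\<And>t y. Q1 t \<Longrightarrow> Q2 y \<Longrightarrow> smooth_at (prodm realline (bas Y)) (tot Y) (\<lambda>(t, y). u t y) (t, y)"
    "\<And>t y. Q1 t \<Longrightarrow> Q2 y \<Longrightarrow> prj Y (u t y) = y"
  shows "fam Y u y"
  unfolding fam_def
proof
  have "eventually (\<lambda>p. Q1 (fst p) \<and> Q2 (snd p)) (nhdsin (mtop (prodm realline (bas Y))) (0, y))"
    by (rule eventually_prodmI[OF atlas_realline E pts_realline y]) (use assms in \<open>simp_all add: eventually_realline\<close>)
  then show "eventually (\<lambda>p.
     smooth_at (prodm realline (bas Y)) (tot Y) (\<lambda>(t, y). u t y) p \<and> prj Y (u (fst p) (snd p)) = snd p)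
     (nhdsin (mtop (prodm realline (bas Y))) (0, y))"
    by (rule eventually_mono) (use assms(5,6) in auto)
qed (rule y)

text \<open>A neighbourhood of (0, y) contains a product of an interval and an open set W, which is
  the form in which \<open>exch\<close> states the condition.\<close>

lemma fam_iff:
  assumes E: "atlas (bas Y)"
  shows "fam Y u y \<longleftrightarrow> (\<exists>\<epsilon> W. 0 < \<epsilon> \<and> openin (mtop (bas Y)) W \<and> y \<in> W \<and>
     (\<forall>t\<in>{-\<epsilon><..<\<epsilon>}. \<forall>y'\<in>W.
        smooth_at (prodm realline (bas Y)) (tot Y) (\<lambda>(t, y). u t y) (t, y') \<and> prj Y (u t y') = y'))" (is "_ \<longleftrightarrow> ?R")
proof
  assume u: "fam Y u y"
  then have y: "y \<in> pts (bas Y)" by (simp add: fam_def)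
  obtain Q1 Q2 where Q: "eventually Q1 (nhds 0)" "eventually Q2 (nhdsin (mtop (bas Y)) y)"
    "\<And>t y. Q1 t \<Longrightarrow> Q2 y \<Longrightarrow> smooth_at (prodm realline (bas Y)) (tot Y) (\<lambda>(t, y). u t y) (t, y)"
    "\<And>t y. Q1 t \<Longrightarrow> Q2 y \<Longrightarrow> prj Y (u t y) = y" using famE[OF E u] by metis
  obtain \<epsilon> where "\<epsilon> > 0" "\<And>t. dist t 0 < \<epsilon> \<Longrightarrow> Q1 t" using Q(1) by (auto simp: eventually_nhds_metric)
  moreover obtain W where "openin (mtop (bas Y)) W" "y \<in> W" "\<And>y. y \<in> W \<Longrightarrow> Q2 y"
    using Q(2) y by (auto simp: eventually_nhdsin topspace_mtop[OF E])
  ultimately show ?R using Q(3,4) by (intro exI[of _ \<epsilon>] exI[of _ W]) (simp add: dist_real_def abs_less_iff)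
next
  assume ?R
  then obtain \<epsilon> W where W: "0 < \<epsilon>" "openin (mtop (bas Y)) W" "y \<in> W"
     "\<forall>t\<in>{-\<epsilon><..<\<epsilon>}. \<forall>y'\<in>W.
        smooth_at (prodm realline (bas Y)) (tot Y) (\<lambda>(t, y). u t y) (t, y') \<and> prj Y (u t y') = y'" by auto
  show "fam Y u y"
  proof (rule famI[OF E])
    show "y \<in> pts (bas Y)" using openin_subset[OF W(2)] W(3) topspace_mtop[OF E] by auto
    show "eventually (\<lambda>t. t \<in> {-\<epsilon><..<\<epsilon>}) (nhds 0)" using W(1) by (intro eventually_nhds_in_open) auto
    show "eventually (\<lambda>y. y \<in> W) (nhdsin (mtop (bas Y)) y)" using W by (auto simp: eventually_nhdsin)
  qed (use W(4) in auto)
qed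

lemma smooth_at_slice_t:
  assumes Y: "fib Y" and u: "smooth_at (prodm realline (bas Y)) (tot Y) (\<lambda>(t, y). u t y) (t, y)"
  shows "smooth_at realline (tot Y) (\<lambda>t. u t y) t"
proof -
  note E = fibD(1)[OF Y]
  have y: "y \<in> pts (bas Y)" using smooth_at_pts(1)[OF u] by (simp add: pts_prodm)
  have "smooth_at realline (prodm realline (bas Y)) (\<lambda>t. (t, y)) t"
    by (intro smooth_at_pair atlas_realline atlas_tame[OF atlas_realline] fibD(3)[OF Y] smooth_at_id smooth_at_const
        pts_realline y)
  from smooth_at_comp[OF atlas_tame[OF atlas_realline] atlas_tame[OF atlas_prodm[OF atlas_realline E]] fibD(2)[OF Y] this
      smooth_at_wsmooth[OF u atlas_tame[OF atlas_prodm[OF atlas_realline E]] fibD(2)[OF Y]]]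
  show ?thesis by simp
qed

lemma smooth_at_slice_y:
  assumes Y: "fib Y" and u: "smooth_at (prodm realline (bas Y)) (tot Y) (\<lambda>(t, y). u t y) (t, y)"
  shows "smooth_at (bas Y) (tot Y) (u t) y"
proof -
  note E = fibD(1)[OF Y]
  have y: "y \<in> pts (bas Y)" using smooth_at_pts(1)[OF u] by (simp add: pts_prodm)
  have "smooth_at (bas Y) (prodm realline (bas Y)) (\<lambda>y. (t, y)) y"
    by (intro smooth_at_pair E atlas_tame[OF atlas_realline] fibD(3)[OF Y] smooth_at_id smooth_at_const
        pts_realline y)
  from smooth_at_comp[OF fibD(3)[OF Y] atlas_tame[OF atlas_prodm[OF atlas_realline E]] fibD(2)[OF Y] this
      smooth_at_wsmooth[OF u atlas_tame[OF atlas_prodm[OF atlas_realline E]] fibD(2)[OF Y]]]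
  show ?thesis by simp
qed

lemma eventually_fam:
  assumes E: "atlas (bas Y)" and u: "fam Y u y" shows "eventually (fam Y u) (nhdsin (mtop (bas Y)) y)"
proof -
  obtain Q1 Q2 where Q: "eventually Q1 (nhds 0)" "eventually Q2 (nhdsin (mtop (bas Y)) y)"
    "\<And>t y. Q1 t \<Longrightarrow> Q2 y \<Longrightarrow> smooth_at (prodm realline (bas Y)) (tot Y) (\<lambda>(t, y). u t y) (t, y)"
    "\<And>t y. Q1 t \<Longrightarrow> Q2 y \<Longrightarrow> prj Y (u t y) = y" using famE[OF E u] by metis
  show ?thesis using eventually_eventually_mtop[OF Q(2)] eventually_pts[OF E, of y]
    by eventually_elim (rule famI[OF E _ Q(1) _ Q(3,4)])
qed

lemma fam_local_section:
  assumes Y: "fib Y" and u: "fam Y u y"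
  shows "eventually (\<lambda>t. local_section Y y (u t)) (nhds 0)"
proof -
  note E = fibD(1)[OF Y]
  have y: "y \<in> pts (bas Y)" using u by (simp add: fam_def)
  obtain Q1 Q2 where Q: "eventually Q1 (nhds 0)" "eventually Q2 (nhdsin (mtop (bas Y)) y)"
    "\<And>t y. Q1 t \<Longrightarrow> Q2 y \<Longrightarrow> smooth_at (prodm realline (bas Y)) (tot Y) (\<lambda>(t, y). u t y) (t, y)"
    "\<And>t y. Q1 t \<Longrightarrow> Q2 y \<Longrightarrow> prj Y (u t y) = y" using famE[OF E u] by metis
  show ?thesis using Q(1)
  proof eventually_elim
    case (elim t)
    show ?case
    proof (rule local_sectionI[OF E y])
      show "eventually (\<lambda>y'. smooth_at (bas Y) (tot Y) (u t) y' \<and> prj Y (u t y') = y') (nhdsin (mtop (bas Y)) y)"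
        using Q(2) by eventually_elim (use Q(3,4) elim smooth_at_slice_y[OF Y] in blast)
    qed
  qed
qed

lemma fam_local_section0: "fib Y \<Longrightarrow> fam Y u y \<Longrightarrow> local_section Y y (u 0)"
  using eventually_nhds_x_imp_x[OF fam_local_section] .

lemma fam_smooth0: "fib Y \<Longrightarrow> fam Y u y \<Longrightarrow> smooth_at (prodm realline (bas Y)) (tot Y) (\<lambda>(t, y). u t y) (0, y)"
  using eventually_mtop_self[OF atlas_prodm[OF atlas_realline], of "bas Y" "(0, y)"]
  by (auto simp: fam_def fib_def pts_prodm charts_realline)

lemma fam_vcurve:
  assumes Y: "fib Y" and u: "fam Y u y" shows "vcurve Y (\<lambda>t. u t y)"
  unfolding vcurve_def
proof
  note E = fibD(1)[OF Y]
  show "curve (tot Y) (\<lambda>t. u t y)" unfolding curve_def by (rule smooth_at_slice_t[OF Y fam_smooth0[OF Y u]])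
  have p0: "prj Y (u 0 y) = y" using local_sectionD(2)[OF E fam_local_section0[OF Y u]] .
  have "eventually (\<lambda>t. prj Y (u t y) = y) (nhds 0)"
    using fam_local_section[OF Y u] by eventually_elim (rule local_sectionD(2)[OF E])
  then show "jeq 1 realline (bas Y) 0 (\<lambda>t. prj Y (u t y)) (\<lambda>_. prj Y (u 0 y))"
    by (intro jeq_cong[OF atlas_realline pts_realline]) (simp add: eventually_realline p0)
qed

text \<open>The coordinate expression of the family as one function of time (\<open>Inl ()\<close>)
  and base coordinates (\<open>Inr\<close>), so that time and base derivatives are partial
  derivatives of the same function.\<close>

definition joint :: "('p \<Rightarrow> 'j \<Rightarrow> real) \<Rightarrow> (real \<Rightarrow> 'e \<Rightarrow> 'p) \<Rightarrow> 'j \<Rightarrow> 'e set \<Rightarrow> ('e \<Rightarrow> nat \<Rightarrow> real) \<Rightarrow>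
    (unit + nat \<Rightarrow> real) \<Rightarrow> real" where
  "joint \<eta> u j D \<phi> x = \<eta> (u (x (Inl ())) (inv_into D \<phi> (x \<circ> Inr))) j"

lemma joint_slice: "joint \<eta> u j D \<phi> (case_sum (\<lambda>_. t) x) = \<eta> (u t (inv_into D \<phi> x)) j"
  by (simp add: joint_def case_sum_comp)

lemma pds_joint_slice:
  "pds \<alpha> (\<lambda>x. \<eta> (u t (inv_into D \<phi> x)) j) x = pds (map Inr \<alpha>) (joint \<eta> u j D \<phi>) (case_sum (\<lambda>_. t) x)"
  using pds_case_sum[of \<alpha> "joint \<eta> u j D \<phi>" "\<lambda>_. t" x] by (simp add: joint_slice)

lemma pd_Inl: "pd (Inl ()) K (case_sum (\<lambda>_. 0) x) = deriv (\<lambda>t. K (case_sum (\<lambda>_. t) x)) 0"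
proof -
  have "(case_sum (\<lambda>_. 0) x)(Inl () := t) = case_sum (\<lambda>_. t) x" for t :: real
    by (auto simp: fun_eq_iff split: sum.split)
  then show ?thesis by (simp add: pd_def)
qed

lemma vel_joint: "vel \<eta> (\<lambda>t. u t (inv_into D \<phi> x)) j = pd (Inl ()) (joint \<eta> u j D \<phi>) (case_sum (\<lambda>_. 0) x)"
  by (simp add: pd_Inl joint_slice vel_def)

lemma fam_joint:
  assumes Y: "fib Y" and u: "fam Y u y" and D: "(D, \<phi>) \<in> charts (bas Y)" "y \<in> D"
    and C: "(C, \<eta>) \<in> charts (tot Y)" "u 0 y \<in> C" and j: "j \<in> idx (tot Y)"
  shows "sm ({()} <+> idx (bas Y)) (joint \<eta> u j D \<phi>) (case_sum (\<lambda>_. 0) (\<phi> y))"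
proof -
  note E = fibD(1)[OF Y]
  note RE = atlas_prodm[OF atlas_realline E]
  have cD: "compatible (bas Y) (D, \<phi>)" using atlas_compatible[OF E D(1)] .
  let ?\<Psi> = "\<lambda>(t, y). case_sum ((\<lambda>t _. t) t) (\<phi> y)"
  have c: "compatible (prodm realline (bas Y)) (UNIV \<times> D, ?\<Psi>)"
    by (rule compatible_prodm[OF atlas_realline E compatible_realline cD])
  have "smf (prodm realline (bas Y)) (\<lambda>p. \<eta> ((\<lambda>(t, y). u t y) p) j) (0, y)"
    by (rule smooth_atD(2)[OF fam_smooth0[OF Y u] RE fibD(2)[OF Y] C(1) _ j]) (simp add: C(2))
  then have "sm ({()} <+> idx (bas Y)) (\<lambda>x. \<eta> ((\<lambda>(t, y). u t y) (inv_into (UNIV \<times> D) ?\<Psi> x)) j) (?\<Psi> (0, y))"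
    using smf_iff[OF RE c, of "(0, y)"] D(2) by (simp add: idx_prodm charts_realline)
  then have "sm ({()} <+> idx (bas Y)) (joint \<eta> u j D \<phi>) (?\<Psi> (0, y))"
  proof (rule sm_cong)
    have "(0, y) \<in> UNIV \<times> D" using D(2) by simp
    from eventually_chart[OF c this]
    show "eventually (\<lambda>x. \<eta> ((\<lambda>(t, y). u t y) (inv_into (UNIV \<times> D) ?\<Psi> x)) j = joint \<eta> u j D \<phi> x)
        (near ({()} <+> idx (bas Y)) (?\<Psi> (0, y)))"
      unfolding idx_prodm charts_realline
    proof eventually_elim
      case (elim x)
      then obtain t z where tz: "z \<in> D" "x = ?\<Psi> (t, z)" by auto
      have "inv_into (UNIV \<times> D) ?\<Psi> x = (t, z)"
        using inv_into_prod[OF compatible_dom(2)[OF compatible_realline] compatible_dom(2)[OF cD], of t z] tz by simp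
      then show ?case using tz compatible_dom(2)[OF cD] by (simp add: joint_def case_sum_comp)
    qed
  qed
  then show ?thesis by simp
qed

text \<open>Base derivatives of the velocity are time derivatives of base derivatives: the time
  direction, differentiated first on the left, is moved to the front of the list by symmetry. The
  exchange map rests on this identity.\<close>

lemma pds_vel_joint:
  assumes fin: "finite I" and sm: "sm ({()} <+> I) (joint \<eta> u j D \<phi>) (case_sum (\<lambda>_. 0) x)" and \<alpha>: "\<alpha> \<in> lists I"
  shows "pds \<alpha> (\<lambda>x. vel \<eta> (\<lambda>t. u t (inv_into D \<phi> x)) j) x
    = pd (Inl ()) (pds (map Inr \<alpha>) (joint \<eta> u j D \<phi>)) (case_sum (\<lambda>_. 0) x)"
proof -
  let ?K = "joint \<eta> u j D \<phi>"
  have "pds \<alpha> (\<lambda>x. vel \<eta> (\<lambda>t. u t (inv_into D \<phi> x)) j) x = pds (map Inr \<alpha>) (pd (Inl ()) ?K) (case_sum (\<lambda>_. 0) x)"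
    unfolding vel_joint by (rule pds_case_sum)
  also have "\<dots> = pds (map Inr \<alpha> @ [Inl ()]) ?K (case_sum (\<lambda>_. 0) x)" by (simp add: pds_append)
  also have "\<dots> = pds (Inl () # map Inr \<alpha>) ?K (case_sum (\<lambda>_. 0) x)"
    by (rule pds_perm[OF _ _ _ sm]) (use fin \<alpha> in auto)
  finally show ?thesis by simp
qed

text \<open>Near t = 0 the jet coordinates of u(t, _) at y are base derivatives of
  \<open>joint\<close> at (t, \<phi> y), smooth in t. The source is constantly y, whence the zero
  components along the base.\<close>

lemma fam_sjet:
  assumes Y: "fib Y" and u: "fam Y u y"
  shows "vcurve (Jet s Y) (\<lambda>t. sjet s Y y (u t))"
    and "\<And>D \<phi> C \<eta>. (D, \<phi>) \<in> charts (bas Y) \<Longrightarrow> y \<in> D \<Longrightarrow> (C, \<eta>) \<in> charts (tot Y) \<Longrightarrow> u 0 y \<in> C \<Longrightarrow>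
      vel (Jco s Y D \<phi> \<eta>) (\<lambda>t. sjet s Y y (u t)) = case_sum (\<lambda>_. 0)
       (\<lambda>(j, \<alpha>). if j \<in> idx (tot Y) \<and> \<alpha> \<in> multiindices s (idx (bas Y))
          then pd (Inl ()) (pds (map Inr \<alpha>) (joint \<eta> u j D \<phi>)) (case_sum (\<lambda>_. 0) (\<phi> y)) else 0)"
proof -
  note E = fibD(1)[OF Y]
  let ?c = "\<lambda>t. sjet s Y y (u t)"
  have y: "y \<in> pts (bas Y)" using u by (simp add: fam_def)
  note u0 = fam_local_section0[OF Y u]
  have ev: "eventually (\<lambda>t. local_section Y y (u t) \<and> u t y \<in> C) (nhds 0)"
    if "(C, \<eta>) \<in> charts (tot Y)" "u 0 y \<in> C" for C \<eta>
    using fam_local_section[OF Y u] curveD(1)[OF vcurve_curve[OF fam_vcurve[OF Y u]] fibD(2)[OF Y] that]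
    by (rule eventually_conj)
  have co: "eventually (\<lambda>t. case_sum (\<phi> y)
       (\<lambda>(j, \<alpha>). if j \<in> idx (tot Y) \<and> \<alpha> \<in> multiindices s (idx (bas Y))
          then pds (map Inr \<alpha>) (joint \<eta> u j D \<phi>) (case_sum (\<lambda>_. t) (\<phi> y)) else 0) = Jco s Y D \<phi> \<eta> (?c t)) (nhds 0)"
    if D: "(D, \<phi>) \<in> charts (bas Y)" "y \<in> D" and C: "(C, \<eta>) \<in> charts (tot Y)" "u 0 y \<in> C" for D \<phi> C \<eta>
    using ev[OF C]
  proof eventually_elim
    case (elim t)
    then show ?case unfolding Jco_sjet[OF E local_sectionD(1)[OF E conjunct1[OF elim]] D C(1) conjunct2[OF elim]]
      by (simp only: pds_joint_slice cong: if_cong)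
  qed
  have sm: "sm ({()} <+> idx (bas Y)) (pds (map Inr \<alpha>) (joint \<eta> u j D \<phi>)) (case_sum (\<lambda>_. 0) (\<phi> y))"
    if "(D, \<phi>) \<in> charts (bas Y)" "y \<in> D" "(C, \<eta>) \<in> charts (tot Y)" "u 0 y \<in> C"
      "j \<in> idx (tot Y)" "\<alpha> \<in> multiindices s (idx (bas Y))" for D \<phi> C \<eta> j \<alpha>
    by (rule sm_pds[OF fam_joint[OF Y u that(1-5)]]) (use multiindices_lists(1)[OF that(6)] in auto)
  show "vel (Jco s Y D \<phi> \<eta>) ?c = case_sum (\<lambda>_. 0)
       (\<lambda>(j, \<alpha>). if j \<in> idx (tot Y) \<and> \<alpha> \<in> multiindices s (idx (bas Y))
          then pd (Inl ()) (pds (map Inr \<alpha>) (joint \<eta> u j D \<phi>)) (case_sum (\<lambda>_. 0) (\<phi> y)) else 0)"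
    if D: "(D, \<phi>) \<in> charts (bas Y)" "y \<in> D" and C: "(C, \<eta>) \<in> charts (tot Y)" "u 0 y \<in> C" for D \<phi> C \<eta>
  proof
    fix i
    have "vel (Jco s Y D \<phi> \<eta>) ?c i = deriv (\<lambda>t. case_sum (\<phi> y)
       (\<lambda>(j, \<alpha>). if j \<in> idx (tot Y) \<and> \<alpha> \<in> multiindices s (idx (bas Y))
          then pds (map Inr \<alpha>) (joint \<eta> u j D \<phi>) (case_sum (\<lambda>_. t) (\<phi> y)) else 0) i) 0"
      unfolding vel_def by (rule deriv_cong_ev) (use co[OF D C] in eventually_elim, simp, simp)
    then show "vel (Jco s Y D \<phi> \<eta>) ?c i = case_sum (\<lambda>_. 0)
       (\<lambda>(j, \<alpha>). if j \<in> idx (tot Y) \<and> \<alpha> \<in> multiindices s (idx (bas Y))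
          then pd (Inl ()) (pds (map Inr \<alpha>) (joint \<eta> u j D \<phi>)) (case_sum (\<lambda>_. 0) (\<phi> y)) else 0) i"
      by (auto simp: pd_Inl split: sum.split)
  qed
  show "vcurve (Jet s Y) ?c"
    unfolding vcurve_def
  proof
    show "jeq 1 realline (bas (Jet s Y)) 0 (\<lambda>t. prj (Jet s Y) (?c t)) (\<lambda>_. prj (Jet s Y) (?c 0))"
      by (simp add: jeq_refl)
    show "curve (tot (Jet s Y)) ?c"
      unfolding curve_def
    proof (rule smooth_atI[OF atlas_realline tame_Jet[OF Y] pts_realline])
      show "?c 0 \<in> pts (tot (Jet s Y))" using u0 by (auto simp: pts_Jet[OF E])
      fix W \<Psi> assume W: "(W, \<Psi>) \<in> charts (tot (Jet s Y))" "?c 0 \<in> W"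
      obtain D \<phi> C \<eta> where w: "W = Jdom s Y D C" "\<Psi> = Jco s Y D \<phi> \<eta>" and D: "(D, \<phi>) \<in> charts (bas Y)"
        and C: "(C, \<eta>) \<in> charts (tot Y)" using Jet_chartE[OF W(1) E] .
      have yD: "y \<in> D" "u 0 y \<in> C" using W(2) unfolding w sjet_Jdom[OF E u0] by auto
      show "eventually (\<lambda>t. ?c t \<in> W) (nhdsin (mtop realline) 0)"
        unfolding eventually_realline using ev[OF C yD(2)]
        by eventually_elim (simp add: w sjet_Jdom[OF E] yD)
      fix i assume i: "i \<in> idx (tot (Jet s Y))"
      have "smf realline (\<lambda>t. case_sum (\<phi> y)
       (\<lambda>(j, \<alpha>). if j \<in> idx (tot Y) \<and> \<alpha> \<in> multiindices s (idx (bas Y))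
          then pds (map Inr \<alpha>) (joint \<eta> u j D \<phi>) (case_sum (\<lambda>_. t) (\<phi> y)) else 0) i) 0"
      proof (cases i)
        case (Inl m)
        then show ?thesis by (simp add: smf_const[OF atlas_realline pts_realline])
      next
        case (Inr p)
        obtain j \<alpha> where p: "p = (j, \<alpha>)" by (cases p)
        then have j: "j \<in> idx (tot Y)" "\<alpha> \<in> multiindices s (idx (bas Y))" using i Inr by (auto simp: idx_Jet)
        have "smf realline (\<lambda>t. pds (map Inr \<alpha>) (joint \<eta> u j D \<phi>) (case_sum (\<lambda>_. t) (\<phi> y))) 0"
        proof (rule smf_comp[where J = "{()} <+> idx (bas Y)" and H = "\<lambda>t. case_sum (\<lambda>_. t) (\<phi> y)", OF atlas_realline])
          show "sm ({()} <+> idx (bas Y)) (pds (map Inr \<alpha>) (joint \<eta> u j D \<phi>)) (case_sum (\<lambda>_. 0) (\<phi> y))"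
            by (rule sm[OF D yD(1) C yD(2) j])
          show "finite ({()} <+> idx (bas Y))" using atlas_finite[OF E] by simp
          show "smf realline (\<lambda>t. case_sum (\<lambda>_. t) (\<phi> y) k) 0" for k
            using smf_coord[OF atlas_realline compatible_realline UNIV_I, where z = 0]
            by (cases k) (auto intro: smf_const[OF atlas_realline pts_realline])
          show "eventually (\<lambda>t. case_sum (\<lambda>_. t) (\<phi> y) \<in> Euc ({()} <+> idx (bas Y))) (nhdsin (mtop realline) 0)"
            using tame_Euc[OF fibD(3)[OF Y] D yD(1)] by (simp add: Euc_sum case_sum_comp Euc_unit)
        qed (rule pts_realline)
        then show ?thesis using Inr p j by simp
      qed
      then show "smf realline (\<lambda>t. \<Psi> (?c t) i) 0"
        by (rule smf_cong[OF atlas_realline])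
          (unfold eventually_realline w, use co[OF D yD(1) C yD(2)] in eventually_elim, simp)
    qed
  qed
qed

lemma Vco_fam:
  assumes "fib Y" "fam Y u y" "(C, \<eta>) \<in> charts (tot Y)" "u 0 y \<in> C"
  shows "Vco \<eta> (tvec (tot Y) (\<lambda>t. u t y)) = case_sum (\<eta> (u 0 y)) (vel \<eta> (\<lambda>t. u t y))"
  by (rule Vco_tvec[OF vcurve_curve[OF fam_vcurve[OF assms(1,2)]] assms(1,3,4)])

section \<open>The velocity field of a family\<close>

lemma fam_velocity_section:
  assumes Y: "fib Y" and u: "fam Y u y"
  shows "local_section (Vert Y) y (\<lambda>y. tvec (tot Y) (\<lambda>t. u t y))"
proof -
  note E = fibD(1)[OF Y]
  have sm: "smooth_at (bas Y) (tot (Vert Y)) (\<lambda>y. tvec (tot Y) (\<lambda>t. u t y)) y" if u: "fam Y u y" for y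
  proof (rule smooth_atI[OF E fibD(2)[OF fib_Vert[OF Y]]])
    show y: "y \<in> pts (bas Y)" using u by (simp add: fam_def)
    show "tvec (tot Y) (\<lambda>t. u t y) \<in> pts (tot (Vert Y))" using fam_vcurve[OF Y u] by (auto simp: pts_Vert[OF Y])
    fix W \<Psi> assume W: "(W, \<Psi>) \<in> charts (tot (Vert Y))" "tvec (tot Y) (\<lambda>t. u t y) \<in> W"
    obtain C \<eta> where w: "W = Vdom Y C" "\<Psi> = Vco \<eta>" and C: "(C, \<eta>) \<in> charts (tot Y)"
      using W(1) unfolding charts_Vert[OF Y] by blast
    have yC: "u 0 y \<in> C" using tvec_Vdom[OF vcurve_curve[OF fam_vcurve[OF Y u]] W(2)[unfolded w]] .
    obtain D \<phi> where D: "(D, \<phi>) \<in> charts (bas Y)" "y \<in> D" using atlas_chart[OF E y] by blast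
    have cD: "compatible (bas Y) (D, \<phi>)" using atlas_compatible[OF E D(1)] .
    note u0 = fam_local_section0[OF Y u]
    have ev: "eventually (\<lambda>y. fam Y u y \<and> u 0 y \<in> C \<and> y \<in> D) (nhdsin (mtop (bas Y)) y)"
      using eventually_fam[OF E u] eventually_in_chart[OF Y u0 D C yC] by eventually_elim simp
    show "eventually (\<lambda>y. tvec (tot Y) (\<lambda>t. u t y) \<in> W) (nhdsin (mtop (bas Y)) y)"
      using ev by eventually_elim (use fam_vcurve[OF Y] in \<open>auto simp: w Vdom_def\<close>)
    fix i assume i: "i \<in> idx (tot (Vert Y))"
    have co: "eventually (\<lambda>y. case_sum (\<eta> (u 0 y)) (vel \<eta> (\<lambda>t. u t y)) i = \<Psi> (tvec (tot Y) (\<lambda>t. u t y)) i) (nhdsin (mtop (bas Y)) y)"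
      using ev by eventually_elim (simp add: w Vco_fam[OF Y _ C])
    have "smf (bas Y) (\<lambda>y. case_sum (\<eta> (u 0 y)) (vel \<eta> (\<lambda>t. u t y)) i) y"
    proof (cases i)
      case (Inl j)
      then show ?thesis using smooth_atD(2)[OF local_sectionD(1)[OF E u0] E fibD(2)[OF Y] C yC] i by (auto simp: idx_Vert)
    next
      case (Inr j)
      then have j: "j \<in> idx (tot Y)" using i by (auto simp: idx_Vert)
      have "smf (bas Y) (\<lambda>y. pd (Inl ()) (joint \<eta> u j D \<phi>) (case_sum (\<lambda>_. 0) (\<phi> y))) y"
      proof (rule smf_comp[where J = "{()} <+> idx (bas Y)" and H = "\<lambda>y. case_sum (\<lambda>_. 0) (\<phi> y)", OF E])
        show "finite ({()} <+> idx (bas Y))" using atlas_finite[OF E] by simp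
        show "sm ({()} <+> idx (bas Y)) (pd (Inl ()) (joint \<eta> u j D \<phi>)) (case_sum (\<lambda>_. 0) (\<phi> y))"
          by (rule sm_pd[OF fam_joint[OF Y u D C yC j]]) auto
        show "smf (bas Y) (\<lambda>y. case_sum (\<lambda>_. 0) (\<phi> y) k) y" for k
          using smf_coord[OF E cD D(2)] by (cases k) (auto intro: smf_const[OF E y])
        show "eventually (\<lambda>y. case_sum (\<lambda>_. 0) (\<phi> y) \<in> Euc ({()} <+> idx (bas Y))) (nhdsin (mtop (bas Y)) y)"
          using ev by eventually_elim (use tame_Euc[OF fibD(3)[OF Y] D(1)] in \<open>simp add: Euc_sum case_sum_comp Euc_unit\<close>)
      qed (rule y)
      then have "smf (bas Y) (\<lambda>y. vel \<eta> (\<lambda>t. u t y) j) y"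
      proof (rule smf_cong[OF E])
        show "eventually (\<lambda>y. pd (Inl ()) (joint \<eta> u j D \<phi>) (case_sum (\<lambda>_. 0) (\<phi> y)) = vel \<eta> (\<lambda>t. u t y) j) (nhdsin (mtop (bas Y)) y)"
          using ev
        proof eventually_elim
          case (elim z)
          then have "inv_into D \<phi> (\<phi> z) = z" using compatible_dom(2)[OF cD] by simp
          then show ?case using vel_joint[of \<eta> u D \<phi> "\<phi> z" j] by simp
        qed
      qed
      then show ?thesis using Inr by simp
    qed
    then show "smf (bas Y) (\<lambda>y. \<Psi> (tvec (tot Y) (\<lambda>t. u t y)) i) y" by (rule smf_cong[OF E]) (rule co)
  qed
  show ?thesis
  proof (rule local_sectionI)
    show "atlas (bas (Vert Y))" using E by simp
    show "y \<in> pts (bas (Vert Y))" using u by (simp add: fam_def)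
    show "eventually (\<lambda>y. smooth_at (bas (Vert Y)) (tot (Vert Y)) (\<lambda>y. tvec (tot Y) (\<lambda>t. u t y)) y \<and>
        prj (Vert Y) (tvec (tot Y) (\<lambda>t. u t y)) = y) (nhdsin (mtop (bas (Vert Y))) y)"
      unfolding bas_Vert using eventually_fam[OF E u]
    proof eventually_elim
      case (elim z)
      then show ?case using sm foot_tvec[OF vcurve_curve[OF fam_vcurve[OF Y elim]]]
          local_sectionD(2)[OF E fam_local_section0[OF Y elim]] by (simp add: prj_Vert)
    qed
  qed
qed

lemma foot_velocity:
  "fib Y \<Longrightarrow> fam Y u y \<Longrightarrow> foot (tvec (tot Y) (\<lambda>t. u t y)) = u 0 y"
  using foot_tvec[OF vcurve_curve[OF fam_vcurve]] .

lemma foot_sjet: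
  "fib Y \<Longrightarrow> fam Y u y \<Longrightarrow> foot (tvec (tot (Jet s Y)) (\<lambda>t. sjet s Y y (u t))) = sjet s Y y (u 0)"
  using foot_tvec[OF vcurve_curve[OF fam_sjet(1)]] .

text \<open>The foot coordinates of the velocity field see u(0, _), the remaining ones see
  derivatives of the family with exactly one derivative in t.\<close>

lemma Vco_velocity_agr:
  assumes Y: "fib Y" and u: "fam Y u y" and D: "(D, \<phi>) \<in> charts (bas Y)" "y \<in> D"
    and C: "(C, \<eta>) \<in> charts (tot Y)" "u 0 y \<in> C" and j: "j \<in> idx (tot Y)" and \<alpha>: "\<alpha> \<in> lists (idx (bas Y))"
  shows "pds \<alpha> (\<lambda>x. Vco \<eta> (tvec (tot Y) (\<lambda>t. u t (inv_into D \<phi> x))) (Inl j)) (\<phi> y)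
      = pds \<alpha> (\<lambda>x. \<eta> (u 0 (inv_into D \<phi> x)) j) (\<phi> y)" (is ?A)
    and "pds \<alpha> (\<lambda>x. Vco \<eta> (tvec (tot Y) (\<lambda>t. u t (inv_into D \<phi> x))) (Inr j)) (\<phi> y)
      = pd (Inl ()) (pds (map Inr \<alpha>) (joint \<eta> u j D \<phi>)) (case_sum (\<lambda>_. 0) (\<phi> y))" (is ?B)
proof -
  note E = fibD(1)[OF Y]
  have cD: "compatible (bas Y) (D, \<phi>)" using atlas_compatible[OF E D(1)] .
  have y: "\<phi> y \<in> Euc (idx (bas Y))" using tame_Euc[OF fibD(3)[OF Y] D] .
  have "eventually (\<lambda>y. fam Y u y \<and> u 0 y \<in> C) (nhdsin (mtop (bas Y)) y)"
    using eventually_fam[OF E u] eventually_in_chart[OF Y fam_local_section0[OF Y u] D C] by eventually_elim simp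
  from this[unfolded eventually_mtop[OF E cD D(2)]]
  have ev: "eventually (\<lambda>x. Vco \<eta> (tvec (tot Y) (\<lambda>t. u t (inv_into D \<phi> x))) =
     case_sum (\<eta> (u 0 (inv_into D \<phi> x))) (vel \<eta> (\<lambda>t. u t (inv_into D \<phi> x)))) (near (idx (bas Y)) (\<phi> y))"
    by eventually_elim (rule Vco_fam[OF Y _ C(1)], simp_all)
  show ?A by (rule pds_cong[OF _ y \<alpha>]) (use ev in eventually_elim, simp)
  have "pds \<alpha> (\<lambda>x. Vco \<eta> (tvec (tot Y) (\<lambda>t. u t (inv_into D \<phi> x))) (Inr j)) (\<phi> y)
      = pds \<alpha> (\<lambda>x. vel \<eta> (\<lambda>t. u t (inv_into D \<phi> x)) j) (\<phi> y)"
    by (rule pds_cong[OF _ y \<alpha>]) (use ev in eventually_elim, simp)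
  then show ?B unfolding pds_vel_joint[OF atlas_finite[OF E] fam_joint[OF Y u D C j] \<alpha>] .
qed

lemma Vert_chart: "fib Y \<Longrightarrow> (C, \<eta>) \<in> charts (tot Y) \<Longrightarrow> (Vdom Y C, Vco \<eta>) \<in> charts (tot (Vert Y))"
  by (auto simp: charts_Vert)

text \<open>Read from left to right this makes the exchange map well defined, from right to left
  injective.\<close>

lemma jeq_velocity:
  assumes Y: "fib Y" and u: "fam Y u y" and u': "fam Y u' y"
  shows "jeq 1 realline (tot (Jet s Y)) 0 (\<lambda>t. sjet s Y y (u t)) (\<lambda>t. sjet s Y y (u' t)) \<longleftrightarrow>
    jeq s (bas Y) (tot (Vert Y)) y (\<lambda>y. tvec (tot Y) (\<lambda>t. u t y)) (\<lambda>y. tvec (tot Y) (\<lambda>t. u' t y))" (is "?L \<longleftrightarrow> ?R")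
proof -
  note E = fibD(1)[OF Y]
  have y: "y \<in> pts (bas Y)" using u by (simp add: fam_def)
  note u0 = fam_local_section0[OF Y u] fam_local_section0[OF Y u']
  note b = fam_velocity_section[OF Y u] fam_velocity_section[OF Y u']
  \<comment> \<open>The coordinate content common to both relations: base derivatives of order at
    most s of the family at t = 0, each taken without and with one derivative in t.\<close>
  define P where "P \<longleftrightarrow> u' 0 y = u 0 y \<and> (\<forall>D \<phi> C \<eta> j \<alpha>. (D, \<phi>) \<in> charts (bas Y) \<longrightarrow> y \<in> D \<longrightarrow>
    (C, \<eta>) \<in> charts (tot Y) \<longrightarrow> u 0 y \<in> C \<longrightarrow> j \<in> idx (tot Y) \<longrightarrow> \<alpha> \<in> multiindices s (idx (bas Y)) \<longrightarrow>
    pds \<alpha> (\<lambda>x. \<eta> (u 0 (inv_into D \<phi> x)) j) (\<phi> y) = pds \<alpha> (\<lambda>x. \<eta> (u' 0 (inv_into D \<phi> x)) j) (\<phi> y) \<and>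
    pd (Inl ()) (pds (map Inr \<alpha>) (joint \<eta> u j D \<phi>)) (case_sum (\<lambda>_. 0) (\<phi> y)) =
    pd (Inl ()) (pds (map Inr \<alpha>) (joint \<eta> u' j D \<phi>)) (case_sum (\<lambda>_. 0) (\<phi> y)))"
  have "?L \<longleftrightarrow> P"
  proof
    assume L: ?L
    then have s0: "sjet s Y y (u 0) = sjet s Y y (u' 0)" by (simp add: jeq_def)
    have j0: "jeq s (bas Y) (tot Y) y (u 0) (u' 0)" by (rule jet_eqD(2)[OF s0 local_sectionD(1)[OF E u0(1)]])
    have e: "u' 0 y = u 0 y" using j0 by (simp add: jeq_def)
    show P unfolding P_def
    proof (intro conjI allI impI e)
      fix D \<phi> C \<eta> j \<alpha> assume D: "(D, \<phi>) \<in> charts (bas Y)" "y \<in> D"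
        and C: "(C, \<eta>) \<in> charts (tot Y)" "u 0 y \<in> C" and j: "j \<in> idx (tot Y)" "\<alpha> \<in> multiindices s (idx (bas Y))"
      have "agf (bas Y) s (\<lambda>y. \<eta> (u 0 y) j) (\<lambda>y. \<eta> (u' 0 y) j) y" using j0 C j(1) unfolding jeq_def by blast
      then show "pds \<alpha> (\<lambda>x. \<eta> (u 0 (inv_into D \<phi> x)) j) (\<phi> y) = pds \<alpha> (\<lambda>x. \<eta> (u' 0 (inv_into D \<phi> x)) j) (\<phi> y)"
        using D multiindices_lists[OF j(2)] by (simp add: agf_def agr_def)
      have "Inr (j, \<alpha>) \<in> idx (tot (Jet s Y))" "sjet s Y y (u 0) \<in> Jdom s Y D C"
        using j sjet_Jdom[OF E u0(1), of s D C] D C by (auto simp: idx_Jet)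
      from conjunct2[OF L[unfolded jeq_vel], rule_format, OF Jdom_Jco_chart[OF E D(1) C(1)] this(2,1)]
      have "vel (Jco s Y D \<phi> \<eta>) (\<lambda>t. sjet s Y y (u' t)) (Inr (j, \<alpha>)) = vel (Jco s Y D \<phi> \<eta>) (\<lambda>t. sjet s Y y (u t)) (Inr (j, \<alpha>))" .
      then show "pd (Inl ()) (pds (map Inr \<alpha>) (joint \<eta> u j D \<phi>)) (case_sum (\<lambda>_. 0) (\<phi> y)) =
        pd (Inl ()) (pds (map Inr \<alpha>) (joint \<eta> u' j D \<phi>)) (case_sum (\<lambda>_. 0) (\<phi> y))"
        unfolding fam_sjet(2)[OF Y u D C] fam_sjet(2)[OF Y u' D C(1) C(2)[folded e]] using j by simp
    qed
  next
    assume P: P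
    then have e: "u' 0 y = u 0 y" by (simp add: P_def)
    have "jeq s (bas Y) (tot Y) y (u 0) (u' 0)"
      unfolding jeq_def agf_def
    proof (intro conjI allI impI e)
      fix C \<eta> j D \<phi> assume D: "(D, \<phi>) \<in> charts (bas Y)" "y \<in> D"
        and C: "(C, \<eta>) \<in> charts (tot Y)" "u 0 y \<in> C" and j: "j \<in> idx (tot Y)"
      show "agr (idx (bas Y)) s (\<lambda>x. \<eta> (u 0 (inv_into D \<phi> x)) j) (\<lambda>x. \<eta> (u' 0 (inv_into D \<phi> x)) j) (\<phi> y)"
        by (rule agr_sorted[OF atlas_finite[OF E] section_sm[OF Y u0(1) D C j] section_sm[OF Y u0(2) D C(1) C(2)[folded e] j]])
          (use P D C j in \<open>simp add: P_def\<close>)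
    qed
    then have s0: "sjet s Y y (u 0) = sjet s Y y (u' 0)" by (rule jet_eqI)
    show ?L unfolding jeq_vel
    proof (intro conjI allI impI)
      show "sjet s Y y (u' 0) = sjet s Y y (u 0)" using s0 by simp
      fix W \<Psi> i assume W: "(W, \<Psi>) \<in> charts (tot (Jet s Y))" "sjet s Y y (u 0) \<in> W" and i: "i \<in> idx (tot (Jet s Y))"
      obtain D \<phi> C \<eta> where w: "W = Jdom s Y D C" "\<Psi> = Jco s Y D \<phi> \<eta>" and D: "(D, \<phi>) \<in> charts (bas Y)"
        and C: "(C, \<eta>) \<in> charts (tot Y)" using Jet_chartE[OF W(1) E] .
      have yD: "y \<in> D" "u 0 y \<in> C" using W(2) unfolding w sjet_Jdom[OF E u0(1)] by auto
      show "vel \<Psi> (\<lambda>t. sjet s Y y (u' t)) i = vel \<Psi> (\<lambda>t. sjet s Y y (u t)) i"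
        unfolding w fam_sjet(2)[OF Y u D yD(1) C yD(2)] fam_sjet(2)[OF Y u' D yD(1) C yD(2)[folded e]]
        using P D C yD unfolding P_def by (auto split: sum.split)
    qed
  qed
  moreover have "?R \<longleftrightarrow> P"
  proof
    assume R: ?R
    have e: "u' 0 y = u 0 y"
      using R foot_velocity[OF Y u] foot_velocity[OF Y u'] by (simp add: jeq_def)
    show P unfolding P_def
    proof (intro conjI allI impI e)
      fix D \<phi> C \<eta> j \<alpha> assume D: "(D, \<phi>) \<in> charts (bas Y)" "y \<in> D"
        and C: "(C, \<eta>) \<in> charts (tot Y)" "u 0 y \<in> C" and j: "j \<in> idx (tot Y)" "\<alpha> \<in> multiindices s (idx (bas Y))"
      note \<alpha> = multiindices_lists[OF j(2)]
      have v: "tvec (tot Y) (\<lambda>t. u t y) \<in> Vdom Y C" using fam_vcurve[OF Y u] C by (auto simp: Vdom_def)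
      have a: "agf (bas Y) s (\<lambda>y. Vco \<eta> (tvec (tot Y) (\<lambda>t. u t y)) i) (\<lambda>y. Vco \<eta> (tvec (tot Y) (\<lambda>t. u' t y)) i) y"
        if "i \<in> idx (tot Y) <+> idx (tot Y)" for i
        using R Vert_chart[OF Y C(1)] v that unfolding jeq_def idx_Vert by blast
      have "pds \<alpha> (\<lambda>x. Vco \<eta> (tvec (tot Y) (\<lambda>t. u t (inv_into D \<phi> x))) i) (\<phi> y) =
          pds \<alpha> (\<lambda>x. Vco \<eta> (tvec (tot Y) (\<lambda>t. u' t (inv_into D \<phi> x))) i) (\<phi> y)"
        if "i \<in> idx (tot Y) <+> idx (tot Y)" for i
        using a[OF that] D \<alpha> unfolding agf_def agr_def by blast
      from this[OF InlI[OF j(1)]] this[OF InrI[OF j(1)]]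
      show "pds \<alpha> (\<lambda>x. \<eta> (u 0 (inv_into D \<phi> x)) j) (\<phi> y) = pds \<alpha> (\<lambda>x. \<eta> (u' 0 (inv_into D \<phi> x)) j) (\<phi> y)"
        "pd (Inl ()) (pds (map Inr \<alpha>) (joint \<eta> u j D \<phi>)) (case_sum (\<lambda>_. 0) (\<phi> y)) =
        pd (Inl ()) (pds (map Inr \<alpha>) (joint \<eta> u' j D \<phi>)) (case_sum (\<lambda>_. 0) (\<phi> y))"
        unfolding Vco_velocity_agr[OF Y u D C j(1) \<alpha>(1)] Vco_velocity_agr[OF Y u' D C(1) C(2)[folded e] j(1) \<alpha>(1)]
        by simp_all
    qed
  next
    assume P: P
    then have e: "u' 0 y = u 0 y" by (simp add: P_def)
    have nil: "[] \<in> multiindices s (idx (bas Y))" by (simp add: multiindices_def)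
    \<comment> \<open>Contact of the velocity fields includes equality of their values at y; this is
      the case of the empty multiindex.\<close>
    have "tvec (tot Y) (\<lambda>t. u t y) = tvec (tot Y) (\<lambda>t. u' t y)"
    proof (rule tvec_eqI, unfold jeq_vel, intro conjI allI impI e)
      fix C \<eta> j assume C: "(C, \<eta>) \<in> charts (tot Y)" "u 0 y \<in> C" and j: "j \<in> idx (tot Y)"
      obtain D \<phi> where D: "(D, \<phi>) \<in> charts (bas Y)" "y \<in> D" using atlas_chart[OF E y] by blast
      have i: "inv_into D \<phi> (\<phi> y) = y" using compatible_dom(2)[OF atlas_compatible[OF E D(1)]] D by simp
      have "pd (Inl ()) (pds (map Inr []) (joint \<eta> u j D \<phi>)) (case_sum (\<lambda>_. 0) (\<phi> y)) =
        pd (Inl ()) (pds (map Inr []) (joint \<eta> u' j D \<phi>)) (case_sum (\<lambda>_. 0) (\<phi> y))"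
        using P D C j nil unfolding P_def by blast
      then show "vel \<eta> (\<lambda>t. u' t y) j = vel \<eta> (\<lambda>t. u t y) j"
        using vel_joint[of \<eta> u D \<phi> "\<phi> y" j] vel_joint[of \<eta> u' D \<phi> "\<phi> y" j] by (simp add: i)
    qed
    then show ?R unfolding jeq_def
    proof (intro conjI allI impI)
      fix W \<Psi> i assume W: "(W, \<Psi>) \<in> charts (tot (Vert Y))" "tvec (tot Y) (\<lambda>t. u t y) \<in> W" and i: "i \<in> idx (tot (Vert Y))"
        and tv: "tvec (tot Y) (\<lambda>t. u t y) = tvec (tot Y) (\<lambda>t. u' t y)"
      obtain C \<eta> where w: "W = Vdom Y C" "\<Psi> = Vco \<eta>" and C: "(C, \<eta>) \<in> charts (tot Y)"
        using W(1) unfolding charts_Vert[OF Y] by blast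
      have yC: "u 0 y \<in> C" using tvec_Vdom[OF vcurve_curve[OF fam_vcurve[OF Y u]] W(2)[unfolded w]] .
      show "agf (bas Y) s (\<lambda>y. \<Psi> (tvec (tot Y) (\<lambda>t. u t y)) i) (\<lambda>y. \<Psi> (tvec (tot Y) (\<lambda>t. u' t y)) i) y"
        unfolding agf_def
      proof (intro allI impI)
        fix D \<phi> assume D: "(D, \<phi>) \<in> charts (bas Y)" "y \<in> D"
        show "agr (idx (bas Y)) s (\<lambda>x. \<Psi> (tvec (tot Y) (\<lambda>t. u t (inv_into D \<phi> x))) i)
            (\<lambda>x. \<Psi> (tvec (tot Y) (\<lambda>t. u' t (inv_into D \<phi> x))) i) (\<phi> y)"
        proof (rule agr_sorted[OF atlas_finite[OF E]])
          show "sm (idx (bas Y)) (\<lambda>x. \<Psi> (tvec (tot Y) (\<lambda>t. u t (inv_into D \<phi> x))) i) (\<phi> y)"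
            using section_sm[OF fib_Vert[OF Y] b(1) _ D(2) W i, of \<phi>] D(1) by simp
          show "sm (idx (bas Y)) (\<lambda>x. \<Psi> (tvec (tot Y) (\<lambda>t. u' t (inv_into D \<phi> x))) i) (\<phi> y)"
            using section_sm[OF fib_Vert[OF Y] b(2) _ D(2) W(1) W(2)[unfolded tv] i, of \<phi>] D(1) by simp
          fix \<alpha> assume \<alpha>: "\<alpha> \<in> multiindices s (idx (bas Y))"
          note A = Vco_velocity_agr[OF Y u D C yC _ multiindices_lists(1)[OF \<alpha>]]
            Vco_velocity_agr[OF Y u' D C yC[folded e] _ multiindices_lists(1)[OF \<alpha>]]
          have "i \<in> idx (tot Y) <+> idx (tot Y)" using i by (simp add: idx_Vert)
          then show "pds \<alpha> (\<lambda>x. \<Psi> (tvec (tot Y) (\<lambda>t. u t (inv_into D \<phi> x))) i) (\<phi> y) =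
            pds \<alpha> (\<lambda>x. \<Psi> (tvec (tot Y) (\<lambda>t. u' t (inv_into D \<phi> x))) i) (\<phi> y)"
            using P D C yC \<alpha> unfolding P_def by (elim PlusE) (simp_all add: w A)
        qed
      qed
    qed simp
  qed
  ultimately show ?thesis by simp
qed

section \<open>The exchange map\<close>

lemma exch_iff: "atlas (bas Y) \<Longrightarrow> exch s Y v = (THE Z. \<exists>u y. fam Y u y \<and>
     v = tvec (tot (Jet s Y)) (\<lambda>t. sjet s Y y (u t)) \<and>
     Z = sjet s (Vert Y) y (\<lambda>y'. tvec (tot Y) (\<lambda>t. u t y')))"
  unfolding exch_def fam_iff by (rule arg_cong[where f = The], rule ext) blast

text \<open>The source y' of a second family is read off from the foot of the same vector, so both
  families live at y and \<open>jeq_velocity\<close> applies.\<close>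

lemma exch_fam:
  assumes Y: "fib Y" and u: "fam Y u y"
  shows "exch s Y (tvec (tot (Jet s Y)) (\<lambda>t. sjet s Y y (u t))) = sjet s (Vert Y) y (\<lambda>y. tvec (tot Y) (\<lambda>t. u t y))"
  unfolding exch_iff[OF fibD(1)[OF Y]]
proof (rule the_equality)
  fix Z assume "\<exists>u' y'. fam Y u' y' \<and> tvec (tot (Jet s Y)) (\<lambda>t. sjet s Y y (u t)) = tvec (tot (Jet s Y)) (\<lambda>t. sjet s Y y' (u' t)) \<and>
     Z = sjet s (Vert Y) y' (\<lambda>y. tvec (tot Y) (\<lambda>t. u' t y))"
  then obtain u' y' where u': "fam Y u' y'" "tvec (tot (Jet s Y)) (\<lambda>t. sjet s Y y (u t)) = tvec (tot (Jet s Y)) (\<lambda>t. sjet s Y y' (u' t))"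
     and Z: "Z = sjet s (Vert Y) y' (\<lambda>y. tvec (tot Y) (\<lambda>t. u' t y))" by blast
  have j: "jeq 1 realline (tot (Jet s Y)) 0 (\<lambda>t. sjet s Y y (u t)) (\<lambda>t. sjet s Y y' (u' t))"
    by (rule tvec_eqD[OF u'(2) vcurve_curve[OF fam_sjet(1)[OF Y u]]])
  then have "sjet s Y y' (u' 0) = sjet s Y y (u 0)" by (simp add: jeq_def)
  then have yy: "y' = y" using fst_jet by metis
  show "Z = sjet s (Vert Y) y (\<lambda>y. tvec (tot Y) (\<lambda>t. u t y))"
    unfolding Z yy bas_Vert by (rule jet_eqI[OF jeq_sym]) (use jeq_velocity[OF Y u u'(1)[unfolded yy]] j yy in simp)
qed (use u in blast)

section \<open>Retraction onto the fibres and vertical fields as velocities\<close>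

lemma jeq_pair:
  assumes "jeq k E N y f f'" "jeq k E P y g g'"
  shows "jeq k E (prodm N P) y (\<lambda>z. (f z, g z)) (\<lambda>z. (f' z, g' z))"
  unfolding jeq_def
proof (intro conjI allI impI)
  show "(f' y, g' y) = (f y, g y)" using assms by (simp add: jeq_def)
  fix W \<Psi> i assume W: "(W, \<Psi>) \<in> charts (prodm N P)" "(f y, g y) \<in> W" and i: "i \<in> idx (prodm N P)"
  obtain D \<psi> C \<eta> where w: "W = D \<times> C" "\<Psi> = (\<lambda>(a, b). case_sum (\<psi> a) (\<eta> b))" "(D, \<psi>) \<in> charts N" "(C, \<eta>) \<in> charts P"
    using W(1) by (rule charts_prodmE)
  show "agf E k (\<lambda>y. \<Psi> (f y, g y) i) (\<lambda>y. \<Psi> (f' y, g' y) i) y"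
    using assms i w(3,4) W(2) unfolding jeq_def idx_prodm w(1,2) by (elim PlusE) auto
qed

text \<open>The identity of P, expressed from the chart C to any other chart, carries contact
  along.\<close>

lemma jeqI_chart:
  assumes E: "atlas E" and P: "atlas P" and C: "(C, \<eta>) \<in> charts P" "u y \<in> C"
    and u: "smooth_at E P u y" "smooth_at E P v y" and uv: "v y = u y"
    and a: "\<And>j. j \<in> idx P \<Longrightarrow> agf E k (\<lambda>y. \<eta> (u y) j) (\<lambda>y. \<eta> (v y) j) y"
  shows "jeq k E P y u v"
  unfolding jeq_def
proof (intro conjI allI impI uv)
  note tP = atlas_tame[OF P]
  fix C' \<eta>' j assume C': "(C', \<eta>') \<in> charts P" "u y \<in> C'" and j: "j \<in> idx P"
  have "smooth_at P P (\<lambda>z. z) (u y)" by (rule smooth_at_id[OF P smooth_at_pts(2)[OF u(1)]])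
  then have c: "csm P P C \<eta> C' \<eta>' (\<lambda>z. z) (u y)" unfolding smooth_at_csm[OF tP tP] using C C' by blast
  show "agf E k (\<lambda>y. \<eta>' (u y) j) (\<lambda>y. \<eta>' (v y) j) y"
    by (rule csm_agf[where u = u and u' = v and F = "\<lambda>z. z", OF E tP C(1) c])
      (use smooth_atD[OF u(1) E tP C] smooth_atD[OF u(2) E tP C(1)] C uv a j smooth_at_pts[OF u(1)] in auto)
qed

text \<open>In a submersion chart the projection selects the coordinates in the range of \<kappa>.
  The retraction overwrites them by the coordinates of the prescribed base point and keeps the fibre
  coordinates.\<close>

lemma fibre_retraction:
  assumes Y: "fibered_manifold Y" and z0: "z0 \<in> pts (tot Y)"
  obtains R where "smooth_at (prodm (bas Y) (tot Y)) (tot Y) R (prj Y z0, z0)"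
    "R (prj Y z0, z0) = z0"
    "eventually (\<lambda>p. prj Y (R p) = fst p) (nhdsin (mtop (prodm (bas Y) (tot Y))) (prj Y z0, z0))"
    "eventually (\<lambda>z. R (prj Y z, z) = z) (nhdsin (mtop (tot Y)) z0)"
proof -
  have E: "atlas (bas Y)" and T: "atlas (tot Y)" using Y by (auto simp: fibered_manifold_def manifold_atlas)
  note ET = atlas_prodm[OF E T]
  have "surj_submersion (tot Y) (bas Y) (prj Y)" using Y by (simp add: fibered_manifold_def)
  then obtain D \<psi> C \<phi> \<kappa> where D: "compatible (tot Y) (D, \<psi>)" "z0 \<in> D" and C: "compatible (bas Y) (C, \<phi>)" "prj Y ` D \<subseteq> C"
    and \<kappa>: "inj_on \<kappa> (idx (bas Y))" "\<kappa> ` idx (bas Y) \<subseteq> idx (tot Y)"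
      "\<And>z i. z \<in> D \<Longrightarrow> i \<in> idx (bas Y) \<Longrightarrow> \<phi> (prj Y z) i = \<psi> z (\<kappa> i)"
    using z0 unfolding surj_submersion_def by metis
  define y0 where "y0 = prj Y z0"
  have y0: "y0 \<in> C" "y0 \<in> pts (bas Y)" using C D compatible_dom(1)[OF C(1)] by (auto simp: y0_def)
  \<comment> \<open>At z paired with its own projection nothing is changed (\<open>mrg_prj\<close>);
    this is why R fixes the points already in the fibre.\<close>
  define mrg where "mrg p k = (if k \<in> \<kappa> ` idx (bas Y) then \<phi> (fst p) (inv_into (idx (bas Y)) \<kappa> k) else \<psi> (snd p) k)" for p k
  define R where "R p = inv_into D \<psi> (mrg p)" for p
  have mrg_prj: "mrg (prj Y z, z) = \<psi> z" if "z \<in> D" for z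
  proof
    fix k show "mrg (prj Y z, z) k = \<psi> z k"
      using \<kappa>(3)[OF that] \<kappa>(1) by (auto simp: mrg_def)
  qed
  have R_prj: "R (prj Y z, z) = z" if "z \<in> D" for z
    using mrg_prj[OF that] compatible_dom(2)[OF D(1)] that by (simp add: R_def)
  let ?n = "nhdsin (mtop (prodm (bas Y) (tot Y))) (y0, z0)"
  have p0: "(y0, z0) \<in> pts (prodm (bas Y) (tot Y))" using y0 z0 by (simp add: pts_prodm)
  have evCD: "eventually (\<lambda>p. fst p \<in> C \<and> snd p \<in> D) ?n"
    by (rule eventually_prodmI[OF E T y0(2) z0 eventually_dom[OF E C(1) y0(1)] eventually_dom[OF T D]])
  have sm: "smf (prodm (bas Y) (tot Y)) (\<lambda>p. mrg p k) (y0, z0)" for k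
  proof (cases "k \<in> \<kappa> ` idx (bas Y)")
    case True
    have "smf (bas Y) (\<lambda>y. \<phi> y (inv_into (idx (bas Y)) \<kappa> k)) (fst (y0, z0))" using smf_coord[OF E C(1) y0(1)] by simp
    from smf_smooth_at[OF ET E smooth_at_fst[OF E T y0(2) z0] this] True show ?thesis by (simp add: mrg_def)
  next
    case False
    have "smf (tot Y) (\<lambda>z. \<psi> z k) (snd (y0, z0))" using smf_coord[OF T D] by simp
    from smf_smooth_at[OF ET T smooth_at_snd[OF E T y0(2) z0] this] False show ?thesis by (simp add: mrg_def)
  qed
  have Eu: "eventually (\<lambda>p. mrg p \<in> Euc (idx (tot Y))) ?n"
    using evCD
  proof eventually_elim
    case (elim p)
    then have "\<psi> (snd p) \<in> Euc (idx (tot Y))" using compatible_dom(4)[OF D(1)] by auto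
    then show ?case using \<kappa>(2) by (auto simp: mrg_def Euc_def)
  qed
  have "filterlim mrg (near (idx (tot Y)) (mrg (y0, z0))) ?n"
    by (rule filterlim_smf[OF ET sm Eu p0])
  moreover have "mrg (y0, z0) = \<psi> z0" unfolding y0_def by (rule mrg_prj[OF D(2)])
  ultimately have "filterlim mrg (near (idx (tot Y)) (\<psi> z0)) ?n" by simp
  from eventually_compose_filterlim[OF eventually_chart[OF D] this]
  have ev: "eventually (\<lambda>p. R p \<in> D \<and> \<psi> (R p) = mrg p) ?n" by eventually_elim (simp add: R_def)
  have "smooth_at (prodm (bas Y) (tot Y)) (tot Y) R (y0, z0)"
  proof (rule smooth_at_compatible[OF ET T D(1) p0])
    show "R (y0, z0) \<in> D" using R_prj[OF D(2)] D(2) by (simp add: y0_def)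
    show "eventually (\<lambda>p. R p \<in> D) ?n" using ev by eventually_elim simp
    show "smf (prodm (bas Y) (tot Y)) (\<lambda>p. \<psi> (R p) j) (y0, z0)" for j
      by (rule smf_cong[OF ET sm[of j]]) (use ev in eventually_elim, simp)
  qed
  moreover have "eventually (\<lambda>p. prj Y (R p) = fst p) ?n"
    using ev evCD
  proof eventually_elim
    case (elim p)
    have C': "prj Y (R p) \<in> C" using elim C(2) by blast
    have "\<phi> (prj Y (R p)) = \<phi> (fst p)"
    proof (rule Euc_eqI[of _ "idx (bas Y)"])
      fix i assume i: "i \<in> idx (bas Y)"
      have "\<phi> (prj Y (R p)) i = mrg p (\<kappa> i)" using \<kappa>(3)[OF _ i, of "R p"] elim by simp
      then show "\<phi> (prj Y (R p)) i = \<phi> (fst p) i" using i \<kappa>(1) by (simp add: mrg_def)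
    qed (use C' elim compatible_dom(4)[OF C(1)] in auto)
    then show ?case using compatible_dom(2)[OF C(1)] C' elim by (auto dest: inj_onD)
  qed
  moreover have "eventually (\<lambda>z. R (prj Y z, z) = z) (nhdsin (mtop (tot Y)) z0)"
    using eventually_dom[OF T D] by eventually_elim (rule R_prj)
  ultimately show ?thesis using that[of R] R_prj[OF D(2)] unfolding y0_def by blast
qed

text \<open>\<open>R(y, _)\<close> moves points near \<open>z\<close> into the fibre over \<open>y\<close> and fixes those already there.\<close>

definition retr :: "('p, 'j, 'e) fibm \<Rightarrow> 'p \<Rightarrow> ('e \<times> 'p \<Rightarrow> 'p) \<Rightarrow> bool" where
  "retr Y z R \<longleftrightarrow> smooth_at (prodm (bas Y) (tot Y)) (tot Y) R (prj Y z, z) \<and>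
    eventually (\<lambda>p. prj Y (R p) = fst p) (nhdsin (mtop (prodm (bas Y) (tot Y))) (prj Y z, z)) \<and>
    eventually (\<lambda>z. R (prj Y z, z) = z) (nhdsin (mtop (tot Y)) z)"

lemma retr_exists:
  assumes "fibered_manifold Y" "z \<in> pts (tot Y)" shows "\<exists>R. retr Y z R"
proof (rule fibre_retraction[OF assms])
  fix R assume "smooth_at (prodm (bas Y) (tot Y)) (tot Y) R (prj Y z, z)"
    "eventually (\<lambda>p. prj Y (R p) = fst p) (nhdsin (mtop (prodm (bas Y) (tot Y))) (prj Y z, z))"
    "eventually (\<lambda>z. R (prj Y z, z) = z) (nhdsin (mtop (tot Y)) z)"
  then show ?thesis unfolding retr_def by blast
qed

lemma fibered_manifoldD:
  assumes "fibered_manifold Y" shows "atlas (bas Y)" "atlas (tot Y)" "fib Y"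
  using assms by (auto simp: fibered_manifold_def manifold_atlas intro: fibered_manifold_fib)

text \<open>H starts at the coordinates of a point of C and the image of the chart is open, so near
  z its values remain coordinates of points of C.\<close>

lemma smooth_at_chart_inverse:
  assumes N: "atlas N" and P: "atlas P" and C: "compatible P (C, \<eta>)" and z: "z \<in> pts N"
    and H: "\<And>k. k \<in> idx P \<Longrightarrow> smf N (\<lambda>z. H z k) z" and ev: "eventually (\<lambda>z. H z \<in> Euc (idx P)) (nhdsin (mtop N) z)"
    and w: "w \<in> C" "H z = \<eta> w"
  shows "eventually (\<lambda>z. inv_into C \<eta> (H z) \<in> C \<and> \<eta> (inv_into C \<eta> (H z)) = H z) (nhdsin (mtop N) z)"
    and "smooth_at N P (\<lambda>z. inv_into C \<eta> (H z)) z"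
proof -
  have "filterlim H (near (idx P) (H z)) (nhdsin (mtop N) z)"
    by (rule filterlim_smf[OF N H ev z])
  from eventually_compose_filterlim[OF eventually_chart[OF C w(1)] this[unfolded w(2)]]
  show ev: "eventually (\<lambda>z. inv_into C \<eta> (H z) \<in> C \<and> \<eta> (inv_into C \<eta> (H z)) = H z) (nhdsin (mtop N) z)"
    by eventually_elim simp
  show "smooth_at N P (\<lambda>z. inv_into C \<eta> (H z)) z"
  proof (rule smooth_at_compatible[OF N P C z])
    show "inv_into C \<eta> (H z) \<in> C" using w compatible_dom(2)[OF C] by simp
    show "eventually (\<lambda>z. inv_into C \<eta> (H z) \<in> C) (nhdsin (mtop N) z)" using ev by eventually_elim simp
    show "smf N (\<lambda>z. \<eta> (inv_into C \<eta> (H z)) j) z" if "j \<in> idx P" for j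
      by (rule smf_cong[OF N H[OF that]]) (use ev in eventually_elim, simp)
  qed
qed

lemma smf_fst_real: "atlas E \<Longrightarrow> y \<in> pts E \<Longrightarrow> smf (prodm realline E) fst (t, y)"
  using smf_smooth_at[OF atlas_prodm[OF atlas_realline] atlas_realline
      smooth_at_fst[OF atlas_realline _ pts_realline], where h = "\<lambda>t. t"]
    smf_coord[OF atlas_realline compatible_realline UNIV_I, where z = t] by simp

text \<open>Maps with prescribed derivatives are easily written down in a chart, but their values
  need not lie over the right base points; the retraction repairs this.\<close>

lemma fam_retraction:
  assumes Y: "fibered_manifold Y" and R: "retr Y z0 R" and y: "prj Y z0 = y" "y \<in> pts (bas Y)"
    and g: "smooth_at (prodm realline (bas Y)) (tot Y) g (0, y)" "g (0, y) = z0"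
  shows "fam Y (\<lambda>t y. R (y, g (t, y))) y"
proof -
  note E = fibered_manifoldD(1)[OF Y] and T = fibered_manifoldD(2)[OF Y]
  note RE = atlas_prodm[OF atlas_realline E] and ET = atlas_prodm[OF E T]
  have pair: "smooth_at (prodm realline (bas Y)) (prodm (bas Y) (tot Y)) (\<lambda>p. (snd p, g p)) (0, y)"
    by (intro smooth_at_pair RE atlas_tame[OF E] atlas_tame[OF T] smooth_at_snd atlas_realline E pts_realline y g(1))
  have "wsmooth (prodm (bas Y) (tot Y)) (tot Y) R (snd (0, y), g (0, y))"
    using R g(2) y by (auto simp: retr_def intro: smooth_at_wsmooth atlas_tame[OF ET] atlas_tame[OF T])
  then have "smooth_at (prodm realline (bas Y)) (tot Y) (\<lambda>p. R (snd p, g p)) (0, y)"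
    by (intro smooth_at_comp[where f = "\<lambda>p. (snd p, g p)", OF atlas_tame[OF RE] atlas_tame[OF ET] atlas_tame[OF T] pair])
  from eventually_smooth_at[OF RE T this]
  have 1: "eventually (smooth_at (prodm realline (bas Y)) (tot Y) (\<lambda>p. R (snd p, g p)))
     (nhdsin (mtop (prodm realline (bas Y))) (0, y))" .
  have "eventually (\<lambda>p. prj Y (R p) = fst p) (nhdsin (mtop (prodm (bas Y) (tot Y))) (snd (0, y), g (0, y)))"
    using R g(2) y by (simp add: retr_def)
  from smooth_at_eventually[where f = "\<lambda>p. (snd p, g p)", OF RE ET pair this]
  have 2: "eventually (\<lambda>p. prj Y (R (snd p, g p)) = snd p) (nhdsin (mtop (prodm realline (bas Y))) (0, y))" by simp
  have eq: "(\<lambda>(t, y). R (y, g (t, y))) = (\<lambda>p. R (snd p, g p))" by auto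
  show ?thesis unfolding fam_def eq using eventually_conj[OF 1 2] y(2) by simp
qed

lemma local_section_foot:
  assumes Y: "fib Y" and b: "local_section (Vert Y) y b"
  shows "local_section Y y (\<lambda>y. foot (b y))"
proof -
  note E = fibD(1)[OF Y]
  have E': "atlas (bas (Vert Y))" using E by simp
  show ?thesis
  proof (rule local_sectionI[OF E])
    show "y \<in> pts (bas Y)" using local_sectionD(3)[OF E' b] by simp
    show "eventually (\<lambda>y'. smooth_at (bas Y) (tot Y) (\<lambda>y. foot (b y)) y' \<and> prj Y (foot (b y')) = y') (nhdsin (mtop (bas Y)) y)"
      using eventually_local_section[OF E' b] unfolding bas_Vert
    proof eventually_elim
      case (elim z)
      have s: "smooth_at (bas Y) (tot (Vert Y)) b z" using local_sectionD(1)[OF E' elim] by simp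
      have "smooth_at (bas Y) (tot Y) (\<lambda>y. foot (b y)) z"
        by (rule smooth_at_comp[where f = b, OF fibD(3)[OF Y] fibD(2)[OF fib_Vert[OF Y]] fibD(2)[OF Y] s
              wsmooth_foot_Vert[OF Y smooth_at_pts(2)[OF s]]])
      then show ?case using local_sectionD(2)[OF E' elim] by (simp add: prj_Vert)
    qed
  qed
qed

text \<open>From a(z) = foot (b z) one moves along the straight line with velocity b z in a chart
  and retracts onto the fibre over z. The retraction does not disturb the velocity because b z is
  vertical.\<close>

lemma velocity_of_vertical_field:
  assumes Y: "fibered_manifold Y" and b: "local_section (Vert Y) y b"
  shows "\<exists>u. fam Y u y \<and> eventually (\<lambda>y. tvec (tot Y) (\<lambda>t. u t y) = b y) (nhdsin (mtop (bas Y)) y)"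
proof -
  note E = fibered_manifoldD(1)[OF Y] and T = fibered_manifoldD(2)[OF Y] and F = fibered_manifoldD(3)[OF Y]
  note RE = atlas_prodm[OF atlas_realline E] and ET = atlas_prodm[OF E T]
  have E': "atlas (bas (Vert Y))" using E by simp
  define a where "a y = foot (b y)" for y
  have a: "local_section Y y a" unfolding a_def by (rule local_section_foot[OF F b])
  have y: "y \<in> pts (bas Y)" and pa: "prj Y (a y) = y" and sa: "smooth_at (bas Y) (tot Y) a y"
    using local_sectionD[OF E a] by auto
  note ay = smooth_at_pts(2)[OF sa]
  obtain C \<eta> where C: "(C, \<eta>) \<in> charts (tot Y)" "compatible (tot Y) (C, \<eta>)" "a y \<in> C"
    using smf_chartE[OF T ay] by metis
  note VC = Vert_chart[OF F C(1)]
  have bV: "b z \<in> Vdom Y C" if z: "b z \<in> pts (tot (Vert Y))" "foot (b z) \<in> C" for z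
  proof -
    obtain c where c: "b z = tvec (tot Y) c" "vcurve Y c" using z(1) by (auto simp: pts_Vert[OF F])
    then show ?thesis using z(2) foot_tvec[OF vcurve_curve[OF c(2)]] by (auto simp: Vdom_def)
  qed
  have sb: "smooth_at (bas Y) (tot (Vert Y)) b y" using local_sectionD(1)[OF E' b] by simp
  have by': "b y \<in> Vdom Y C" by (rule bV[OF smooth_at_pts(2)[OF sb]]) (use C(3) in \<open>simp add: a_def\<close>)
  note sbd = smooth_atD[OF sb E fibD(2)[OF fib_Vert[OF F]] VC by']
  define H where "H p = (\<lambda>k. \<eta> (a (snd p)) k + fst p * vcomp \<eta> (b (snd p)) k)" for p :: "real \<times> _"
  let ?n = "nhdsin (mtop (prodm realline (bas Y)))"
  define g where "g p = inv_into C \<eta> (H p)" for p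
  have p0: "(0, y) \<in> pts (prodm realline (bas Y))" using y pts_realline by (simp add: pts_prodm)
  have VE: "\<eta> (a z) \<in> Euc (idx (tot Y)) \<and> vcomp \<eta> (b z) \<in> Euc (idx (tot Y))" if "b z \<in> Vdom Y C" for z
    using tame_Euc[OF fibD(2)[OF fib_Vert[OF F]] VC that]
    by (simp add: Vco_def idx_Vert Euc_sum case_sum_comp a_def)
  have snd_ev: "eventually (\<lambda>p. Q (snd p)) (?n (0, y))" if "eventually Q (nhdsin (mtop (bas Y)) y)" for Q
    by (rule smooth_at_eventually[OF RE E smooth_at_snd[OF atlas_realline E pts_realline y]]) (simp add: that)
  have smH: "smf (prodm realline (bas Y)) (\<lambda>p. H p k) (0, y)" if k: "k \<in> idx (tot Y)" for k
  proof -
    have "smf (bas Y) (\<lambda>z. \<eta> (a z) k) y" "smf (bas Y) (\<lambda>z. vcomp \<eta> (b z) k) y"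
      using sbd(2)[of "Inl k"] sbd(2)[of "Inr k"] k by (auto simp: idx_Vert Vco_def a_def)
    then have "smf (prodm realline (bas Y)) (\<lambda>p. \<eta> (a (snd p)) k) (0, y)"
      "smf (prodm realline (bas Y)) (\<lambda>p. vcomp \<eta> (b (snd p)) k) (0, y)"
      using smf_smooth_at[OF RE E smooth_at_snd[OF atlas_realline E pts_realline y], of "\<lambda>z. \<eta> (a z) k"]
        smf_smooth_at[OF RE E smooth_at_snd[OF atlas_realline E pts_realline y], of "\<lambda>z. vcomp \<eta> (b z) k"] by auto
    then show ?thesis unfolding H_def by (intro smf_add[OF RE] smf_mult[OF RE] smf_fst_real[OF E y])
  qed
  have HE: "eventually (\<lambda>p. H p \<in> Euc (idx (tot Y))) (?n (0, y))"
    using snd_ev[OF sbd(1)]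
  proof eventually_elim
    case (elim p)
    then show ?case using VE[OF elim] by (auto simp: H_def Euc_def)
  qed
  have H0: "H (0, z) = \<eta> (a z)" for z by (simp add: H_def)
  note gi = smooth_at_chart_inverse[OF RE T C(2) p0 smH HE C(3) H0, folded g_def]
  have g0: "g (0, z) = a z" if "a z \<in> C" for z
    using that compatible_dom(2)[OF C(2)] by (simp add: g_def H0)
  obtain R where R: "retr Y (a y) R" using retr_exists[OF Y ay] ..
  define u where "u t z = R (z, g (t, z))" for t z
  have u: "fam Y u y" unfolding u_def by (rule fam_retraction[OF Y R pa y gi(2) g0[OF C(3)]])
  have pairs: "smooth_at (bas Y) (prodm (bas Y) (tot Y)) (\<lambda>z. (z, a z)) y"
    by (intro smooth_at_pair E atlas_tame[OF E] atlas_tame[OF T] smooth_at_id y sa)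
  have "eventually (smooth_at (prodm (bas Y) (tot Y)) (tot Y) R) (nhdsin (mtop (prodm (bas Y) (tot Y))) (y, a y))"
    using R pa eventually_smooth_at[OF ET T] by (auto simp: retr_def)
  from smooth_at_eventually[where f = "\<lambda>z. (z, a z)", OF E ET pairs this]
  have evR: "eventually (\<lambda>z. smooth_at (prodm (bas Y) (tot Y)) (tot Y) R (z, a z)) (nhdsin (mtop (bas Y)) y)" .
  have "eventually (\<lambda>z. eventually (\<lambda>z. R (prj Y z, z) = z) (nhdsin (mtop (tot Y)) z)) (nhdsin (mtop (tot Y)) (a y))"
    using R unfolding retr_def by (intro eventually_eventually_mtop) simp
  from smooth_at_eventually[OF E T sa this]
  have evI: "eventually (\<lambda>z. eventually (\<lambda>z. R (prj Y z, z) = z) (nhdsin (mtop (tot Y)) (a z))) (nhdsin (mtop (bas Y)) y)" .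
  have slice0: "smooth_at (bas Y) (prodm realline (bas Y)) (\<lambda>z. (0, z)) y"
    by (intro smooth_at_pair E atlas_tame[OF atlas_realline] atlas_tame[OF E] smooth_at_id smooth_at_const pts_realline y)
  have "eventually (\<lambda>p. smooth_at (prodm realline (bas Y)) (tot Y) g p \<and>
      eventually (\<lambda>p. g p \<in> C \<and> \<eta> (g p) = H p) (?n p)) (?n (0, y))"
    using eventually_smooth_at[OF RE T gi(2)] eventually_eventually_mtop[OF gi(1)] by (rule eventually_conj)
  from smooth_at_eventually[where f = "\<lambda>z. (0, z)", OF E RE slice0 this]
  have evg: "eventually (\<lambda>z. smooth_at (prodm realline (bas Y)) (tot Y) g (0, z) \<and>
      eventually (\<lambda>p. g p \<in> C \<and> \<eta> (g p) = H p) (?n (0, z))) (nhdsin (mtop (bas Y)) y)" .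
  have evC: "eventually (\<lambda>z. a z \<in> C) (nhdsin (mtop (bas Y)) y)"
    by (rule smooth_atD(1)[OF sa E atlas_tame[OF T] C(1,3)])
  have evb: "eventually (\<lambda>z. local_section (Vert Y) z b) (nhdsin (mtop (bas Y)) y)"
    using eventually_local_section[OF E' b] by simp
  have "eventually (\<lambda>y. tvec (tot Y) (\<lambda>t. u t y) = b y) (nhdsin (mtop (bas Y)) y)"
    using evR evI evg evC evb
  proof eventually_elim
    case (elim z)
    have zp: "z \<in> pts (bas Y)" using local_sectionD(3)[OF E' elim(5)] by simp
    have "b z \<in> pts (tot (Vert Y))" using smooth_at_pts(2)[OF local_sectionD(1)[OF E' elim(5)]] by simp
    then obtain c where c: "b z = tvec (tot Y) c" "vcurve Y c" by (auto simp: pts_Vert[OF F])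
    note cc = vcurve_curve[OF c(2)]
    have c0: "c 0 = a z" using foot_tvec[OF cc] by (simp add: a_def c(1))
    have pz: "prj Y (a z) = z" using local_sectionD(2)[OF E' elim(5)] by (simp add: prj_Vert a_def)
    have c0C: "c 0 \<in> C" using c0 elim(4) by simp
    define \<gamma> where "\<gamma> t = g (t, z)" for t
    have "smooth_at (prodm realline (bas Y)) (tot Y) (\<lambda>(t, y). g (t, y)) (0, z)" using elim(3) by simp
    from smooth_at_slice_t[OF F this] have s\<gamma>: "smooth_at realline (tot Y) \<gamma> 0" unfolding \<gamma>_def .
    have sc: "smooth_at realline (tot Y) c 0" using cc by (simp add: curve_def)
    have \<gamma>0: "\<gamma> 0 = c 0" using g0[OF elim(4)] by (simp add: \<gamma>_def c0)
    have slt: "smooth_at realline (prodm realline (bas Y)) (\<lambda>t. (t, z)) 0"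
      by (intro smooth_at_pair atlas_realline E atlas_tame[OF atlas_realline] atlas_tame[OF E] smooth_at_id smooth_at_const
          pts_realline zp)
    from smooth_at_eventually[where f = "\<lambda>t. (t, z)", OF atlas_realline RE slt conjunct2[OF elim(3)]]
    have ev\<gamma>: "eventually (\<lambda>t. \<eta> (\<gamma> t) = H (t, z)) (nhds 0)"
      unfolding eventually_realline by eventually_elim (simp add: \<gamma>_def)
    \<comment> \<open>The curve c represents b z, and \<gamma> is the straight line with the same
      foot and velocity components.\<close>
    have "jeq 1 realline (tot Y) 0 c \<gamma>"
    proof (rule jeqI_chart[OF atlas_realline T C(1) c0C sc s\<gamma> \<gamma>0])
      fix j assume j: "j \<in> idx (tot Y)"
      have "deriv (\<lambda>t. \<eta> (\<gamma> t) j) 0 = deriv (\<lambda>t. \<eta> (a z) j + t * vcomp \<eta> (b z) j) 0"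
        by (rule deriv_cong_ev) (use ev\<gamma> in eventually_elim, simp_all add: H_def)
      also have "\<dots> = vcomp \<eta> (b z) j" by (rule DERIV_imp_deriv) (auto intro!: derivative_eq_intros)
      also have "\<dots> = deriv (\<lambda>t. \<eta> (c t) j) 0"
        using vcomp_tvec[OF cc atlas_tame[OF T] C(1) c0C] by (simp add: c(1) vel_def)
      finally show "agf realline 1 (\<lambda>t. \<eta> (c t) j) (\<lambda>t. \<eta> (\<gamma> t) j) 0" unfolding agf_realline using \<gamma>0 by simp
    qed
    \<comment> \<open>Verticality of c enters here: to first order its projection may be replaced by
      the constant z in the first argument of R.\<close>
    moreover have "jeq 1 realline (bas Y) 0 (\<lambda>t. prj Y (c t)) (\<lambda>_. z)"
      using c(2) by (simp add: vcurve_def c0 pz)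
    ultimately have jp: "jeq 1 realline (prodm (bas Y) (tot Y)) 0 (\<lambda>t. (prj Y (c t), c t)) (\<lambda>t. (z, \<gamma> t))"
      by (intro jeq_pair)
    have spc: "smooth_at realline (bas Y) (\<lambda>t. prj Y (c t)) 0"
      by (rule smooth_at_comp[where f = c, OF atlas_tame[OF atlas_realline] atlas_tame[OF T] atlas_tame[OF E] sc
            fibD(4)[OF F smooth_at_pts(2)[OF sc]]])
    have "jeq 1 realline (tot Y) 0 (\<lambda>t. R (prj Y (c t), c t)) (\<lambda>t. R (z, \<gamma> t))"
    proof (rule jeq_comp[where u = "\<lambda>t. (prj Y (c t), c t)" and u' = "\<lambda>t. (z, \<gamma> t)", OF atlas_realline atlas_tame[OF ET] _ _ jp])
      show "smooth_at realline (prodm (bas Y) (tot Y)) (\<lambda>t. (prj Y (c t), c t)) 0"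
        by (intro smooth_at_pair atlas_realline atlas_tame[OF E] atlas_tame[OF T] spc sc)
      show "smooth_at realline (prodm (bas Y) (tot Y)) (\<lambda>t. (z, \<gamma> t)) 0"
        by (intro smooth_at_pair atlas_realline atlas_tame[OF E] atlas_tame[OF T] smooth_at_const pts_realline zp s\<gamma>)
      show "wsmooth (prodm (bas Y) (tot Y)) (tot Y) R (prj Y (c 0), c 0)"
        unfolding c0 pz by (rule smooth_at_wsmooth[OF elim(1) atlas_tame[OF ET] atlas_tame[OF T]])
    qed
    \<comment> \<open>R leaves each point near a z unchanged when that point is paired with its own
      projection.\<close>
    moreover have "jeq 1 realline (tot Y) 0 c (\<lambda>t. R (prj Y (c t), c t))"
    proof (rule jeq_cong[OF atlas_realline pts_realline])
      show "eventually (\<lambda>t. c t = R (prj Y (c t), c t)) (nhdsin (mtop realline) 0)"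
        using smooth_at_eventually[OF atlas_realline T sc, unfolded c0, OF elim(2)] by eventually_elim simp
    qed
    ultimately have "jeq 1 realline (tot Y) 0 c (\<lambda>t. u t z)" unfolding u_def \<gamma>_def by (rule jeq_trans[rotated])
    from tvec_eqI[OF this] show ?case by (simp add: c(1))
  qed
  then show ?thesis using u by blast
qed

section \<open>Realizing vertical curves of jets by families\<close>

lemma multiindices_eqI: "\<alpha> \<in> multiindices k I \<Longrightarrow> \<beta> \<in> multiindices k I \<Longrightarrow> mset \<alpha> = mset \<beta> \<Longrightarrow> \<alpha> = \<beta>"
  by (metis (mono_tags, lifting) mem_Collect_eq multiindices_def properties_for_sort sorted_sort_id)

lemma pds_add_taylor:
  assumes I: "finite I" and f: "sm I f x" and \<alpha>: "\<alpha> \<in> multiindices k I"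
  shows "pds \<alpha> (\<lambda>z. f z + (\<Sum>\<beta>\<in>multiindices k I. q \<beta> * taylor_mono I \<beta> (\<lambda>i. z i - x i))) x = pds \<alpha> f x + q \<alpha>"
proof -
  have x: "x \<in> Euc I" using f by (rule sm_Euc)
  note fin = finite_multiindices[OF I, of k]
  have t: "sm I (\<lambda>z. taylor_mono I \<beta> (\<lambda>i. z i - x i)) x" for \<beta>
    by (intro sm_taylor_mono x I sm_diff sm_coord sm_const)
  have "pds \<alpha> (\<lambda>z. q \<beta> * taylor_mono I \<beta> (\<lambda>i. z i - x i)) x = (if \<beta> = \<alpha> then q \<beta> else 0)"
    if \<beta>: "\<beta> \<in> multiindices k I" for \<beta>
    using pds_cmult[OF t multiindices_lists(1)[OF \<alpha>]] multiindices_eqI[OF \<alpha> \<beta>]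
    by (auto simp: pds_taylor_mono[OF I multiindices_lists(1)[OF \<alpha>] multiindices_lists(1)[OF \<beta>]])
  then have "(\<Sum>\<beta>\<in>multiindices k I. pds \<alpha> (\<lambda>z. q \<beta> * taylor_mono I \<beta> (\<lambda>i. z i - x i)) x) = q \<alpha>"
    using \<alpha> fin by (simp add: sum.delta)
  then show ?thesis
    using pds_add[OF f _ multiindices_lists(1)[OF \<alpha>]] pds_sum[OF x fin _ multiindices_lists(1)[OF \<alpha>]] t
    by (simp add: sm_sum[OF x fin] sm_cmult)
qed

text \<open>Provides an interval of times that works for all base points near y, as is needed when
  the base point varies with t. The condition on z includes that the family behaves well on a
  neighbourhood of z, because \<open>local_section\<close> is about neighbourhoods.\<close>

lemma fam_near:
  assumes E: "atlas (bas Y)" and u: "fam Y u y"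
  obtains Q1 Q2 where "eventually Q1 (nhds 0)" "eventually Q2 (nhdsin (mtop (bas Y)) y)"
    "\<And>t y. Q1 t \<Longrightarrow> Q2 y \<Longrightarrow> smooth_at (prodm realline (bas Y)) (tot Y) (\<lambda>(t, y). u t y) (t, y)"
    "\<And>t y. fib Y \<Longrightarrow> Q1 t \<Longrightarrow> Q2 y \<Longrightarrow> local_section Y y (u t)"
proof -
  obtain Q1 Q2 where Q: "eventually Q1 (nhds 0)" "eventually Q2 (nhdsin (mtop (bas Y)) y)"
    "\<And>t y. Q1 t \<Longrightarrow> Q2 y \<Longrightarrow> smooth_at (prodm realline (bas Y)) (tot Y) (\<lambda>(t, y). u t y) (t, y)"
    "\<And>t y. Q1 t \<Longrightarrow> Q2 y \<Longrightarrow> prj Y (u t y) = y" using famE[OF E u] by metis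
  define Q2' where "Q2' y \<longleftrightarrow> y \<in> pts (bas Y) \<and> Q2 y \<and> eventually Q2 (nhdsin (mtop (bas Y)) y)" for y
  have "eventually Q2' (nhdsin (mtop (bas Y)) y)"
    using eventually_eventually_mtop[OF Q(2)] Q(2) eventually_pts[OF E, of y]
    by eventually_elim (simp add: Q2'_def)
  moreover have "local_section Y y (u t)" if "fib Y" "Q1 t" "Q2' y" for t y
  proof (rule local_sectionI[OF E])
    have ev: "eventually Q2 (nhdsin (mtop (bas Y)) y)" using that by (simp add: Q2'_def)
    show "eventually (\<lambda>y'. smooth_at (bas Y) (tot Y) (u t) y' \<and> prj Y (u t y') = y') (nhdsin (mtop (bas Y)) y)"
      using ev by eventually_elim (use Q(3,4) that(2) smooth_at_slice_y[OF that(1)] in blast)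
  qed (use that in \<open>simp add: Q2'_def\<close>)
  ultimately show ?thesis using that[OF Q(1)] Q(3) unfolding Q2'_def by blast
qed

text \<open>The base points of a vertical curve of jets move only to second order, so they may be kept fixed.\<close>

lemma tvec_fixed_source:
  assumes Y: "fib Y" and u: "fam Y u y" and c: "vcurve (Jet s Y) c" and c0: "fst (c 0) = y"
    and cu: "eventually (\<lambda>t. c t = sjet s Y (fst (c t)) (u t)) (nhds 0)"
  shows "tvec (tot (Jet s Y)) c = tvec (tot (Jet s Y)) (\<lambda>t. sjet s Y y (u t))"
proof (rule tvec_eqI)
  note E = fibD(1)[OF Y]
  note RE = atlas_prodm[OF atlas_realline E]
  have y: "y \<in> pts (bas Y)" using u by (simp add: fam_def)
  note u0 = fam_local_section0[OF Y u]
  have c00: "c 0 = sjet s Y y (u 0)" using eventually_nhds_x_imp_x[OF cu] c0 by simp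
  have sc: "smooth_at realline (tot (Jet s Y)) c 0" using vcurve_curve[OF c] by (simp add: curve_def)
  have sx: "smooth_at realline (bas Y) (\<lambda>t. fst (c t)) 0"
    by (rule smooth_at_comp[where f = c, OF atlas_tame[OF atlas_realline] tame_Jet[OF Y] fibD(3)[OF Y] sc
          wsmooth_Jet_fst[OF Y smooth_at_pts(2)[OF sc]]])
  have jx: "jeq 1 realline (bas Y) 0 (\<lambda>t. fst (c t)) (\<lambda>_. y)"
    using c by (simp add: vcurve_def c0)
  have sp: "smooth_at realline (prodm realline (bas Y)) (\<lambda>t. (t, fst (c t))) 0"
    by (intro smooth_at_pair atlas_realline atlas_tame[OF atlas_realline] fibD(3)[OF Y] smooth_at_id pts_realline sx)
  obtain Q1 Q2 where Q: "eventually Q1 (nhds 0)" "eventually Q2 (nhdsin (mtop (bas Y)) y)"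
    "\<And>t y. Q1 t \<Longrightarrow> Q2 y \<Longrightarrow> smooth_at (prodm realline (bas Y)) (tot Y) (\<lambda>(t, y). u t y) (t, y)"
    "\<And>t y. fib Y \<Longrightarrow> Q1 t \<Longrightarrow> Q2 y \<Longrightarrow> local_section Y y (u t)" using fam_near[OF E u] by metis
  have evQ2: "eventually (\<lambda>t. Q2 (fst (c t))) (nhds 0)"
    using smooth_at_eventually[OF atlas_realline E sx] Q(2) c0 by (simp add: eventually_realline)
  have evQ2': "eventually (\<lambda>t. Q2 y) (nhds 0)" using eventually_mtop_self[OF E y Q(2)] by simp
  show "jeq 1 realline (tot (Jet s Y)) 0 c (\<lambda>t. sjet s Y y (u t))"
    unfolding jeq_def
  proof (intro conjI allI impI)
    show "sjet s Y y (u 0) = c 0" using c00 by simp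
    fix W \<Psi> i assume W: "(W, \<Psi>) \<in> charts (tot (Jet s Y))" "c 0 \<in> W" and i: "i \<in> idx (tot (Jet s Y))"
    obtain D \<phi> C \<eta> where w: "W = Jdom s Y D C" "\<Psi> = Jco s Y D \<phi> \<eta>" and D: "(D, \<phi>) \<in> charts (bas Y)"
      and C: "(C, \<eta>) \<in> charts (tot Y)" using Jet_chartE[OF W(1) E] .
    have yD: "y \<in> D" "u 0 y \<in> C" using W(2) unfolding c00 w sjet_Jdom[OF E u0] by auto
    have cD: "compatible (bas Y) (D, \<phi>)" using atlas_compatible[OF E D] .
    have ax: "agf realline 1 (\<lambda>t. \<phi> (fst (c t)) m) (\<lambda>_. \<phi> y m) 0" if "m \<in> idx (bas Y)" for m
      using jx D yD(1) that c0 unfolding jeq_def by simp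
    have evD: "eventually (\<lambda>t. fst (c t) \<in> D) (nhds 0)"
      using smooth_atD(1)[OF sx atlas_realline fibD(3)[OF Y] D] yD(1) c0 by (simp add: eventually_realline)
    have "eventually (\<lambda>p. (\<lambda>(t, y). u t y) p \<in> C) (nhdsin (mtop (prodm realline (bas Y))) (0, fst (c 0)))"
      using smooth_atD(1)[OF fam_smooth0[OF Y u] RE fibD(2)[OF Y] C] yD(2) c0 by simp
    from smooth_at_eventually[where f = "\<lambda>t. (t, fst (c t))", OF atlas_realline RE sp this]
    have evC: "eventually (\<lambda>t. u t (fst (c t)) \<in> C) (nhds 0)" by (simp add: eventually_realline)
    have evC': "eventually (\<lambda>t. u t y \<in> C) (nhds 0)"
      using curveD(1)[OF vcurve_curve[OF fam_vcurve[OF Y u]] fibD(2)[OF Y] C] yD(2) by simp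
    have smx: "smf realline (\<lambda>t. \<phi> (fst (c t)) m) 0" if "m \<in> idx (bas Y)" for m
      using smooth_atD(2)[OF sx atlas_realline fibD(3)[OF Y] D _ that] yD(1) c0 by simp
    show "agf realline 1 (\<lambda>t. \<Psi> (c t) i) (\<lambda>t. \<Psi> (sjet s Y y (u t)) i) 0"
    proof (cases i)
      case (Inl m)
      then have "m \<in> idx (bas Y)" using i by (auto simp: idx_Jet)
      from ax[OF this] show ?thesis using Inl by (simp add: w Jco_def)
    next
      case (Inr p)
      obtain j \<alpha> where p: "p = (j, \<alpha>)" by (cases p)
      then have j: "j \<in> idx (tot Y)" "\<alpha> \<in> multiindices s (idx (bas Y))" using i Inr by (auto simp: idx_Jet)
      let ?K = "pds (map Inr \<alpha>) (joint \<eta> u j D \<phi>)"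
      have co: "eventually (\<lambda>t. \<Psi> (sjet s Y (x t) (u t)) i = ?K (case_sum (\<lambda>_. t) (\<phi> (x t)))) (nhds 0)"
        if x: "eventually (\<lambda>t. Q2 (x t)) (nhds 0)" "eventually (\<lambda>t. x t \<in> D) (nhds 0)"
          "eventually (\<lambda>t. u t (x t) \<in> C) (nhds 0)" for x
        using x Q(1)
      proof eventually_elim
        case (elim t)
        show ?case unfolding w Jco_sjet[OF E local_sectionD(1)[OF E Q(4)[OF Y elim(4,1)]] D elim(2) C elim(3)]
          using j by (simp add: Inr p pds_joint_slice)
      qed
      have "eventually (\<lambda>t. \<Psi> (c t) i = ?K (case_sum (\<lambda>_. t) (\<phi> (fst (c t))))) (nhds 0)"
        using co[OF evQ2 evD evC] cu by eventually_elim simp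
      then have co1: "eventually (\<lambda>t. \<Psi> (c t) i = ?K (case_sum (\<lambda>_. t) (\<phi> (fst (c t))))) (nhdsin (mtop realline) 0)"
        by (simp add: eventually_realline)
      have "eventually (\<lambda>t. y \<in> D) (nhds 0)" using yD(1) by simp
      then have co2: "eventually (\<lambda>t. \<Psi> (sjet s Y y (u t)) i = ?K (case_sum (\<lambda>_. t) (\<phi> y))) (nhdsin (mtop realline) 0)"
        using co[OF evQ2' _ evC'] by (simp add: eventually_realline)
      \<comment> \<open>Both curves insert t into the time slot. In the base slots they agree to
        first order, since c is vertical and the velocity of its source vanishes.\<close>
      have "agf realline 1 (\<lambda>t. ?K (case_sum (\<lambda>_. t) (\<phi> (fst (c t))))) (\<lambda>t. ?K (case_sum (\<lambda>_. t) (\<phi> y))) 0"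
      proof (rule agf_comp[where J = "{()} <+> idx (bas Y)" and H = "\<lambda>t. case_sum (\<lambda>_. t) (\<phi> (fst (c t)))"
            and H' = "\<lambda>t. case_sum (\<lambda>_. t) (\<phi> y)", OF atlas_realline])
        show "finite ({()} <+> idx (bas Y))" using atlas_finite[OF E] by simp
        show "sm ({()} <+> idx (bas Y)) ?K (case_sum (\<lambda>_. 0) (\<phi> (fst (c 0))))"
          unfolding c0 by (rule sm_pds[OF fam_joint[OF Y u D yD(1) C yD(2) j(1)]])
            (use multiindices_lists(1)[OF j(2)] in auto)
        have st: "smf realline (\<lambda>t. t) 0"
          using smf_coord[OF atlas_realline compatible_realline UNIV_I, where z = 0] by simp
        show "smf realline (\<lambda>t. case_sum (\<lambda>_. t) (\<phi> (fst (c t))) k) 0" if "k \<in> {()} <+> idx (bas Y)" for k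
          using that st smx by (elim PlusE) auto
        show "smf realline (\<lambda>t. case_sum (\<lambda>_. t) (\<phi> y) k) 0" if "k \<in> {()} <+> idx (bas Y)" for k
          using that st by (elim PlusE) (auto intro: smf_const[OF atlas_realline pts_realline])
        show "agf realline 1 (\<lambda>t. case_sum (\<lambda>_. t) (\<phi> (fst (c t))) k) (\<lambda>t. case_sum (\<lambda>_. t) (\<phi> y) k) 0"
          if "k \<in> {()} <+> idx (bas Y)" for k
          using that ax agf_refl by (elim PlusE) auto
        show "eventually (\<lambda>t. case_sum (\<lambda>_. t) (\<phi> (fst (c t))) \<in> Euc ({()} <+> idx (bas Y))) (nhdsin (mtop realline) 0)"
          unfolding eventually_realline using evD
          by eventually_elim (use tame_Euc[OF fibD(3)[OF Y] D] in \<open>simp add: Euc_sum case_sum_comp Euc_unit\<close>)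
        show "eventually (\<lambda>t. case_sum (\<lambda>_. t) (\<phi> y) \<in> Euc ({()} <+> idx (bas Y))) (nhdsin (mtop realline) 0)"
          using tame_Euc[OF fibD(3)[OF Y] D yD(1)] by (simp add: Euc_sum case_sum_comp Euc_unit)
      qed (rule pts_realline)
      then show ?thesis using agf_cong[OF atlas_realline pts_realline co1 co2] by blast
    qed
  qed
qed

text \<open>To a one adds, for each t, the Taylor polynomial centred at the source of c t whose
  coefficients are the amounts by which the jet of a fails to be c t. These vanish at t = 0, so the
  family starts at a. After retraction the jet at the moving source is exactly c t, and
  \<open>tvec_fixed_source\<close> then moves the source back to y.\<close>

lemma vertical_jet_family:
  assumes Y: "fibered_manifold Y" and v: "v \<in> pts (tot (Vert (Jet s Y)))"
    and a: "local_section Y y a" and va: "foot v = sjet s Y y a"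
  shows "\<exists>u. fam Y u y \<and> eventually (\<lambda>z. u 0 z = a z) (nhdsin (mtop (bas Y)) y) \<and>
    v = tvec (tot (Jet s Y)) (\<lambda>t. sjet s Y y (u t))"
proof -
  note E = fibered_manifoldD(1)[OF Y] and T = fibered_manifoldD(2)[OF Y] and F = fibered_manifoldD(3)[OF Y]
  note RE = atlas_prodm[OF atlas_realline E] and ET = atlas_prodm[OF E T]
  note fin = atlas_finite[OF E]
  obtain c where c: "v = tvec (tot (Jet s Y)) c" "vcurve (Jet s Y) c" using v by (auto simp: pts_Vert[OF fib_Jet[OF F]])
  note cc = vcurve_curve[OF c(2)]
  have c0: "c 0 = sjet s Y y a" using foot_tvec[OF cc] va c(1) by simp
  then have fc0: "fst (c 0) = y" by simp
  have y: "y \<in> pts (bas Y)" and pa: "prj Y (a y) = y" and sa: "smooth_at (bas Y) (tot Y) a y"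
    using local_sectionD[OF E a] by auto
  note ay = smooth_at_pts(2)[OF sa]
  obtain C \<eta> where C: "(C, \<eta>) \<in> charts (tot Y)" "compatible (tot Y) (C, \<eta>)" "a y \<in> C"
    using smf_chartE[OF T ay] by metis
  obtain D \<phi> where D: "(D, \<phi>) \<in> charts (bas Y)" "compatible (bas Y) (D, \<phi>)" "y \<in> D"
    using smf_chartE[OF E y] by metis
  note W = Jdom_Jco_chart[OF E D(1) C(1), of s]
  have c0W: "c 0 \<in> Jdom s Y D C" unfolding c0 sjet_Jdom[OF E a] using C D by simp
  let ?I = "idx (bas Y)" and ?M = "multiindices s (idx (bas Y))"
  define Q where "Q t = Jco s Y D \<phi> \<eta> (c t)" for t
  define x where "x t = fst (c t)" for t
  have sQ: "smf realline (\<lambda>t. Q t i) 0" if "i \<in> idx (tot (Jet s Y))" for i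
    unfolding Q_def by (rule curveD(2)[OF cc tame_Jet[OF F] W c0W that])
  have evW: "eventually (\<lambda>t. c t \<in> Jdom s Y D C) (nhds 0)" by (rule curveD(1)[OF cc tame_Jet[OF F] W c0W])
  have QInl: "Q t (Inl i) = \<phi> (x t) i" for t i by (simp add: Q_def x_def Jco_def)
  have sx: "smooth_at realline (bas Y) x 0"
    unfolding x_def using cc[unfolded curve_def]
    by (intro smooth_at_comp[where f = c, OF atlas_tame[OF atlas_realline] tame_Jet[OF F] atlas_tame[OF E] _
          wsmooth_Jet_fst[OF F curve_pts[OF cc]]])
  have x0: "x 0 = y" by (simp add: x_def fc0)
  have evx: "eventually (\<lambda>t. P (x t)) (nhds 0)" if "eventually P (nhdsin (mtop (bas Y)) y)" for P
    using smooth_at_eventually[OF atlas_realline E sx, of P] that x0 by (simp add: eventually_realline)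
  define f where "f k = (\<lambda>z. \<eta> (a (inv_into D \<phi> z)) k)" for k
  have smfk: "sm ?I (f k) (\<phi> y)" if "k \<in> idx (tot Y)" for k
    unfolding f_def by (rule section_sm[OF F a D(1,3) C(1,3) that])
  \<comment> \<open>The Taylor coefficients: the coordinates of c t minus the derivatives of a at
    the source x t. They are smooth in t, as c is a smooth curve in the jet bundle.\<close>
  define q where "q t k \<beta> = Q t (Inr (k, \<beta>)) - pds \<beta> (f k) (\<phi> (x t))" for t k \<beta>
  define H where "H p = (\<lambda>k. \<eta> (a (snd p)) k + (if k \<in> idx (tot Y) then
     \<Sum>\<beta>\<in>?M. q (fst p) k \<beta> * taylor_mono ?I \<beta> (\<lambda>i. \<phi> (snd p) i - \<phi> (x (fst p)) i) else 0))" for p :: "real \<times> _"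
  let ?n = "nhdsin (mtop (prodm realline (bas Y)))"
  define g where "g p = inv_into C \<eta> (H p)" for p
  have p0: "(0, y) \<in> pts (prodm realline (bas Y))" using y pts_realline by (simp add: pts_prodm)
  have evsnd: "eventually (\<lambda>p. P (snd p)) (?n (0, y))" if "eventually P (nhdsin (mtop (bas Y)) y)" for P
    by (rule smooth_at_eventually[OF RE E smooth_at_snd[OF atlas_realline E pts_realline y]]) (simp add: that)
  have sfst: "smf (prodm realline (bas Y)) (\<lambda>p. h (fst p)) (0, y)" if "smf realline h 0" for h
    using smf_smooth_at[OF RE atlas_realline smooth_at_fst[OF atlas_realline E pts_realline y], where h = h] that by simp
  have ssnd: "smf (prodm realline (bas Y)) (\<lambda>p. h (snd p)) (0, y)" if "smf (bas Y) h y" for h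
    using smf_smooth_at[OF RE E smooth_at_snd[OF atlas_realline E pts_realline y], where h = h] that by simp
  have sq: "smf realline (\<lambda>t. q t k \<beta>) 0" if k: "k \<in> idx (tot Y)" "\<beta> \<in> ?M" for k \<beta>
  proof -
    have "smf realline (\<lambda>t. pds \<beta> (f k) (\<phi> (x t))) 0"
    proof (rule smf_comp[where J = ?I and H = "\<lambda>t. \<phi> (x t)", OF atlas_realline fin])
      show "sm ?I (pds \<beta> (f k)) (\<phi> (x 0))" unfolding x0 by (rule sm_pds[OF smfk[OF k(1)] multiindices_lists(1)[OF k(2)]])
      show "smf realline (\<lambda>t. \<phi> (x t) j) 0" if "j \<in> ?I" for j
        using sQ[of "Inl j"] that by (auto simp: QInl idx_Jet)
      show "eventually (\<lambda>t. \<phi> (x t) \<in> Euc ?I) (nhdsin (mtop realline) 0)"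
        unfolding eventually_realline using evx[OF eventually_dom[OF E D(2,3)]]
        by eventually_elim (use tame_Euc[OF atlas_tame[OF E] D(1)] in simp)
    qed (rule pts_realline)
    then show ?thesis unfolding q_def using sQ[of "Inr (k, \<beta>)"] k
      by (intro smf_diff[OF atlas_realline]) (auto simp: idx_Jet)
  qed
  have smH: "smf (prodm realline (bas Y)) (\<lambda>p. H p k) (0, y)" if k: "k \<in> idx (tot Y)" for k
  proof -
    have 1: "smf (bas Y) (\<lambda>z. \<eta> (a z) k) y" by (rule smooth_atD(2)[OF sa E atlas_tame[OF T] C(1,3) k])
    have "smf (prodm realline (bas Y)) (\<lambda>p. \<eta> (a (snd p)) k +
      (\<Sum>\<beta>\<in>?M. q (fst p) k \<beta> * taylor_mono ?I \<beta> (\<lambda>i. \<phi> (snd p) i - \<phi> (x (fst p)) i))) (0, y)"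
    proof (intro smf_add[OF RE] smf_sum[OF RE p0] smf_mult[OF RE] finite_multiindices fin smf_taylor_mono[OF RE p0]
          smf_diff[OF RE] ssnd sfst sq k 1 smf_coord[OF E D(2,3)])
      show "smf realline (\<lambda>t. \<phi> (x t) i) 0" if "i \<in> ?I" for i using sQ[of "Inl i"] that by (auto simp: QInl idx_Jet)
    qed
    then show ?thesis using k by (simp add: H_def)
  qed
  have aC: "eventually (\<lambda>z. a z \<in> C) (nhdsin (mtop (bas Y)) y)" by (rule smooth_atD(1)[OF sa E atlas_tame[OF T] C(1,3)])
  have HE: "eventually (\<lambda>p. H p \<in> Euc (idx (tot Y))) (?n (0, y))"
    using evsnd[OF aC] by eventually_elim (use tame_Euc[OF atlas_tame[OF T] C(1)] in \<open>auto simp: H_def Euc_def\<close>)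
  \<comment> \<open>At t = 0 the curve passes through the jet of a, so there is nothing to correct
    and H(0, _) is a in coordinates.\<close>
  have Q0: "q 0 k \<beta> = 0" if "k \<in> idx (tot Y)" "\<beta> \<in> ?M" for k \<beta>
    using that unfolding q_def Q_def x0 c0 Jco_sjet[OF E sa D(1,3) C(1,3)] by (simp add: f_def)
  have H0: "H (0, z) = \<eta> (a z)" for z unfolding H_def by (rule ext) (simp add: Q0)
  note gi = smooth_at_chart_inverse[OF RE T C(2) p0 smH HE C(3) H0, folded g_def]
  have g0: "g (0, z) = a z" if "a z \<in> C" for z
    using that compatible_dom(2)[OF C(2)] by (simp add: g_def H0)
  obtain R where R: "retr Y (a y) R" using retr_exists[OF Y ay] ..
  \<comment> \<open>\<open>g(t, _)\<close> has the derivatives of \<open>c t\<close> at the source of \<open>c t\<close>, but need not be a section.\<close>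
  define u where "u t z = R (z, g (t, z))" for t z
  have u: "fam Y u y" unfolding u_def by (rule fam_retraction[OF Y R pa y gi(2) g0[OF C(3)]])
  have RI: "eventually (\<lambda>z. R (prj Y z, z) = z) (nhdsin (mtop (tot Y)) (a y))" using R by (simp add: retr_def)
  have u0: "eventually (\<lambda>z. u 0 z = a z) (nhdsin (mtop (bas Y)) y)"
    using smooth_at_eventually[OF E T sa RI] aC eventually_local_section[OF E a]
  proof eventually_elim
    case (elim z)
    then show ?case using g0[of z] local_sectionD(2)[OF E, of z a] by (simp add: u_def)
  qed
  have sp: "smooth_at realline (prodm realline (bas Y)) (\<lambda>t. (t, x t)) 0"
    by (intro smooth_at_pair atlas_realline atlas_tame[OF atlas_realline] atlas_tame[OF E] smooth_at_id pts_realline sx)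
  have evp: "eventually (\<lambda>t. P (t, x t)) (nhds 0)" if "eventually P (?n (0, y))" for P
    using smooth_at_eventually[where f = "\<lambda>t. (t, x t)", OF atlas_realline RE sp, of P] that x0
    by (simp add: eventually_realline)
  have pairs: "smooth_at (prodm realline (bas Y)) (prodm (bas Y) (tot Y)) (\<lambda>p. (snd p, g p)) (0, y)"
    by (intro smooth_at_pair RE atlas_tame[OF E] atlas_tame[OF T] smooth_at_snd atlas_realline E pts_realline y gi(2))
  have g0y: "g (0, y) = a y" by (rule g0[OF C(3)])
  have "eventually (smooth_at (prodm (bas Y) (tot Y)) (tot Y) R) (nhdsin (mtop (prodm (bas Y) (tot Y))) (snd (0, y), g (0, y)))"
    using R eventually_smooth_at[OF ET T] pa g0y by (simp add: retr_def)
  from smooth_at_eventually[where f = "\<lambda>p. (snd p, g p)", OF RE ET pairs this]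
  have "eventually (\<lambda>p. smooth_at (prodm (bas Y) (tot Y)) (tot Y) R (snd p, g p)) (?n (0, y))" .
  from evp[OF this] have ev1: "eventually (\<lambda>t. smooth_at (prodm (bas Y) (tot Y)) (tot Y) R (x t, g (t, x t))) (nhds 0)" by simp
  have "eventually (\<lambda>z. eventually (\<lambda>z. R (prj Y z, z) = z) (nhdsin (mtop (tot Y)) z)) (nhdsin (mtop (tot Y)) (g (0, y)))"
    unfolding g0y by (rule eventually_eventually_mtop[OF RI])
  from evp[OF smooth_at_eventually[OF RE T gi(2) this]]
  have ev2: "eventually (\<lambda>t. eventually (\<lambda>z. R (prj Y z, z) = z) (nhdsin (mtop (tot Y)) (g (t, x t)))) (nhds 0)" .
  from evp[OF eventually_conj[OF eventually_smooth_at[OF RE T gi(2)] eventually_conj[OF gi(1) eventually_eventually_mtop[OF gi(1)]]]]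
  have ev3: "eventually (\<lambda>t. smooth_at (prodm realline (bas Y)) (tot Y) g (t, x t) \<and>
      (g (t, x t) \<in> C \<and> \<eta> (g (t, x t)) = H (t, x t)) \<and>
      eventually (\<lambda>p. g p \<in> C \<and> \<eta> (g p) = H p) (?n (t, x t))) (nhds 0)" .
  have ev4: "eventually (\<lambda>t. local_section Y (x t) a \<and> x t \<in> D \<and> a (x t) \<in> C) (nhds 0)"
    by (rule evx[OF eventually_in_chart[OF F a D(1,3) C(1,3)]])
  have cu: "eventually (\<lambda>t. c t = sjet s Y (fst (c t)) (u t)) (nhds 0)"
    using ev1 ev2 ev3 ev4 evW
  proof eventually_elim
    case (elim t)
    \<comment> \<open>For the fixed t a section aa representing c t near its own source is compared
      with g(t, _). Nothing is asserted about the dependence of aa on t.\<close>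
    from elim(5) obtain y' aa where aa': "c t = sjet s Y y' aa" "local_section Y y' aa" "y' \<in> D" "aa y' \<in> C"
      unfolding Jdom_def by blast
    have xt: "y' = x t" by (simp add: x_def aa'(1))
    note aa = aa'[unfolded xt]
    have axt: "local_section Y (x t) a" "x t \<in> D" "a (x t) \<in> C" using elim(4) by auto
    have xp: "x t \<in> pts (bas Y)" using local_sectionD(3)[OF E axt(1)] .
    have sat: "smooth_at (bas Y) (tot Y) aa (x t)" using local_sectionD(1)[OF E aa(2)] .
    let ?gt = "\<lambda>z. g (t, z)"
    have "smooth_at (prodm realline (bas Y)) (tot Y) (\<lambda>(t, z). g (t, z)) (t, x t)" using elim(3) by simp
    from smooth_at_slice_y[OF F this] have sgt: "smooth_at (bas Y) (tot Y) ?gt (x t)" .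
    have slz: "smooth_at (bas Y) (prodm realline (bas Y)) (\<lambda>z. (t, z)) (x t)"
      by (intro smooth_at_pair E atlas_tame[OF atlas_realline] atlas_tame[OF E] smooth_at_id smooth_at_const pts_realline xp)
    have "eventually (\<lambda>p. \<eta> (g p) = H p) (?n (t, x t))" using elim(3) by (auto elim: eventually_mono)
    from smooth_at_eventually[where f = "\<lambda>z. (t, z)", OF E RE slz this]
    have evH: "eventually (\<lambda>z. \<eta> (?gt z) = H (t, z)) (nhdsin (mtop (bas Y)) (x t))" .
    \<comment> \<open>The polynomial adds q t k \<alpha> to the derivative \<alpha> of a at its
      centre, which turns that derivative into the coordinate of c t.\<close>
    have agr: "agr ?I s (\<lambda>z. \<eta> (?gt (inv_into D \<phi> z)) k) (\<lambda>z. \<eta> (aa (inv_into D \<phi> z)) k) (\<phi> (x t))"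
      if k: "k \<in> idx (tot Y)" for k
    proof (rule agr_sorted[OF fin])
      have gC: "?gt (x t) \<in> C" using elim(3) by simp
      show "sm ?I (\<lambda>z. \<eta> (?gt (inv_into D \<phi> z)) k) (\<phi> (x t))"
        using smooth_atD(2)[OF sgt E atlas_tame[OF T] C(1) gC k] unfolding smf_iff[OF E D(2) axt(2)] .
      show "sm ?I (\<lambda>z. \<eta> (aa (inv_into D \<phi> z)) k) (\<phi> (x t))" by (rule section_sm[OF F aa(2) D(1) aa(3) C(1) aa(4) k])
      fix \<alpha> assume \<alpha>: "\<alpha> \<in> ?M"
      have fk: "sm ?I (f k) (\<phi> (x t))" unfolding f_def by (rule section_sm[OF F axt(1) D(1) axt(2) C(1) axt(3) k])
      have "eventually (\<lambda>z. \<eta> (?gt (inv_into D \<phi> z)) k =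
          f k z + (\<Sum>\<beta>\<in>?M. q t k \<beta> * taylor_mono ?I \<beta> (\<lambda>i. z i - \<phi> (x t) i))) (near ?I (\<phi> (x t)))"
        using evH[unfolded eventually_mtop[OF E D(2) axt(2)]] eventually_chart[OF D(2) axt(2)]
        by eventually_elim (simp add: H_def f_def k)
      then have "pds \<alpha> (\<lambda>z. \<eta> (?gt (inv_into D \<phi> z)) k) (\<phi> (x t)) =
          pds \<alpha> (\<lambda>z. f k z + (\<Sum>\<beta>\<in>?M. q t k \<beta> * taylor_mono ?I \<beta> (\<lambda>i. z i - \<phi> (x t) i))) (\<phi> (x t))"
        by (rule pds_cong[OF _ sm_Euc[OF fk] multiindices_lists(1)[OF \<alpha>]])
      also have "\<dots> = pds \<alpha> (f k) (\<phi> (x t)) + q t k \<alpha>" by (rule pds_add_taylor[OF fin fk \<alpha>])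
      also have "\<dots> = Q t (Inr (k, \<alpha>))" by (simp add: q_def)
      also have "\<dots> = pds \<alpha> (\<lambda>z. \<eta> (aa (inv_into D \<phi> z)) k) (\<phi> (x t))"
        unfolding Q_def aa(1) Jco_sjet[OF E sat D(1) aa(3) C(1) aa(4)] using k \<alpha> by simp
      finally show "pds \<alpha> (\<lambda>z. \<eta> (?gt (inv_into D \<phi> z)) k) (\<phi> (x t)) = pds \<alpha> (\<lambda>z. \<eta> (aa (inv_into D \<phi> z)) k) (\<phi> (x t))" .
    qed
    have ix: "inv_into D \<phi> (\<phi> (x t)) = x t" using compatible_dom(2)[OF D(2)] axt(2) by simp
    have gC: "?gt (x t) \<in> C" using elim(3) by simp
    have ge: "\<eta> (?gt (x t)) = \<eta> (aa (x t))"
    proof (rule Euc_eqI[of _ "idx (tot Y)"])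
      show "\<eta> (?gt (x t)) k = \<eta> (aa (x t)) k" if "k \<in> idx (tot Y)" for k
        using agr_le[OF agr[OF that], of 0] by (simp add: agr_0 ix)
    qed (rule tame_Euc[OF atlas_tame[OF T] C(1) gC], rule tame_Euc[OF atlas_tame[OF T] C(1) aa(4)])
    have eq: "aa (x t) = ?gt (x t)"
      by (rule inj_onD[OF compatible_dom(2)[OF C(2)] ge[symmetric] aa(4) gC])
    have "jeq s (bas Y) (tot Y) (x t) ?gt aa"
    proof (rule jeqI_chart[OF E T C(1) _ sgt sat eq])
      show "?gt (x t) \<in> C" using elim(3) by simp
      fix k assume k: "k \<in> idx (tot Y)"
      show "agf (bas Y) s (\<lambda>z. \<eta> (?gt z) k) (\<lambda>z. \<eta> (aa z) k) (x t)"
        unfolding agf_iff[OF E D(1) axt(2) smooth_atD(2)[OF sgt E atlas_tame[OF T] C(1) gC k]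
            smooth_atD(2)[OF sat E atlas_tame[OF T] C(1) aa(4) k]] by (rule agr[OF k])
    qed
    then have jp: "jeq s (bas Y) (prodm (bas Y) (tot Y)) (x t) (\<lambda>z. (z, ?gt z)) (\<lambda>z. (z, aa z))"
      by (intro jeq_pair jeq_refl)
    have "jeq s (bas Y) (tot Y) (x t) (\<lambda>z. R (z, ?gt z)) (\<lambda>z. R (z, aa z))"
    proof (rule jeq_comp[where u = "\<lambda>z. (z, ?gt z)" and u' = "\<lambda>z. (z, aa z)", OF E atlas_tame[OF ET] _ _ jp])
      show "smooth_at (bas Y) (prodm (bas Y) (tot Y)) (\<lambda>z. (z, ?gt z)) (x t)"
        by (intro smooth_at_pair E atlas_tame[OF E] atlas_tame[OF T] smooth_at_id xp sgt)
      show "smooth_at (bas Y) (prodm (bas Y) (tot Y)) (\<lambda>z. (z, aa z)) (x t)"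
        by (intro smooth_at_pair E atlas_tame[OF E] atlas_tame[OF T] smooth_at_id xp sat)
      show "wsmooth (prodm (bas Y) (tot Y)) (tot Y) R (x t, ?gt (x t))"
        by (rule smooth_at_wsmooth[OF elim(1) atlas_tame[OF ET] atlas_tame[OF T]])
    qed
    \<comment> \<open>aa is a section, so R fixes its values. Retracting g(t, _) therefore yields a
      map with the same s-jet as aa.\<close>
    moreover have "jeq s (bas Y) (tot Y) (x t) (\<lambda>z. R (z, aa z)) aa"
    proof (rule jeq_cong[OF E xp])
      show "eventually (\<lambda>z. R (z, aa z) = aa z) (nhdsin (mtop (bas Y)) (x t))"
        using smooth_at_eventually[OF E T sat, unfolded eq, OF elim(2)] eventually_local_section[OF E aa(2)]
      proof eventually_elim
        case (elim z)
        then show ?case using local_sectionD(2)[OF E elim(2)] by simp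
      qed
    qed
    ultimately have "jeq s (bas Y) (tot Y) (x t) (u t) aa" unfolding u_def by (rule jeq_trans)
    from jet_eqI[OF this] show ?case unfolding x_def[symmetric] aa(1) by simp
  qed
  have "v = tvec (tot (Jet s Y)) (\<lambda>t. sjet s Y y (u t))"
    unfolding c(1) by (rule tvec_fixed_source[OF F u c(2) fc0 cu])
  then show ?thesis using u u0 by blast
qed

section \<open>The inverse of the exchange map\<close>

lemma velocity_pts:
  "fib Y \<Longrightarrow> fam Y u y \<Longrightarrow> tvec (tot (Jet s Y)) (\<lambda>t. sjet s Y y (u t)) \<in> pts (tot (Vert (Jet s Y)))"
  using fam_sjet(1)[of Y u y s] pts_Vert[OF fib_Jet, of Y s] by blast

lemma vertical_jet_rep:
  assumes Y: "fibered_manifold Y" and v: "v \<in> pts (tot (Vert (Jet s Y)))"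
  shows "\<exists>u y. fam Y u y \<and> v = tvec (tot (Jet s Y)) (\<lambda>t. sjet s Y y (u t))"
proof -
  note F = fibered_manifoldD(3)[OF Y]
  have "foot v \<in> pts (tot (Jet s Y))" by (rule wsmooth_pts(2)[OF wsmooth_foot_Vert[OF fib_Jet[OF F] v]])
  then obtain y a where "foot v = sjet s Y y a" "local_section Y y a"
    by (auto simp: pts_Jet[OF fibered_manifoldD(1)[OF Y]])
  then show ?thesis using vertical_jet_family[OF Y v] by blast
qed

text \<open>Every vertical vector of the jet bundle is the velocity of a family of jets, so
  injectivity can be checked on families, where \<open>jeq_velocity\<close> gives it.\<close>

lemma inj_on_exch:
  assumes Y: "fibered_manifold Y" shows "inj_on (exch s Y) (pts (tot (Vert (Jet s Y))))"
proof (rule inj_onI)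
  note F = fibered_manifoldD(3)[OF Y]
  fix v v' assume v: "v \<in> pts (tot (Vert (Jet s Y)))" and v': "v' \<in> pts (tot (Vert (Jet s Y)))"
    and e: "exch s Y v = exch s Y v'"
  obtain u y where u: "fam Y u y" "v = tvec (tot (Jet s Y)) (\<lambda>t. sjet s Y y (u t))"
    using vertical_jet_rep[OF Y v] by blast
  obtain u' y' where u': "fam Y u' y'" "v' = tvec (tot (Jet s Y)) (\<lambda>t. sjet s Y y' (u' t))"
    using vertical_jet_rep[OF Y v'] by blast
  have e': "jet s (bas Y) (tot (Vert Y)) y (\<lambda>y. tvec (tot Y) (\<lambda>t. u t y)) =
      jet s (bas Y) (tot (Vert Y)) y' (\<lambda>y. tvec (tot Y) (\<lambda>t. u' t y))"
    using e unfolding u(2) u'(2) exch_fam[OF F u(1)] exch_fam[OF F u'(1)] by simp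
  have "smooth_at (bas Y) (tot (Vert Y)) (\<lambda>y. tvec (tot Y) (\<lambda>t. u t y)) y"
    using local_sectionD(1)[OF _ fam_velocity_section[OF F u(1)]] fibered_manifoldD(1)[OF Y] by simp
  note d = jet_eqD[OF e' this]
  have "jeq 1 realline (tot (Jet s Y)) 0 (\<lambda>t. sjet s Y y (u t)) (\<lambda>t. sjet s Y y (u' t))"
    unfolding jeq_velocity[OF F u(1) u'(1)[unfolded d(1)]] by (rule d(2))
  from tvec_eqI[OF this] show "v = v'" unfolding u(2) u'(2) d(1) .
qed

lemma exch_inv_fam:
  assumes Y: "fibered_manifold Y" and u: "fam Y u y"
  shows "exch_inv s Y (sjet s (Vert Y) y (\<lambda>y. tvec (tot Y) (\<lambda>t. u t y))) = tvec (tot (Jet s Y)) (\<lambda>t. sjet s Y y (u t))"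
  unfolding exch_inv_def
  by (rule inv_into_f_eq[OF inj_on_exch[OF Y] velocity_pts[OF _ u] exch_fam[OF _ u]]) (rule fibered_manifoldD(3)[OF Y])+

text \<open>Near y the vertical field b is the velocity field of a family, so its s-jet is a value
  of the exchange map, and the inverse can be computed from that family.\<close>

lemma exch_inv_section:
  assumes Y: "fibered_manifold Y" and b: "local_section (Vert Y) y b"
  obtains u where "fam Y u y" "tvec (tot Y) (\<lambda>t. u t y) = b y" "eventually (\<lambda>z. u 0 z = foot (b z)) (nhdsin (mtop (bas Y)) y)"
    "sjet s (Vert Y) y b = sjet s (Vert Y) y (\<lambda>y. tvec (tot Y) (\<lambda>t. u t y))"
    "exch_inv s Y (sjet s (Vert Y) y b) = tvec (tot (Jet s Y)) (\<lambda>t. sjet s Y y (u t))"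
proof -
  note E = fibered_manifoldD(1)[OF Y] and F = fibered_manifoldD(3)[OF Y]
  obtain u where u: "fam Y u y" and ev: "eventually (\<lambda>y. tvec (tot Y) (\<lambda>t. u t y) = b y) (nhdsin (mtop (bas Y)) y)"
    using velocity_of_vertical_field[OF Y b] by blast
  have y: "y \<in> pts (bas Y)" using u by (simp add: fam_def)
  have s: "sjet s (Vert Y) y b = sjet s (Vert Y) y (\<lambda>y. tvec (tot Y) (\<lambda>t. u t y))"
    by (rule sjet_cong[OF fib_Vert[OF F]]) (use y ev in \<open>auto elim: eventually_mono\<close>)
  have f: "eventually (\<lambda>z. u 0 z = foot (b z)) (nhdsin (mtop (bas Y)) y)"
    using ev eventually_fam[OF E u]
  proof eventually_elim
    case (elim z)
    show ?case using foot_velocity[OF F elim(2)] elim(1) by simp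
  qed
  show ?thesis
    by (rule that[OF u eventually_mtop_self[OF E y ev] f s]) (unfold s, rule exch_inv_fam[OF Y u])
qed

lemma foot_exch_inv:
  assumes Y: "fibered_manifold Y" and b: "local_section (Vert Y) y b"
  shows "foot (exch_inv s Y (sjet s (Vert Y) y b)) = sjet s Y y (foot \<circ> b)"
proof -
  note F = fibered_manifoldD(3)[OF Y]
  obtain u where u: "fam Y u y" "tvec (tot Y) (\<lambda>t. u t y) = b y" "eventually (\<lambda>z. u 0 z = foot (b z)) (nhdsin (mtop (bas Y)) y)"
    "sjet s (Vert Y) y b = sjet s (Vert Y) y (\<lambda>y. tvec (tot Y) (\<lambda>t. u t y))"
    "exch_inv s Y (sjet s (Vert Y) y b) = tvec (tot (Jet s Y)) (\<lambda>t. sjet s Y y (u t))"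
    by (rule exch_inv_section[OF Y b])
  show ?thesis unfolding u(5) foot_sjet[OF F u(1)]
    by (rule sjet_cong[OF F]) (use u in \<open>auto simp: fam_def\<close>)
qed

text \<open>In corresponding charts the exchange map is a permutation of the coordinates.\<close>

lemma wsmooth_exch_inv:
  fixes Y :: "('p, 'j, 'e) fibm"
  assumes Y: "fibered_manifold Y" and Z: "Z \<in> pts (tot (Jet s (Vert Y)))"
  shows "wsmooth (tot (Jet s (Vert Y))) (tot (Vert (Jet s Y))) (exch_inv s Y) Z"
  unfolding wsmooth_def
proof (intro conjI allI impI Z)
  note E = fibered_manifoldD(1)[OF Y] and F = fibered_manifoldD(3)[OF Y]
  note FV = fib_Vert[OF F] and FJ = fib_Jet[OF F]
  have E': "atlas (bas (Vert Y))" using E by simp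
  have EJ: "atlas (bas (Jet s Y))" using E by simp
  obtain y b where b: "Z = sjet s (Vert Y) y b" "local_section (Vert Y) y b" using Z by (auto simp: pts_Jet[OF E'])
  have yp: "y \<in> pts (bas Y)" using local_sectionD(3)[OF E' b(2)] by simp
  obtain u where u: "fam Y u y" "tvec (tot Y) (\<lambda>t. u t y) = b y" "eventually (\<lambda>z. u 0 z = foot (b z)) (nhdsin (mtop (bas Y)) y)"
    "sjet s (Vert Y) y b = sjet s (Vert Y) y (\<lambda>y. tvec (tot Y) (\<lambda>t. u t y))"
    "exch_inv s Y (sjet s (Vert Y) y b) = tvec (tot (Jet s Y)) (\<lambda>t. sjet s Y y (u t))"
    by (rule exch_inv_section[OF Y b(2)])
  show "exch_inv s Y Z \<in> pts (tot (Vert (Jet s Y)))" unfolding b(1) u(5) by (rule velocity_pts[OF F u(1)])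
  fix W \<Psi> assume W: "(W, \<Psi>) \<in> charts (tot (Vert (Jet s Y)))" "exch_inv s Y Z \<in> W"
  obtain W' \<Psi>' where W': "W = Vdom (Jet s Y) W'" "\<Psi> = Vco \<Psi>'" "(W', \<Psi>') \<in> charts (tot (Jet s Y))"
    using W(1) unfolding charts_Vert[OF FJ] by blast
  obtain D \<phi> C \<eta> where w: "W' = Jdom s Y D C" "\<Psi>' = Jco s Y D \<phi> \<eta>" and D: "(D, \<phi>) \<in> charts (bas Y)"
    and C: "(C, \<eta>) \<in> charts (tot Y)" using Jet_chartE[OF W'(3) E] .
  have "sjet s Y y (u 0) \<in> Jdom s Y D C"
    using tvec_Vdom[OF vcurve_curve[OF fam_sjet(1)[OF F u(1)]]] W(2) unfolding W'(1) w b(1) u(5) by blast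
  then have yD: "y \<in> D" "u 0 y \<in> C" using sjet_Jdom[OF E fam_local_section0[OF F u(1)]] by auto
  let ?S = "Jdom s (Vert Y) D (Vdom Y C)" and ?\<sigma> = "Jco s (Vert Y) D \<phi> (Vco \<eta>)"
  have VC: "(Vdom Y C, Vco \<eta>) \<in> charts (tot (Vert Y))" by (rule Vert_chart[OF F C])
  have S: "(?S, ?\<sigma>) \<in> charts (tot (Jet s (Vert Y)))" by (rule Jdom_Jco_chart[OF E' _ VC]) (simp add: D)
  have "b y \<in> Vdom Y C" unfolding u(2)[symmetric] using fam_vcurve[OF F u(1)] yD(2) by (auto simp: Vdom_def)
  then have ZS: "Z \<in> ?S" unfolding b(1) sjet_Jdom[OF E' b(2)] using yD by simp
  have Eu: "?\<sigma> Z \<in> Euc (idx (tot (Jet s (Vert Y))))" by (rule tame_Euc[OF tame_Jet[OF FV] S ZS])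
  \<comment> \<open>The regrouping of coordinates: derivatives of the foot components become jet
    coordinates of the foot, derivatives of the velocity components become velocities of jet
    coordinates. The velocity along the base is set to 0, since the source of the jets stays
    fixed.\<close>
  define G where "G x = case_sum (case_sum (\<lambda>i. x (Inl i)) (\<lambda>(j, \<alpha>). x (Inr (Inl j, \<alpha>))))
     (case_sum (\<lambda>_ :: nat. 0) (\<lambda>(j, \<alpha>). x (Inr (Inr j, \<alpha>))))" for x :: "nat + ('j + 'j) \<times> nat list \<Rightarrow> real"
  have *: "exch_inv s Y z \<in> W \<and> (\<forall>j\<in>idx (tot (Vert (Jet s Y))). \<Psi> (exch_inv s Y z) j = G (?\<sigma> z) j)" if zS: "z \<in> ?S" for z
  proof -
    from zS obtain y b where b: "z = sjet s (Vert Y) y b" "local_section (Vert Y) y b" "y \<in> D" "b y \<in> Vdom Y C"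
      unfolding Jdom_def by blast
    obtain u where u: "fam Y u y" "tvec (tot Y) (\<lambda>t. u t y) = b y" "eventually (\<lambda>z. u 0 z = foot (b z)) (nhdsin (mtop (bas Y)) y)"
    "sjet s (Vert Y) y b = sjet s (Vert Y) y (\<lambda>y. tvec (tot Y) (\<lambda>t. u t y))"
    "exch_inv s Y (sjet s (Vert Y) y b) = tvec (tot (Jet s Y)) (\<lambda>t. sjet s Y y (u t))"
      by (rule exch_inv_section[OF Y b(2)])
    have uC: "u 0 y \<in> C" by (rule tvec_Vdom[OF vcurve_curve[OF fam_vcurve[OF F u(1)]]]) (use b(4) u(2) in simp)
    note u0 = fam_local_section0[OF F u(1)]
    have c0: "sjet s Y y (u 0) \<in> Jdom s Y D C" unfolding sjet_Jdom[OF E u0] using b(3) uC by simp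
    have W1: "exch_inv s Y z \<in> W" unfolding b(1) u(5) W'(1) w Vdom_def using fam_sjet(1)[OF F u(1)] c0 by blast
    have l: "\<Psi> (exch_inv s Y z) = case_sum (Jco s Y D \<phi> \<eta> (sjet s Y y (u 0))) (vel (Jco s Y D \<phi> \<eta>) (\<lambda>t. sjet s Y y (u t)))"
      unfolding b(1) u(5) W'(2) w
      by (rule Vco_tvec[OF vcurve_curve[OF fam_sjet(1)[OF F u(1)]] FJ Jdom_Jco_chart[OF E D C] c0])
    have sv: "smooth_at (bas (Vert Y)) (tot (Vert Y)) (\<lambda>y. tvec (tot Y) (\<lambda>t. u t y)) y"
      by (rule local_sectionD(1)[OF E' fam_velocity_section[OF F u(1)]])
    have uV: "tvec (tot Y) (\<lambda>t. u t y) \<in> Vdom Y C" using u(2) b(4) by simp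
    have D': "(D, \<phi>) \<in> charts (bas (Vert Y))" using D by simp
    note r = Jco_sjet[OF E' sv D' b(3) VC uV, of s]
    show ?thesis
    proof (intro conjI W1 ballI)
      fix i assume i: "i \<in> idx (tot (Vert (Jet s Y)))"
      then consider (1) m where "i = Inl (Inl m)" "m \<in> idx (bas Y)"
        | (2) j \<alpha> where "i = Inl (Inr (j, \<alpha>))" "j \<in> idx (tot Y)" "\<alpha> \<in> multiindices s (idx (bas Y))"
        | (3) m where "i = Inr (Inl m)" "m \<in> idx (bas Y)"
        | (4) j \<alpha> where "i = Inr (Inr (j, \<alpha>))" "j \<in> idx (tot Y)" "\<alpha> \<in> multiindices s (idx (bas Y))"
        unfolding idx_Vert idx_Jet by auto
      then show "\<Psi> (exch_inv s Y z) i = G (?\<sigma> z) i"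
      proof cases
        case 1
        then show ?thesis unfolding l by (simp add: G_def b(1) Jco_def)
      next
        case 2
        then show ?thesis
          unfolding l unfolding b(1) u(4) G_def r Jco_sjet[OF E local_sectionD(1)[OF E u0] D b(3) C uC]
          using Vco_velocity_agr(1)[OF F u(1) D b(3) C uC 2(2) multiindices_lists(1)[OF 2(3)]] by (simp add: idx_Vert InlI)
      next
        case 3
        then show ?thesis unfolding l fam_sjet(2)[OF F u(1) D b(3) C uC] by (simp add: G_def)
      next
        case 4
        then show ?thesis
          unfolding l fam_sjet(2)[OF F u(1) D b(3) C uC] unfolding b(1) u(4) G_def r
          using Vco_velocity_agr(2)[OF F u(1) D b(3) C uC 4(2) multiindices_lists(1)[OF 4(3)]] by (simp add: idx_Vert InrI)
      qed
    qed
  qed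
  have "csm (tot (Jet s (Vert Y))) (tot (Vert (Jet s Y))) ?S ?\<sigma> W \<Psi> (exch_inv s Y) Z"
    unfolding csm_def
  proof (intro conjI exI[of _ G])
    show "\<forall>\<^sub>F x in near (idx (tot (Jet s (Vert Y)))) (?\<sigma> Z). \<forall>z'\<in>?S. ?\<sigma> z' = x \<longrightarrow>
        exch_inv s Y z' \<in> W \<and> (\<forall>j\<in>idx (tot (Vert (Jet s Y))). \<Psi> (exch_inv s Y z') j = G x j)"
      by (rule always_eventually) (use * in blast)
    show "\<forall>j\<in>idx (tot (Vert (Jet s Y))). sm (idx (tot (Jet s (Vert Y)))) (\<lambda>x. G x j) (?\<sigma> Z)"
    proof
      fix j :: "(nat + 'j \<times> nat list) + nat + 'j \<times> nat list"
      consider (1) m where "j = Inl (Inl m)" | (2) k \<alpha> where "j = Inl (Inr (k, \<alpha>))"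
        | (3) m where "j = Inr (Inl m)" | (4) k \<alpha> where "j = Inr (Inr (k, \<alpha>))"
        by (metis sumE surj_pair)
      then show "sm (idx (tot (Jet s (Vert Y)))) (\<lambda>x. G x j) (?\<sigma> Z)"
        by cases (simp_all add: G_def sm_coord[OF Eu] sm_const[OF Eu])
    qed
  qed (use W ZS Eu in auto)
  then show "\<exists>D' \<psi>. (D', \<psi>) \<in> charts (tot (Jet s (Vert Y))) \<and>
      csm (tot (Jet s (Vert Y))) (tot (Vert (Jet s Y))) D' \<psi> W \<Psi> (exch_inv s Y) Z" using S by blast
qed

lemma smooth_at_exch_inv:
  assumes Y: "fibered_manifold Y" and b: "local_section (Vert Y) y b"
  shows "smooth_at (bas Y) (tot (Vert (Jet s Y))) (\<lambda>z. exch_inv s Y (sjet s (Vert Y) z b)) y"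
proof -
  note F = fibered_manifoldD(3)[OF Y]
  have s: "smooth_at (bas Y) (tot (Jet s (Vert Y))) (\<lambda>z. sjet s (Vert Y) z b) y"
    using smooth_at_sjet[OF fib_Vert[OF F] b, of s] by simp
  show ?thesis
    by (rule smooth_at_comp[where f = "\<lambda>z. sjet s (Vert Y) z b", OF fibD(3)[OF F] tame_Jet[OF fib_Vert[OF F]]
          fibD(2)[OF fib_Vert[OF fib_Jet[OF F]]] s wsmooth_exch_inv[OF Y smooth_at_pts(2)[OF s]]])
qed

section \<open>The inclusion of holonomic vertical vectors\<close>

lemma J1map_sjet:
  assumes Y: "fib Y" and Y': "bas Y' = bas Y" and f: "wsmooth (tot Y) (tot Y') f (w y)" and w: "local_section Y y w"
  shows "J1map Y Y' f (sjet 1 Y y w) = sjet 1 Y' y (f \<circ> w)"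
  unfolding J1map_def
proof (rule the_equality)
  fix Z assume "\<exists>y' w'. local_section Y y' w' \<and> sjet 1 Y y w = sjet 1 Y y' w' \<and> Z = sjet 1 Y' y' (f \<circ> w')"
  then obtain y' w' where w': "local_section Y y' w'" "sjet 1 Y y w = sjet 1 Y y' w'" "Z = sjet 1 Y' y' (f \<circ> w')" by blast
  note E = fibD(1)[OF Y]
  note d = jet_eqD[OF w'(2) local_sectionD(1)[OF E w]]
  have "jeq 1 (bas Y) (tot Y') y (\<lambda>z. f (w z)) (\<lambda>z. f (w' z))"
    by (rule jeq_comp[OF E fibD(2)[OF Y] local_sectionD(1)[OF E w] local_sectionD(1)[OF E w'(1)[unfolded d(1)]] d(2) f])
  from jet_eqI[OF this] show "Z = sjet 1 Y' y (f \<circ> w)" unfolding w'(3) d(1) Y' comp_def by simp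
qed (use w in blast)

text \<open>Evaluates the composite defining \<open>holV\<close> on any section b that represents
  the exchanged vector; this lets \<open>holV\<close> and \<open>J1hol\<close> be compared through
  the same b.\<close>

lemma holV_exch:
  assumes Y: "fibered_manifold Y" and b: "local_section (Vert Y) y b" and v: "exch (Suc s) Y v = sjet (Suc s) (Vert Y) y b"
  shows "holV s Y v = sjet 1 (Vert (Jet s Y)) y (\<lambda>z. exch_inv s Y (sjet s (Vert Y) z b))"
proof -
  note F = fibered_manifoldD(3)[OF Y]
  note FV = fib_Vert[OF F]
  note ls = local_section_sjet[OF FV b, of s]
  have Z: "sjet s (Vert Y) y b \<in> pts (tot (Jet s (Vert Y)))"
    using b pts_Jet[OF fibD(1)[OF FV]] by blast
  have "J1map (Jet s (Vert Y)) (Vert (Jet s Y)) (exch_inv s Y) (sjet 1 (Jet s (Vert Y)) y (\<lambda>z. sjet s (Vert Y) z b)) =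
      sjet 1 (Vert (Jet s Y)) y (exch_inv s Y \<circ> (\<lambda>z. sjet s (Vert Y) z b))"
    by (rule J1map_sjet[OF fib_Jet[OF FV] _ wsmooth_exch_inv[OF Y Z] ls]) simp
  then show ?thesis unfolding holV_def comp_def v hol_sjet[OF FV b] .
qed

section \<open>The formal exterior differentials\<close>

lemma tame_Forms:
  assumes E: "atlas E" shows "tame (tot (Forms l E))"
proof (rule tameI)
  have "{\<alpha> \<in> lists (idx E). length \<alpha> = l \<and> sorted_wrt (<) \<alpha>} \<subseteq> {\<alpha>. set \<alpha> \<subseteq> idx E \<and> length \<alpha> \<le> l}" by auto
  then have "finite {\<alpha> \<in> lists (idx E). length \<alpha> = l \<and> sorted_wrt (<) \<alpha>}"
    using finite_lists_length_le[OF atlas_finite[OF E]] finite_subset by blast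
  then show "finite (idx (tot (Forms l E)))" using atlas_finite[OF E] by (simp add: Forms_def)
  show "z \<in> pts (tot (Forms l E)) \<longleftrightarrow> (\<exists>D \<psi>. (D, \<psi>) \<in> charts (tot (Forms l E)) \<and> z \<in> D)" for z
  proof
    assume "z \<in> pts (tot (Forms l E))"
    then obtain y \<omega> where z: "z = (y, \<omega>)" "y \<in> pts E" "altform E l y \<omega>" by (auto simp: Forms_def)
    obtain D \<phi> where "(D, \<phi>) \<in> charts E" "y \<in> D" using atlas_chart[OF E z(2)] by blast
    then show "\<exists>D \<psi>. (D, \<psi>) \<in> charts (tot (Forms l E)) \<and> z \<in> D"
      using z unfolding Forms_def fibm.simps mfd.simps by blast
  next
    assume "\<exists>D \<psi>. (D, \<psi>) \<in> charts (tot (Forms l E)) \<and> z \<in> D"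
    then show "z \<in> pts (tot (Forms l E))" using tame_pts[OF atlas_tame[OF E]] by (auto simp: Forms_def)
  qed
  show "\<psi> z \<in> Euc (idx (tot (Forms l E)))" if W: "(W, \<psi>) \<in> charts (tot (Forms l E))" "z \<in> W" for W \<psi> z
  proof -
    obtain y \<omega> where z: "z = (y, \<omega>)" by (cases z)
    obtain D \<phi> where D: "(D, \<phi>) \<in> charts E" "y \<in> D"
      "\<psi> = (\<lambda>(y, \<omega>). case_sum (\<phi> y)
                   (\<lambda>\<alpha>. if \<alpha> \<in> lists (idx E) \<and> length \<alpha> = l \<and> sorted_wrt (<) \<alpha>
                      then \<omega> (map (\<lambda>i. cvec E D \<phi> y (\<lambda>j. of_bool (j = i))) \<alpha>) else 0))"
      using W z unfolding Forms_def fibm.simps mfd.simps by blast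
    show ?thesis using tame_Euc[OF atlas_tame[OF E] D(1,2)]
      by (auto simp: z D(3) Forms_def Euc_sum case_sum_comp split: if_splits intro!: EucI)
  qed
qed

lemma charts_Forms_base: "bas (Forms l E) = E" "prj (Forms l E) = fst"
  by (simp_all add: Forms_def)

section \<open>Maps into the fibered product over J^sQ\<close>

lemma jeq_restr: "jeq k E N y u v \<Longrightarrow> jeq k E (restr N A) y u v"
  by (auto simp: jeq_def charts_restr idx_restr)

text \<open>The common shape of the two kinds of pairs to be compared: the given sections (a, b) on
  the functional side and prolongations of sections on the finite dimensional side.\<close>

definition JV_pair :: "nat \<Rightarrow> nat \<Rightarrow> ('p, 'j, 'e) fibm \<Rightarrow> 'e \<Rightarrow> ('e \<Rightarrow> 'e \<times> ('e \<Rightarrow> 'p) set) \<Rightarrow>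
    ('e \<Rightarrow> (real \<Rightarrow> 'e \<times> ('e \<Rightarrow> 'p) set) set) \<Rightarrow> bool" where
  "JV_pair r s Y y a b \<longleftrightarrow> smooth_at (bas Y) (tot (Jet r Y)) a y \<and> smooth_at (bas Y) (tot (Vert (Jet s Y))) b y \<and>
    eventually (\<lambda>y. jproj s Y (a y) = foot (b y)) (nhdsin (mtop (bas Y)) y)"

lemma tame_JV: "fib Y \<Longrightarrow> tame (JV r s Y)"
  unfolding JV_def by (intro tame_restr tame_prodm tame_Jet fibD(2)[OF fib_Vert] fib_Jet)

lemma JV_pair_smooth:
  assumes Y: "fib Y" and ab: "JV_pair r s Y y a b"
  shows "smooth_at (bas Y) (JV r s Y) (\<lambda>y. (a y, b y)) y"
proof -
  have t: "tame (tot (Jet r Y))" "tame (tot (Vert (Jet s Y)))"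
    using tame_Jet[OF Y] fibD(2)[OF fib_Vert[OF fib_Jet[OF Y]]] by auto
  have "smooth_at (bas Y) (prodm (tot (Jet r Y)) (tot (Vert (Jet s Y)))) (\<lambda>y. (a y, b y)) y"
    using ab unfolding JV_pair_def by (intro smooth_at_pair fibD(1)[OF Y] t) auto
  then show ?thesis
    using ab unfolding JV_def smooth_at_restr[OF fibD(1)[OF Y] tame_prodm[OF t]] JV_pair_def by simp
qed

lemma smooth_at_JV_comp:
  assumes Y: "fib Y" and B: "smooth_map (JV r s Y) P B" and P: "tame P" and ab: "JV_pair r s Y y a b"
  shows "smooth_at (bas Y) P (\<lambda>y. B (a y, b y)) y"
    and "wsmooth (JV r s Y) P B (a y, b y)" and "(a y, b y) \<in> pts (JV r s Y)"
proof -
  note s = JV_pair_smooth[OF Y ab]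
  show p: "(a y, b y) \<in> pts (JV r s Y)" using smooth_at_pts(2)[OF s] .
  then show w: "wsmooth (JV r s Y) P B (a y, b y)"
    using B tame_JV[OF Y] P by (auto simp: smooth_map_def intro: smooth_at_wsmooth)
  show "smooth_at (bas Y) P (\<lambda>y. B (a y, b y)) y"
    by (rule smooth_at_comp[where f = "\<lambda>y. (a y, b y)", OF fibD(3)[OF Y] tame_JV[OF Y] P s w])
qed

text \<open>Contact of the two components is contact of the pair, also inside the fibered product,
  and B preserves it. Independence of representatives is obtained from this on both sides of the
  formula.\<close>

lemma jet1_JV_comp:
  assumes Y: "fib Y" and B: "smooth_map (JV r s Y) P B" and P: "tame P"
    and ab: "JV_pair r s Y y a b" and ab': "JV_pair r s Y y a' b'"
    and j: "jeq 1 (bas Y) (tot (Jet r Y)) y a a'" "jeq 1 (bas Y) (tot (Vert (Jet s Y))) y b b'"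
  shows "jet 1 (bas Y) P y (\<lambda>y. B (a y, b y)) = jet 1 (bas Y) P y (\<lambda>y. B (a' y, b' y))"
proof (rule jet_eqI)
  have "jeq 1 (bas Y) (JV r s Y) y (\<lambda>y. (a y, b y)) (\<lambda>y. (a' y, b' y))"
    unfolding JV_def by (rule jeq_restr[OF jeq_pair[OF j]])
  then show "jeq 1 (bas Y) P y (\<lambda>y. B (a y, b y)) (\<lambda>y. B (a' y, b' y))"
    by (rule jeq_comp[where u = "\<lambda>y. (a y, b y)" and u' = "\<lambda>y. (a' y, b' y)", OF fibD(1)[OF Y] tame_JV[OF Y]
          JV_pair_smooth[OF Y ab] JV_pair_smooth[OF Y ab']])
      (rule smooth_at_JV_comp(2)[OF Y B P ab])
qed

lemma JV_pair_jets:
  assumes Y: "fibered_manifold Y" and s: "s \<le> r" and a: "local_section Y y a" and b: "local_section (Vert Y) y b"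
    and ev: "eventually (\<lambda>z. sjet s Y z a = sjet s Y z (foot \<circ> b)) (nhdsin (mtop (bas Y)) y)"
  shows "JV_pair r s Y y (\<lambda>z. sjet r Y z a) (\<lambda>z. exch_inv s Y (sjet s (Vert Y) z b))"
  unfolding JV_pair_def
proof (intro conjI)
  note E = fibered_manifoldD(1)[OF Y] and F = fibered_manifoldD(3)[OF Y]
  show "smooth_at (bas Y) (tot (Jet r Y)) (\<lambda>z. sjet r Y z a) y" by (rule smooth_at_sjet[OF F a])
  show "smooth_at (bas Y) (tot (Vert (Jet s Y))) (\<lambda>z. exch_inv s Y (sjet s (Vert Y) z b)) y"
    by (rule smooth_at_exch_inv[OF Y b])
  have "eventually (\<lambda>z. local_section (Vert Y) z b) (nhdsin (mtop (bas Y)) y)"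
    using eventually_local_section[of "Vert Y", OF _ b] E by simp
  then show "eventually (\<lambda>z. jproj s Y (sjet r Y z a) = foot (exch_inv s Y (sjet s (Vert Y) z b))) (nhdsin (mtop (bas Y)) y)"
    using eventually_local_section[OF E a] ev
    by eventually_elim (simp add: jproj_sjet[OF E _ s] foot_exch_inv[OF Y, simplified bas_Vert])
qed

section \<open>Jets of sections of the functional bundles\<close>

lemma Fjet_eqD:
  assumes "Fjet k M \<pi> P x u = Fjet k M \<pi> P x' v" "x \<in> U" "Fsection M \<pi> P U u" "y \<in> over (bas P) \<pi> {x}"
  shows "x' = x" "sjet k P y u = sjet k P y v"
proof -
  show x: "x' = x" using assms(1) by (simp add: Fjet_def)
  have "u \<in> snd (Fjet k M \<pi> P x u)" using assms by (auto simp: Fjet_def)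
  then have "u \<in> snd (Fjet k M \<pi> P x v)" using assms(1) x by simp
  then show "sjet k P y u = sjet k P y v" using assms(4) by (auto simp: Fjet_def)
qed

text \<open>u belongs to its own jet, so the chosen member exists; all members have the same jet at
  each point of the fibre.\<close>

lemma inj_i_Fjet:
  assumes "x \<in> U" "Fsection M \<pi> P U u" "y \<in> over (bas P) \<pi> {x}"
  shows "inj_i k \<pi> P (Fjet k M \<pi> P x u) y = sjet k P y u"
proof -
  have "u \<in> snd (Fjet k M \<pi> P x u)" using assms by (auto simp: Fjet_def)
  then have "(SOME v. v \<in> snd (Fjet k M \<pi> P x u)) \<in> snd (Fjet k M \<pi> P x u)"
    by (rule someI[where P = "\<lambda>v. v \<in> snd (Fjet k M \<pi> P x u)"])
  then have "sjet k P y (SOME v. v \<in> snd (Fjet k M \<pi> P x u)) = sjet k P y u"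
    using assms(3) by (auto simp: Fjet_def)
  then show ?thesis using assms(3) by (simp add: inj_i_def Fjet_def)
qed

lemma eventually_over:
  assumes E: "atlas E" and M: "atlas M" and \<pi>: "smooth_map E M \<pi>" and U: "openin (mtop M) U"
    and y: "y \<in> over E \<pi> U"
  shows "eventually (\<lambda>y. y \<in> over E \<pi> U) (nhdsin (mtop E) y)"
proof -
  have "smooth_at E M \<pi> y" using \<pi> y by (simp add: smooth_map_def over_def)
  moreover have "eventually (\<lambda>x. x \<in> U) (nhdsin (mtop M) (\<pi> y))" using U y by (auto simp: eventually_nhdsin over_def)
  ultimately have "eventually (\<lambda>y. \<pi> y \<in> U) (nhdsin (mtop E) y)" by (rule smooth_at_eventually[OF E M])
  then show ?thesis using eventually_pts[OF E, of y] by eventually_elim (simp add: over_def)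
qed

lemma represents_JV_pair:
  assumes Y: "fib Y" and M: "atlas M" and \<pi>: "smooth_map (bas Y) M \<pi>" and U: "openin (mtop M) U"
    and a: "section_on (Jet r Y) (over (bas Y) \<pi> U) a" and b: "section_on (Vert (Jet s Y)) (over (bas Y) \<pi> U) b"
    and ab: "\<forall>y\<in>over (bas Y) \<pi> U. jproj s Y (a y) = foot (b y)" and y: "y \<in> over (bas Y) \<pi> U"
  shows "JV_pair r s Y y a b"
  unfolding JV_pair_def
proof (intro conjI)
  show "smooth_at (bas Y) (tot (Jet r Y)) a y" "smooth_at (bas Y) (tot (Vert (Jet s Y))) b y"
    using a b y by (auto simp: section_on_def)
  show "eventually (\<lambda>y. jproj s Y (a y) = foot (b y)) (nhdsin (mtop (bas Y)) y)"
    using eventually_over[OF fibD(1)[OF Y] M \<pi> U y] by eventually_elim (use ab in simp)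
qed

text \<open>Any admissible pair of sections gives the stated jet, because its prolongations are in
  first order contact with A and B'. That an admissible pair exists is the harder half: X and v
  yield unrelated sections, and the one for v has to be replaced by one whose foot is the section
  for X.\<close>

lemma J1hol_eq:
  assumes Y: "fibered_manifold Y" and s: "s \<le> r" and B: "smooth_map (JV r s Y) (tot P) B" and P: "tame (tot P)" "bas P = bas Y"
    and AB: "JV_pair r s Y y A B'"
    and A: "X \<in> pts (tot (Jet (Suc r) Y))" "hol r Y X = sjet 1 (Jet r Y) y A"
    and v: "v \<in> pts (tot (Vert (Jet (Suc s) Y)))" "holV s Y v = sjet 1 (Vert (Jet s Y)) y B'"
  shows "J1hol r s Y P (\<lambda>(X', Z'). B (X', exch_inv s Y Z')) (X, exch (Suc s) Y v) = sjet 1 P y (\<lambda>y. B (A y, B' y))"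
proof -
  note E = fibered_manifoldD(1)[OF Y] and F = fibered_manifoldD(3)[OF Y]
  note FV = fib_Vert[OF F] and FJs = fib_Jet[OF F, of s] and FVJ = fib_Vert[OF fib_Jet[OF F, of s]]
  have smA: "smooth_at (bas Y) (tot (Jet r Y)) A y" and smB: "smooth_at (bas Y) (tot (Vert (Jet s Y))) B' y"
    using AB by (auto simp: JV_pair_def)
  have y: "y \<in> pts (bas Y)" using smooth_at_pts(1)[OF smA] .
  \<comment> \<open>Any section representing X has a prolongation with the 1-jet of A at y, since
    both are the holonomic image of X; \<open>jB\<close> is the analogue for v.\<close>
  have jA: "y' = y \<and> jeq 1 (bas Y) (tot (Jet r Y)) y A (\<lambda>z. sjet r Y z a)"
    if a: "local_section Y y' a" "X = sjet (Suc r) Y y' a" for y' a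
  proof -
    have e: "jet 1 (bas Y) (tot (Jet r Y)) y A = jet 1 (bas Y) (tot (Jet r Y)) y' (\<lambda>z. sjet r Y z a)"
      using A(2) hol_sjet[OF F a(1), of r] a(2) by simp
    show ?thesis using jet_eqD[OF e smA] by simp
  qed
  have jB: "y' = y \<and> jeq 1 (bas Y) (tot (Vert (Jet s Y))) y B' (\<lambda>z. exch_inv s Y (sjet s (Vert Y) z b))"
    if b: "local_section (Vert Y) y' b" "exch (Suc s) Y v = sjet (Suc s) (Vert Y) y' b" for y' b
  proof -
    have e: "jet 1 (bas Y) (tot (Vert (Jet s Y))) y B' =
        jet 1 (bas Y) (tot (Vert (Jet s Y))) y' (\<lambda>z. exch_inv s Y (sjet s (Vert Y) z b))"
      using v(2) holV_exch[OF Y b] by simp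
    show ?thesis using jet_eqD[OF e smB] by simp
  qed
  have unique: "sjet 1 P y (\<lambda>z. B (sjet r Y z a, exch_inv s Y (sjet s (Vert Y) z b))) = sjet 1 P y (\<lambda>y. B (A y, B' y))"
    if a: "local_section Y y a" "X = sjet (Suc r) Y y a"
      and b: "local_section (Vert Y) y b" "exch (Suc s) Y v = sjet (Suc s) (Vert Y) y b"
      and ev: "eventually (\<lambda>z. sjet s Y z a = sjet s Y z (foot \<circ> b)) (nhdsin (mtop (bas Y)) y)" for a b
    unfolding P(2)
    by (rule jet1_JV_comp[OF F B P(1) AB JV_pair_jets[OF Y s a(1) b(1) ev], symmetric])
      (use jA[OF a] jB[OF b] in auto)
  obtain y1 a where a1: "X = sjet (Suc r) Y y1 a" "local_section Y y1 a" using A(1) by (auto simp: pts_Jet[OF E])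
  have y1: "y1 = y" and ja: "jeq 1 (bas Y) (tot (Jet r Y)) y A (\<lambda>z. sjet r Y z a)" using jA[OF a1(2,1)] by auto
  note a = a1(2)[unfolded y1] a1(1)[unfolded y1]
  obtain u y2 where u1: "fam Y u y2" "v = tvec (tot (Jet (Suc s) Y)) (\<lambda>t. sjet (Suc s) Y y2 (u t))"
    using vertical_jet_rep[OF Y v(1)] by blast
  define b0 where "b0 = (\<lambda>z. tvec (tot Y) (\<lambda>t. u t z))"
  have b0: "local_section (Vert Y) y2 b0" "exch (Suc s) Y v = sjet (Suc s) (Vert Y) y2 b0"
    unfolding b0_def u1(2) using fam_velocity_section[OF F u1(1)] exch_fam[OF F u1(1)] by auto
  have y2: "y2 = y" and jb: "jeq 1 (bas Y) (tot (Vert (Jet s Y))) y B' (\<lambda>z. exch_inv s Y (sjet s (Vert Y) z b0))"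
    using jB[OF b0] by auto
  note u = u1[unfolded y2] and b0 = b0[unfolded y2]
  note u0 = fam_local_section0[OF F u(1)]
  \<comment> \<open>The chain \<open>e1\<close> to \<open>e5\<close> connects j^s a with j^s u(0, _)
    by first order contact at y. It passes through the common projection of A and B' to J^sQ, the
    only link between X and v.\<close>
  have e1: "jeq 1 (bas Y) (tot (Jet s Y)) y (\<lambda>z. sjet s Y z a) (\<lambda>z. jproj s Y (sjet r Y z a))"
    by (rule jeq_cong[OF E y]) (use eventually_local_section[OF E a(1)] in eventually_elim, simp add: jproj_sjet[OF E _ s])
  have e2: "jeq 1 (bas Y) (tot (Jet s Y)) y (\<lambda>z. jproj s Y (sjet r Y z a)) (\<lambda>z. jproj s Y (A z))"
    by (rule jeq_comp[where u = "\<lambda>z. sjet r Y z a" and u' = A, OF E tame_Jet[OF F] smooth_at_sjet[OF F a(1)] smA jeq_sym[OF ja]])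
      (rule wsmooth_jproj[OF F s smooth_at_pts(2)[OF smooth_at_sjet[OF F a(1)]]])
  have e3: "jeq 1 (bas Y) (tot (Jet s Y)) y (\<lambda>z. jproj s Y (A z)) (\<lambda>z. foot (B' z))"
    by (rule jeq_cong[OF E y]) (use AB in \<open>simp add: JV_pair_def\<close>)
  have e4: "jeq 1 (bas Y) (tot (Jet s Y)) y (\<lambda>z. foot (B' z)) (\<lambda>z. foot (exch_inv s Y (sjet s (Vert Y) z b0)))"
    by (rule jeq_comp[where u = B' and u' = "\<lambda>z. exch_inv s Y (sjet s (Vert Y) z b0)", OF E fibD(2)[OF FVJ] smB
          smooth_at_exch_inv[OF Y b0(1)] jb wsmooth_foot_Vert[OF FJs smooth_at_pts(2)[OF smB]]])
  have e5: "jeq 1 (bas Y) (tot (Jet s Y)) y (\<lambda>z. foot (exch_inv s Y (sjet s (Vert Y) z b0))) (\<lambda>z. sjet s Y z (u 0))"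
  proof (rule jeq_cong[OF E y])
    show "eventually (\<lambda>z. foot (exch_inv s Y (sjet s (Vert Y) z b0)) = sjet s Y z (u 0)) (nhdsin (mtop (bas Y)) y)"
      using eventually_fam[OF E u(1)]
    proof eventually_elim
      case (elim z)
      show ?case unfolding b0_def exch_inv_fam[OF Y elim] by (rule foot_sjet[OF F elim])
    qed
  qed
  have "jeq 1 (bas Y) (tot (Jet s Y)) y (\<lambda>z. sjet s Y z a) (\<lambda>z. sjet s Y z (u 0))"
    by (rule jeq_trans[OF jeq_trans[OF jeq_trans[OF jeq_trans[OF e1 e2] e3] e4] e5])
  \<comment> \<open>First order contact of the two prolongations in J^sQ amounts to equality of the
    (s+1)-jets of a and u(0, _).\<close>
  from jeq_hol_inj[OF F a(1) u0 this] have ju: "sjet (Suc s) Y y a = sjet (Suc s) Y y (u 0)" by (rule jet_eqI)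
  have "foot v = sjet (Suc s) Y y a" unfolding u(2) ju by (rule foot_sjet[OF F u(1)])
  \<comment> \<open>The vector v is realized anew, by a family starting at a itself; its velocity
    field b then has foot a.\<close>
  from vertical_jet_family[OF Y v(1) a(1) this] obtain w where
    w: "fam Y w y" "eventually (\<lambda>z. w 0 z = a z) (nhdsin (mtop (bas Y)) y)"
      "v = tvec (tot (Jet (Suc s) Y)) (\<lambda>t. sjet (Suc s) Y y (w t))" by blast
  define b where "b = (\<lambda>z. tvec (tot Y) (\<lambda>t. w t z))"
  have b: "local_section (Vert Y) y b" "exch (Suc s) Y v = sjet (Suc s) (Vert Y) y b"
    unfolding b_def w(3) using fam_velocity_section[OF F w(1)] exch_fam[OF F w(1)] by auto
  \<comment> \<open>The s-jets agree at every z near y, since foot o b and a coincide on a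
    neighbourhood of each such z.\<close>
  have ev: "eventually (\<lambda>z. sjet s Y z a = sjet s Y z (foot \<circ> b)) (nhdsin (mtop (bas Y)) y)"
    using eventually_eventually_mtop[OF w(2)] eventually_eventually_mtop[OF eventually_fam[OF E w(1)]] eventually_pts[OF E, of y]
  proof eventually_elim
    case (elim z)
    show ?case
    proof (rule sjet_cong[OF F elim(3)])
      show "eventually (\<lambda>z. a z = (foot \<circ> b) z) (nhdsin (mtop (bas Y)) z)"
        using elim(1,2)
      proof eventually_elim
        case (elim z')
        show ?case using foot_velocity[OF F elim(2)] elim(1) by (simp add: b_def)
      qed
    qed
  qed
  obtain W where W: "openin (mtop (bas Y)) W" "y \<in> W" "section_on Y W a" "section_on (Vert Y) W b"
    "\<forall>y'\<in>W. sjet s Y y' a = sjet s Y y' (foot \<circ> b)"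
  proof -
    have "eventually (\<lambda>z. local_section Y z a) (nhdsin (mtop (bas Y)) y)"
      "eventually (\<lambda>z. local_section (Vert Y) z b) (nhdsin (mtop (bas Y)) y)"
      using eventually_local_section[OF E a(1)] eventually_local_section[of "Vert Y", OF _ b(1)] E by simp_all
    with ev have "eventually (\<lambda>z. sjet s Y z a = sjet s Y z (foot \<circ> b) \<and> local_section Y z a \<and> local_section (Vert Y) z b) (nhdsin (mtop (bas Y)) y)"
      by eventually_elim simp
    then obtain W where W: "openin (mtop (bas Y)) W" "y \<in> W"
      "\<And>z. z \<in> W \<Longrightarrow> sjet s Y z a = sjet s Y z (foot \<circ> b) \<and> local_section Y z a \<and> local_section (Vert Y) z b"
      using y by (auto simp: eventually_nhdsin topspace_mtop[OF E])
    have "section_on Y W a" unfolding section_on_def using W(3) local_sectionD(1,2)[OF E] by blast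
    moreover have "section_on (Vert Y) W b" unfolding section_on_def using W(3) local_sectionD(1,2)[of "Vert Y"] E by simp
    ultimately show ?thesis using W by (intro that[of W]) auto
  qed
  show ?thesis
    unfolding J1hol_def prod.case
  proof (rule the_equality)
    show "\<exists>y' W a b. openin (mtop (bas Y)) W \<and> y' \<in> W \<and> section_on Y W a \<and> section_on (Vert Y) W b \<and>
       X = sjet (Suc r) Y y' a \<and> exch (Suc s) Y v = sjet (Suc s) (Vert Y) y' b \<and>
       (\<forall>y'\<in>W. sjet s Y y' a = sjet s Y y' (foot \<circ> b)) \<and>
       sjet 1 P y (\<lambda>y. B (A y, B' y)) = sjet 1 P y' (\<lambda>y'. B (sjet r Y y' a, exch_inv s Y (sjet s (Vert Y) y' b)))"
      using W a(2) b(2) unique[OF a b ev] by (intro exI[of _ y] exI[of _ W] exI[of _ a] exI[of _ b]) simp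
    fix \<Xi> assume "\<exists>y' W a b. openin (mtop (bas Y)) W \<and> y' \<in> W \<and> section_on Y W a \<and> section_on (Vert Y) W b \<and>
       X = sjet (Suc r) Y y' a \<and> exch (Suc s) Y v = sjet (Suc s) (Vert Y) y' b \<and>
       (\<forall>y'\<in>W. sjet s Y y' a = sjet s Y y' (foot \<circ> b)) \<and>
       \<Xi> = sjet 1 P y' (\<lambda>y'. B (sjet r Y y' a, exch_inv s Y (sjet s (Vert Y) y' b)))"
    then obtain y' W a b where *: "openin (mtop (bas Y)) W" "y' \<in> W" "section_on Y W a" "section_on (Vert Y) W b"
       "X = sjet (Suc r) Y y' a" "exch (Suc s) Y v = sjet (Suc s) (Vert Y) y' b"
       "\<forall>y'\<in>W. sjet s Y y' a = sjet s Y y' (foot \<circ> b)"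
       "\<Xi> = sjet 1 P y' (\<lambda>y'. B (sjet r Y y' a, exch_inv s Y (sjet s (Vert Y) y' b)))" by blast
    have la: "local_section Y y' a" by (rule section_on_local[OF *(1,3,2)])
    have lb: "local_section (Vert Y) y' b" by (rule section_on_local[OF _ *(4,2)]) (simp add: *(1))
    have y': "y' = y" using jA[OF la *(5)] by simp
    have "eventually (\<lambda>z. sjet s Y z a = sjet s Y z (foot \<circ> b)) (nhdsin (mtop (bas Y)) y)"
      using *(1,2,7) y' by (auto simp: eventually_nhdsin)
    from unique[OF la[unfolded y'] *(5)[unfolded y'] lb[unfolded y'] *(6)[unfolded y'] this]
    show "\<Xi> = sjet 1 P y (\<lambda>y. B (A y, B' y))" unfolding *(8) y' .
  qed
qed

theorem proposition5p2:
  fixes M :: "('m, nat) mfd"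
    and Y :: "('q, nat, 'e) fibm"
    and \<pi> :: "'e \<Rightarrow> 'm"
    and r s l :: nat
    and B :: "('e \<times> ('e \<Rightarrow> 'q) set) \<times> (real \<Rightarrow> 'e \<times> ('e \<Rightarrow> 'q) set) set \<Rightarrow>
                'e \<times> ((real \<Rightarrow> 'e) set list \<Rightarrow> real)"
  assumes "fibered_manifold Y"
    and "manifold M" and "surj_submersion (bas Y) M \<pi>"
    and "s \<le> r"
    and "smooth_map (JV r s Y) (tot (Forms l (bas Y))) B"
    and "\<And>X v. (X, v) \<in> pts (JV r s Y) \<Longrightarrow> fst (B (X, v)) = fst X"
  shows "\<forall>XZ \<in> holonomic_part r s M \<pi> Y.
           functional_d r s l M \<pi> Y B XZ =
           Smap (over (bas Y) \<pi> {fst (fst XZ)}) (formal_d r s l Y B) (inj_I r s \<pi> Y XZ)"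
proof
  fix XZ assume XZ: "XZ \<in> holonomic_part r s M \<pi> Y"
  note Y = assms(1)
  note E = fibered_manifoldD(1)[OF Y] and F = fibered_manifoldD(3)[OF Y]
  have M: "atlas M" using assms(2) by (rule manifold_atlas)
  have \<pi>: "smooth_map (bas Y) M \<pi>" using assms(3) by (simp add: surj_submersion_def)
  let ?P = "Forms l (bas Y)"
  note tP = tame_Forms[OF E, of l]
  obtain X Z where xz: "XZ = (X, Z)" by (cases XZ)
  from XZ obtain x a b where x: "x \<in> pts M" and rep: "represents r s M \<pi> Y x a b X Z"
    and hol: "\<And>y. y \<in> over (bas Y) \<pi> {fst X} \<Longrightarrow>
       inj_i 1 \<pi> (Jet r Y) X y \<in> hol r Y ` pts (tot (Jet (Suc r) Y)) \<and>
       inj_i 1 \<pi> (Vert (Jet s Y)) Z y \<in> holV s Y ` pts (tot (Vert (Jet (Suc s) Y)))"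
    unfolding xz holonomic_part_def J1S_fibprod_def by auto
  from rep obtain U where U: "x \<in> U" and a: "Fsection M \<pi> (Jet r Y) U a" and b: "Fsection M \<pi> (Vert (Jet s Y)) U b"
    and ab: "\<forall>y\<in>over (bas Y) \<pi> U. jproj s Y (a y) = foot (b y)"
    and XZ': "X = Fjet 1 M \<pi> (Jet r Y) x a" "Z = Fjet 1 M \<pi> (Vert (Jet s Y)) x b"
    unfolding represents_def by blast
  have fX: "fst X = x" by (simp add: XZ'(1) Fjet_def)
  have o: "openin (mtop M) U" and sa: "section_on (Jet r Y) (over (bas Y) \<pi> U) a"
    and sb: "section_on (Vert (Jet s Y)) (over (bas Y) \<pi> U) b" using a b by (auto simp: Fsection_def)
  have pair: "JV_pair r s Y y a b" if "y \<in> over (bas Y) \<pi> U" for y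
    by (rule represents_JV_pair[OF F M \<pi> o sa sb ab that])
  have sub: "over (bas Y) \<pi> {x} \<subseteq> over (bas Y) \<pi> U" using U by (auto simp: over_def)
  \<comment> \<open>B covers the identity of E, so the composite is again a section; it thereby
    belongs to its own functional jet, which \<open>inj_i_Fjet\<close> asks for.\<close>
  have Bsec: "Fsection M \<pi> ?P U (\<lambda>y. B (a y, b y))"
    unfolding Fsection_def section_on_def charts_Forms_base
  proof (intro conjI o ballI)
    fix y assume y: "y \<in> over (bas Y) \<pi> U"
    note c = smooth_at_JV_comp[OF F assms(5) tP pair[OF y]]
    show "smooth_at (bas Y) (tot ?P) (\<lambda>y. B (a y, b y)) y" by (rule c(1))
    show "fst (B (a y, b y)) = y" using assms(6)[OF c(3)] sa y by (simp add: section_on_def)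
  qed
  \<comment> \<open>The definite description in \<open>J1S\<close> is evaluated at the given
    representatives; others have the same 1-jets along the fibre and give the same jet after
    applying B.\<close>
  have J: "J1S r s M \<pi> Y ?P B (X, Z) = Fjet 1 M \<pi> ?P x (\<lambda>y. B (a y, b y))"
    unfolding J1S_def prod.case
  proof (rule the_equality)
    fix \<Xi> assume "\<exists>x\<in>pts M. \<exists>a b. represents r s M \<pi> Y x a b X Z \<and> \<Xi> = Fjet 1 M \<pi> ?P x (\<lambda>y. B (a y, b y))"
    then obtain x' a' b' U' where U': "x' \<in> U'" and a': "Fsection M \<pi> (Jet r Y) U' a'" and b': "Fsection M \<pi> (Vert (Jet s Y)) U' b'"
      and ab': "\<forall>y\<in>over (bas Y) \<pi> U'. jproj s Y (a' y) = foot (b' y)"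
      and XZ'': "X = Fjet 1 M \<pi> (Jet r Y) x' a'" "Z = Fjet 1 M \<pi> (Vert (Jet s Y)) x' b'"
      and \<Xi>: "\<Xi> = Fjet 1 M \<pi> ?P x' (\<lambda>y. B (a' y, b' y))" unfolding represents_def by blast
    have x': "x' = x" using fX by (simp add: XZ''(1) Fjet_def)
    have "sjet 1 ?P y (\<lambda>y. B (a' y, b' y)) = sjet 1 ?P y (\<lambda>y. B (a y, b y))" if y: "y \<in> over (bas Y) \<pi> {x}" for y
    proof -
      have yU: "y \<in> over (bas Y) \<pi> U" "y \<in> over (bas Y) \<pi> U'" using y U U' x' by (auto simp: over_def)
      have p': "JV_pair r s Y y a' b'"
        by (rule represents_JV_pair[OF F M \<pi> _ _ _ ab' yU(2)]) (use a' b' in \<open>auto simp: Fsection_def\<close>)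
      note p = pair[OF yU(1)]
      have "sjet 1 (Jet r Y) y a = sjet 1 (Jet r Y) y a'"
        by (rule Fjet_eqD(2)[OF XZ'(1)[symmetric, unfolded XZ''(1) x'] U a]) (simp add: y)
      then have ja: "jeq 1 (bas Y) (tot (Jet r Y)) y a a'" using p unfolding JV_pair_def bas_Jet by (intro jet_eqD(2)) auto
      have "sjet 1 (Vert (Jet s Y)) y b = sjet 1 (Vert (Jet s Y)) y b'"
        by (rule Fjet_eqD(2)[OF XZ'(2)[symmetric, unfolded XZ''(2) x'] U b]) (simp add: y)
      then have jb: "jeq 1 (bas Y) (tot (Vert (Jet s Y))) y b b'"
        using p unfolding JV_pair_def bas_Jet bas_Vert by (intro jet_eqD(2)) auto
      show ?thesis unfolding charts_Forms_base by (rule jet1_JV_comp[OF F assms(5) tP p p' ja jb, symmetric])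
    qed
    then show "\<Xi> = Fjet 1 M \<pi> ?P x (\<lambda>y. B (a y, b y))" unfolding \<Xi> x' by (auto simp: Fjet_def charts_Forms_base)
  qed (use x rep in blast)
  show "functional_d r s l M \<pi> Y B XZ =
           Smap (over (bas Y) \<pi> {fst (fst XZ)}) (formal_d r s l Y B) (inj_I r s \<pi> Y XZ)"
    unfolding functional_d_def xz J fst_conv fX Smap_def comp_def
  proof (rule restrict_ext)
    fix y assume y: "y \<in> over (bas Y) \<pi> {x}"
    then have yU: "y \<in> over (bas Y) \<pi> U" using sub by blast
    have L: "inj_i 1 \<pi> ?P (Fjet 1 M \<pi> ?P x (\<lambda>y. B (a y, b y))) y = sjet 1 ?P y (\<lambda>y. B (a y, b y))"
      by (rule inj_i_Fjet[OF U Bsec]) (simp add: charts_Forms_base y)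
    have iX: "inj_i 1 \<pi> (Jet r Y) X y = sjet 1 (Jet r Y) y a"
      unfolding XZ'(1) by (rule inj_i_Fjet[OF U a]) (simp add: y)
    have iZ: "inj_i 1 \<pi> (Vert (Jet s Y)) Z y = sjet 1 (Vert (Jet s Y)) y b"
      unfolding XZ'(2) by (rule inj_i_Fjet[OF U b]) (simp add: y)
    define A where "A = inv_into (pts (tot (Jet (Suc r) Y))) (hol r Y) (inj_i 1 \<pi> (Jet r Y) X y)"
    define v where "v = inv_into (pts (tot (Vert (Jet (Suc s) Y)))) (holV s Y) (inj_i 1 \<pi> (Vert (Jet s Y)) Z y)"
    \<comment> \<open>The holonomic part guarantees that the jet lies in the image of the inclusion,
      so \<open>inv_into\<close> yields a genuine preimage; likewise for v.\<close>
    have A: "A \<in> pts (tot (Jet (Suc r) Y))" "hol r Y A = sjet 1 (Jet r Y) y a"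
      using hol[of y] y fX iX by (auto simp: A_def intro: inv_into_into f_inv_into_f)
    have v: "v \<in> pts (tot (Vert (Jet (Suc s) Y)))" "holV s Y v = sjet 1 (Vert (Jet s Y)) y b"
      using hol[of y] y fX iZ by (auto simp: v_def intro: inv_into_into f_inv_into_f)
    \<comment> \<open>On the fibre the restriction in \<open>inj_I\<close> is invisible. Both sides
      are now \<delta> of one and the same 1-jet.\<close>
    have "inj_I r s \<pi> Y (X, Z) y = (A, v)" using y by (simp add: inj_I_def A_def v_def fX)
    then have "formal_d r s l Y B (inj_I r s \<pi> Y (X, Z) y) = delta (bas Y) l (sjet 1 ?P y (\<lambda>y. B (a y, b y)))"
      using J1hol_eq[OF Y assms(4,5) tP _ pair[OF yU] A v]
      by (simp add: formal_d_def scrJ1hol_def charts_Forms_base)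
    then show "delta (bas Y) l (inj_i 1 \<pi> ?P (Fjet 1 M \<pi> ?P x (\<lambda>y. B (a y, b y))) y) =
        formal_d r s l Y B (inj_I r s \<pi> Y (X, Z) y)" unfolding L by simp
  qed
qed

end
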